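(* Let $\Omega\subset\mathbb{R}^2$ be a symmetric exterior domain with Lipschitz boundary. There exists a constant $\delta=\delta(\Omega)>0$, depending only on $\Omega$, with the following property. Let $f\in\dot{H}_{0,\sigma}^{-1}(\Omega)$ and let $u,v\in\dot{H}_{0,\sigma}^{1,S}(\Omega)$ be symmetric weak solutions of the stationary Navier-Stokes equation in $\Omega$ with the same external force $f$, having the same symmetry property, i.e. for each $i=1,2$, either both $u_i$ and $v_i$ satisfy $g(x_1,x_2)=-g(x_1,-x_2)$, or both $u_i$ and $v_i$ satisfy $g(x_1,x_2)=-g(-x_1,x_2)$. If $u$ satisfies the energy inequality $$\|\nabla u\|_{L^2(\Omega)}^2\le (f,u)$$ and $$\sup_{x\in\Omega}(|x|+1)|v(x)|\le\delta,$$ then $u=v$.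
   Context: An exterior domain is a domain (connected open set) in $\mathbb{R}^2$ that is the complement of a nonempty compact set. It is called a symmetric exterior domain if $(x_1,x_2)\in\Omega$ implies $(x_1,-x_2),(-x_1,x_2)\in\Omega$. $C_{0,\sigma}^\infty(\Omega)$ is the set of smooth vector fields $\varphi=(\varphi_1,\varphi_2)$ with compact support in $\Omega$ and $\operatorname{div}\varphi=0$. $\dot{H}_{0,\sigma}^1(\Omega)$ is the completion of $C_{0,\sigma}^\infty(\Omega)$ in the norm $\|\nabla\cdot\|_{L^2(\Omega)}$, and $\dot{H}_{0,\sigma}^{-1}(\Omega)$ is its dual space. $\dot{H}_{0,\sigma}^{1,S}(\Omega)$ is the set of $u=(u_1,u_2)\in\dot{H}_{0,\sigma}^1(\Omega)$ such that for each $i=1,2$ either $u_i(x_1,x_2)=-u_i(x_1,-x_2)$ or $u_i(x_1,x_2)=-u_i(-x_1,x_2)$ holds. By $(\cdot,\cdot)$ we denote the various duality pairings (in particular the $L^2(\Omega)$-type integral pairing and the pairing between $\dot{H}_{0,\sigma}^{-1}(\Omega)$ and $\dot{H}_{0,\sigma}^{1}(\Omega)$). The stationary Navier-Stokes equation is: $-\Delta u+u\cdot\nabla u+\nabla p=f$ and $\operatorname{div}u=0$ in $\Omega$, $u=0$ on $\partial\Omega$, $u(x)\to0$ as $|x|\to\infty$. Given $f\in\dot{H}_{0,\sigma}^{-1}(\Omega)$, a function $u\in\dot{H}_{0,\sigma}^{1,S}(\Omega)$ is called a symmetric weak solution of it if $$(\nabla u,\nabla\varphi)+(u\cdot\nabla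 u,\varphi)=(f,\varphi)\quad\text{for all }\varphi\in C_{0,\sigma}^\infty(\Omega),$$ where $(u\cdot\nabla u)_j=\sum_{i=1}^2u_i\partial_iu_j$. Suprema of functions defined almost everywhere are essential suprema. *)

theory Defs
  imports "HOL-Probability.Essential_Supremum"
begin

section \<open>Domains\<close>

definition exterior_domain :: "(real^2) set \<Rightarrow> bool" where
  "exterior_domain \<Omega> \<longleftrightarrow> open \<Omega> \<and> connected \<Omega> \<and> compact (- \<Omega>) \<and> - \<Omega> \<noteq> {}"

definition flip1 :: "real^2 \<Rightarrow> real^2" where
  "flip1 x = vector [- x $ 1, x $ 2]"

definition flip2 :: "real^2 \<Rightarrow> real^2" where
  "flip2 x = vector [x $ 1, - x $ 2]"

definition symmetric_exterior_domain :: "(real^2) set \<Rightarrow> bool" where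
  "symmetric_exterior_domain \<Omega> \<longleftrightarrow>
     exterior_domain \<Omega> \<and> (\<forall>x\<in>\<Omega>. flip2 x \<in> \<Omega> \<and> flip1 x \<in> \<Omega>)"

text \<open>Near each boundary point the set is, in suitable orthogonal coordinates, the strict
  epigraph of a Lipschitz function. The translation of the origin to the boundary point is
  absorbed into the function.\<close>

definition lipschitz_boundary :: "(real^2) set \<Rightarrow> bool" where
  "lipschitz_boundary \<Omega> \<longleftrightarrow>
     (\<forall>p\<in>frontier \<Omega>. \<exists>T \<gamma> L r.
        orthogonal_transformation (T :: real^2 \<Rightarrow> real^2) \<and>
        L-lipschitz_on UNIV (\<gamma> :: real \<Rightarrow> real) \<and> r > 0 \<and>
        \<Omega> \<inter> ball p r = {x \<in> ball p r. \<gamma> (T x $ 1) < T x $ 2})"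

section \<open>Smooth functions\<close>

definition partial_deriv :: "2 \<Rightarrow> (real^2 \<Rightarrow> 'b::real_normed_vector) \<Rightarrow> real^2 \<Rightarrow> 'b" where
  "partial_deriv i g x = frechet_derivative g (at x) (axis i 1)"

primrec Ck :: "nat \<Rightarrow> (real^2 \<Rightarrow> 'b::real_normed_vector) \<Rightarrow> bool" where
  "Ck 0 g \<longleftrightarrow> continuous_on UNIV g"
| "Ck (Suc k) g \<longleftrightarrow> (\<forall>x. g differentiable (at x)) \<and> (\<forall>i. Ck k (partial_deriv i g))"

definition smooth_fun :: "(real^2 \<Rightarrow> 'b::real_normed_vector) \<Rightarrow> bool" where
  "smooth_fun g \<longleftrightarrow> (\<forall>k. Ck k g)"

text \<open>Functions with compact support in \<open>\<Omega>\<close> are represented by their extension by zero to the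
  whole plane.\<close>

definition test_funs :: "(real^2) set \<Rightarrow> (real^2 \<Rightarrow> 'b::real_normed_vector) set" where
  "test_funs \<Omega> = {g. smooth_fun g \<and> compact (closure {x. g x \<noteq> 0}) \<and> closure {x. g x \<noteq> 0} \<subseteq> \<Omega>}"

text \<open>Row \<open>j\<close>, column \<open>i\<close> of a gradient is the derivative of component \<open>j\<close> in direction \<open>i\<close>. The
  norm and inner product on \<open>real^2^2\<close> are the Frobenius ones.\<close>

definition grad :: "(real^2 \<Rightarrow> real^2) \<Rightarrow> real^2 \<Rightarrow> real^2^2" where
  "grad u x = (\<chi> j i. partial_deriv i (\<lambda>y. u y $ j) x)"

definition test_funs_sol :: "(real^2) set \<Rightarrow> (real^2 \<Rightarrow> real^2) set" where
  "test_funs_sol \<Omega> = {\<phi> \<in> test_funs \<Omega>. \<forall>x. (\<Sum>i\<in>UNIV. grad \<phi> x $ i $ i) = 0}"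

section \<open>Function spaces\<close>

text \<open>Elements of the function spaces below are representatives defined on the whole plane; their
  values outside \<open>\<Omega>\<close> are irrelevant.\<close>

definition L2_space :: "(real^2) set \<Rightarrow> (real^2 \<Rightarrow> 'b::euclidean_space) set" where
  "L2_space S = {g \<in> borel_measurable (lebesgue_on S). integrable (lebesgue_on S) (\<lambda>x. (norm (g x))\<^sup>2)}"

definition L2_norm :: "(real^2) set \<Rightarrow> (real^2 \<Rightarrow> 'b::euclidean_space) \<Rightarrow> real" where
  "L2_norm S g = sqrt (LINT x|lebesgue_on S. (norm (g x))\<^sup>2)"

definition locally_integrable :: "(real^2) set \<Rightarrow> (real^2 \<Rightarrow> 'b::euclidean_space) \<Rightarrow> bool" where
  "locally_integrable \<Omega> g \<longleftrightarrow> (\<forall>K. compact K \<and> K \<subseteq> \<Omega> \<longrightarrow> integrable (lebesgue_on K) g)"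

definition has_weak_grad ::
    "(real^2) set \<Rightarrow> (real^2 \<Rightarrow> real^2) \<Rightarrow> (real^2 \<Rightarrow> real^2^2) \<Rightarrow> bool" where
  "has_weak_grad \<Omega> u G \<longleftrightarrow>
     locally_integrable \<Omega> u \<and> locally_integrable \<Omega> G \<and>
     (\<forall>\<psi>\<in>test_funs \<Omega>. \<forall>i j.
        (LINT x|lebesgue_on \<Omega>. u x $ j * partial_deriv i \<psi> x) =
        - (LINT x|lebesgue_on \<Omega>. G x $ j $ i * \<psi> x))"

text \<open>The weak gradient is determined almost everywhere; a representative is chosen.\<close>

definition weak_grad :: "(real^2) set \<Rightarrow> (real^2 \<Rightarrow> real^2) \<Rightarrow> real^2 \<Rightarrow> real^2^2" where
  "weak_grad \<Omega> u = (SOME G. has_weak_grad \<Omega> u G)"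

text \<open>The completion of the solenoidal test fields in the Dirichlet norm, realised as a space of
  functions. If the boundary of the exterior domain is Lipschitz, its complement has interior, so
  by Poincare's inequality the Dirichlet norm controls the \<open>L\<^sup>2\<close> norm on each
  \<open>\<Omega> \<inter> ball 0 R\<close>. Hence a Dirichlet-Cauchy sequence of test fields converges in these norms, and
  the abstract limit is identified with that function.\<close>

definition hdot :: "(real^2) set \<Rightarrow> (real^2 \<Rightarrow> real^2) set" where
  "hdot \<Omega> = {u. (\<forall>R>0. u \<in> L2_space (\<Omega> \<inter> ball 0 R)) \<and>
                (\<exists>G. has_weak_grad \<Omega> u G) \<and> weak_grad \<Omega> u \<in> L2_space \<Omega> \<and>
                (\<exists>\<phi>. (\<forall>n::nat. \<phi> n \<in> test_funs_sol \<Omega>) \<and>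
                     (\<lambda>n. L2_norm \<Omega> (\<lambda>x. grad (\<phi> n) x - weak_grad \<Omega> u x)) \<longlonglongrightarrow> 0 \<and>
                     (\<forall>R>0. (\<lambda>n. L2_norm (\<Omega> \<inter> ball 0 R) (\<lambda>x. \<phi> n x - u x)) \<longlonglongrightarrow> 0))}"

text \<open>Bounded linear functionals on \<open>hdot\<close>. Boundedness makes them independent of the
  representative. Their values outside \<open>hdot\<close> are irrelevant.\<close>

definition hdot_dual :: "(real^2) set \<Rightarrow> ((real^2 \<Rightarrow> real^2) \<Rightarrow> real) set" where
  "hdot_dual \<Omega> = {f.
     (\<forall>u\<in>hdot \<Omega>. \<forall>v\<in>hdot \<Omega>. f (\<lambda>x. u x + v x) = f u + f v) \<and>
     (\<forall>c. \<forall>u\<in>hdot \<Omega>. f (\<lambda>x. c *\<^sub>R u x) = c * f u) \<and>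
     (\<exists>C. \<forall>u\<in>hdot \<Omega>. \<bar>f u\<bar> \<le> C * L2_norm \<Omega> (weak_grad \<Omega> u))}"

definition odd1 :: "(real^2) set \<Rightarrow> (real^2 \<Rightarrow> real) \<Rightarrow> bool" where
  "odd1 \<Omega> g \<longleftrightarrow> (AE x in lebesgue_on \<Omega>. g x = - g (flip1 x))"

definition odd2 :: "(real^2) set \<Rightarrow> (real^2 \<Rightarrow> real) \<Rightarrow> bool" where
  "odd2 \<Omega> g \<longleftrightarrow> (AE x in lebesgue_on \<Omega>. g x = - g (flip2 x))"

definition hdot_sym :: "(real^2) set \<Rightarrow> (real^2 \<Rightarrow> real^2) set" where
  "hdot_sym \<Omega> = {u \<in> hdot \<Omega>. \<forall>i. odd2 \<Omega> (\<lambda>x. u x $ i) \<or> odd1 \<Omega> (\<lambda>x. u x $ i)}"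

definition same_symmetry ::
    "(real^2) set \<Rightarrow> (real^2 \<Rightarrow> real^2) \<Rightarrow> (real^2 \<Rightarrow> real^2) \<Rightarrow> bool" where
  "same_symmetry \<Omega> u v \<longleftrightarrow>
     (\<forall>i. (odd2 \<Omega> (\<lambda>x. u x $ i) \<and> odd2 \<Omega> (\<lambda>x. v x $ i)) \<or>
          (odd1 \<Omega> (\<lambda>x. u x $ i) \<and> odd1 \<Omega> (\<lambda>x. v x $ i)))"

section \<open>Stationary Navier-Stokes equation\<close>

definition convection :: "(real^2) set \<Rightarrow> (real^2 \<Rightarrow> real^2) \<Rightarrow> real^2 \<Rightarrow> real^2" where
  "convection \<Omega> u x = (\<chi> j. \<Sum>i\<in>UNIV. u x $ i * weak_grad \<Omega> u x $ j $ i)"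

definition symmetric_weak_solution ::
    "(real^2) set \<Rightarrow> ((real^2 \<Rightarrow> real^2) \<Rightarrow> real) \<Rightarrow> (real^2 \<Rightarrow> real^2) \<Rightarrow> bool" where
  "symmetric_weak_solution \<Omega> f u \<longleftrightarrow>
     u \<in> hdot_sym \<Omega> \<and>
     (\<forall>\<phi>\<in>test_funs_sol \<Omega>.
        (LINT x|lebesgue_on \<Omega>. weak_grad \<Omega> u x \<bullet> grad \<phi> x) +
        (LINT x|lebesgue_on \<Omega>. convection \<Omega> u x \<bullet> \<phi> x) = f \<phi>)"

end

theory Submission
  imports Defs "HOL-Computational_Algebra.Polynomial"
begin

text \<open>Write \<open>w = u - v\<close>. Adding the energy inequality for \<open>u\<close> to the equations for \<open>u\<close> tested with \<open>v\<close>
  and for \<open>v\<close> tested with \<open>u\<close> and \<open>v\<close> gives, after cancellation in the trilinear form,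
  \<open>\<parallel>\<nabla>w\<parallel>\<^sup>2 \<le> (w \<cdot> \<nabla>w, v) \<le> \<delta> \<parallel>w / (1 + |x|)\<parallel> \<parallel>\<nabla>w\<parallel>\<close>. The components of \<open>w\<close> are antisymmetric, so the
  one-dimensional Hardy inequality bounds the right-hand side by \<open>2 \<delta> \<parallel>\<nabla>w\<parallel>\<^sup>2\<close>, and every
  \<open>\<delta> < 1/2\<close> suffices.

  Hardy's inequality needs antisymmetric approximating test fields. They exist because a solenoidal
  field with the assumed component symmetries is invariant, up to sign, under both reflections.

  The delicate point is to test the equation for \<open>u\<close> with \<open>v\<close>, since \<open>u\<close> has no decay. The test fields
  approximating \<open>v\<close> are cut off by means of their stream functions; Poincare's inequality on the frame
  where the cut-off function varies, Ladyzhenskaya's inequality and the decay of \<open>v\<close> show that the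
  commutator terms vanish as the frame moves to infinity.\<close>

section \<open>Calculus of \<open>Ck\<close> functions\<close>

text \<open>In the plane the Dirichlet norm alone does not control the field divided by 1 + |x|; a
  logarithm is missing. Antisymmetry makes every component vanish on a coordinate axis, so Hardy's
  inequality holds line by line with a constant that does not see the domain, and \<delta> is
  absolute. The form (u \<cdot> \<nabla>u, v) is finite by the decay of v, but the test fields
  tending to v have no common decay, so the limit cannot be taken in one step. For a frame of fixed
  size R the index of the test field goes to infinity first, and constants may depend on R. Only
  then does R grow. By that time the test fields have been replaced by v on the frame, where |v| is
  at most \<delta> / R, so the bounds for the corrector that restores zero divergence are O(1) in L2
  and O(1/R) for the gradient. Ladyzhenskaya's estimate loses a factor R, which this product exactly
  compensates; what remains small is the tail of \<nabla>u. The frames are square because they are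
  then unions of four rectangles and the cut-off function is a product of functions of one
  variable.\<close>

lemma partial_deriv_eqI:
  "(g has_derivative D) (at x) \<Longrightarrow> partial_deriv i g x = D (axis i 1)"
  by (simp add: partial_deriv_def frechet_derivative_at[symmetric])

lemma vec2_axis_sum: "(h :: real^2) = (\<Sum>i\<in>UNIV. (h $ i) *\<^sub>R axis i 1)"
  using basis_expansion[of h] by (simp add: scalar_mult_eq_scaleR)

lemma differentiable_partial_derivs:
  assumes "g differentiable (at x)"
  shows "(g has_derivative (\<lambda>h. \<Sum>i\<in>UNIV. (h $ i) *\<^sub>R partial_deriv i g x)) (at x)"
proof -
  obtain D where D: "(g has_derivative D) (at x)"
    using assms differentiable_def by blast
  have lin: "linear D" using D has_derivative_linear by blast
  have "D h = (\<Sum>i\<in>UNIV. (h $ i) *\<^sub>R partial_deriv i g x)" for h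
  proof -
    have "D h = D (\<Sum>i\<in>UNIV. (h $ i) *\<^sub>R axis i 1)"
      using vec2_axis_sum by metis
    also have "\<dots> = (\<Sum>i\<in>UNIV. (h $ i) *\<^sub>R D (axis i 1))"
      by (simp add: lin linear_sum linear_cmul)
    finally show ?thesis by (simp add: partial_deriv_eqI[OF D])
  qed
  then show ?thesis using D by (metis (no_types, lifting) ext)
qed

lemma Ck_has_derivative:
  "Ck (Suc k) g \<Longrightarrow> (g has_derivative (\<lambda>h. \<Sum>i\<in>UNIV. (h $ i) *\<^sub>R partial_deriv i g x)) (at x)"
  by (intro differentiable_partial_derivs) simp

lemma Ck_SucD: "Ck (Suc k) g \<Longrightarrow> Ck k g"
proof (induction k arbitrary: g)
  case 0
  then show ?case
    by (auto simp: continuous_on_eq_continuous_at differentiable_imp_continuous_within)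
next
  case (Suc k)
  then show ?case by (metis Ck.simps(2))
qed

lemma Ck_imp_continuous: "Ck k g \<Longrightarrow> continuous_on UNIV g"
  by (induction k arbitrary: g)
     (auto simp: continuous_on_eq_continuous_at differentiable_imp_continuous_within)

text \<open>Introduction rule behind the closure lemmas: an explicit derivative \<open>D\<close>
  identifies the partial derivatives as its values on the axis vectors, and only their regularity
  remains to be shown.\<close>

lemma Ck_SucI:
  assumes "\<And>x. (g has_derivative D x) (at x)" "\<And>i. Ck k (\<lambda>x. D x (axis i 1))"
  shows "Ck (Suc k) g"
proof -
  have "partial_deriv i g = (\<lambda>x. D x (axis i 1))" for i
    using assms(1) partial_deriv_eqI by blast
  then show ?thesis using assms differentiable_def by (auto simp: differentiable_def)
qed

declare Ck.simps(2) [simp del]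

lemma Ck_const: "Ck k (\<lambda>x. c)"
proof (induction k arbitrary: c)
  case (Suc k)
  show ?case by (rule Ck_SucI[where D="\<lambda>_ _. 0"]) (auto simp: Suc.IH)
qed auto

lemma sum_axis_scaleR: "(\<Sum>j\<in>UNIV. (axis i 1 $ j) *\<^sub>R (f j :: 'b::real_vector)) = f (i::2)"
proof -
  have "(\<Sum>j\<in>UNIV. (axis i (1::real) $ j) *\<^sub>R f j) = (\<Sum>j\<in>UNIV. if i = j then f j else 0)"
    by (intro sum.cong) (auto simp: axis_def)
  then show ?thesis by simp
qed

lemma Ck_add: "Ck k f \<Longrightarrow> Ck k g \<Longrightarrow> Ck k (\<lambda>x. f x + g x)"
proof (induction k arbitrary: f g)
  case (Suc k)
  show ?case
  proof (rule Ck_SucI)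
    show "((\<lambda>x. f x + g x) has_derivative
       (\<lambda>h. (\<Sum>i\<in>UNIV. (h $ i) *\<^sub>R partial_deriv i f x) + (\<Sum>i\<in>UNIV. (h $ i) *\<^sub>R partial_deriv i g x))) (at x)" for x
      using Suc.prems by (intro has_derivative_add Ck_has_derivative)
    show "Ck k (\<lambda>x. (\<Sum>j\<in>UNIV. (axis i 1 $ j) *\<^sub>R partial_deriv j f x) + (\<Sum>j\<in>UNIV. (axis i 1 $ j) *\<^sub>R partial_deriv j g x))" for i
      unfolding sum_axis_scaleR using Suc by (simp add: Ck.simps)
  qed
qed (auto intro: continuous_intros)

lemma Ck_linear:
  assumes "bounded_linear L"
  shows "Ck k f \<Longrightarrow> Ck k (\<lambda>x. L (f x))"
proof (induction k arbitrary: f)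
  case 0
  then show ?case using assms by (simp add: bounded_linear.continuous_on)
next
  case (Suc k)
  show ?case
  proof (rule Ck_SucI)
    show "((\<lambda>x. L (f x)) has_derivative
       (\<lambda>h. L (\<Sum>i\<in>UNIV. (h $ i) *\<^sub>R partial_deriv i f x))) (at x)" for x
      by (rule bounded_linear.has_derivative[OF assms Ck_has_derivative[OF Suc.prems]])
    show "Ck k (\<lambda>x. L (\<Sum>j\<in>UNIV. (axis i 1 $ j) *\<^sub>R partial_deriv j f x))" for i
      using Suc by (simp add: sum_axis_scaleR Ck.simps)
  qed
qed

text \<open>The product rule pairs a derivative of one factor with the other factor itself, so the
  induction must vary both \<open>f\<close> and \<open>g\<close>, and \<open>Ck_SucD\<close> lowers
  the order of the undifferentiated factor.\<close>

lemma Ck_bilinear: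
  assumes B: "bounded_bilinear B"
  shows "Ck k f \<Longrightarrow> Ck k g \<Longrightarrow> Ck k (\<lambda>x. B (f x) (g x))"
proof (induction k arbitrary: f g)
  case 0
  then show ?case using B by (simp add: bounded_bilinear.continuous_on)
next
  case (Suc k)
  show ?case
  proof (rule Ck_SucI)
    show "((\<lambda>x. B (f x) (g x)) has_derivative
       (\<lambda>h. B (f x) (\<Sum>i\<in>UNIV. (h $ i) *\<^sub>R partial_deriv i g x) + B (\<Sum>i\<in>UNIV. (h $ i) *\<^sub>R partial_deriv i f x) (g x))) (at x)" for x
      by (rule bounded_bilinear.FDERIV[OF B Ck_has_derivative[OF Suc.prems(1)] Ck_has_derivative[OF Suc.prems(2)]])
    show "Ck k (\<lambda>x. B (f x) (\<Sum>j\<in>UNIV. (axis i 1 $ j) *\<^sub>R partial_deriv j g x) + B (\<Sum>j\<in>UNIV. (axis i 1 $ j) *\<^sub>R partial_deriv j f x) (g x))" for i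
      unfolding sum_axis_scaleR
      using Suc.prems by (intro Ck_add Suc.IH) (auto simp: Ck.simps(2)[of k] intro: Ck_SucD)
  qed
qed

lemmas Ck_mult = Ck_bilinear[OF bounded_bilinear_mult]
lemmas Ck_scaleR = Ck_bilinear[OF bounded_bilinear_scaleR]
lemmas Ck_nth = Ck_linear[OF bounded_linear_vec_nth]
lemmas Ck_cmult = Ck_linear[OF bounded_linear_scaleR_right]

lemma Ck_diff: "Ck k f \<Longrightarrow> Ck k g \<Longrightarrow> Ck k (\<lambda>x. f x - g x)"
  using Ck_add[of k f "\<lambda>x. (-1) *\<^sub>R g x"] Ck_cmult[of k g "-1"] by simp

lemma Ck_sum: "finite A \<Longrightarrow> (\<And>i. i \<in> A \<Longrightarrow> Ck k (f i)) \<Longrightarrow> Ck k (\<lambda>x. \<Sum>i\<in>A. f i x)"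
  by (induction rule: finite_induct) (auto intro: Ck_const Ck_add)

lemmas Ck1_has_derivative = Ck_has_derivative[of 0]

lemma partial_deriv_add:
  "Ck (Suc 0) f \<Longrightarrow> Ck (Suc 0) g \<Longrightarrow>
    partial_deriv i (\<lambda>x. f x + g x) x = partial_deriv i f x + partial_deriv i g x"
  by (subst partial_deriv_eqI[OF has_derivative_add[OF Ck1_has_derivative Ck1_has_derivative]])
     (auto simp: sum_axis_scaleR)

lemma partial_deriv_linear:
  "bounded_linear L \<Longrightarrow> Ck (Suc 0) f \<Longrightarrow> partial_deriv i (\<lambda>x. L (f x)) x = L (partial_deriv i f x)"
  by (subst partial_deriv_eqI[OF bounded_linear.has_derivative[OF _ Ck1_has_derivative]])
     (auto simp: sum_axis_scaleR)

lemma partial_deriv_diff: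
  "Ck (Suc 0) f \<Longrightarrow> Ck (Suc 0) g \<Longrightarrow>
    partial_deriv i (\<lambda>x. f x - g x) x = partial_deriv i f x - partial_deriv i g x"
  by (subst partial_deriv_eqI[OF has_derivative_diff[OF Ck1_has_derivative Ck1_has_derivative]])
     (auto simp: sum_axis_scaleR)

lemma partial_deriv_mult:
  "Ck (Suc 0) f \<Longrightarrow> Ck (Suc 0) g \<Longrightarrow>
    partial_deriv i (\<lambda>x. f x * g x :: real) x = f x * partial_deriv i g x + partial_deriv i f x * g x"
  by (subst partial_deriv_eqI[OF has_derivative_mult[OF Ck1_has_derivative Ck1_has_derivative]])
     (auto simp: sum_axis_scaleR[where 'b=real, simplified])

lemma partial_deriv_cmult:
  "Ck (Suc 0) f \<Longrightarrow> partial_deriv i (\<lambda>x. c *\<^sub>R f x) x = c *\<^sub>R partial_deriv i f x"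
  by (rule partial_deriv_linear[OF bounded_linear_scaleR_right])

lemma partial_deriv_const [simp]: "partial_deriv i (\<lambda>x. c) x = 0"
  by (rule partial_deriv_eqI[where D="\<lambda>_. 0", simplified]) auto

subsection \<open>Reflections\<close>

text \<open>Indexing the reflections by the coordinate they negate lets a symmetry type be a map
  from components to indices, and lets both reflections share every proof.\<close>

definition flip :: "2 \<Rightarrow> real^2 \<Rightarrow> real^2" where
  "flip i x = (\<chi> j. if j = i then - x $ j else x $ j)"

lemma flip_nth: "flip i x $ j = (if j = i then - x $ j else x $ j)"
  by (simp add: flip_def)

lemma flip1_eq: "flip1 = flip 1" and flip2_eq: "flip2 = flip 2"
  by (auto simp: fun_eq_iff flip1_def flip2_def vec_eq_iff flip_nth forall_2)

lemma flip_flip [simp]: "flip i (flip i x) = x"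
  by (simp add: vec_eq_iff flip_nth)

lemma flip_commute: "flip i (flip j x) = flip j (flip i x)"
  by (simp add: vec_eq_iff flip_nth)

lemma norm_flip [simp]: "norm (flip i x) = norm x"
  by (simp add: norm_vec_def L2_set_def flip_nth sum_2 power2_eq_square if_distrib)

lemma bounded_linear_flip: "bounded_linear (flip i)"
  by (rule bounded_linear_intro[where K=1]) (auto simp: vec_eq_iff flip_nth)

lemma flip_axis: "flip i (axis j 1) = (if j = i then -1 else 1) *\<^sub>R axis j 1"
  by (auto simp: vec_eq_iff flip_nth axis_def)

lemma Ck_flip: "Ck k f \<Longrightarrow> Ck k (\<lambda>x. f (flip i x))"
proof (induction k arbitrary: f)
  case 0
  then have "continuous_on UNIV f" by simp
  from continuous_on_compose2[OF this bounded_linear.continuous_on[OF bounded_linear_flip continuous_on_id]]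
  show ?case by auto
next
  case (Suc k)
  have D: "((\<lambda>x. f (flip i x)) has_derivative
       (\<lambda>h. (\<Sum>j\<in>UNIV. (flip i h $ j) *\<^sub>R partial_deriv j f (flip i x)))) (at x)" for x
    using has_derivative_compose[OF bounded_linear.has_derivative[OF bounded_linear_flip has_derivative_ident] Ck_has_derivative[OF Suc.prems]]
    by simp
  show ?case
  proof (rule Ck_SucI[OF D])
    show "Ck k (\<lambda>x. \<Sum>j\<in>UNIV. (flip i (axis l 1) $ j) *\<^sub>R partial_deriv j f (flip i x))" for l
      using Suc by (intro Ck_sum Ck_cmult) (auto simp: Ck.simps)
  qed
qed

lemma partial_deriv_flip:
  assumes "Ck (Suc 0) f"
  shows "partial_deriv j (\<lambda>x. f (flip i x)) x = (if j = i then -1 else 1) *\<^sub>R partial_deriv j f (flip i x)"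
proof -
  have D: "((\<lambda>x. f (flip i x)) has_derivative
       (\<lambda>h. (\<Sum>j\<in>UNIV. (flip i h $ j) *\<^sub>R partial_deriv j f (flip i x)))) (at x)"
    using has_derivative_compose[OF bounded_linear.has_derivative[OF bounded_linear_flip has_derivative_ident] Ck_has_derivative[OF assms]]
    by simp
  have "(\<Sum>l\<in>UNIV. (flip i (axis j 1) $ l) *\<^sub>R partial_deriv l f (flip i x))
     = (if j = i then -1 else 1) *\<^sub>R (\<Sum>l\<in>UNIV. (axis j 1 $ l) *\<^sub>R partial_deriv l f (flip i x))"
    by (simp add: flip_axis scaleR_sum_right)
  then show ?thesis by (simp add: partial_deriv_eqI[OF D] sum_axis_scaleR)
qed

subsection \<open>Bump functions\<close>

text \<open>The derivative is quantified existentially so that closure proofs can name it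
  explicitly; \<open>Ck_coord\<close> lifts the result to functions of one coordinate in the
  plane.\<close>

primrec Ck_line :: "nat \<Rightarrow> (real \<Rightarrow> real) \<Rightarrow> bool" where
  "Ck_line 0 f \<longleftrightarrow> continuous_on UNIV f"
| "Ck_line (Suc k) f \<longleftrightarrow> (\<exists>f'. (\<forall>x. (f has_real_derivative f' x) (at x)) \<and> Ck_line k f')"

lemma Ck_line_SucI: "(\<And>x. (f has_real_derivative f' x) (at x)) \<Longrightarrow> Ck_line k f' \<Longrightarrow> Ck_line (Suc k) f"
  unfolding Ck_line.simps by (rule exI[of _ f']) simp

lemma Ck_line_SucD: "Ck_line (Suc k) f \<Longrightarrow> Ck_line k f"
proof (induction k arbitrary: f)
  case 0
  then show ?case by (auto intro: DERIV_continuous_on DERIV_subset)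
next
  case (Suc k)
  then obtain f' where "\<And>x. (f has_real_derivative f' x) (at x)" "Ck_line (Suc k) f'" by auto
  with Suc.IH show ?case by (intro Ck_line_SucI)
qed

lemma Ck_line_add: "Ck_line k f \<Longrightarrow> Ck_line k g \<Longrightarrow> Ck_line k (\<lambda>x. f x + g x)"
proof (induction k arbitrary: f g)
  case (Suc k)
  then obtain f' g' where "\<And>x. (f has_real_derivative f' x) (at x)" "Ck_line k f'"
    "\<And>x. (g has_real_derivative g' x) (at x)" "Ck_line k g'" by auto
  then show ?case by (intro Ck_line_SucI[where f'="\<lambda>x. f' x + g' x"] DERIV_add Suc.IH)
qed (auto intro: continuous_intros)

lemma Ck_line_mult: "Ck_line k f \<Longrightarrow> Ck_line k g \<Longrightarrow> Ck_line k (\<lambda>x. f x * g x)"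
proof (induction k arbitrary: f g)
  case (Suc k)
  then obtain f' g' where *: "\<And>x. (f has_real_derivative f' x) (at x)" "Ck_line k f'"
    "\<And>x. (g has_real_derivative g' x) (at x)" "Ck_line k g'" by auto
  have "Ck_line k (\<lambda>x. f' x * g x + g' x * f x)"
    using * Ck_line_SucD[OF Suc.prems(1)] Ck_line_SucD[OF Suc.prems(2)] by (intro Ck_line_add Suc.IH)
  with * show ?case by (intro Ck_line_SucI[where f'="\<lambda>x. f' x * g x + g' x * f x"] DERIV_mult)
qed (auto intro: continuous_intros)

lemma Ck_line_const: "Ck_line k (\<lambda>x. c)"
proof (induction k arbitrary: c)
  case (Suc k)
  have "((\<lambda>x. c) has_real_derivative 0) (at x)" for x by simp
  then show ?case by (rule Ck_line_SucI[where f'="\<lambda>_. 0"]) (rule Suc)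
qed auto

lemma Ck_line_affine: "Ck_line k f \<Longrightarrow> Ck_line k (\<lambda>x. f (c + d * x))"
proof (induction k arbitrary: f)
  case 0
  then have "continuous_on UNIV f" by simp
  show ?case unfolding Ck_line.simps Ck.simps
    by (rule continuous_on_compose2[OF \<open>continuous_on UNIV f\<close>]) (auto intro!: continuous_intros)
next
  case (Suc k)
  then obtain f' where f: "\<And>x. (f has_real_derivative f' x) (at x)" "Ck_line k f'" by auto
  have "((\<lambda>x. f (c + d * x)) has_real_derivative f' (c + d * x) * d) (at x)" for x
    by (rule DERIV_chain'[OF _ f(1)]) (auto intro!: derivative_eq_intros)
  then show ?case using Ck_line_mult[OF Suc.IH[OF f(2)] Ck_line_const[of k d]] by (rule Ck_line_SucI)
qed

lemma Ck_coord: "Ck_line k f \<Longrightarrow> Ck k (\<lambda>x. f (x $ i))"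
proof (induction k arbitrary: f)
  case 0
  then have "continuous_on UNIV f" by simp
  show ?case unfolding Ck_line.simps Ck.simps
    by (rule continuous_on_compose2[OF \<open>continuous_on UNIV f\<close>]) (auto intro!: continuous_intros)
next
  case (Suc k)
  then obtain f' where f: "\<And>x. (f has_real_derivative f' x) (at x)" "Ck_line k f'" by auto
  have D: "((\<lambda>x. f (x $ i)) has_derivative (\<lambda>h. f' (x $ i) * h $ i)) (at x)" for x :: "real^2"
    using has_derivative_compose[OF bounded_linear_imp_has_derivative[OF bounded_linear_vec_nth]
       f(1)[unfolded has_field_derivative_def]] .
  show ?case
    by (rule Ck_SucI[OF D]) (intro Ck_mult Ck_const Suc.IH f)
qed

definition bump_e :: "real \<Rightarrow> real" where
  "bump_e s = (if s > 0 then exp (- (1 / s)) else 0)"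

text \<open>With y = 1/s this is the decay of p(y) exp(-y) at infinity, checked monomial by
  monomial.\<close>

lemma poly_exp_inverse_tendsto:
  "((\<lambda>s. poly p (1 / s) * exp (- (1 / s))) \<longlongrightarrow> (0::real)) (at_right 0)"
proof -
  have 1: "((\<lambda>y. poly p y / exp y) \<longlongrightarrow> (0::real)) at_top"
  proof (induction p)
    case 0 then show ?case by simp
  next
    case (pCons a p)
    have "((\<lambda>y. (\<Sum>i\<le>degree (pCons a p). coeff (pCons a p) i * (y ^ i / exp y))) \<longlongrightarrow>
        (\<Sum>i\<le>degree (pCons a p). coeff (pCons a p) i * 0)) at_top"
      by (intro tendsto_sum tendsto_mult tendsto_const tendsto_power_div_exp_0)
    then show ?case by (simp add: poly_altdef sum_divide_distrib)
  qed
  have "filterlim (\<lambda>s::real. 1 / s) at_top (at_right 0)"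
    using filterlim_inverse_at_top_right by (simp add: inverse_eq_divide)
  from filterlim_compose[OF 1 this] show ?thesis
    by (simp add: exp_minus field_simps)
qed

text \<open>All derivatives of \<open>bump_e\<close> have the form p(1/s) exp(-1/s) on the positive
  half-line, so the family of all such functions is what is closed under differentiation and carries
  the induction.\<close>

lemma Ck_line_poly_exp: "Ck_line k (\<lambda>s. if s > 0 then poly p (1 / s) * exp (- (1 / s)) else 0)"
proof (induction k arbitrary: p)
  case 0
  let ?f = "\<lambda>s::real. if s > 0 then poly p (1 / s) * exp (- (1 / s)) else 0"
  have "isCont ?f x" for x
  proof -
    consider "x < 0" | "x > 0" | "x = 0" by linarith
    then show ?thesis
    proof cases
      case 1
      have "\<forall>\<^sub>F y in nhds x. y < 0" using 1 by (intro order_tendstoD[OF _ 1]) (auto intro: filterlim_ident)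
      then have "\<forall>\<^sub>F y in nhds x. ?f y = 0" by eventually_elim auto
      then show ?thesis by (simp add: isCont_cong)
    next
      case 2
      have "\<forall>\<^sub>F y in nhds x. y > 0" using 2 by (intro order_tendstoD[OF _ 2]) (auto intro: filterlim_ident)
      then have "\<forall>\<^sub>F y in nhds x. ?f y = poly p (1 / y) * exp (- (1 / y))" by eventually_elim auto
      then have "isCont ?f x \<longleftrightarrow> isCont (\<lambda>y. poly p (1 / y) * exp (- (1 / y))) x" by (rule isCont_cong)
      then show ?thesis using 2 by (auto intro!: continuous_intros)
    next
      case 3
      have "(?f \<longlongrightarrow> 0) (at_right 0)"
        using poly_exp_inverse_tendsto[of p] by (rule Lim_transform_eventually)
          (auto simp: eventually_at_filter)
      moreover have "(?f \<longlongrightarrow> 0) (at_left 0)"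
        by (rule Lim_transform_eventually[OF tendsto_const]) (auto simp: eventually_at_filter)
      ultimately show ?thesis using 3
        by (simp add: isCont_def filterlim_split_at)
    qed
  qed
  then show ?case by (simp add: continuous_on_eq_continuous_at)
next
  case (Suc k)
  \<comment> \<open>The derivative of p(1/s) exp(-1/s) is (p - p')(1/s) exp(-1/s) / s^2;
    \<open>[:0, 0, 1:]\<close> encodes the factor 1/s^2.\<close>
  define q where "q = (p - pderiv p) * [:0, 0, 1:]"
  let ?f = "\<lambda>s::real. if s > 0 then poly p (1 / s) * exp (- (1 / s)) else 0"
  let ?g = "\<lambda>s::real. if s > 0 then poly q (1 / s) * exp (- (1 / s)) else 0"
  have *: "(?f has_real_derivative ?g x) (at x)" for x
  proof -
    consider "x < 0" | "x > 0" | "x = 0" by linarith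
    then show ?thesis
    proof cases
      case 1
      have "\<forall>\<^sub>F y in nhds x. y < 0" using 1 by (intro order_tendstoD[OF _ 1]) (auto intro: filterlim_ident)
      then have "\<forall>\<^sub>F y in nhds x. ?f y = 0" by eventually_elim auto
      then have "(?f has_real_derivative 0) (at x) \<longleftrightarrow> ((\<lambda>_. 0) has_real_derivative 0) (at x)"
        by (rule DERIV_cong_ev[OF refl _ refl])
      then show ?thesis using 1 by simp
    next
      case 2
      have "\<forall>\<^sub>F y in nhds x. y > 0" using 2 by (intro order_tendstoD[OF _ 2]) (auto intro: filterlim_ident)
      then have "\<forall>\<^sub>F y in nhds x. ?f y = poly p (1 / y) * exp (- (1 / y))" by eventually_elim auto
      then have **: "(?f has_real_derivative ?g x) (at x) \<longleftrightarrow>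
         ((\<lambda>y. poly p (1 / y) * exp (- (1 / y))) has_real_derivative ?g x) (at x)"
        by (rule DERIV_cong_ev[OF refl _ refl])
      have "((\<lambda>y. poly p (1 / y) * exp (- (1 / y))) has_real_derivative ?g x) (at x)"
      proof -
        have d: "((\<lambda>y. 1 / y) has_real_derivative (- (1 / (x * x)))) (at x)"
          using 2 by (auto intro!: derivative_eq_intros)
        have "((\<lambda>y. poly p (1 / y) * exp (- (1 / y))) has_real_derivative
            (poly (pderiv p) (1 / x) * (- (1 / (x * x)))) * exp (- (1 / x)) +
            (exp (- (1 / x)) * - (- (1 / (x * x)))) * poly p (1 / x)) (at x)"
          by (intro DERIV_mult DERIV_chain'[OF d poly_DERIV] DERIV_chain'[OF DERIV_minus[OF d] DERIV_exp])
        also have "(poly (pderiv p) (1 / x) * (- (1 / (x * x)))) * exp (- (1 / x)) +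
            (exp (- (1 / x)) * - (- (1 / (x * x)))) * poly p (1 / x) = ?g x"
          using 2 by (simp add: q_def algebra_simps)
        finally show ?thesis .
      qed
      then show ?thesis unfolding ** .
    next
      case 3
      \<comment> \<open>The difference quotient at the origin is again of the same form: dividing by
        s multiplies the polynomial by \<open>[:0, 1:]\<close>.\<close>
      have "((\<lambda>s. ?f s / s) \<longlongrightarrow> 0) (at_right 0)"
        using poly_exp_inverse_tendsto[of "p * [:0, 1:]"] by (rule Lim_transform_eventually)
          (auto simp: eventually_at_filter)
      moreover have "((\<lambda>s. ?f s / s) \<longlongrightarrow> 0) (at_left 0)"
        by (rule Lim_transform_eventually[OF tendsto_const]) (auto simp: eventually_at_filter)
      ultimately have "((\<lambda>s. ?f s / s) \<longlongrightarrow> 0) (at 0)"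
        by (simp add: filterlim_split_at)
      then show ?thesis unfolding 3 DERIV_def add_0 by simp
    qed
  qed
  show ?case
    apply (rule Ck_line_SucI[where f'="?g"])
    apply (fact *)
    apply (rule Suc.IH)
    done
qed

lemma Ck_line_bump_e: "Ck_line k bump_e"
proof -
  have "bump_e = (\<lambda>s. if s > 0 then poly 1 (1 / s) * exp (- (1 / s)) else 0)"
    by (auto simp: bump_e_def fun_eq_iff)
  then show ?thesis using Ck_line_poly_exp[of k 1] by metis
qed

lemma bump_e_bounds: "0 \<le> bump_e s" "bump_e s \<le> 1" "bump_e s > 0 \<longleftrightarrow> s > 0" "bump_e s = 0 \<longleftrightarrow> s \<le> 0"
  by (auto simp: bump_e_def)

section \<open>Integral inequalities for smooth functions\<close>

subsection \<open>One variable\<close>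

text \<open>The fundamental theorem of calculus, with a nonnegative integral over the whole
  interval: the bound no longer depends on the two points and can be fed to Tonelli's theorem
  without integrability proofs.\<close>

lemma abs_diff_le_nn_integral_deriv:
  fixes h :: "real \<Rightarrow> real"
  assumes h: "\<And>s. (h has_real_derivative h' s) (at s)" and c: "continuous_on UNIV h'"
    and xy: "x \<in> {a..b}" "y \<in> {a..b}"
  shows "ennreal \<bar>h x - h y\<bar> \<le> (\<integral>\<^sup>+s. ennreal \<bar>h' s\<bar> * indicator {a..b} s \<partial>lborel)"
proof -
  have *: "ennreal \<bar>h x - h y\<bar> \<le> (\<integral>\<^sup>+s. ennreal \<bar>h' s\<bar> * indicator {a..b} s \<partial>lborel)"
    if "y \<le> x" "x \<in> {a..b}" "y \<in> {a..b}" for x y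
  proof -
    have "has_bochner_integral lborel (\<lambda>s. h' s * indicator {y..x} s) (h x - h y)"
      using h c that by (intro has_bochner_integral_FTC_Icc_real) (auto simp: continuous_on_eq_continuous_at)
    then have "ennreal \<bar>h x - h y\<bar> \<le> (\<integral>\<^sup>+s. norm (h' s * indicator {y..x} s) \<partial>lborel)"
      using integral_norm_bound_ennreal[of lborel "\<lambda>s. h' s * indicator {y..x} s"]
      by (auto simp: has_bochner_integral_iff)
    also have "\<dots> \<le> (\<integral>\<^sup>+s. ennreal \<bar>h' s\<bar> * indicator {a..b} s \<partial>lborel)"
      using that by (intro nn_integral_mono) (auto simp: abs_mult indicator_def)
    finally show ?thesis .
  qed
  show ?thesis
    using *[of x y] *[of y x] xy by (cases "y \<le> x") (auto simp: abs_minus_commute)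
qed

text \<open>Cauchy-Schwarz against the indicator of the interval, which contributes the factor
  \<open>b - a\<close>; for this the indicator is written twice.\<close>

lemma sq_diff_le_nn_integral_deriv:
  fixes h :: "real \<Rightarrow> real"
  assumes h: "\<And>s. (h has_real_derivative h' s) (at s)" and c: "continuous_on UNIV h'"
    and xy: "x \<in> {a..b}" "y \<in> {a..b}"
  shows "ennreal ((h x - h y)\<^sup>2) \<le> ennreal (b - a) * (\<integral>\<^sup>+s. ennreal ((h' s)\<^sup>2) * indicator {a..b} s \<partial>lborel)"
proof -
  have [measurable]: "h' \<in> borel_measurable borel"
    using c by (rule borel_measurable_continuous_onI)
  have "ennreal ((h x - h y)\<^sup>2) = (ennreal \<bar>h x - h y\<bar>)\<^sup>2"
    by (simp add: ennreal_power)
  also have "\<dots> \<le> (\<integral>\<^sup>+s. ennreal \<bar>h' s\<bar> * indicator {a..b} s \<partial>lborel)\<^sup>2"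
    by (intro power_mono abs_diff_le_nn_integral_deriv assms) auto
  also have "\<dots> = (\<integral>\<^sup>+s. (ennreal \<bar>h' s\<bar> * indicator {a..b} s) * indicator {a..b} s \<partial>lborel)\<^sup>2"
    by (intro arg_cong[where f="\<lambda>x. x\<^sup>2"] nn_integral_cong) (auto simp: indicator_def)
  also have "\<dots> \<le> (\<integral>\<^sup>+s. (ennreal \<bar>h' s\<bar> * indicator {a..b} s)\<^sup>2 \<partial>lborel) * (\<integral>\<^sup>+s. (indicator {a..b} s)\<^sup>2 \<partial>lborel)"
    by (rule Cauchy_Schwarz_nn_integral) auto
  also have "(\<integral>\<^sup>+s. (ennreal \<bar>h' s\<bar> * indicator {a..b} s)\<^sup>2 \<partial>lborel) = (\<integral>\<^sup>+s. ennreal ((h' s)\<^sup>2) * indicator {a..b} s \<partial>lborel)"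
    by (intro nn_integral_cong) (auto simp: indicator_def ennreal_power)
  also have "(\<integral>\<^sup>+s. (indicator {a..b} s)\<^sup>2 \<partial>lborel) = (\<integral>\<^sup>+s. indicator {a..b} s \<partial>lborel)"
    by (intro nn_integral_cong) (auto simp: indicator_def)
  also have "\<dots> = ennreal (b - a)"
    using xy by simp
  finally show ?thesis by (simp add: mult.commute)
qed

text \<open>Fundamental theorem of calculus for the square of \<open>h\<close>, started outside the
  support. This is the one-dimensional ingredient of Ladyzhenskaya's inequality: the bound is the
  same for all points of the line.\<close>

lemma sq_le_nn_integral_deriv:
  fixes h :: "real \<Rightarrow> real"
  assumes h: "\<And>s. (h has_real_derivative h' s) (at s)" and c: "continuous_on UNIV h'"
    and supp: "\<And>s. R < \<bar>s\<bar> \<Longrightarrow> h s = 0"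
  shows "ennreal ((h x)\<^sup>2) \<le> (\<integral>\<^sup>+s. ennreal (2 * \<bar>h s * h' s\<bar>) \<partial>lborel)"
proof -
  have ch: "continuous_on UNIV h" using h by (auto intro: DERIV_continuous_on)
  \<comment> \<open>The offset puts \<open>y\<close> beyond the support and to the left of
    \<open>x\<close>, whatever the sign of \<open>R\<close>.\<close>
  define y where "y = - \<bar>R\<bar> - 1 - \<bar>x\<bar>"
  have "ennreal \<bar>(h x)\<^sup>2 - (h y)\<^sup>2\<bar> \<le> (\<integral>\<^sup>+s. ennreal \<bar>2 * (h s * h' s)\<bar> * indicator {y..x} s \<partial>lborel)"
    using h c ch by (intro abs_diff_le_nn_integral_deriv[of "\<lambda>s. (h s)\<^sup>2"])
      (auto intro!: derivative_eq_intros continuous_intros simp: y_def)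
  also have "\<dots> \<le> (\<integral>\<^sup>+s. ennreal (2 * \<bar>h s * h' s\<bar>) \<partial>lborel)"
    by (intro nn_integral_mono) (auto simp: indicator_def abs_mult)
  also have "h y = 0" by (rule supp) (auto simp: y_def)
  finally show ?thesis by simp
qed

lemma integral_deriv_compact_support:
  fixes h :: "real \<Rightarrow> real"
  assumes h: "\<And>s. (h has_real_derivative h' s) (at s)" and c: "continuous_on UNIV h'"
    and supp: "\<And>s. R < \<bar>s\<bar> \<Longrightarrow> h s = 0" "\<And>s. R < \<bar>s\<bar> \<Longrightarrow> h' s = 0"
  shows "(\<integral>s. h' s \<partial>lborel) = 0"
proof -
  have "(\<integral>s. h' s * indicator {- \<bar>R\<bar> - 1 .. \<bar>R\<bar> + 1} s \<partial>lborel) = h (\<bar>R\<bar> + 1) - h (- \<bar>R\<bar> - 1)"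
    using h c by (intro integral_FTC_Icc_real) (auto simp: continuous_on_eq_continuous_at)
  moreover have "h' s * indicator {- \<bar>R\<bar> - 1 .. \<bar>R\<bar> + 1} s = h' s" for s
    using supp(2)[of s] by (cases "R < \<bar>s\<bar>") (auto simp: indicator_def)
  ultimately show ?thesis using supp(1) by simp
qed

text \<open>With \<open>k s = 1 / (2 (1 + s))\<close> one has
  \<open>h'\<^sup>2 - h\<^sup>2 / (4 (1 + s)\<^sup>2) = (h' - k h)\<^sup>2 + (k h\<^sup>2)'\<close>.\<close>

lemma hardy_half_line:
  fixes h :: "real \<Rightarrow> real"
  assumes h: "\<And>s. (h has_real_derivative h' s) (at s)" and c: "continuous_on UNIV h'"
    and h0: "h 0 = 0" and R: "0 \<le> R"
  shows "(\<integral>\<^sup>+s. ennreal ((h s)\<^sup>2 / (1 + \<bar>s\<bar>)\<^sup>2) * indicator {0..R} s \<partial>lborel)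
    \<le> (\<integral>\<^sup>+s. ennreal (4 * (h' s)\<^sup>2) * indicator {0..R} s \<partial>lborel)"
proof -
  have ch: "continuous_on UNIV h" using h by (auto intro: DERIV_continuous_on)
  \<comment> \<open>\<open>F\<close> is the term \<open>4 * k * h\<^sup>2\<close> of the identity
    above multiplied by 4, and \<open>f\<close> is its derivative on the nonnegative
    half-line.\<close>
  define F where "F = (\<lambda>s. 2 * (h s)\<^sup>2 / (1 + s))"
  define f where "f = (\<lambda>s. 4 * h s * h' s / (1 + s) - 2 * (h s)\<^sup>2 / (1 + s)\<^sup>2)"
  have F: "has_bochner_integral lborel (\<lambda>s. f s * indicator {0..R} s) (F R - F 0)"
  proof (rule has_bochner_integral_FTC_Icc_real[OF R])
    show "DERIV F x :> f x" if "0 \<le> x" for x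
    proof -
      have nz: "1 + x \<noteq> 0" using that by linarith
      have "DERIV (\<lambda>s. 2 * (h s * h s)) x :> 2 * (h' x * h x + h' x * h x)"
        by (intro DERIV_cmult DERIV_mult h)
      moreover have "DERIV (\<lambda>s. 1 + s) x :> 1" by (auto intro!: derivative_eq_intros)
      ultimately have "DERIV (\<lambda>s. 2 * (h s * h s) / (1 + s)) x :>
          (2 * (h' x * h x + h' x * h x) * (1 + x) - 2 * (h x * h x) * 1) / ((1 + x) * (1 + x))"
        using nz by (rule DERIV_divide)
      also have "(2 * (h' x * h x + h' x * h x) * (1 + x) - 2 * (h x * h x) * 1) / ((1 + x) * (1 + x)) = f x"
        unfolding f_def using nz by (simp add: diff_divide_distrib power2_eq_square)
      finally show ?thesis by (simp add: F_def power2_eq_square)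
    qed
    show "isCont f x" if "0 \<le> x" for x
      unfolding f_def using that c ch by (auto intro!: continuous_intros simp: continuous_on_eq_continuous_at)
  qed
  have intg: "integrable lborel (\<lambda>s. g s * indicator {0..R} s)" if "continuous_on UNIV g" for g :: "real \<Rightarrow> real"
    using that by (intro borel_integrable_atLeastAtMost) (auto simp: continuous_on_eq_continuous_at)
  have w: "1 + \<bar>s\<bar> \<noteq> 0" for s :: real by linarith
  have i1: "integrable lborel (\<lambda>s. (h s)\<^sup>2 / (1 + \<bar>s\<bar>)\<^sup>2 * indicator {0..R} s)"
    by (intro intg) (auto intro!: continuous_intros ch simp: w)
  have i2: "integrable lborel (\<lambda>s. 4 * (h' s)\<^sup>2 * indicator {0..R} s)"
    by (intro intg) (auto intro!: continuous_intros c)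
  have "(\<integral>s. (h s)\<^sup>2 / (1 + \<bar>s\<bar>)\<^sup>2 * indicator {0..R} s \<partial>lborel)
      \<le> (\<integral>s. 4 * (h' s)\<^sup>2 * indicator {0..R} s - f s * indicator {0..R} s \<partial>lborel)"
  proof (rule integral_mono)
    fix s
    show "(h s)\<^sup>2 / (1 + \<bar>s\<bar>)\<^sup>2 * indicator {0..R} s \<le> 4 * (h' s)\<^sup>2 * indicator {0..R} s - f s * indicator {0..R} s"
    proof (cases "s \<in> {0..R}")
      case True
      then have s: "1 + s > 0" by auto
      define q where "q = h s / (1 + s)"
      have f: "f s = 4 * h' s * q - 2 * q\<^sup>2"
        by (simp add: f_def q_def power_divide)
      have "0 \<le> (2 * h' s - q)\<^sup>2" by simp
      also have "\<dots> = 4 * (h' s)\<^sup>2 - f s - q\<^sup>2"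
        unfolding f by (simp add: power2_eq_square algebra_simps)
      also have "q\<^sup>2 = (h s)\<^sup>2 / (1 + s)\<^sup>2" by (simp add: q_def power_divide)
      finally show ?thesis using True by simp
    qed auto
  qed (use i1 i2 F in \<open>auto simp: has_bochner_integral_iff\<close>)
  also have "\<dots> = (\<integral>s. 4 * (h' s)\<^sup>2 * indicator {0..R} s \<partial>lborel) - (F R - F 0)"
    using i2 F by (subst Bochner_Integration.integral_diff) (auto simp: has_bochner_integral_iff)
  \<comment> \<open>\<open>F 0\<close> vanishes with \<open>h 0\<close>, and \<open>F R\<close> is
    nonnegative, so the boundary term only helps.\<close>
  also have "\<dots> \<le> (\<integral>s. 4 * (h' s)\<^sup>2 * indicator {0..R} s \<partial>lborel)"
    using R h0 by (simp add: F_def)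
  finally have le: "(\<integral>s. (h s)\<^sup>2 / (1 + \<bar>s\<bar>)\<^sup>2 * indicator {0..R} s \<partial>lborel) \<le> (\<integral>s. 4 * (h' s)\<^sup>2 * indicator {0..R} s \<partial>lborel)" .
  have "(\<integral>\<^sup>+s. ennreal ((h s)\<^sup>2 / (1 + \<bar>s\<bar>)\<^sup>2) * indicator {0..R} s \<partial>lborel)
     = (\<integral>\<^sup>+s. ennreal ((h s)\<^sup>2 / (1 + \<bar>s\<bar>)\<^sup>2 * indicator {0..R} s) \<partial>lborel)"
    by (intro nn_integral_cong) (auto simp: indicator_def)
  also have "\<dots> = ennreal (\<integral>s. (h s)\<^sup>2 / (1 + \<bar>s\<bar>)\<^sup>2 * indicator {0..R} s \<partial>lborel)"
    by (intro nn_integral_eq_integral i1) auto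
  also have "\<dots> \<le> ennreal (\<integral>s. 4 * (h' s)\<^sup>2 * indicator {0..R} s \<partial>lborel)"
    by (intro ennreal_leI le)
  also have "\<dots> = (\<integral>\<^sup>+s. ennreal (4 * (h' s)\<^sup>2 * indicator {0..R} s) \<partial>lborel)"
    by (intro nn_integral_eq_integral[symmetric] i2) auto
  also have "\<dots> = (\<integral>\<^sup>+s. ennreal (4 * (h' s)\<^sup>2) * indicator {0..R} s \<partial>lborel)"
    by (intro nn_integral_cong) (auto simp: indicator_def)
  finally show ?thesis .
qed

text \<open>The zero at the origin separates the half-lines; the negative one is reduced to
  \<open>hardy_half_line\<close> by reflection. The two pieces overlap in a null set, so no constant
  is lost.\<close>

lemma hardy_line:
  fixes h :: "real \<Rightarrow> real"
  assumes h: "\<And>s. (h has_real_derivative h' s) (at s)" and c: "continuous_on UNIV h'"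
    and h0: "h 0 = 0" and supp: "\<And>s. R < \<bar>s\<bar> \<Longrightarrow> h s = 0"
  shows "(\<integral>\<^sup>+s. ennreal ((h s)\<^sup>2 / (1 + \<bar>s\<bar>)\<^sup>2) \<partial>lborel) \<le> (\<integral>\<^sup>+s. ennreal (4 * (h' s)\<^sup>2) \<partial>lborel)"
proof -
  define S where "S = \<bar>R\<bar>"
  have S: "0 \<le> S" by (simp add: S_def)
  have ch: "continuous_on UNIV h" using h by (auto intro: DERIV_continuous_on)
  have [measurable]: "h' \<in> borel_measurable borel" "h \<in> borel_measurable borel"
    using c ch by (auto intro: borel_measurable_continuous_onI)
  let ?u = "\<lambda>s. ennreal ((h s)\<^sup>2 / (1 + \<bar>s\<bar>)\<^sup>2)"
  let ?d = "\<lambda>s. ennreal (4 * (h' s)\<^sup>2)"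
  have h2: "((\<lambda>s. h (- s)) has_real_derivative - h' (- s)) (at s)" for s
  proof -
    have "((\<lambda>s::real. - s) has_real_derivative -1) (at s)" by (auto intro!: derivative_eq_intros)
    from DERIV_chain'[OF this h] show ?thesis by simp
  qed
  have c2: "continuous_on UNIV (\<lambda>s. - h' (- s))"
    by (intro continuous_intros continuous_on_compose2[OF c]) auto
  have neg: "(\<integral>\<^sup>+s. ?u s * indicator {-S..0} s \<partial>lborel) \<le> (\<integral>\<^sup>+s. ?d s * indicator {-S..0} s \<partial>lborel)"
  proof -
    have "(\<integral>\<^sup>+s. ?u s * indicator {-S..0} s \<partial>lborel) = (\<integral>\<^sup>+s. ?u (- s) * indicator {-S..0} (- s) \<partial>lborel)"
      by (subst nn_integral_real_affine[where c="-1" and t=0]) auto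
    also have "\<dots> = (\<integral>\<^sup>+s. ennreal ((h (-s))\<^sup>2 / (1 + \<bar>s\<bar>)\<^sup>2) * indicator {0..S} s \<partial>lborel)"
      by (intro nn_integral_cong) (auto simp: indicator_def)
    also have "\<dots> \<le> (\<integral>\<^sup>+s. ennreal (4 * (- h' (-s))\<^sup>2) * indicator {0..S} s \<partial>lborel)"
      using h0 S by (intro hardy_half_line h2 c2) auto
    also have "\<dots> = (\<integral>\<^sup>+s. ?d (- s) * indicator {-S..0} (- s) \<partial>lborel)"
      by (intro nn_integral_cong) (auto simp: indicator_def)
    also have "\<dots> = (\<integral>\<^sup>+s. ?d s * indicator {-S..0} s \<partial>lborel)"
      by (subst nn_integral_real_affine[where c="-1" and t=0]) auto
    finally show ?thesis .
  qed
  have "(\<integral>\<^sup>+s. ?u s \<partial>lborel) \<le> (\<integral>\<^sup>+s. ?u s * indicator {-S..0} s + ?u s * indicator {0..S} s \<partial>lborel)"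
    using supp by (intro nn_integral_mono) (auto simp: indicator_def S_def)
  also have "\<dots> = (\<integral>\<^sup>+s. ?u s * indicator {-S..0} s \<partial>lborel) + (\<integral>\<^sup>+s. ?u s * indicator {0..S} s \<partial>lborel)"
    by (intro nn_integral_add) auto
  also have "\<dots> \<le> (\<integral>\<^sup>+s. ?d s * indicator {-S..0} s \<partial>lborel) + (\<integral>\<^sup>+s. ?d s * indicator {0..S} s \<partial>lborel)"
    by (intro add_mono neg hardy_half_line h c h0 S)
  also have "\<dots> = (\<integral>\<^sup>+s. ?d s * indicator {-S..0} s + ?d s * indicator {0..S} s \<partial>lborel)"
    by (intro nn_integral_add[symmetric]) auto
  also have "\<dots> \<le> (\<integral>\<^sup>+s. ?d s \<partial>lborel)"
    using AE_lborel_singleton[of "0::real"]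
    by (intro nn_integral_mono_AE) (auto simp: indicator_def elim!: eventually_mono)
  finally show ?thesis .
qed

subsection \<open>Fubini in the plane\<close>

text \<open>The index selects the inner variable, so one form of Fubini's theorem serves horizontal
  and vertical lines.\<close>

definition pt :: "2 \<Rightarrow> real \<Rightarrow> real \<Rightarrow> real^2" where
  "pt i s t = (\<chi> j. if j = i then s else t)"

definition oth :: "2 \<Rightarrow> 2" where
  "oth i = (if i = 1 then 2 else 1)"

lemma oth_neq [simp]: "oth i \<noteq> i" "i \<noteq> oth i"
  by (auto simp: oth_def)

lemma UNIV_oth: "(UNIV :: 2 set) = {i, oth i}"
  using exhaust_2[of i] by (auto simp: oth_def UNIV_2)

lemma pt_nth [simp]: "pt i s t $ i = s" "pt i s t $ oth i = t"
  by (auto simp: pt_def)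

lemma eq_oth: "j \<noteq> i \<longleftrightarrow> j = oth i"
  using UNIV_oth[of i] by auto

lemma oth_oth [simp]: "oth (oth i) = i"
  using eq_oth[of i "oth i"] by simp

lemma pt_oth: "pt (oth i) s t = pt i t s"
  using eq_oth[of _ i] by (auto simp: pt_def vec_eq_iff)

lemma pt_eq_sum: "pt i s t = s *\<^sub>R axis i 1 + t *\<^sub>R axis (oth i) 1"
  using eq_oth[of _ i] by (auto simp: pt_def vec_eq_iff axis_def)

lemma continuous_on_pt [continuous_intros]:
  "continuous_on A f \<Longrightarrow> continuous_on A g \<Longrightarrow> continuous_on A (\<lambda>x. pt i (f x) (g x))"
  by (simp add: pt_eq_sum continuous_intros)

lemma measurable_pt [measurable]: "(\<lambda>(s, t). pt i s t) \<in> borel_measurable (lborel \<Otimes>\<^sub>M lborel)"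
proof -
  have "continuous_on UNIV (\<lambda>z. pt i (fst z) (snd z))" by (intro continuous_intros)
  then have "(\<lambda>z. pt i (fst z) (snd z)) \<in> borel_measurable borel" by (rule borel_measurable_continuous_onI)
  then show ?thesis by (simp add: lborel_prod case_prod_beta')
qed

lemma prod_Basis_vec: "(\<Prod>b\<in>Basis. (x::real^2) \<bullet> b) = x $ i * x $ oth i"
proof -
  have B: "(Basis :: (real^2) set) = {axis i 1, axis (oth i) 1}"
    unfolding Basis_vec_def using UNIV_oth[of i] by auto
  have "axis i (1::real) \<noteq> axis (oth i) 1" by (simp add: axis_eq_axis)
  then show ?thesis unfolding B by (simp add: inner_axis)
qed

lemma box_vec: "(x::real^2) \<in> box a b \<longleftrightarrow> a $ i < x $ i \<and> x $ i < b $ i \<and> a $ oth i < x $ oth i \<and> x $ oth i < b $ oth i"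
proof -
  have "(\<forall>j. a $ j < x $ j \<and> x $ j < b $ j) \<longleftrightarrow> (\<forall>j\<in>{i, oth i}. a $ j < x $ j \<and> x $ j < b $ j)"
    using UNIV_oth[of i] by (metis UNIV_I)
  then show ?thesis by (auto simp: mem_box_cart)
qed

lemma cbox_vec: "(x::real^2) \<in> cbox a b \<longleftrightarrow> a $ i \<le> x $ i \<and> x $ i \<le> b $ i \<and> a $ oth i \<le> x $ oth i \<and> x $ oth i \<le> b $ oth i"
proof -
  have "(\<forall>j. a $ j \<le> x $ j \<and> x $ j \<le> b $ j) \<longleftrightarrow> (\<forall>j\<in>{i, oth i}. a $ j \<le> x $ j \<and> x $ j \<le> b $ j)"
    using UNIV_oth[of i] by (metis UNIV_I)
  then show ?thesis by (auto simp: mem_box_cart)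
qed

text \<open>Lebesgue measure is characterised by its values on boxes, and the preimage of a box is a
  product of two intervals. This transfers Fubini's theorem from pairs to
  \<open>real^2\<close>.\<close>

lemma lborel_pt: "lborel = distr (lborel \<Otimes>\<^sub>M lborel) borel (\<lambda>(s, t). pt i s t)"
proof (rule lborel_eqI)
  fix l u :: "real^2" assume lu: "\<And>b. b \<in> Basis \<Longrightarrow> l \<bullet> b \<le> u \<bullet> b"
  have lu': "l $ j \<le> u $ j" for j
    using lu[of "axis j 1"] by (auto simp: inner_axis Basis_vec_def)
  have "(\<lambda>(s, t). pt i s t) -` box l u \<inter> space (lborel \<Otimes>\<^sub>M lborel) = {l$i<..<u$i} \<times> {l$oth i<..<u$oth i}"
    by (auto simp: box_vec[where i=i] space_pair_measure)
  then show "emeasure (distr (lborel \<Otimes>\<^sub>M lborel) borel (\<lambda>(s, t). pt i s t)) (box l u) = (\<Prod>b\<in>Basis. (u - l) \<bullet> b)"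
    by (simp add: emeasure_distr lborel.emeasure_pair_measure_Times lu' prod_Basis_vec[of _ i] ennreal_mult)
qed simp

lemma nn_integral_pt:
  assumes f [measurable]: "f \<in> borel_measurable (borel :: (real^2) measure)"
  shows "(\<integral>\<^sup>+x. f x \<partial>lborel) = (\<integral>\<^sup>+t. (\<integral>\<^sup>+s. f (pt i s t) \<partial>lborel) \<partial>lborel)"
proof -
  have "(\<integral>\<^sup>+x. f x \<partial>lborel) = (\<integral>\<^sup>+z. f (case z of (s, t) \<Rightarrow> pt i s t) \<partial>(lborel \<Otimes>\<^sub>M lborel))"
    by (subst lborel_pt[of i]) (rule nn_integral_distr, auto)
  also have "\<dots> = (\<integral>\<^sup>+t. (\<integral>\<^sup>+s. f (pt i s t) \<partial>lborel) \<partial>lborel)"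
    by (subst lborel_pair.nn_integral_snd[symmetric]) auto
  finally show ?thesis .
qed

lemma integral_pt:
  fixes f :: "real^2 \<Rightarrow> real"
  assumes f: "integrable lborel f"
  shows "(\<integral>x. f x \<partial>lborel) = (\<integral>t. (\<integral>s. f (pt i s t) \<partial>lborel) \<partial>lborel)"
proof -
  have [measurable]: "f \<in> borel_measurable borel" using f by auto
  have i: "integrable (lborel \<Otimes>\<^sub>M lborel) (\<lambda>z. f (case z of (s, t) \<Rightarrow> pt i s t))"
    using f by (subst (asm) lborel_pt[of i]) (subst (asm) integrable_distr_eq, auto)
  have "(\<integral>x. f x \<partial>lborel) = (\<integral>z. f (case z of (s, t) \<Rightarrow> pt i s t) \<partial>(lborel \<Otimes>\<^sub>M lborel))"
    by (subst lborel_pt[of i]) (rule integral_distr, auto)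
  also have "\<dots> = (\<integral>t. (\<integral>s. f (pt i s t) \<partial>lborel) \<partial>lborel)"
    using lborel_pair.integral_snd[of "\<lambda>s t. f (pt i s t)"] i by (simp add: case_prod_beta')
  finally show ?thesis .
qed

lemma DERIV_pt:
  assumes "Ck (Suc 0) g"
  shows "((\<lambda>s. g (pt i s t)) has_real_derivative partial_deriv i g (pt i s t)) (at s)"
proof -
  have 1: "((\<lambda>s. pt i s t) has_derivative (\<lambda>h. h *\<^sub>R axis i 1)) (at s)"
    unfolding pt_eq_sum by (auto intro!: derivative_eq_intros)
  have "((\<lambda>s. g (pt i s t)) has_derivative (\<lambda>h. \<Sum>j\<in>UNIV. ((h *\<^sub>R axis i 1) $ j) *\<^sub>R partial_deriv j g (pt i s t))) (at s)"
    using has_derivative_compose[OF 1 Ck1_has_derivative[OF assms]] .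
  moreover have "(\<Sum>j\<in>UNIV. ((h *\<^sub>R axis i 1) $ j) *\<^sub>R partial_deriv j g (pt i s t)) = partial_deriv i g (pt i s t) * h" for h
  proof -
    have "(\<Sum>j\<in>UNIV. ((h *\<^sub>R axis i 1) $ j) *\<^sub>R partial_deriv j g (pt i s t)) = h *\<^sub>R (\<Sum>j\<in>UNIV. (axis i 1 $ j) *\<^sub>R partial_deriv j g (pt i s t))"
      by (simp add: scaleR_sum_right sum_distrib_left mult.assoc)
    then show ?thesis unfolding sum_axis_scaleR by simp
  qed
  ultimately show ?thesis by (simp add: has_field_derivative_def)
qed

lemma continuous_partial_deriv: "Ck (Suc k) g \<Longrightarrow> continuous_on UNIV (partial_deriv i g)"
  by (auto simp: Ck.simps(2) intro: Ck_imp_continuous)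

subsection \<open>The plane\<close>

lemma partial_deriv_zero_open:
  assumes "open U" "x \<in> U" "\<And>y. y \<in> U \<Longrightarrow> g y = 0"
  shows "partial_deriv i g x = 0"
proof -
  have "(g has_derivative (\<lambda>h. 0)) (at x)"
    by (rule has_derivative_transform_within_open[OF has_derivative_const[of 0] assms(1,2)]) (simp add: assms)
  then show ?thesis by (rule partial_deriv_eqI)
qed

lemma partial_deriv_zero_far:
  assumes "\<And>x. R < norm x \<Longrightarrow> g x = 0" "R < norm x"
  shows "partial_deriv i g x = 0"
proof (rule partial_deriv_zero_open)
  show "open {x::real^2. R < norm x}" by (intro open_Collect_less continuous_intros)
qed (use assms in auto)

lemma integrable_cs:
  fixes f :: "real^2 \<Rightarrow> 'b::{banach, second_countable_topology}"
  assumes "continuous_on UNIV f" "\<And>x. R < norm x \<Longrightarrow> f x = 0"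
  shows "integrable lborel f"
proof -
  have "integrable lborel (\<lambda>x. indicator (cball 0 R) x *\<^sub>R f x)"
    using assms(1) by (intro borel_integrable_compact) (auto intro: continuous_on_subset)
  moreover have "(\<lambda>x. indicator (cball 0 R) x *\<^sub>R f x) = f"
    using assms(2) by (auto simp: fun_eq_iff indicator_def not_le)
  ultimately show ?thesis by simp
qed

lemma abs_le_norm_pt: "\<bar>s\<bar> \<le> norm (pt i s t)" "\<bar>t\<bar> \<le> norm (pt i s t)"
  using component_le_norm_cart[of "pt i s t" i] component_le_norm_cart[of "pt i s t" "oth i"] by auto

lemma integral_partial_deriv_zero:
  fixes g :: "real^2 \<Rightarrow> real"
  assumes g: "Ck (Suc 0) g" and supp: "\<And>x. R < norm x \<Longrightarrow> g x = 0"
  shows "(\<integral>x. partial_deriv i g x \<partial>lborel) = 0"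
proof -
  note c = continuous_partial_deriv[OF g, of i]
  have "integrable lborel (partial_deriv i g)"
    by (rule integrable_cs[OF c]) (rule partial_deriv_zero_far[OF supp])
  from integral_pt[OF this, of i]
  have eq: "(\<integral>x. partial_deriv i g x \<partial>lborel) = (\<integral>t. (\<integral>s. partial_deriv i g (pt i s t) \<partial>lborel) \<partial>lborel)" .
  have z: "(\<integral>s. partial_deriv i g (pt i s t) \<partial>lborel) = 0" for t
  proof (rule integral_deriv_compact_support[where R=R])
    show "((\<lambda>s. g (pt i s t)) has_real_derivative partial_deriv i g (pt i s t)) (at s)" for s
      by (rule DERIV_pt[OF g])
    show "continuous_on UNIV (\<lambda>s. partial_deriv i g (pt i s t))"
      by (intro continuous_on_compose2[OF c] continuous_intros) auto
    show "g (pt i s t) = 0" if "R < \<bar>s\<bar>" for s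
      using that abs_le_norm_pt(1)[of s i t] by (intro supp) linarith
    show "partial_deriv i g (pt i s t) = 0" if "R < \<bar>s\<bar>" for s
      using that abs_le_norm_pt(1)[of s i t] by (intro partial_deriv_zero_far[where R=R, OF supp]) linarith+
  qed
  show ?thesis unfolding eq z by simp
qed

text \<open>Oddness makes \<open>g\<close> vanish where a line in direction \<open>i\<close> meets
  the mirror axis, so \<open>hardy_line\<close> applies on each such line. The weight in
  \<open>norm x\<close> is first replaced by the larger one in the single coordinate
  \<open>x $ i\<close>.\<close>

lemma hardy_plane:
  fixes g :: "real^2 \<Rightarrow> real"
  assumes g: "Ck (Suc 0) g" and supp: "\<And>x. R < norm x \<Longrightarrow> g x = 0"
    and odd: "\<And>x. g (flip i x) = - g x"
  shows "(\<integral>x. (g x)\<^sup>2 / (1 + norm x)\<^sup>2 \<partial>lborel) \<le> 4 * (\<integral>x. (partial_deriv i g x)\<^sup>2 \<partial>lborel)"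
proof -
  note c = continuous_partial_deriv[OF g, of i]
  note cg = Ck_imp_continuous[OF g]
  have [measurable]: "g \<in> borel_measurable borel" "partial_deriv i g \<in> borel_measurable borel"
    using c cg by (auto intro: borel_measurable_continuous_onI)
  have w: "1 + norm x \<noteq> 0" for x :: "real^2" using norm_ge_zero[of x] by linarith
  have i1: "integrable lborel (\<lambda>x. (g x)\<^sup>2 / (1 + norm x)\<^sup>2)"
    by (rule integrable_cs[where R=R]) (auto intro!: continuous_intros cg simp: w supp)
  have i2: "integrable lborel (\<lambda>x. 4 * (partial_deriv i g x)\<^sup>2)"
    by (rule integrable_cs[where R=R]) (auto intro!: continuous_intros c simp: partial_deriv_zero_far[OF supp])
  have "ennreal (\<integral>x. (g x)\<^sup>2 / (1 + norm x)\<^sup>2 \<partial>lborel) = (\<integral>\<^sup>+x. ennreal ((g x)\<^sup>2 / (1 + norm x)\<^sup>2) \<partial>lborel)"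
    by (intro nn_integral_eq_integral[symmetric] i1) auto
  also have "\<dots> \<le> (\<integral>\<^sup>+x. ennreal ((g x)\<^sup>2 / (1 + \<bar>x $ i\<bar>)\<^sup>2) \<partial>lborel)"
    using component_le_norm_cart by (intro nn_integral_mono ennreal_leI divide_left_mono power_mono) (auto simp: w)
  also have "\<dots> = (\<integral>\<^sup>+t. (\<integral>\<^sup>+s. ennreal ((g (pt i s t))\<^sup>2 / (1 + \<bar>s\<bar>)\<^sup>2) \<partial>lborel) \<partial>lborel)"
    by (subst nn_integral_pt[where i=i]) auto
  also have "\<dots> \<le> (\<integral>\<^sup>+t. (\<integral>\<^sup>+s. ennreal (4 * (partial_deriv i g (pt i s t))\<^sup>2) \<partial>lborel) \<partial>lborel)"
  proof (rule nn_integral_mono)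
   fix t :: real
   show "(\<integral>\<^sup>+s. ennreal ((g (pt i s t))\<^sup>2 / (1 + \<bar>s\<bar>)\<^sup>2) \<partial>lborel) \<le> (\<integral>\<^sup>+s. ennreal (4 * (partial_deriv i g (pt i s t))\<^sup>2) \<partial>lborel)"
   proof (rule hardy_line[where R=R])
    show "((\<lambda>s. g (pt i s t)) has_real_derivative partial_deriv i g (pt i s t)) (at s)" for s
      by (rule DERIV_pt[OF g])
    show "continuous_on UNIV (\<lambda>s. partial_deriv i g (pt i s t))"
      by (intro continuous_on_compose2[OF c] continuous_intros) auto
    show "g (pt i s t) = 0" if "R < \<bar>s\<bar>" for s
      using that abs_le_norm_pt(1)[of s i t] by (intro supp) linarith
    have "flip i (pt i 0 t) = pt i 0 t" by (auto simp: vec_eq_iff flip_nth pt_def)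
    then show "g (pt i 0 t) = 0" using odd[of "pt i 0 t"] by simp
   qed
  qed
  also have "\<dots> = (\<integral>\<^sup>+x. ennreal (4 * (partial_deriv i g x)\<^sup>2) \<partial>lborel)"
    by (subst nn_integral_pt[where i=i]) auto
  also have "\<dots> = ennreal (\<integral>x. 4 * (partial_deriv i g x)\<^sup>2 \<partial>lborel)"
    by (intro nn_integral_eq_integral i2) auto
  finally have "(\<integral>x. (g x)\<^sup>2 / (1 + norm x)\<^sup>2 \<partial>lborel) \<le> (\<integral>x. 4 * (partial_deriv i g x)\<^sup>2 \<partial>lborel)"
    by (subst (asm) ennreal_le_iff) (auto intro!: integral_nonneg)
  then show ?thesis by simp
qed

text \<open>Ladyzhenskaya's argument: bound \<open>a\<^sup>2\<close> on vertical and \<open>b\<^sup>2\<close> on horizontal lines.\<close>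

lemma product_plane:
  fixes a b :: "real^2 \<Rightarrow> real"
  assumes a: "Ck (Suc 0) a" "\<And>x. R < norm x \<Longrightarrow> a x = 0"
    and b: "Ck (Suc 0) b" "\<And>x. R < norm x \<Longrightarrow> b x = 0"
  shows "(\<integral>x. (a x * b x)\<^sup>2 \<partial>lborel)
    \<le> 4 * (\<integral>x. \<bar>a x * partial_deriv 2 a x\<bar> \<partial>lborel) * (\<integral>x. \<bar>b x * partial_deriv 1 b x\<bar> \<partial>lborel)"
proof -
  note ca = Ck_imp_continuous[OF a(1)] continuous_partial_deriv[OF a(1)]
  note cb = Ck_imp_continuous[OF b(1)] continuous_partial_deriv[OF b(1)]
  have [measurable]: "a \<in> borel_measurable borel" "b \<in> borel_measurable borel"
    "partial_deriv i a \<in> borel_measurable borel" "partial_deriv i b \<in> borel_measurable borel" for i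
    using ca cb by (auto intro: borel_measurable_continuous_onI)
  have o: "oth 1 = 2" "oth 2 = 1" by (auto simp: oth_def)
  have i0: "integrable lborel (\<lambda>x. (a x * b x)\<^sup>2)"
    by (rule integrable_cs[where R=R]) (auto intro!: continuous_intros ca cb simp: a)
  have ia: "integrable lborel (\<lambda>x. 2 * \<bar>a x * partial_deriv 2 a x\<bar>)"
    by (rule integrable_cs[where R=R]) (auto intro!: continuous_intros ca simp: a)
  have ib: "integrable lborel (\<lambda>x. 2 * \<bar>b x * partial_deriv 1 b x\<bar>)"
    by (rule integrable_cs[where R=R]) (auto intro!: continuous_intros cb simp: b)
  define A where "A s = (\<integral>\<^sup>+t. ennreal (2 * \<bar>a (pt 1 s t) * partial_deriv 2 a (pt 1 s t)\<bar>) \<partial>lborel)" for s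
  define B where "B t = (\<integral>\<^sup>+s. ennreal (2 * \<bar>b (pt 1 s t) * partial_deriv 1 b (pt 1 s t)\<bar>) \<partial>lborel)" for t
  have [measurable]: "A \<in> borel_measurable borel" "B \<in> borel_measurable borel"
    unfolding A_def[abs_def] B_def[abs_def] by measurable
  have leA: "ennreal ((a (pt 1 s t))\<^sup>2) \<le> A s" for s t
    unfolding A_def
  proof (rule sq_le_nn_integral_deriv[where R=R])
    show "((\<lambda>t. a (pt 1 s t)) has_real_derivative partial_deriv 2 a (pt 1 s t)) (at t)" for t
      using DERIV_pt[OF a(1), of 2 s t] pt_oth[of 1] by (simp add: o)
    show "continuous_on UNIV (\<lambda>t. partial_deriv 2 a (pt 1 s t))"
      by (intro continuous_on_compose2[OF ca(2)] continuous_intros) auto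
    show "a (pt 1 s t) = 0" if "R < \<bar>t\<bar>" for t
      using that abs_le_norm_pt(2)[of t 1 s] by (intro a) linarith
  qed
  have leB: "ennreal ((b (pt 1 s t))\<^sup>2) \<le> B t" for s t
    unfolding B_def
  proof (rule sq_le_nn_integral_deriv[where R=R])
    show "((\<lambda>s. b (pt 1 s t)) has_real_derivative partial_deriv 1 b (pt 1 s t)) (at s)" for s
      by (rule DERIV_pt[OF b(1)])
    show "continuous_on UNIV (\<lambda>s. partial_deriv 1 b (pt 1 s t))"
      by (intro continuous_on_compose2[OF cb(2)] continuous_intros) auto
    show "b (pt 1 s t) = 0" if "R < \<bar>s\<bar>" for s
      using that abs_le_norm_pt(1)[of s 1 t] by (intro b) linarith
  qed
  have IA: "(\<integral>\<^sup>+s. A s \<partial>lborel) = ennreal (\<integral>x. 2 * \<bar>a x * partial_deriv 2 a x\<bar> \<partial>lborel)"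
  proof -
    have "(\<integral>\<^sup>+s. A s \<partial>lborel) = (\<integral>\<^sup>+x. ennreal (2 * \<bar>a x * partial_deriv 2 a x\<bar>) \<partial>lborel)"
      unfolding A_def using pt_oth[of 1] by (subst nn_integral_pt[where i=2]) (auto simp: o)
    then show ?thesis using ia by (simp add: nn_integral_eq_integral)
  qed
  have IB: "(\<integral>\<^sup>+t. B t \<partial>lborel) = ennreal (\<integral>x. 2 * \<bar>b x * partial_deriv 1 b x\<bar> \<partial>lborel)"
  proof -
    have "(\<integral>\<^sup>+t. B t \<partial>lborel) = (\<integral>\<^sup>+x. ennreal (2 * \<bar>b x * partial_deriv 1 b x\<bar>) \<partial>lborel)"
      unfolding B_def by (subst nn_integral_pt[where i=1]) auto
    then show ?thesis using ib by (simp add: nn_integral_eq_integral)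
  qed
  have "ennreal (\<integral>x. (a x * b x)\<^sup>2 \<partial>lborel) = (\<integral>\<^sup>+x. ennreal ((a x * b x)\<^sup>2) \<partial>lborel)"
    by (intro nn_integral_eq_integral[symmetric] i0) auto
  also have "\<dots> = (\<integral>\<^sup>+t. (\<integral>\<^sup>+s. ennreal ((a (pt 1 s t))\<^sup>2) * ennreal ((b (pt 1 s t))\<^sup>2) \<partial>lborel) \<partial>lborel)"
    by (subst nn_integral_pt[where i=1]) (auto simp: power_mult_distrib ennreal_mult)
  \<comment> \<open>Each bound depends on one variable only, so the double integral splits into a
    product.\<close>
  also have "\<dots> \<le> (\<integral>\<^sup>+t. (\<integral>\<^sup>+s. A s * B t \<partial>lborel) \<partial>lborel)"
    by (intro nn_integral_mono mult_mono leA leB) auto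
  also have "\<dots> = (\<integral>\<^sup>+s. A s \<partial>lborel) * (\<integral>\<^sup>+t. B t \<partial>lborel)"
    by (simp add: nn_integral_multc nn_integral_cmult)
  also have "\<dots> = ennreal ((\<integral>x. 2 * \<bar>a x * partial_deriv 2 a x\<bar> \<partial>lborel) * (\<integral>x. 2 * \<bar>b x * partial_deriv 1 b x\<bar> \<partial>lborel))"
    unfolding IA IB by (rule ennreal_mult[symmetric]) (auto intro!: integral_nonneg)
  finally have "(\<integral>x. (a x * b x)\<^sup>2 \<partial>lborel)
      \<le> (\<integral>x. 2 * \<bar>a x * partial_deriv 2 a x\<bar> \<partial>lborel) * (\<integral>x. 2 * \<bar>b x * partial_deriv 1 b x\<bar> \<partial>lborel)"
    by (subst (asm) ennreal_le_iff) (auto intro!: integral_nonneg mult_nonneg_nonneg)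
  then show ?thesis by simp
qed

subsection \<open>Poincare's inequality on square frames\<close>

text \<open>The constant is the value of the function at a point of a vertical line
  carrying at most the average share of the Dirichlet energy.\<close>

lemma poincare_box:
  fixes \<psi> :: "real^2 \<Rightarrow> real" and p q :: "real^2"
  assumes \<psi>: "Ck (Suc 0) \<psi>" and le: "p $ 1 < q $ 1" "p $ 2 < q $ 2" "q $ 1 - p $ 1 \<le> L" "q $ 2 - p $ 2 \<le> L"
  obtains c where "(\<integral>\<^sup>+x. ennreal ((\<psi> x - c)\<^sup>2) * indicator (cbox p q) x \<partial>lborel)
    \<le> ennreal (2 * L\<^sup>2) * (\<integral>\<^sup>+x. ennreal (\<Sum>i\<in>UNIV. (partial_deriv i \<psi> x)\<^sup>2) * indicator (cbox p q) x \<partial>lborel)"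
proof -
  note c = continuous_partial_deriv[OF \<psi>]
  note cg = Ck_imp_continuous[OF \<psi>]
  have [measurable]: "\<psi> \<in> borel_measurable borel" "partial_deriv i \<psi> \<in> borel_measurable borel" for i
    using c cg by (auto intro: borel_measurable_continuous_onI)
  have o: "oth 1 = 2" "oth 2 = 1" by (auto simp: oth_def)
  define I1 where "I1 = {p $ 1 .. q $ 1}"
  define I2 where "I2 = {p $ 2 .. q $ 2}"
  have [measurable]: "I1 \<in> sets borel" "I2 \<in> sets borel" by (auto simp: I1_def I2_def)
  have ind: "indicator (cbox p q) (pt 1 s t) = (indicator I1 s * indicator I2 t :: ennreal)" for s t
    using pt_nth[of 1 s t] by (auto simp: indicator_def I1_def I2_def cbox_vec[where i=1] o)
  define l1 where "l1 = q $ 1 - p $ 1"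
  define l2 where "l2 = q $ 2 - p $ 2"
  have l: "0 < l1" "0 < l2" "l1 \<le> L" "l2 \<le> L" using le by (auto simp: l1_def l2_def)
  define F where "F t = (\<integral>\<^sup>+s. ennreal ((partial_deriv 1 \<psi> (pt 1 s t))\<^sup>2) * indicator I1 s \<partial>lborel)" for t
  define E where "E s = (\<integral>\<^sup>+t. ennreal ((partial_deriv 2 \<psi> (pt 1 s t))\<^sup>2) * indicator I2 t \<partial>lborel)" for s
  define J where "J i = (\<integral>\<^sup>+x. ennreal ((partial_deriv i \<psi> x)\<^sup>2) * indicator (cbox p q) x \<partial>lborel)" for i
  have [measurable]: "F \<in> borel_measurable borel" "E \<in> borel_measurable borel"
    unfolding F_def[abs_def] E_def[abs_def] by measurable
  have J1: "J 1 = (\<integral>\<^sup>+t. F t * indicator I2 t \<partial>lborel)"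
    unfolding J_def F_def
    by (subst nn_integral_pt[where i=1]) (auto simp: ind nn_integral_multc mult.assoc[symmetric])
  have J2: "J 2 = (\<integral>\<^sup>+s. E s * indicator I1 s \<partial>lborel)"
    unfolding J_def E_def using pt_oth[of 1]
    by (subst nn_integral_pt[where i=2]) (auto simp: ind nn_integral_cmult mult_ac o)
  have Jfin: "J i < \<infinity>" for i
  proof -
    have "integrable lborel (\<lambda>x. indicator (cbox p q) x *\<^sub>R (partial_deriv i \<psi> x)\<^sup>2)"
      by (intro borel_integrable_compact continuous_intros continuous_on_subset[OF c]) auto
    then have "(\<integral>\<^sup>+x. norm (indicator (cbox p q) x *\<^sub>R (partial_deriv i \<psi> x)\<^sup>2) \<partial>lborel) < \<infinity>"
      by (simp add: integrable_iff_bounded)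
    also have "(\<integral>\<^sup>+x. norm (indicator (cbox p q) x *\<^sub>R (partial_deriv i \<psi> x)\<^sup>2) \<partial>lborel) = J i"
      unfolding J_def by (intro nn_integral_cong) (auto simp: indicator_def)
    finally show ?thesis .
  qed
  have em1: "emeasure lborel I1 = ennreal l1" and em2: "emeasure lborel I2 = ennreal l2"
    using l by (auto simp: I1_def I2_def l1_def l2_def)
  \<comment> \<open>Mean value argument: if every vertical line carried more than the average
    energy, integration over \<open>I1\<close> would give more than the total \<open>J 2\<close>.
    Strictness survives because \<open>I1\<close> has positive length.\<close>
  have "\<exists>y\<in>I1. ennreal l1 * E y \<le> J 2"
  proof (rule ccontr)
    assume "\<not> (\<exists>y\<in>I1. ennreal l1 * E y \<le> J 2)"
    then have less: "J 2 < ennreal l1 * E s" if "s \<in> I1" for s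
      using that by (auto simp: not_le)
    define m where "m = J 2 / ennreal l1"
    have lm: "ennreal l1 * m = J 2"
      using l Jfin by (simp add: m_def ennreal_times_divide mult.commute[of "ennreal l1"] ennreal_mult_divide_eq)
    have "(\<integral>\<^sup>+s. m * indicator I1 s \<partial>lborel) < (\<integral>\<^sup>+s. E s * indicator I1 s \<partial>lborel)"
    proof (rule nn_integral_less)
      show "(\<integral>\<^sup>+s. m * indicator I1 s \<partial>lborel) \<noteq> \<infinity>"
        using lm Jfin[of 2] by (simp add: nn_integral_cmult em1 mult.commute)
      have mE: "m < E s" if "s \<in> I1" for s
      proof (rule ccontr)
        assume "\<not> m < E s"
        then have "ennreal l1 * E s \<le> ennreal l1 * m" by (intro mult_left_mono) auto
        then show False using less[OF that] lm by simp
      qed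
      show "AE s in lborel. m * indicator I1 s \<le> E s * indicator I1 s"
        using mE by (intro AE_I2) (auto simp: indicator_def intro: less_imp_le)
      show "\<not> (AE s in lborel. E s * indicator I1 s \<le> m * indicator I1 s)"
      proof
        assume "AE s in lborel. E s * indicator I1 s \<le> m * indicator I1 s"
        then have "AE s in lborel. s \<notin> I1"
        proof eventually_elim
          case (elim s)
          with mE[of s] show ?case by (auto simp: indicator_def dest: leD)
        qed
        then have "emeasure lborel I1 = 0"
          by (subst (asm) AE_iff_measurable[where N=I1]) auto
        then show False using l by (simp add: em1)
      qed
    qed auto
    also have "(\<integral>\<^sup>+s. m * indicator I1 s \<partial>lborel) = J 2"
      using lm by (simp add: nn_integral_cmult em1 mult.commute)
    finally show False using J2 by simp
  qed
  then obtain y where y: "y \<in> I1" "ennreal l1 * E y \<le> J 2" by auto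
  define c where "c = \<psi> (pt 1 y (p $ 2))"
  \<comment> \<open>The point is joined to the base point by a horizontal segment to the line
    through \<open>y\<close> and a vertical segment along that line; \<open>F t\<close> and
    \<open>E y\<close> are the energies on the two lines.\<close>
  have bd: "ennreal ((\<psi> (pt 1 s t) - c)\<^sup>2) \<le> ennreal (2 * l1) * F t + ennreal (2 * l2) * E y"
    if st: "s \<in> I1" "t \<in> I2" for s t
  proof -
    have 1: "ennreal ((\<psi> (pt 1 s t) - \<psi> (pt 1 y t))\<^sup>2) \<le> ennreal l1 * F t"
      unfolding F_def I1_def l1_def
    proof (rule sq_diff_le_nn_integral_deriv[where h="\<lambda>s. \<psi> (pt 1 s t)" and h'="\<lambda>s. partial_deriv 1 \<psi> (pt 1 s t)"])
      show "((\<lambda>s. \<psi> (pt 1 s t)) has_real_derivative partial_deriv 1 \<psi> (pt 1 s t)) (at s)" for s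
        by (rule DERIV_pt[OF \<psi>])
      show "continuous_on UNIV (\<lambda>s. partial_deriv 1 \<psi> (pt 1 s t))"
        by (intro continuous_on_compose2[OF c] continuous_intros) auto
    qed (use st y in \<open>auto simp: I1_def\<close>)
    have 2: "ennreal ((\<psi> (pt 1 y t) - c)\<^sup>2) \<le> ennreal l2 * E y"
      unfolding E_def I2_def l2_def c_def
    proof (rule sq_diff_le_nn_integral_deriv[where h="\<lambda>t. \<psi> (pt 1 y t)" and h'="\<lambda>t. partial_deriv 2 \<psi> (pt 1 y t)"])
      show "((\<lambda>t. \<psi> (pt 1 y t)) has_real_derivative partial_deriv 2 \<psi> (pt 1 y t)) (at t)" for t
        using DERIV_pt[OF \<psi>, of 2 y t] pt_oth[of 1] by (simp add: o)
      show "continuous_on UNIV (\<lambda>t. partial_deriv 2 \<psi> (pt 1 y t))"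
        by (intro continuous_on_compose2[OF c] continuous_intros) auto
    qed (use st le in \<open>auto simp: I2_def\<close>)
    have "(\<psi> (pt 1 s t) - c)\<^sup>2 \<le> 2 * (\<psi> (pt 1 s t) - \<psi> (pt 1 y t))\<^sup>2 + 2 * (\<psi> (pt 1 y t) - c)\<^sup>2"
      using sum_squares_bound[of "\<psi> (pt 1 s t) - \<psi> (pt 1 y t)" "\<psi> (pt 1 y t) - c"]
      by (simp add: power2_eq_square algebra_simps)
    then have "ennreal ((\<psi> (pt 1 s t) - c)\<^sup>2) \<le> ennreal (2 * (\<psi> (pt 1 s t) - \<psi> (pt 1 y t))\<^sup>2 + 2 * (\<psi> (pt 1 y t) - c)\<^sup>2)"
      by (rule ennreal_leI)
    also have "\<dots> = 2 * ennreal ((\<psi> (pt 1 s t) - \<psi> (pt 1 y t))\<^sup>2) + 2 * ennreal ((\<psi> (pt 1 y t) - c)\<^sup>2)"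
      by (simp add: ennreal_plus ennreal_mult)
    also have "\<dots> \<le> 2 * (ennreal l1 * F t) + 2 * (ennreal l2 * E y)"
      by (intro add_mono mult_left_mono 1 2) auto
    finally show ?thesis using l by (simp add: ennreal_mult mult.assoc)
  qed
  have "(\<integral>\<^sup>+x. ennreal ((\<psi> x - c)\<^sup>2) * indicator (cbox p q) x \<partial>lborel)
      = (\<integral>\<^sup>+t. (\<integral>\<^sup>+s. ennreal ((\<psi> (pt 1 s t) - c)\<^sup>2) * (indicator I1 s * indicator I2 t) \<partial>lborel) \<partial>lborel)"
    by (subst nn_integral_pt[where i=1]) (auto simp: ind)
  also have "\<dots> \<le> (\<integral>\<^sup>+t. (\<integral>\<^sup>+s. (ennreal (2 * l1) * F t + ennreal (2 * l2) * E y) * indicator I2 t * indicator I1 s \<partial>lborel) \<partial>lborel)"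
    using bd by (intro nn_integral_mono) (auto simp: indicator_def)
  also have "\<dots> = (\<integral>\<^sup>+t. ennreal l1 * ((ennreal (2 * l1) * F t + ennreal (2 * l2) * E y) * indicator I2 t) \<partial>lborel)"
    by (intro nn_integral_cong, subst nn_integral_cmult_indicator) (auto simp: em1 mult.commute)
  also have "\<dots> = ennreal l1 * (\<integral>\<^sup>+t. ennreal (2 * l1) * (F t * indicator I2 t) + ennreal (2 * l2) * E y * indicator I2 t \<partial>lborel)"
    by (subst nn_integral_cmult[symmetric]) (auto simp: distrib_right mult.assoc)
  also have "(\<integral>\<^sup>+t. ennreal (2 * l1) * (F t * indicator I2 t) + ennreal (2 * l2) * E y * indicator I2 t \<partial>lborel)
      = ennreal (2 * l1) * J 1 + ennreal (2 * l2) * E y * ennreal l2"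
    by (subst nn_integral_add) (auto simp: nn_integral_cmult em2 J1)
  also have "ennreal l1 * (ennreal (2 * l1) * J 1 + ennreal (2 * l2) * E y * ennreal l2)
      = ennreal (2 * l1\<^sup>2) * J 1 + ennreal (2 * l2\<^sup>2) * (ennreal l1 * E y)"
    using l by (simp add: distrib_left power2_eq_square ennreal_mult mult_ac)
  also have "\<dots> \<le> ennreal (2 * L\<^sup>2) * J 1 + ennreal (2 * L\<^sup>2) * J 2"
    using l y by (intro add_mono mult_mono ennreal_leI power_mono) auto
  also have "\<dots> = ennreal (2 * L\<^sup>2) * (\<integral>\<^sup>+x. ennreal (\<Sum>i\<in>UNIV. (partial_deriv i \<psi> x)\<^sup>2) * indicator (cbox p q) x \<partial>lborel)"
    unfolding J_def
    by (subst distrib_left[symmetric], subst nn_integral_add[symmetric])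
       (auto simp: sum_2 ennreal_plus distrib_right)
  finally show ?thesis by (rule that)
qed

text \<open>On the overlap \<open>K\<close> both constants approximate the function, which bounds
  the squared difference of the constants times the area of \<open>K\<close> by
  \<open>4 * B\<close>. As \<open>S'\<close> has four times that area, exchanging \<open>c'\<close>
  for \<open>c\<close> on it costs 2 + 8 * 4 times \<open>B\<close>; the piece \<open>S\<close> adds
  one more, which makes 35.\<close>

lemma poincare_glue:
  fixes \<psi> :: "real^2 \<Rightarrow> real"
  assumes [measurable]: "\<psi> \<in> borel_measurable borel" "S \<in> sets borel" "S' \<in> sets borel" "K \<in> sets borel"
    and K: "K \<subseteq> S" "K \<subseteq> S'" "emeasure lborel S' = 4 * emeasure lborel K"
    and S: "(\<integral>\<^sup>+x. ennreal ((\<psi> x - c)\<^sup>2) * indicator S x \<partial>lborel) \<le> B"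
    and S': "(\<integral>\<^sup>+x. ennreal ((\<psi> x - c')\<^sup>2) * indicator S' x \<partial>lborel) \<le> B"
  shows "(\<integral>\<^sup>+x. ennreal ((\<psi> x - c)\<^sup>2) * indicator (S \<union> S') x \<partial>lborel) \<le> 35 * B"
proof -
  have two: "ennreal ((x + y)\<^sup>2) \<le> 2 * ennreal (x\<^sup>2) + 2 * ennreal (y\<^sup>2)" for x y :: real
  proof -
    have "(x + y)\<^sup>2 \<le> 2 * x\<^sup>2 + 2 * y\<^sup>2"
      using sum_squares_bound[of x y] by (simp add: power2_eq_square algebra_simps)
    then have "ennreal ((x + y)\<^sup>2) \<le> ennreal (2 * x\<^sup>2 + 2 * y\<^sup>2)" by (rule ennreal_leI)
    then show ?thesis by (simp add: ennreal_plus ennreal_mult)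
  qed
  have "ennreal ((c - c')\<^sup>2) * emeasure lborel K = (\<integral>\<^sup>+x. ennreal ((c - c')\<^sup>2) * indicator K x \<partial>lborel)"
    by (simp add: nn_integral_cmult)
  also have "\<dots> \<le> (\<integral>\<^sup>+x. 2 * (ennreal ((\<psi> x - c)\<^sup>2) * indicator S x) + 2 * (ennreal ((\<psi> x - c')\<^sup>2) * indicator S' x) \<partial>lborel)"
  proof (rule nn_integral_mono)
    fix x
    show "ennreal ((c - c')\<^sup>2) * indicator K x \<le> 2 * (ennreal ((\<psi> x - c)\<^sup>2) * indicator S x) + 2 * (ennreal ((\<psi> x - c')\<^sup>2) * indicator S' x)"
      using K two[of "c - \<psi> x" "\<psi> x - c'"] by (auto simp: indicator_def power2_commute)
  qed
  also have "\<dots> = 2 * (\<integral>\<^sup>+x. ennreal ((\<psi> x - c)\<^sup>2) * indicator S x \<partial>lborel) + 2 * (\<integral>\<^sup>+x. ennreal ((\<psi> x - c')\<^sup>2) * indicator S' x \<partial>lborel)"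
    by (subst nn_integral_add) (auto simp: nn_integral_cmult)
  also have "\<dots> \<le> 2 * B + 2 * B"
    by (intro add_mono mult_left_mono S S') auto
  finally have cK: "ennreal ((c - c')\<^sup>2) * emeasure lborel K \<le> 4 * B"
    by (simp add: distrib_right[symmetric])
  have "(\<integral>\<^sup>+x. ennreal ((\<psi> x - c)\<^sup>2) * indicator (S \<union> S') x \<partial>lborel)
      \<le> (\<integral>\<^sup>+x. ennreal ((\<psi> x - c)\<^sup>2) * indicator S x +
          (2 * (ennreal ((\<psi> x - c')\<^sup>2) * indicator S' x) + 2 * (ennreal ((c - c')\<^sup>2) * indicator S' x)) \<partial>lborel)"
  proof (rule nn_integral_mono)
    fix x
    have "ennreal ((\<psi> x - c)\<^sup>2) \<le> 2 * ennreal ((\<psi> x - c')\<^sup>2) + 2 * ennreal ((c - c')\<^sup>2)"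
      using two[of "\<psi> x - c'" "c' - c"] by (simp add: power2_commute)
    then show "ennreal ((\<psi> x - c)\<^sup>2) * indicator (S \<union> S') x \<le> ennreal ((\<psi> x - c)\<^sup>2) * indicator S x +
          (2 * (ennreal ((\<psi> x - c')\<^sup>2) * indicator S' x) + 2 * (ennreal ((c - c')\<^sup>2) * indicator S' x))"
      by (auto simp: indicator_def)
  qed
  also have "\<dots> = (\<integral>\<^sup>+x. ennreal ((\<psi> x - c)\<^sup>2) * indicator S x \<partial>lborel) +
      (2 * (\<integral>\<^sup>+x. ennreal ((\<psi> x - c')\<^sup>2) * indicator S' x \<partial>lborel) + 2 * (ennreal ((c - c')\<^sup>2) * emeasure lborel S'))"
    by (simp add: nn_integral_add nn_integral_cmult)
  also have "\<dots> = (\<integral>\<^sup>+x. ennreal ((\<psi> x - c)\<^sup>2) * indicator S x \<partial>lborel) +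
      (2 * (\<integral>\<^sup>+x. ennreal ((\<psi> x - c')\<^sup>2) * indicator S' x \<partial>lborel) + 8 * (ennreal ((c - c')\<^sup>2) * emeasure lborel K))"
  proof -
    have "2 * (a * (4 * b)) = 8 * (a * b)" for a b :: ennreal
    proof -
      have "2 * (a * (4 * b)) = (2 * 4) * (a * b)" by (simp only: mult_ac)
      then show ?thesis by simp
    qed
    then show ?thesis unfolding K(3) by simp
  qed
  also have "\<dots> \<le> B + (2 * B + 8 * (4 * B))"
    by (intro add_mono mult_left_mono S S' cK) auto
  also have "\<dots> = 35 * B"
    using distrib_right[of 1 34 B] by (simp add: mult.assoc[symmetric] flip: distrib_right)
  finally show ?thesis .
qed

text \<open>The region between two concentric squares, outside which \<open>chi R\<close> is locally
  constant. Four overlapping rectangles cover it exactly, so Poincare's inequality reduces to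
  boxes.\<close>

definition frame :: "real \<Rightarrow> (real^2) set" where
  "frame R = {x. (\<forall>j. \<bar>x $ j\<bar> \<le> 2 * R) \<and> (\<exists>j. R \<le> \<bar>x $ j\<bar>)}"

lemma emeasure_box_vec:
  assumes "a \<le> a'" "b \<le> b'"
  shows "emeasure lborel (cbox (vector [a, b]) (vector [a', b'] :: real^2)) = ennreal ((a' - a) * (b' - b))"
proof -
  have "\<forall>v\<in>Basis. (vector [a, b] :: real^2) \<bullet> v \<le> vector [a', b'] \<bullet> v"
    using assms by (auto simp: Basis_vec_def inner_axis forall_2)
  moreover have "(\<Prod>v\<in>Basis. (vector [a', b'] - vector [a, b] :: real^2) \<bullet> v) = (a' - a) * (b' - b)"
    by (simp add: prod_Basis_vec[of _ 1] oth_def)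
  ultimately show ?thesis by (simp add: emeasure_lborel_cbox_eq)
qed

lemma mem_cbox_vector2:
  "x \<in> cbox (vector [a, b]) (vector [a', b'] :: real^2) \<longleftrightarrow> a \<le> x $ 1 \<and> x $ 1 \<le> a' \<and> b \<le> x $ 2 \<and> x $ 2 \<le> b'"
  by (auto simp: cbox_vec[where i=1] oth_def)

lemma ex_2: "(\<exists>i::2. P i) \<longleftrightarrow> P 1 \<or> P 2"
  by (metis exhaust_2)

lemma frame_eq:
  "frame R = cbox (vector [R, -2*R]) (vector [2*R, 2*R]) \<union> cbox (vector [-2*R, R]) (vector [2*R, 2*R])
    \<union> cbox (vector [-2*R, -2*R]) (vector [-R, 2*R]) \<union> cbox (vector [-2*R, -2*R]) (vector [2*R, -R])"
proof (rule set_eqI)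
  fix x :: "real^2"
  have "R \<le> \<bar>y\<bar> \<longleftrightarrow> R \<le> y \<or> y \<le> - R" "\<bar>y\<bar> \<le> 2 * R \<longleftrightarrow> - 2 * R \<le> y \<and> y \<le> 2 * R" for y :: real
    by linarith+
  then show "x \<in> frame R \<longleftrightarrow> x \<in> cbox (vector [R, -2*R]) (vector [2*R, 2*R]) \<union> cbox (vector [-2*R, R]) (vector [2*R, 2*R])
    \<union> cbox (vector [-2*R, -2*R]) (vector [-R, 2*R]) \<union> cbox (vector [-2*R, -2*R]) (vector [2*R, -R])"
    unfolding frame_def Un_iff mem_cbox_vector2 mem_Collect_eq forall_2 ex_2 by (smt (verit))
qed

lemma sets_frame [measurable]: "frame R \<in> sets borel"
  unfolding frame_eq by measurable

text \<open>Four strips of size R by 4 R are glued one after the other. Each new strip shares a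
  corner square of side R, a quarter of its area, with the part already covered. Three gluings give
  35^3, a box contributes 2 (4 R)^2, and 42875 * 32 = 1372000.\<close>

lemma poincare_frame:
  fixes \<psi> :: "real^2 \<Rightarrow> real"
  assumes \<psi>: "Ck (Suc 0) \<psi>" and R: "R > 0"
  obtains c where "(\<integral>\<^sup>+x. ennreal ((\<psi> x - c)\<^sup>2) * indicator (frame R) x \<partial>lborel)
    \<le> ennreal (1372000 * R\<^sup>2) * (\<integral>\<^sup>+x. ennreal (\<Sum>i\<in>UNIV. (partial_deriv i \<psi> x)\<^sup>2) * indicator (frame R) x \<partial>lborel)"
proof -
  have [measurable]: "\<psi> \<in> borel_measurable borel" "partial_deriv i \<psi> \<in> borel_measurable borel" for i
    using continuous_partial_deriv[OF \<psi>] Ck_imp_continuous[OF \<psi>] by (auto intro: borel_measurable_continuous_onI)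
  let ?G = "\<lambda>x. ennreal (\<Sum>i\<in>UNIV. (partial_deriv i \<psi> x)\<^sup>2)"
  let ?P = "\<lambda>S c. (\<integral>\<^sup>+x. ennreal ((\<psi> x - c)\<^sup>2) * indicator S x \<partial>lborel)"
  define I where "I = (\<integral>\<^sup>+x. ?G x * indicator (frame R) x \<partial>lborel)"
  define B where "B = ennreal (2 * (4 * R)\<^sup>2) * I"
  let ?S1 = "cbox (vector [R, -2*R]) (vector [2*R, 2*R]) :: (real^2) set"
  let ?S2 = "cbox (vector [-2*R, R]) (vector [2*R, 2*R]) :: (real^2) set"
  let ?S3 = "cbox (vector [-2*R, -2*R]) (vector [-R, 2*R]) :: (real^2) set"
  let ?S4 = "cbox (vector [-2*R, -2*R]) (vector [2*R, -R]) :: (real^2) set"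
  have box: "\<exists>c. ?P (cbox p q) c \<le> B"
    if pq: "p $ 1 < q $ 1" "p $ 2 < q $ 2" "q $ 1 - p $ 1 \<le> 4 * R" "q $ 2 - p $ 2 \<le> 4 * R" "cbox p q \<subseteq> frame R" for p q
  proof -
    obtain c where c: "?P (cbox p q) c \<le> ennreal (2 * (4 * R)\<^sup>2) * (\<integral>\<^sup>+x. ?G x * indicator (cbox p q) x \<partial>lborel)"
      by (rule poincare_box[OF \<psi> pq(1-4)])
    have "(\<integral>\<^sup>+x. ?G x * indicator (cbox p q) x \<partial>lborel) \<le> I"
      unfolding I_def using pq(5) by (intro nn_integral_mono) (auto simp: indicator_def)
    then have "ennreal (2 * (4 * R)\<^sup>2) * (\<integral>\<^sup>+x. ?G x * indicator (cbox p q) x \<partial>lborel) \<le> B"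
      unfolding B_def by (intro mult_left_mono) auto
    with c show ?thesis by (blast intro: order_trans)
  qed
  note out = that
  obtain c1 where c1: "?P ?S1 c1 \<le> B" using box[of "vector [R, -2*R]" "vector [2*R, 2*R]"] R by (auto simp: frame_eq)
  obtain c2 where c2: "?P ?S2 c2 \<le> B" using box[of "vector [-2*R, R]" "vector [2*R, 2*R]"] R by (auto simp: frame_eq)
  obtain c3 where c3: "?P ?S3 c3 \<le> B" using box[of "vector [-2*R, -2*R]" "vector [-R, 2*R]"] R by (auto simp: frame_eq)
  obtain c4 where c4: "?P ?S4 c4 \<le> B" using box[of "vector [-2*R, -2*R]" "vector [2*R, -R]"] R by (auto simp: frame_eq)
  have four: "ennreal (R * (R * 4)) = ennreal (R * R) * 4"
    using R ennreal_mult[of "R * R" 4] by (simp add: mult_ac)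
  have g2: "?P (?S1 \<union> ?S2) c1 \<le> 35 * B"
    using R by (intro poincare_glue[where K="cbox (vector [R, R]) (vector [2*R, 2*R])" and c'=c2] c1 c2)
      (auto simp: mem_cbox_vector2 emeasure_box_vec four algebra_simps)
  have mB: "B \<le> 35 * B" "B \<le> 35 * (35 * B)"
    using mult_right_mono[of 1 35 B] mult_right_mono[of 1 "35 * 35" B] by (auto simp: mult.assoc)
  have g3: "?P (?S1 \<union> ?S2 \<union> ?S3) c1 \<le> 35 * (35 * B)"
    using R by (intro poincare_glue[where K="cbox (vector [-2*R, R]) (vector [-R, 2*R])" and c'=c3] g2 order_trans[OF c3 mB(1)])
      (auto simp: mem_cbox_vector2 emeasure_box_vec four algebra_simps)
  have g4: "?P (?S1 \<union> ?S2 \<union> ?S3 \<union> ?S4) c1 \<le> 35 * (35 * (35 * B))"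
    using R by (intro poincare_glue[where K="cbox (vector [R, -2*R]) (vector [2*R, -R])" and c'=c4] g3 order_trans[OF c4 mB(2)])
      (auto simp: mem_cbox_vector2 emeasure_box_vec four algebra_simps)
  have "35 * (35 * (35 * B)) = ennreal (1372000 * R\<^sup>2) * I"
  proof -
    have "ennreal (1372000 * R\<^sup>2) = 42875 * ennreal (2 * (4 * R)\<^sup>2)"
      using ennreal_mult[of 42875 "2 * (4 * R)\<^sup>2"] by (simp add: power_mult_distrib)
    then show ?thesis by (simp add: B_def mult.assoc[symmetric])
  qed
  with g4 show ?thesis unfolding frame_eq[of R, symmetric] I_def by (intro out) simp
qed

section \<open>Square-integrable functions\<close>

text \<open>Square integrability on the whole plane, over the completed measure as in the
  definitions; functions on a subset enter through extension by zero.\<close>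

definition sqint :: "(real^2 \<Rightarrow> 'b::euclidean_space) \<Rightarrow> bool" where
  "sqint f \<longleftrightarrow> f \<in> borel_measurable lebesgue \<and> integrable lebesgue (\<lambda>x. (norm (f x))\<^sup>2)"

definition nrm :: "(real^2 \<Rightarrow> 'b::euclidean_space) \<Rightarrow> real" where
  "nrm f = sqrt (\<integral>x. (norm (f x))\<^sup>2 \<partial>lebesgue)"

lemma sqint_measurable [measurable_dest]: "sqint f \<Longrightarrow> f \<in> borel_measurable lebesgue"
  by (simp add: sqint_def)

lemma nrm_nonneg [simp]: "0 \<le> nrm f"
  by (simp add: nrm_def)

lemma nrm_sq: "(nrm f)\<^sup>2 = (\<integral>x. (norm (f x))\<^sup>2 \<partial>lebesgue)"
  by (simp add: nrm_def integral_nonneg)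

lemma nrm_leI: "(\<integral>x. (norm (f x))\<^sup>2 \<partial>lebesgue) \<le> C\<^sup>2 \<Longrightarrow> 0 \<le> C \<Longrightarrow> nrm f \<le> C"
  unfolding nrm_def by (rule real_le_lsqrt) auto

lemma nrm_cong_AE:
  assumes "AE x in lebesgue. f x = g x" "f \<in> borel_measurable lebesgue" "g \<in> borel_measurable lebesgue"
  shows "nrm f = nrm g"
  unfolding nrm_def using assms
  by (intro arg_cong[where f=sqrt] integral_cong_AE) (auto elim: eventually_mono)

lemma nrm_cong_norm: "(\<And>x. norm (f x) = norm (g x)) \<Longrightarrow> nrm f = nrm g"
  by (simp add: nrm_def)

lemma sqint_dominated:
  assumes g: "sqint g" and f: "f \<in> borel_measurable lebesgue" and le: "AE x in lebesgue. norm (f x) \<le> C * norm (g x)"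
  shows "sqint f"
  unfolding sqint_def
proof
  show "integrable lebesgue (\<lambda>x. (norm (f x))\<^sup>2)"
  proof (rule Bochner_Integration.integrable_bound)
    show "integrable lebesgue (\<lambda>x. C\<^sup>2 * (norm (g x))\<^sup>2)" using g by (simp add: sqint_def)
    show "AE x in lebesgue. norm ((norm (f x))\<^sup>2) \<le> norm (C\<^sup>2 * (norm (g x))\<^sup>2)"
      using le
    proof eventually_elim
      case (elim x)
      then have "(norm (f x))\<^sup>2 \<le> (C * norm (g x))\<^sup>2" by (intro power_mono) auto
      then show ?case by (simp add: power_mult_distrib)
    qed
  qed (use f in measurable)
qed (rule f)

lemma nrm_dominated:
  assumes g: "sqint g" and f: "f \<in> borel_measurable lebesgue" and le: "AE x in lebesgue. norm (f x) \<le> C * norm (g x)" and C: "0 \<le> C"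
  shows "nrm f \<le> C * nrm g"
proof (rule nrm_leI)
  have "(\<integral>x. (norm (f x))\<^sup>2 \<partial>lebesgue) \<le> (\<integral>x. C\<^sup>2 * (norm (g x))\<^sup>2 \<partial>lebesgue)"
  proof (rule integral_mono_AE)
    show "AE x in lebesgue. (norm (f x))\<^sup>2 \<le> C\<^sup>2 * (norm (g x))\<^sup>2"
      using le
    proof eventually_elim
      case (elim x)
      then have "(norm (f x))\<^sup>2 \<le> (C * norm (g x))\<^sup>2" by (intro power_mono) auto
      then show ?case by (simp add: power_mult_distrib)
    qed
    show "integrable lebesgue (\<lambda>x. (norm (f x))\<^sup>2)"
      using sqint_dominated[OF g f le] by (simp add: sqint_def)
    show "integrable lebesgue (\<lambda>x. C\<^sup>2 * (norm (g x))\<^sup>2)" using g by (simp add: sqint_def)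
  qed
  then show "(\<integral>x. (norm (f x))\<^sup>2 \<partial>lebesgue) \<le> (C * nrm g)\<^sup>2"
    by (simp add: power_mult_distrib nrm_sq)
qed (use C in auto)

lemma sqint_norm_mult:
  assumes f: "sqint f" and g: "sqint g"
  shows "integrable lebesgue (\<lambda>x. norm (f x) * norm (g x))"
    and "(\<integral>x. norm (f x) * norm (g x) \<partial>lebesgue) \<le> nrm f * nrm g"
proof -
  have [measurable]: "f \<in> borel_measurable lebesgue" "g \<in> borel_measurable lebesgue"
    using f g by (auto simp: sqint_def)
  show i: "integrable lebesgue (\<lambda>x. norm (f x) * norm (g x))"
  proof (rule Bochner_Integration.integrable_bound)
    show "integrable lebesgue (\<lambda>x. (norm (f x))\<^sup>2 + (norm (g x))\<^sup>2)"
      using f g by (auto simp: sqint_def)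
    have "norm (f x) * norm (g x) \<le> (norm (f x))\<^sup>2 + (norm (g x))\<^sup>2" for x
      using sum_squares_bound[of "norm (f x)" "norm (g x)"] mult_nonneg_nonneg[OF norm_ge_zero norm_ge_zero, of "f x" "g x"]
      by (simp only: mult.assoc)
    then show "AE x in lebesgue. norm (norm (f x) * norm (g x)) \<le> norm ((norm (f x))\<^sup>2 + (norm (g x))\<^sup>2)"
      by auto
  qed auto
  have "(ennreal (\<integral>x. norm (f x) * norm (g x) \<partial>lebesgue))\<^sup>2 = (\<integral>\<^sup>+x. ennreal (norm (f x)) * ennreal (norm (g x)) \<partial>lebesgue)\<^sup>2"
    using i by (subst nn_integral_eq_integral[symmetric]) (auto simp: ennreal_mult)
  also have "\<dots> \<le> (\<integral>\<^sup>+x. (ennreal (norm (f x)))\<^sup>2 \<partial>lebesgue) * (\<integral>\<^sup>+x. (ennreal (norm (g x)))\<^sup>2 \<partial>lebesgue)"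
    by (rule Cauchy_Schwarz_nn_integral) auto
  also have "\<dots> = ennreal (\<integral>x. (norm (f x))\<^sup>2 \<partial>lebesgue) * ennreal (\<integral>x. (norm (g x))\<^sup>2 \<partial>lebesgue)"
    using f g by (subst (1 2) nn_integral_eq_integral[symmetric]) (auto simp: sqint_def ennreal_power)
  also have "\<dots> = (ennreal (nrm f * nrm g))\<^sup>2"
    by (simp add: nrm_sq[symmetric] ennreal_power power_mult_distrib ennreal_mult)
  finally have "ennreal ((\<integral>x. norm (f x) * norm (g x) \<partial>lebesgue)\<^sup>2) \<le> ennreal ((nrm f * nrm g)\<^sup>2)"
    by (simp add: ennreal_power integral_nonneg)
  then have "(\<integral>x. norm (f x) * norm (g x) \<partial>lebesgue)\<^sup>2 \<le> (nrm f * nrm g)\<^sup>2"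
    by (subst (asm) ennreal_le_iff) auto
  then show "(\<integral>x. norm (f x) * norm (g x) \<partial>lebesgue) \<le> nrm f * nrm g"
    by (rule power2_le_imp_le) auto
qed

text \<open>Pointwise control by a product of two square-integrable functions yields integrability
  and the Cauchy-Schwarz bound at once; the estimates of the trilinear form rest on it.\<close>

lemma sqint_product:
  fixes h :: "real^2 \<Rightarrow> 'c::{banach, second_countable_topology}"
  assumes f: "sqint f" and g: "sqint g" and h: "h \<in> borel_measurable lebesgue"
    and le: "AE x in lebesgue. norm (h x) \<le> C * (norm (f x) * norm (g x))" and C: "0 \<le> C"
  shows "integrable lebesgue h" and "norm (\<integral>x. h x \<partial>lebesgue) \<le> C * nrm f * nrm g"
    and "(\<integral>x. norm (h x) \<partial>lebesgue) \<le> C * nrm f * nrm g"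
proof -
  note fg = sqint_norm_mult[OF f g]
  show i: "integrable lebesgue h"
  proof (rule Bochner_Integration.integrable_bound)
    show "integrable lebesgue (\<lambda>x. C * (norm (f x) * norm (g x)))" using fg by simp
    show "AE x in lebesgue. norm (h x) \<le> norm (C * (norm (f x) * norm (g x)))"
      using le C by (auto elim: eventually_mono)
  qed (rule h)
  have "(\<integral>x. norm (h x) \<partial>lebesgue) \<le> (\<integral>x. C * (norm (f x) * norm (g x)) \<partial>lebesgue)"
    using i fg le by (intro integral_mono_AE) auto
  also have "\<dots> \<le> C * (nrm f * nrm g)"
    using fg C by (simp add: mult_left_mono)
  finally show *: "(\<integral>x. norm (h x) \<partial>lebesgue) \<le> C * nrm f * nrm g" by (simp add: mult.assoc)
  have "norm (\<integral>x. h x \<partial>lebesgue) \<le> (\<integral>x. norm (h x) \<partial>lebesgue)"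
    by (rule integral_norm_bound)
  from this * show "norm (\<integral>x. h x \<partial>lebesgue) \<le> C * nrm f * nrm g" by (rule order_trans)
qed

lemma sqint_scaleR: "sqint f \<Longrightarrow> sqint (\<lambda>x. c *\<^sub>R f x)"
  by (rule sqint_dominated[where C="\<bar>c\<bar>" and g=f]) auto

lemma nrm_scaleR: "nrm (\<lambda>x. c *\<^sub>R f x) = \<bar>c\<bar> * nrm f"
  by (simp add: nrm_def power_mult_distrib real_sqrt_mult)

lemma sqint_minus: "sqint f \<Longrightarrow> sqint (\<lambda>x. - f x)"
  using sqint_scaleR[of f "-1"] by simp

lemma sqint_add:
  assumes f: "sqint f" and g: "sqint g"
  shows "sqint (\<lambda>x. f x + g x)"
  unfolding sqint_def
proof
  have [measurable]: "f \<in> borel_measurable lebesgue" "g \<in> borel_measurable lebesgue"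
    using f g by (auto simp: sqint_def)
  show "(\<lambda>x. f x + g x) \<in> borel_measurable lebesgue" by measurable
  show "integrable lebesgue (\<lambda>x. (norm (f x + g x))\<^sup>2)"
  proof (rule Bochner_Integration.integrable_bound)
    show "integrable lebesgue (\<lambda>x. 2 * (norm (f x))\<^sup>2 + 2 * (norm (g x))\<^sup>2)"
      using f g by (auto simp: sqint_def)
    have "(norm (f x + g x))\<^sup>2 \<le> 2 * (norm (f x))\<^sup>2 + 2 * (norm (g x))\<^sup>2" for x
    proof -
      have "(norm (f x + g x))\<^sup>2 \<le> (norm (f x) + norm (g x))\<^sup>2"
        by (intro power_mono norm_triangle_ineq) auto
      also have "\<dots> \<le> 2 * (norm (f x))\<^sup>2 + 2 * (norm (g x))\<^sup>2"
        using sum_squares_bound[of "norm (f x)" "norm (g x)"] by (simp add: power2_eq_square algebra_simps)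
      finally show ?thesis .
    qed
    then show "AE x in lebesgue. norm ((norm (f x + g x))\<^sup>2) \<le> norm (2 * (norm (f x))\<^sup>2 + 2 * (norm (g x))\<^sup>2)"
      by auto
  qed measurable
qed

lemma sqint_diff: "sqint f \<Longrightarrow> sqint g \<Longrightarrow> sqint (\<lambda>x. f x - g x)"
  using sqint_add[of f "\<lambda>x. - g x"] sqint_minus[of g] by simp

lemma sqint_zero [simp]: "sqint (\<lambda>x. 0)"
  by (simp add: sqint_def)

lemma nrm_zero [simp]: "nrm (\<lambda>x. 0) = 0"
  by (simp add: nrm_def)

lemma nrm_minus [simp]: "nrm (\<lambda>x. - f x) = nrm f"
  by (simp add: nrm_def)

lemma nrm_minus_commute: "nrm (\<lambda>x. f x - g x) = nrm (\<lambda>x. g x - f x)"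
  by (simp add: nrm_def norm_minus_commute)

lemma nrm_triangle:
  assumes f: "sqint f" and g: "sqint g"
  shows "nrm (\<lambda>x. f x + g x) \<le> nrm f + nrm g"
proof (rule nrm_leI)
  have i: "integrable lebesgue (\<lambda>x. (norm (f x))\<^sup>2)" "integrable lebesgue (\<lambda>x. (norm (g x))\<^sup>2)"
    "integrable lebesgue (\<lambda>x. (norm (f x + g x))\<^sup>2)"
    using f g sqint_add[OF f g] by (auto simp: sqint_def)
  note fg = sqint_norm_mult[OF f g]
  have "(\<integral>x. (norm (f x + g x))\<^sup>2 \<partial>lebesgue) \<le> (\<integral>x. (norm (f x))\<^sup>2 + 2 * (norm (f x) * norm (g x)) + (norm (g x))\<^sup>2 \<partial>lebesgue)"
  proof (rule integral_mono)
    fix x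
    have "(norm (f x + g x))\<^sup>2 \<le> (norm (f x) + norm (g x))\<^sup>2"
      by (intro power_mono norm_triangle_ineq) auto
    then show "(norm (f x + g x))\<^sup>2 \<le> (norm (f x))\<^sup>2 + 2 * (norm (f x) * norm (g x)) + (norm (g x))\<^sup>2"
      by (simp add: power2_eq_square algebra_simps)
  qed (use i fg in auto)
  also have "\<dots> = (nrm f)\<^sup>2 + 2 * (\<integral>x. norm (f x) * norm (g x) \<partial>lebesgue) + (nrm g)\<^sup>2"
    using i fg by (simp add: nrm_sq)
  also have "\<dots> \<le> (nrm f + nrm g)\<^sup>2"
    using fg by (simp add: power2_sum)
  finally show "(\<integral>x. (norm (f x + g x))\<^sup>2 \<partial>lebesgue) \<le> (nrm f + nrm g)\<^sup>2" .
qed auto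

lemma nrm_triangle_diff: "sqint f \<Longrightarrow> sqint g \<Longrightarrow> nrm (\<lambda>x. f x - g x) \<le> nrm f + nrm g"
  using nrm_triangle[of f "\<lambda>x. - g x"] sqint_minus[of g] by simp

lemma nrm_diff_abs:
  assumes f: "sqint f" and g: "sqint g"
  shows "\<bar>nrm f - nrm g\<bar> \<le> nrm (\<lambda>x. f x - g x)"
  using nrm_triangle[OF sqint_diff[OF f g] g] nrm_triangle[OF sqint_diff[OF g f] f]
  by (simp add: nrm_minus_commute[of g f])

lemma nrm_tendsto:
  assumes "\<And>n. sqint (f n)" "sqint g" "(\<lambda>n. nrm (\<lambda>x. f n x - g x)) \<longlonglongrightarrow> 0"
  shows "(\<lambda>n. nrm (f n)) \<longlonglongrightarrow> nrm g"
proof -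
  have "(\<lambda>n. nrm (f n) - nrm g) \<longlonglongrightarrow> 0"
    by (rule Lim_null_comparison[OF _ assms(3)]) (auto intro!: always_eventually nrm_diff_abs assms)
  then show ?thesis by (simp add: LIM_zero_iff)
qed

lemma nrm_eq_0:
  assumes "sqint f" "nrm f = 0"
  shows "AE x in lebesgue. f x = 0"
proof -
  have "integrable lebesgue (\<lambda>x. (norm (f x))\<^sup>2)" using assms by (simp add: sqint_def)
  moreover have "(\<integral>x. (norm (f x))\<^sup>2 \<partial>lebesgue) = 0" using assms(2) nrm_sq[of f] by simp
  ultimately have "AE x in lebesgue. (norm (f x))\<^sup>2 = 0"
    by (subst (asm) integral_nonneg_eq_0_iff_AE) auto
  then show ?thesis by simp
qed

text \<open>The error is split into one part with the difference of the \<open>g n\<close> and one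
  with the difference of the \<open>f n\<close>; the norms of the \<open>f n\<close> converge and
  hence do not spoil the first part.\<close>

lemma integral_bilinear_tendsto:
  fixes B :: "'a::euclidean_space \<Rightarrow> 'b::euclidean_space \<Rightarrow> real"
  assumes B: "bounded_bilinear B"
    and f: "\<And>n. sqint (f n)" "sqint f'" "(\<lambda>n. nrm (\<lambda>x. f n x - f' x)) \<longlonglongrightarrow> 0"
    and g: "\<And>n. sqint (g n)" "sqint g'" "(\<lambda>n. nrm (\<lambda>x. g n x - g' x)) \<longlonglongrightarrow> 0"
  shows "(\<lambda>n. \<integral>x. B (f n x) (g n x) \<partial>lebesgue) \<longlonglongrightarrow> (\<integral>x. B (f' x) (g' x) \<partial>lebesgue)"
proof -
  obtain K where K: "0 < K" "\<And>a b. norm (B a b) \<le> norm a * norm b * K"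
    using bounded_bilinear.pos_bounded[OF B] by blast
  have K': "norm (B a b) \<le> K * (norm a * norm b)" for a b using K(2)[of a b] by (simp add: mult_ac)
  have m: "(\<lambda>x. B (p x) (q x)) \<in> borel_measurable lebesgue" if "sqint p" "sqint q" for p q
  proof -
    have [measurable]: "p \<in> borel_measurable lebesgue" "q \<in> borel_measurable lebesgue" using that by (auto simp: sqint_def)
    have "(\<lambda>z. B (fst z) (snd z)) \<in> borel_measurable borel"
      by (intro borel_measurable_continuous_onI bounded_bilinear.continuous_on[OF B] continuous_intros)
    then have "(\<lambda>x. (\<lambda>z. B (fst z) (snd z)) (p x, q x)) \<in> borel_measurable lebesgue"
      by (rule measurable_compose[rotated]) measurable
    then show ?thesis by simp
  qed
  have i: "integrable lebesgue (\<lambda>x. B (p x) (q x))"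
    and n: "norm (\<integral>x. B (p x) (q x) \<partial>lebesgue) \<le> K * nrm p * nrm q" if "sqint p" "sqint q" for p q
    using sqint_product[OF that m[OF that], of K] K K' by auto
  have "(\<lambda>n. (\<integral>x. B (f n x) (g n x) \<partial>lebesgue) - (\<integral>x. B (f' x) (g' x) \<partial>lebesgue)) \<longlonglongrightarrow> 0"
  proof (rule Lim_null_comparison[OF always_eventually])
    show "\<forall>n. norm ((\<integral>x. B (f n x) (g n x) \<partial>lebesgue) - (\<integral>x. B (f' x) (g' x) \<partial>lebesgue))
        \<le> K * nrm (f n) * nrm (\<lambda>x. g n x - g' x) + K * nrm (\<lambda>x. f n x - f' x) * nrm g'"
    proof
      fix n
      have "(\<integral>x. B (f n x) (g n x) \<partial>lebesgue) - (\<integral>x. B (f' x) (g' x) \<partial>lebesgue)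
          = (\<integral>x. B (f n x) (g n x - g' x) \<partial>lebesgue) + (\<integral>x. B (f n x - f' x) (g' x) \<partial>lebesgue)"
        using i f g sqint_diff
        by (simp add: bounded_bilinear.diff_left[OF B] bounded_bilinear.diff_right[OF B])
      then show "norm ((\<integral>x. B (f n x) (g n x) \<partial>lebesgue) - (\<integral>x. B (f' x) (g' x) \<partial>lebesgue))
        \<le> K * nrm (f n) * nrm (\<lambda>x. g n x - g' x) + K * nrm (\<lambda>x. f n x - f' x) * nrm g'"
        using n[OF f(1) sqint_diff[OF g(1,2)], of n n] n[OF sqint_diff[OF f(1,2)] g(2), of n]
        by (simp add: norm_triangle_le)
    qed
    have "(\<lambda>n. K * nrm (f n) * nrm (\<lambda>x. g n x - g' x) + K * nrm (\<lambda>x. f n x - f' x) * nrm g') \<longlonglongrightarrow>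
        K * nrm f' * 0 + K * 0 * nrm g'"
      by (intro tendsto_intros nrm_tendsto f g)
    then show "(\<lambda>n. K * nrm (f n) * nrm (\<lambda>x. g n x - g' x) + K * nrm (\<lambda>x. f n x - f' x) * nrm g') \<longlonglongrightarrow> 0"
      by simp
  qed
  then show ?thesis by (simp add: LIM_zero_iff)
qed

lemma borel_measurable_lebesgue_continuous:
  "continuous_on UNIV f \<Longrightarrow> f \<in> borel_measurable lebesgue"
  by (intro borel_measurable_if_I measurable_completion) (auto intro: borel_measurable_continuous_onI)

lemma integrable_lebesgue_cs:
  fixes f :: "real^2 \<Rightarrow> 'b::{banach, second_countable_topology}"
  assumes "continuous_on UNIV f" "\<And>x. R < norm x \<Longrightarrow> f x = 0"
  shows "integrable lebesgue f"
  using integrable_cs[OF assms] by (rule integrable_completion[THEN iffD2, rotated])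
   (use assms in \<open>auto intro: borel_measurable_continuous_onI\<close>)

lemma integral_lebesgue_continuous:
  fixes f :: "real^2 \<Rightarrow> real"
  assumes "continuous_on UNIV f"
  shows "(\<integral>x. f x \<partial>lebesgue) = (\<integral>x. f x \<partial>lborel)"
  using assms by (intro integral_completion) (auto intro: borel_measurable_continuous_onI)

lemma sqint_cs:
  assumes "continuous_on UNIV f" "\<And>x. R < norm x \<Longrightarrow> f x = 0"
  shows "sqint f"
  unfolding sqint_def using assms
  by (auto intro!: borel_measurable_lebesgue_continuous integrable_lebesgue_cs[where R=R] continuous_intros)

subsection \<open>Cutting off at balls\<close>

text \<open>Serves three purposes: extension by zero from the domain, restriction to balls, and the
  tail outside a ball.\<close>

definition cutf :: "(real^2) set \<Rightarrow> (real^2 \<Rightarrow> 'b::real_vector) \<Rightarrow> real^2 \<Rightarrow> 'b" where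
  "cutf A f x = indicator A x *\<^sub>R f x"

lemma measurable_cutf:
  "A \<in> sets lebesgue \<Longrightarrow> f \<in> borel_measurable lebesgue \<Longrightarrow> cutf A f \<in> borel_measurable lebesgue"
  for f :: "real^2 \<Rightarrow> 'b::euclidean_space"
  unfolding cutf_def[abs_def] by (intro borel_measurable_scaleR borel_measurable_indicator)

lemma norm_cutf_le: "norm (cutf A f x) \<le> norm (f x)"
  by (simp add: cutf_def indicator_def)

lemma sqint_cutf: "A \<in> sets lebesgue \<Longrightarrow> sqint f \<Longrightarrow> sqint (cutf A f)"
  by (rule sqint_dominated[where C=1 and g=f]) (auto simp: norm_cutf_le intro: measurable_cutf sqint_measurable)

lemma nrm_cutf_le: "A \<in> sets lebesgue \<Longrightarrow> sqint f \<Longrightarrow> nrm (cutf A f) \<le> nrm f"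
  using nrm_dominated[where C=1 and g=f and f="cutf A f"] by (auto simp: norm_cutf_le intro: measurable_cutf sqint_measurable)

lemma nrm_cutf_mono:
  assumes "A \<subseteq> B" "A \<in> sets lebesgue" "sqint (cutf B f)" "f \<in> borel_measurable lebesgue"
  shows "nrm (cutf A f) \<le> nrm (cutf B f)"
proof -
  have "norm (cutf A f x) \<le> 1 * norm (cutf B f x)" for x
    using assms(1) by (auto simp: cutf_def indicator_def)
  then have "nrm (cutf A f) \<le> 1 * nrm (cutf B f)"
    by (intro nrm_dominated[OF assms(3) measurable_cutf[OF assms(2,4)]] AE_I2) auto
  then show ?thesis by simp
qed

lemma sqint_cutf_mono:
  assumes "A \<subseteq> B" "A \<in> sets lebesgue" "sqint (cutf B f)" "f \<in> borel_measurable lebesgue"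
  shows "sqint (cutf A f)"
proof -
  have "norm (cutf A f x) \<le> 1 * norm (cutf B f x)" for x
    using assms(1) by (auto simp: cutf_def indicator_def)
  then show ?thesis
    by (intro sqint_dominated[OF assms(3) measurable_cutf[OF assms(2,4)], where C=1] AE_I2)
qed

text \<open>Fatou's lemma along growing balls. Convergence is only local, so bounds are first
  obtained on balls; uniformity in the radius makes them global.\<close>

lemma sqint_if_balls_bounded:
  fixes f :: "real^2 \<Rightarrow> 'b::euclidean_space"
  assumes f: "f \<in> borel_measurable lebesgue"
    and s: "\<And>n::nat. sqint (cutf (ball 0 n) f)" and b: "\<And>n::nat. nrm (cutf (ball 0 n) f) \<le> C"
  shows "sqint f" and "nrm f \<le> C"
proof -
  have [measurable]: "cutf (ball 0 (real n)) f \<in> borel_measurable lebesgue" for n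
    using f by (intro measurable_cutf) auto
  have C: "0 \<le> C" using b[of 0] nrm_nonneg order_trans by blast
  have lim: "(\<lambda>n::nat. (norm (cutf (ball 0 n) f x))\<^sup>2) \<longlonglongrightarrow> (norm (f x))\<^sup>2" for x
  proof (rule tendsto_eventually)
    obtain N :: nat where "norm x < N" using reals_Archimedean2 by blast
    then show "\<forall>\<^sub>F n in sequentially. (norm (cutf (ball 0 (real n)) f x))\<^sup>2 = (norm (f x))\<^sup>2"
      by (intro eventually_sequentiallyI[of N]) (auto simp: cutf_def indicator_def)
  qed
  have "(\<integral>\<^sup>+x. ennreal ((norm (f x))\<^sup>2) \<partial>lebesgue) \<le> liminf (\<lambda>n. \<integral>\<^sup>+x. ennreal ((norm (cutf (ball 0 (real n)) f x))\<^sup>2) \<partial>lebesgue)"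
  proof -
    have "(\<integral>\<^sup>+x. ennreal ((norm (f x))\<^sup>2) \<partial>lebesgue) = (\<integral>\<^sup>+x. liminf (\<lambda>n. ennreal ((norm (cutf (ball 0 (real n)) f x))\<^sup>2)) \<partial>lebesgue)"
      using lim by (intro nn_integral_cong lim_imp_Liminf[symmetric] tendsto_ennrealI) auto
    also have "\<dots> \<le> liminf (\<lambda>n. \<integral>\<^sup>+x. ennreal ((norm (cutf (ball 0 (real n)) f x))\<^sup>2) \<partial>lebesgue)"
      by (rule nn_integral_liminf) measurable
    finally show ?thesis .
  qed
  also have "\<dots> \<le> liminf (\<lambda>n. ennreal (C\<^sup>2))"
  proof (rule Liminf_mono[OF always_eventually], rule allI)
    fix n :: nat
    have "(\<integral>\<^sup>+x. ennreal ((norm (cutf (ball 0 (real n)) f x))\<^sup>2) \<partial>lebesgue) = ennreal ((nrm (cutf (ball 0 (real n)) f))\<^sup>2)"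
      using s[of n] by (simp add: nrm_sq nn_integral_eq_integral sqint_def)
    also have "\<dots> \<le> ennreal (C\<^sup>2)" using b[of n] by (intro ennreal_leI power_mono) auto
    finally show "(\<integral>\<^sup>+x. ennreal ((norm (cutf (ball 0 (real n)) f x))\<^sup>2) \<partial>lebesgue) \<le> ennreal (C\<^sup>2)" .
  qed
  also have "\<dots> = ennreal (C\<^sup>2)" by (simp add: Liminf_const)
  finally have le: "(\<integral>\<^sup>+x. ennreal ((norm (f x))\<^sup>2) \<partial>lebesgue) \<le> ennreal (C\<^sup>2)" .
  have i: "integrable lebesgue (\<lambda>x. (norm (f x))\<^sup>2)"
    by (rule integrableI_bounded) (use le f in \<open>auto intro: le_less_trans borel_measurable_power borel_measurable_norm\<close>)
  with f show "sqint f" by (simp add: sqint_def)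
  have "ennreal (\<integral>x. (norm (f x))\<^sup>2 \<partial>lebesgue) \<le> ennreal (C\<^sup>2)"
    using le i by (simp add: nn_integral_eq_integral)
  then show "nrm f \<le> C" using C by (intro nrm_leI) auto
qed

text \<open>Dominated convergence. Applied to the gradients of the two solutions, it provides the
  decay as the frame moves to infinity.\<close>

lemma nrm_cutf_tail:
  assumes "sqint f"
  shows "(\<lambda>n::nat. nrm (cutf (- ball 0 n) f)) \<longlonglongrightarrow> 0"
proof -
  have [measurable]: "cutf (- ball 0 (real n)) f \<in> borel_measurable lebesgue" for n
    using assms by (intro measurable_cutf) (auto simp: sqint_def)
  have "(\<lambda>n::nat. \<integral>x. (norm (cutf (- ball 0 (real n)) f x))\<^sup>2 \<partial>lebesgue) \<longlonglongrightarrow> (\<integral>x. 0 \<partial>(lebesgue :: (real^2) measure))"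
  proof (rule integral_dominated_convergence[where w="\<lambda>x. (norm (f x))\<^sup>2"])
    show "integrable lebesgue (\<lambda>x. (norm (f x))\<^sup>2)" using assms by (simp add: sqint_def)
    show "AE x in lebesgue. (\<lambda>n. (norm (cutf (- ball 0 (real n)) f x))\<^sup>2) \<longlonglongrightarrow> 0"
    proof (rule AE_I2, rule tendsto_eventually)
      fix x :: "real^2"
      obtain N :: nat where "norm x < N" using reals_Archimedean2 by blast
      then show "\<forall>\<^sub>F n in sequentially. (norm (cutf (- ball 0 (real n)) f x))\<^sup>2 = 0"
        by (intro eventually_sequentiallyI[of N]) (auto simp: cutf_def indicator_def)
    qed
    show "AE x in lebesgue. norm ((norm (cutf (- ball 0 (real n)) f x))\<^sup>2) \<le> (norm (f x))\<^sup>2" for n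
      by (auto intro!: AE_I2 power_mono norm_cutf_le)
  qed auto
  then have "(\<lambda>n::nat. sqrt (\<integral>x. (norm (cutf (- ball 0 (real n)) f x))\<^sup>2 \<partial>lebesgue)) \<longlonglongrightarrow> sqrt 0"
    by (intro tendsto_real_sqrt) simp
  then show ?thesis by (simp add: nrm_def)
qed

section \<open>Weak gradients\<close>

subsection \<open>Test functions\<close>

lemma test_funsI:
  assumes "\<And>k. Ck k g" "compact K" "K \<subseteq> \<Omega>" "\<And>x. x \<notin> K \<Longrightarrow> g x = 0"
  shows "g \<in> test_funs \<Omega>"
proof -
  have "closure {x. g x \<noteq> 0} \<subseteq> K"
    using assms by (intro closure_minimal compact_imp_closed) auto
  then show ?thesis unfolding test_funs_def smooth_fun_def using assms
    by (auto intro: compact_closure[THEN iffD2] bounded_subset[OF compact_imp_bounded[of K]] closure_subset[THEN subsetD] simp del: compact_closure)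
qed

lemma test_funsE:
  assumes "g \<in> test_funs \<Omega>"
  obtains K where "compact K" "K \<subseteq> \<Omega>" "\<And>x. x \<notin> K \<Longrightarrow> g x = 0"
proof (rule that)
  show "compact (closure {x. g x \<noteq> 0})" "closure {x. g x \<noteq> 0} \<subseteq> \<Omega>"
    using assms by (auto simp: test_funs_def simp del: compact_closure)
  show "g x = 0" if "x \<notin> closure {x. g x \<noteq> 0}" for x
    using that closure_subset[of "{x. g x \<noteq> 0}"] by auto
qed

lemma test_funs_Ck: "g \<in> test_funs \<Omega> \<Longrightarrow> Ck k g"
  by (simp add: test_funs_def smooth_fun_def)

lemma test_funs_partial_deriv:
  assumes "g \<in> test_funs \<Omega>"
  shows "partial_deriv i g \<in> test_funs \<Omega>"
proof -
  obtain K where K: "compact K" "K \<subseteq> \<Omega>" "\<And>x. x \<notin> K \<Longrightarrow> g x = 0"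
    using test_funsE[OF assms] by metis
  show ?thesis
  proof (rule test_funsI[OF _ K(1,2)])
    show "Ck k (partial_deriv i g)" for k
      using test_funs_Ck[OF assms, of "Suc k"] by (simp add: Ck.simps)
    show "partial_deriv i g x = 0" if "x \<notin> K" for x
      using K that by (intro partial_deriv_zero_open[of "- K"]) (auto intro: compact_imp_closed)
  qed
qed

lemma test_funs_far:
  assumes "g \<in> test_funs \<Omega>"
  obtains R where "\<And>x. R < norm x \<Longrightarrow> g x = 0"
proof -
  obtain K where K: "compact K" "K \<subseteq> \<Omega>" "\<And>x. x \<notin> K \<Longrightarrow> g x = 0"
    using test_funsE[OF assms] by metis
  obtain R where "\<And>x. x \<in> K \<Longrightarrow> norm x \<le> R"
    using compact_imp_bounded[OF K(1)] by (auto simp: bounded_iff)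
  then show ?thesis using K(3) by (intro that[of R]) (meson not_le)
qed

lemma test_funs_zero: "g \<in> test_funs \<Omega> \<Longrightarrow> x \<notin> \<Omega> \<Longrightarrow> g x = 0"
  by (erule test_funsE) auto

lemma test_funs_continuous: "g \<in> test_funs \<Omega> \<Longrightarrow> continuous_on A g"
  using Ck_imp_continuous[OF test_funs_Ck[of g \<Omega> 0]] continuous_on_subset by blast

lemma test_funs_sqint: "g \<in> test_funs \<Omega> \<Longrightarrow> sqint g"
  by (rule test_funs_far[of g \<Omega>]) (auto intro!: sqint_cs test_funs_continuous)

lemma test_funs_bounded:
  fixes g :: "real^2 \<Rightarrow> 'b::real_normed_vector"
  assumes "g \<in> test_funs \<Omega>"
  obtains B where "0 \<le> B" "\<And>x. norm (g x) \<le> B"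
proof -
  obtain K where K: "compact K" "K \<subseteq> \<Omega>" "\<And>x. x \<notin> K \<Longrightarrow> g x = 0"
    using test_funsE[OF assms] by metis
  have "bounded (g ` K)"
    using K by (intro compact_imp_bounded compact_continuous_image test_funs_continuous[OF assms])
  then obtain B where B: "\<And>x. x \<in> K \<Longrightarrow> norm (g x) \<le> B" by (auto simp: bounded_iff)
  have "norm (g x) \<le> max 0 B" for x
    using B[of x] K(3)[of x] by (cases "x \<in> K") (auto simp: le_max_iff_disj)
  then show ?thesis by (intro that[of "max 0 B"]) auto
qed

lemma test_funs_add: "f \<in> test_funs \<Omega> \<Longrightarrow> g \<in> test_funs \<Omega> \<Longrightarrow> (\<lambda>x. f x + g x) \<in> test_funs \<Omega>"
proof -
  assume fg: "f \<in> test_funs \<Omega>" "g \<in> test_funs \<Omega>"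
  obtain K where K: "compact K" "K \<subseteq> \<Omega>" "\<And>x. x \<notin> K \<Longrightarrow> f x = 0" using test_funsE[OF fg(1)] by metis
  obtain L where L: "compact L" "L \<subseteq> \<Omega>" "\<And>x. x \<notin> L \<Longrightarrow> g x = 0" using test_funsE[OF fg(2)] by metis
  show ?thesis using K L
    by (intro test_funsI[where K="K \<union> L"] Ck_add test_funs_Ck[OF fg(1)] test_funs_Ck[OF fg(2)]) auto
qed

lemma test_funs_linear:
  assumes "bounded_linear L" "f \<in> test_funs \<Omega>" shows "(\<lambda>x. L (f x)) \<in> test_funs \<Omega>"
proof -
  obtain K where K: "compact K" "K \<subseteq> \<Omega>" "\<And>x. x \<notin> K \<Longrightarrow> f x = 0" using test_funsE[OF assms(2)] by metis
  have "L 0 = 0" using assms(1) by (simp add: bounded_linear.linear linear_0)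
  with K show ?thesis
    by (intro test_funsI[where K=K] Ck_linear[OF assms(1)] test_funs_Ck[OF assms(2)]) auto
qed

lemmas test_funs_scaleR = test_funs_linear[OF bounded_linear_scaleR_right]
lemmas test_funs_nth = test_funs_linear[OF bounded_linear_vec_nth]

lemma test_funs_mult:
  fixes f g :: "real^2 \<Rightarrow> real"
  assumes "f \<in> test_funs \<Omega>" "\<And>k. Ck k g" shows "(\<lambda>x. f x * g x) \<in> test_funs \<Omega>"
proof -
  obtain K where K: "compact K" "K \<subseteq> \<Omega>" "\<And>x. x \<notin> K \<Longrightarrow> f x = 0" using test_funsE[OF assms(1)] by metis
  show ?thesis using K
    by (intro test_funsI[where K=K] Ck_mult test_funs_Ck[OF assms(1)] assms(2)) auto
qed

lemma test_funs_mono: "g \<in> test_funs \<Omega> \<Longrightarrow> \<Omega> \<subseteq> \<Omega>' \<Longrightarrow> g \<in> test_funs \<Omega>'"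
  by (auto simp: test_funs_def)

lemma grad_nth: "grad u x $ j $ i = partial_deriv i (\<lambda>y. u y $ j) x"
  by (simp add: grad_def)

lemma grad_add: "Ck (Suc 0) u \<Longrightarrow> Ck (Suc 0) v \<Longrightarrow> grad (\<lambda>x. u x + v x) x = grad u x + grad v x"
  by (simp add: vec_eq_iff grad_nth partial_deriv_add Ck_nth)

lemma grad_scaleR: "Ck (Suc 0) u \<Longrightarrow> grad (\<lambda>x. c *\<^sub>R u x) x = c *\<^sub>R grad u x"
  using partial_deriv_cmult[OF Ck_nth, where c=c and x=x, of u] by (simp add: vec_eq_iff grad_nth)

lemma sol_test: "\<phi> \<in> test_funs_sol \<Omega> \<Longrightarrow> \<phi> \<in> test_funs \<Omega>"
  by (simp add: test_funs_sol_def)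

lemma sol_div: "\<phi> \<in> test_funs_sol \<Omega> \<Longrightarrow> (\<Sum>i\<in>UNIV. grad \<phi> x $ i $ i) = 0"
  by (simp add: test_funs_sol_def)

lemma sol_Ck: "\<phi> \<in> test_funs_sol \<Omega> \<Longrightarrow> Ck k \<phi>"
  by (intro test_funs_Ck sol_test)

lemma sol_add: "\<phi> \<in> test_funs_sol \<Omega> \<Longrightarrow> \<psi> \<in> test_funs_sol \<Omega> \<Longrightarrow> (\<lambda>x. \<phi> x + \<psi> x) \<in> test_funs_sol \<Omega>"
  using grad_add[OF sol_Ck sol_Ck, of \<phi> \<Omega> \<psi> \<Omega>]
  by (auto simp: test_funs_sol_def test_funs_add sum.distrib)

lemma sol_scaleR: "\<phi> \<in> test_funs_sol \<Omega> \<Longrightarrow> (\<lambda>x. c *\<^sub>R \<phi> x) \<in> test_funs_sol \<Omega>"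
  using grad_scaleR[OF sol_Ck, of \<phi> \<Omega> c]
  by (auto simp: test_funs_sol_def test_funs_scaleR sum_distrib_left[symmetric])

lemma continuous_on_vec2I:
  fixes f :: "'a::topological_space \<Rightarrow> 'b::topological_space^2"
  assumes "\<And>i. continuous_on A (\<lambda>x. f x $ i)" shows "continuous_on A f"
  using continuous_on_vec_lambda[of A "\<lambda>i x. f x $ i"] assms by simp

lemma grad_continuous: "\<phi> \<in> test_funs \<Omega> \<Longrightarrow> continuous_on A (grad \<phi>)"
  by (intro continuous_on_vec2I) (auto simp: grad_nth intro!: test_funs_continuous test_funs_partial_deriv test_funs_nth)

lemma grad_zero_off:
  assumes "closed K" "\<And>x. x \<notin> K \<Longrightarrow> \<phi> x = 0" "x \<notin> K"
  shows "grad \<phi> x = 0"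
  using assms
  by (auto simp: vec_eq_iff grad_nth intro!: partial_deriv_zero_open[of "- K"])

lemma grad_far:
  assumes "\<And>x. R < norm x \<Longrightarrow> \<phi> x = 0" "R < norm x"
  shows "grad \<phi> x = 0"
  using assms by (intro grad_zero_off[of "cball 0 R"]) auto

lemma grad_zero: "\<phi> \<in> test_funs \<Omega> \<Longrightarrow> x \<notin> \<Omega> \<Longrightarrow> grad \<phi> x = 0"
  by (auto simp: vec_eq_iff grad_nth intro!: test_funs_zero[of _ \<Omega>] test_funs_partial_deriv test_funs_nth)

lemma grad_sqint: "\<phi> \<in> test_funs \<Omega> \<Longrightarrow> sqint (grad \<phi>)"
  by (rule test_funs_far[of \<phi> \<Omega>]) (auto intro!: sqint_cs grad_continuous grad_far)

subsection \<open>The fundamental lemma of the calculus of variations\<close>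

text \<open>Sharpening \<open>bump_e\<close> by the factor \<open>Suc n\<close> makes these products
  converge to the indicator of the open box, with values in the unit interval, so that dominated
  convergence applies.\<close>

definition box_bump :: "real^2 \<Rightarrow> real^2 \<Rightarrow> nat \<Rightarrow> real^2 \<Rightarrow> real" where
  "box_bump a b n x = (bump_e (real (Suc n) * (x $ 1 - a $ 1)) * bump_e (real (Suc n) * (b $ 1 - x $ 1))) *
     (bump_e (real (Suc n) * (x $ 2 - a $ 2)) * bump_e (real (Suc n) * (b $ 2 - x $ 2)))"

lemma box_bump_Ck: "Ck k (box_bump a b n)"
proof -
  have "Ck k (\<lambda>x. bump_e (- (real (Suc n) * c) + real (Suc n) * x $ i))" for c i
    by (intro Ck_coord[of k "\<lambda>s. bump_e (- (real (Suc n) * c) + real (Suc n) * s)"] Ck_line_affine Ck_line_bump_e)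
  then have 1: "Ck k (\<lambda>x. bump_e (real (Suc n) * (x $ i - c)))" for c i
    by (simp add: algebra_simps)
  have "Ck k (\<lambda>x. bump_e (real (Suc n) * c + (- real (Suc n)) * x $ i))" for c i
    by (intro Ck_coord[of k "\<lambda>s. bump_e (real (Suc n) * c + (- real (Suc n)) * s)"] Ck_line_affine Ck_line_bump_e)
  then have 2: "Ck k (\<lambda>x. bump_e (real (Suc n) * (c - x $ i)))" for c i
    by (simp add: algebra_simps)
  show ?thesis unfolding box_bump_def[abs_def] by (intro Ck_mult 1 2)
qed

lemma box_bump_zero: "x \<notin> box a b \<Longrightarrow> box_bump a b n x = 0"
  by (auto simp: box_bump_def bump_e_bounds mem_box_cart forall_2 not_less mult_le_0_iff)

lemma box_bump_bounds: "0 \<le> box_bump a b n x" "box_bump a b n x \<le> 1"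
  unfolding box_bump_def by (auto intro!: mult_nonneg_nonneg mult_le_one bump_e_bounds)

lemma bump_e_tendsto: "0 < s \<Longrightarrow> (\<lambda>n. bump_e (real (Suc n) * s)) \<longlonglongrightarrow> 1"
proof -
  assume s: "0 < s"
  have "(\<lambda>n. exp (- ((1 / real (Suc n)) / s))) \<longlonglongrightarrow> exp (- (0 / s))"
    by (intro tendsto_intros LIMSEQ_inverse_real_of_nat[unfolded inverse_eq_divide]) (use s in auto)
  moreover have "bump_e (real (Suc n) * s) = exp (- ((1 / real (Suc n)) / s))" for n
    using s by (auto simp: bump_e_def zero_less_mult_iff)
  ultimately show ?thesis by simp
qed

lemma box_bump_tendsto: "(\<lambda>n. box_bump a b n x) \<longlonglongrightarrow> indicator (box a b) x"
proof (cases "x \<in> box a b")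
  case True
  then have "(\<lambda>n. box_bump a b n x) \<longlonglongrightarrow> (1 * 1) * (1 * 1)"
    unfolding box_bump_def by (intro tendsto_mult bump_e_tendsto) (auto simp: mem_box_cart forall_2)
  with True show ?thesis by simp
qed (simp add: box_bump_zero)

lemma box_bump_test: "cbox a b \<subseteq> \<Omega> \<Longrightarrow> box_bump a b n \<in> test_funs \<Omega>"
  using box_subset_cbox[of a b] by (intro test_funsI[where K="cbox a b"] box_bump_Ck box_bump_zero) auto

lemma integral_lebesgue_on:
  fixes f :: "real^2 \<Rightarrow> 'b::euclidean_space"
  assumes "S \<in> sets lebesgue"
  shows "(\<integral>x. f x \<partial>lebesgue_on S) = (\<integral>x. cutf S f x \<partial>lebesgue)"
  using assms by (simp add: integral_restrict_space cutf_def)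

lemma integrable_lebesgue_on:
  fixes f :: "real^2 \<Rightarrow> 'b::euclidean_space"
  assumes "S \<in> sets lebesgue"
  shows "integrable (lebesgue_on S) f \<longleftrightarrow> integrable lebesgue (cutf S f)"
  using assms by (simp add: integrable_restrict_space cutf_def[abs_def])

lemma AE_cbox_box: "AE x in (lebesgue :: (real^2) measure). x \<in> cbox a b \<longleftrightarrow> x \<in> box a b"
proof -
  have "negligible (cbox a b - box a b)" by (rule negligible_frontier_interval)
  then have "AE x in lebesgue. x \<notin> cbox a b - box a b"
    by (intro AE_not_in) (simp add: negligible_iff_null_sets)
  then show ?thesis by eventually_elim (use box_subset_cbox[of a b] in auto)
qed

text \<open>Testing with \<open>box_bump\<close> and passing to the limit shows that the extension
  of \<open>g\<close> by zero has integral 0 over every subbox. Lebesgue's differentiation theorem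
  for the squares with lower left corner x then gives the claim almost everywhere.\<close>

lemma fundamental_lemma_cbox:
  fixes g :: "real^2 \<Rightarrow> real"
  assumes K: "integrable (lebesgue_on (cbox p q)) g" "cbox p q \<subseteq> \<Omega>"
    and z: "\<And>\<psi>. \<psi> \<in> test_funs \<Omega> \<Longrightarrow> (\<integral>x. g x * \<psi> x \<partial>lebesgue_on \<Omega>) = 0" and \<Omega>: "\<Omega> \<in> sets lebesgue"
  shows "AE x in lebesgue. x \<in> cbox p q \<longrightarrow> g x = 0"
proof -
  define h where "h = cutf (cbox p q) g"
  have h: "integrable lebesgue h" using K by (simp add: h_def integrable_lebesgue_on)
  then have [measurable]: "h \<in> borel_measurable lebesgue" by auto
  have zero: "(\<integral>x. indicator (cbox a b) x *\<^sub>R h x \<partial>lebesgue) = 0" if ab: "cbox a b \<subseteq> cbox p q" for a b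
  proof -
    have m: "box_bump a b n \<in> borel_measurable lebesgue" for n
      using Ck_imp_continuous[OF box_bump_Ck[of 0 a b n]] by (rule borel_measurable_lebesgue_continuous)
    have "(\<lambda>n. \<integral>x. h x * box_bump a b n x \<partial>lebesgue) \<longlonglongrightarrow> (\<integral>x. h x * indicator (box a b) x \<partial>lebesgue)"
    proof (rule integral_dominated_convergence[where w="\<lambda>x. norm (h x)"])
      show "AE x in lebesgue. (\<lambda>n. h x * box_bump a b n x) \<longlonglongrightarrow> h x * indicator (box a b) x"
        by (intro AE_I2 tendsto_intros box_bump_tendsto)
      show "AE x in lebesgue. norm (h x * box_bump a b n x) \<le> norm (h x)" for n
        using box_bump_bounds[of a b n] by (auto simp: abs_mult intro!: AE_I2 mult_left_le)
      show "(\<lambda>x. h x * box_bump a b n x) \<in> borel_measurable lebesgue" for n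
        using m by measurable
      show "(\<lambda>x. h x * indicator (box a b) x) \<in> borel_measurable lebesgue"
        by (intro borel_measurable_times borel_measurable_indicator) auto
    qed (use h in auto)
    moreover have "(\<integral>x. h x * box_bump a b n x \<partial>lebesgue) = 0" for n
    proof -
      have eq: "cutf \<Omega> (\<lambda>x. g x * box_bump a b n x) x = h x * box_bump a b n x" for x
        using K(2) ab box_subset_cbox[of a b] box_bump_zero[of x a b n]
        by (cases "x \<in> box a b") (auto simp: h_def cutf_def indicator_def)
      have "0 = (\<integral>x. g x * box_bump a b n x \<partial>lebesgue_on \<Omega>)"
        using z[OF box_bump_test] K(2) ab by force
      also have "\<dots> = (\<integral>x. cutf \<Omega> (\<lambda>x. g x * box_bump a b n x) x \<partial>lebesgue)"
        using \<Omega> by (rule integral_lebesgue_on)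
      finally show ?thesis by (simp add: eq)
    qed
    ultimately have "(\<integral>x. h x * indicator (box a b) x \<partial>lebesgue) = 0"
      by (simp add: LIMSEQ_const_iff)
    moreover have "(\<integral>x. indicator (cbox a b) x *\<^sub>R h x \<partial>lebesgue) = (\<integral>x. h x * indicator (box a b) x \<partial>lebesgue)"
    proof (rule integral_cong_AE)
      show "AE x in lebesgue. indicator (cbox a b) x *\<^sub>R h x = h x * indicator (box a b) x"
        using AE_cbox_box[of a b] by eventually_elim (auto simp: indicator_def)
    qed (intro borel_measurable_times borel_measurable_scaleR borel_measurable_indicator; auto)+
    ultimately show ?thesis by simp
  qed
  have hi: "h integrable_on cbox a b" for a b
  proof -
    have "h absolutely_integrable_on UNIV" using h by (simp add: absolutely_integrable_on_def set_integrable_def)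
    then have "h absolutely_integrable_on cbox a b" by (rule absolutely_integrable_on_subcbox) auto
    then show ?thesis by (rule set_lebesgue_integral_eq_integral)
  qed
  obtain N where N: "negligible N" "\<And>x e. \<lbrakk>x \<notin> N; 0 < e\<rbrakk> \<Longrightarrow>
               \<exists>d>0. \<forall>t. 0 < t \<and> t < d \<longrightarrow>
                         norm (integral (cbox x (x + t *\<^sub>R One)) h /\<^sub>R t ^ DIM(real^2) - h x) < e"
    using integrable_ccontinuous_explicit[OF hi] by blast
  have One: "(One :: real^2) $ i = 1" for i
  proof -
    have "(\<Sum>b\<in>Basis. 1 *\<^sub>R b) \<bullet> axis i (1::real) = 1"
      by (rule inner_sum_left_Basis) (simp add: axis_in_Basis_iff)
    then show ?thesis by (simp add: cart_eq_inner_axis)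
  qed
  have hx: "h x = 0" if x: "x \<in> box p q" "x \<notin> N" for x
  proof (rule ccontr)
    assume "h x \<noteq> 0"
    then obtain d where d: "d > 0" "\<And>t. 0 < t \<Longrightarrow> t < d \<Longrightarrow> norm (integral (cbox x (x + t *\<^sub>R One)) h /\<^sub>R t ^ DIM(real^2) - h x) < norm (h x)"
      using N(2)[OF x(2), of "norm (h x)"] by auto
    \<comment> \<open>Small enough for the differentiation theorem and for the square at
      \<open>x\<close> to stay inside \<open>cbox p q\<close>; halving \<open>d\<close> makes the
      first inequality strict.\<close>
    define t where "t = min (d / 2) (min (q $ 1 - x $ 1) (q $ 2 - x $ 2))"
    have t: "0 < t" "t < d" "x $ 1 + t \<le> q $ 1" "x $ 2 + t \<le> q $ 2"
      using d x by (auto simp: t_def mem_box_cart forall_2)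
    have sub: "cbox x (x + t *\<^sub>R One) \<subseteq> cbox p q"
      using t x by (auto simp: mem_box_cart forall_2 One intro: order_trans less_imp_le simp del: sum_component)
    have "integral (cbox x (x + t *\<^sub>R One)) h = (\<integral>y. indicator (cbox x (x + t *\<^sub>R One)) y *\<^sub>R h y \<partial>lebesgue)"
    proof -
      have "h absolutely_integrable_on UNIV" using h by (simp add: absolutely_integrable_on_def set_integrable_def)
      then have "h absolutely_integrable_on (cbox x (x + t *\<^sub>R One))" by (rule absolutely_integrable_on_subcbox) auto
      from set_lebesgue_integral_eq_integral(2)[OF this] show ?thesis by (simp add: set_lebesgue_integral_def)
    qed
    then have "integral (cbox x (x + t *\<^sub>R One)) h = 0" using zero[OF sub] by simp
    with d(2)[OF t(1,2)] show False by simp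
  qed
  have "AE x in lebesgue. x \<notin> N" using N(1) by (intro AE_not_in) (simp add: negligible_iff_null_sets)
  then show ?thesis using AE_cbox_box[of p q]
  proof eventually_elim
    case (elim x)
    with hx[of x] show ?case by (auto simp: h_def cutf_def)
  qed
qed

lemma fundamental_lemma:
  fixes g :: "real^2 \<Rightarrow> real"
  assumes \<Omega>: "open \<Omega>" and g: "locally_integrable \<Omega> g"
    and z: "\<And>\<psi>. \<psi> \<in> test_funs \<Omega> \<Longrightarrow> (\<integral>x. g x * \<psi> x \<partial>lebesgue_on \<Omega>) = 0"
  shows "AE x in lebesgue. x \<in> \<Omega> \<longrightarrow> g x = 0"
proof -
  obtain D where D: "countable D" "D \<subseteq> Pow \<Omega>" "\<And>X. X \<in> D \<Longrightarrow> \<exists>a b. X = cbox a b" "\<Union>D = \<Omega>"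
    using open_countable_Union_open_cbox[OF \<Omega>] by metis
  have "AE x in lebesgue. \<forall>X\<in>D. x \<in> X \<longrightarrow> g x = 0"
  proof (subst AE_ball_countable[OF D(1)], rule ballI)
    fix X assume X: "X \<in> D"
    then obtain a b where ab: "X = cbox a b" using D by blast
    have sub: "cbox a b \<subseteq> \<Omega>" using X D ab by auto
    show "AE x in lebesgue. x \<in> X \<longrightarrow> g x = 0"
      unfolding ab
    proof (rule fundamental_lemma_cbox[OF _ sub z])
      show "integrable (lebesgue_on (cbox a b)) g" using g sub by (auto simp: locally_integrable_def)
      show "\<Omega> \<in> sets lebesgue" using \<Omega> by auto
    qed
  qed
  then show ?thesis
  proof eventually_elim
    case (elim x)
    with D(4) show ?case by blast
  qed
qed

subsection \<open>Limits of solenoidal test fields\<close>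

text \<open>The working form of \<open>hdot\<close>: a field and its gradient on the whole plane as
  limits of solenoidal test fields. Carrying \<open>G\<close> along makes the notion stable under
  sums and reflections without reference to the choice in \<open>weak_grad\<close>.\<close>

definition conv :: "(real^2) set \<Rightarrow> (nat \<Rightarrow> real^2 \<Rightarrow> real^2) \<Rightarrow> (real^2 \<Rightarrow> real^2) \<Rightarrow> (real^2 \<Rightarrow> real^2^2) \<Rightarrow> bool" where
  "conv \<Omega> \<phi> u G \<longleftrightarrow> (\<forall>n. \<phi> n \<in> test_funs_sol \<Omega>) \<and> sqint G \<and> u \<in> borel_measurable lebesgue \<and>
     (\<forall>n::nat. sqint (cutf (ball 0 (real n)) u)) \<and> (\<lambda>k. nrm (\<lambda>x. grad (\<phi> k) x - G x)) \<longlonglongrightarrow> 0 \<and>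
     (\<forall>n::nat. (\<lambda>k. nrm (cutf (ball 0 (real n)) (\<lambda>x. \<phi> k x - u x))) \<longlonglongrightarrow> 0)"

lemma convD:
  assumes "conv \<Omega> \<phi> u G"
  shows "\<phi> n \<in> test_funs_sol \<Omega>" "\<phi> n \<in> test_funs \<Omega>" "sqint G" "u \<in> borel_measurable lebesgue" "sqint (cutf (ball 0 (real m)) u)"
    "(\<lambda>k. nrm (\<lambda>x. grad (\<phi> k) x - G x)) \<longlonglongrightarrow> 0"
    "(\<lambda>k. nrm (cutf (ball 0 (real m)) (\<lambda>x. \<phi> k x - u x))) \<longlonglongrightarrow> 0"
    "sqint (grad (\<phi> n))" "sqint (\<lambda>x. grad (\<phi> n) x - G x)"
    "sqint (cutf (ball 0 (real m)) (\<phi> n))" "sqint (cutf (ball 0 (real m)) (\<lambda>x. \<phi> n x - u x))"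
proof -
  show *: "\<phi> n \<in> test_funs_sol \<Omega>" "sqint G" "u \<in> borel_measurable lebesgue" "sqint (cutf (ball 0 (real m)) u)"
    "(\<lambda>k. nrm (\<lambda>x. grad (\<phi> k) x - G x)) \<longlonglongrightarrow> 0"
    "(\<lambda>k. nrm (cutf (ball 0 (real m)) (\<lambda>x. \<phi> k x - u x))) \<longlonglongrightarrow> 0"
    using assms by (auto simp: conv_def)
  show t: "\<phi> n \<in> test_funs \<Omega>" using * by (simp add: sol_test)
  show g: "sqint (grad (\<phi> n))" by (rule grad_sqint[OF t])
  show "sqint (\<lambda>x. grad (\<phi> n) x - G x)" using g * by (intro sqint_diff)
  show c: "sqint (cutf (ball 0 (real m)) (\<phi> n))" by (intro sqint_cutf test_funs_sqint[OF t]) auto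
  show "sqint (cutf (ball 0 (real m)) (\<lambda>x. \<phi> n x - u x))"
    using sqint_diff[OF c *(4)] by (simp add: cutf_def[abs_def] scaleR_diff_right)
qed

lemma conv_cong_AE:
  assumes c: "conv \<Omega> \<phi> u G" and u: "AE x in lebesgue. u x = u' x" and G: "AE x in lebesgue. G x = G' x"
  shows "conv \<Omega> \<phi> u' G'"
proof -
  note d = convD[OF c]
  have m: "u' \<in> borel_measurable lebesgue" "G' \<in> borel_measurable lebesgue"
    using borel_measurable_AE[OF d(4) u] borel_measurable_AE[OF sqint_measurable[OF d(3)] G] by auto
  have sG: "sqint G'"
    using G by (intro sqint_dominated[OF d(3) m(2), of 1]) (auto elim: eventually_mono)
  have mc: "cutf (ball 0 r) f \<in> borel_measurable lebesgue" if "f \<in> borel_measurable lebesgue" for r and f :: "real^2 \<Rightarrow> real^2"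
    using that by (intro measurable_cutf) auto
  have mp: "\<phi> k \<in> borel_measurable lebesgue" for k
    using d(2)[of k] by (intro borel_measurable_lebesgue_continuous test_funs_continuous)
  have su: "sqint (cutf (ball 0 (real n)) u')" for n
    using u by (intro sqint_dominated[OF d(5)[of n] mc[OF m(1)], where C=1]) (auto elim!: eventually_mono simp: cutf_def)
  have "nrm (\<lambda>x. grad (\<phi> k) x - G' x) = nrm (\<lambda>x. grad (\<phi> k) x - G x)" for k
    using G sqint_measurable[OF d(9)] sqint_measurable[OF sqint_diff[OF d(8) sG]]
    by (intro nrm_cong_AE) (auto elim: eventually_mono)
  moreover have "nrm (cutf (ball 0 (real n)) (\<lambda>x. \<phi> k x - u' x)) = nrm (cutf (ball 0 (real n)) (\<lambda>x. \<phi> k x - u x))" for k n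
    using u mp d(4) m(1) by (intro nrm_cong_AE mc borel_measurable_diff) (auto elim!: eventually_mono simp: cutf_def)
  ultimately show ?thesis using d m sG su by (simp add: conv_def)
qed

lemma conv_add:
  assumes c: "conv \<Omega> \<phi> u G" and c': "conv \<Omega> \<psi> v H"
  shows "conv \<Omega> (\<lambda>n x. \<phi> n x + \<psi> n x) (\<lambda>x. u x + v x) (\<lambda>x. G x + H x)"
  unfolding conv_def
proof (intro conjI allI)
  note d = convD[OF c] and d' = convD[OF c']
  show "(\<lambda>x. \<phi> n x + \<psi> n x) \<in> test_funs_sol \<Omega>" for n using d d' by (intro sol_add)
  show "sqint (\<lambda>x. G x + H x)" using d d' by (intro sqint_add)
  show "(\<lambda>x. u x + v x) \<in> borel_measurable lebesgue" using d(4) d'(4) by measurable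
  show "sqint (cutf (ball 0 (real n)) (\<lambda>x. u x + v x))" for n
    using sqint_add[OF d(5) d'(5), of n n] by (simp add: cutf_def[abs_def] scaleR_add_right)
  have g: "grad (\<lambda>x. \<phi> k x + \<psi> k x) x = grad (\<phi> k) x + grad (\<psi> k) x" for k x
    using d d' by (intro grad_add sol_Ck)
  show "(\<lambda>k. nrm (\<lambda>x. grad (\<lambda>x. \<phi> k x + \<psi> k x) x - (G x + H x))) \<longlonglongrightarrow> 0"
  proof (rule Lim_null_comparison[OF always_eventually])
    show "\<forall>k. norm (nrm (\<lambda>x. grad (\<lambda>x. \<phi> k x + \<psi> k x) x - (G x + H x))) \<le>
        nrm (\<lambda>x. grad (\<phi> k) x - G x) + nrm (\<lambda>x. grad (\<psi> k) x - H x)"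
      using nrm_triangle[OF d(9) d'(9)] by (simp add: g algebra_simps)
    show "(\<lambda>k. nrm (\<lambda>x. grad (\<phi> k) x - G x) + nrm (\<lambda>x. grad (\<psi> k) x - H x)) \<longlonglongrightarrow> 0"
      using tendsto_add[OF d(6) d'(6)] by simp
  qed
  show "(\<lambda>k. nrm (cutf (ball 0 (real n)) (\<lambda>x. \<phi> k x + \<psi> k x - (u x + v x)))) \<longlonglongrightarrow> 0" for n
  proof (rule Lim_null_comparison[OF always_eventually])
    show "\<forall>k. norm (nrm (cutf (ball 0 (real n)) (\<lambda>x. \<phi> k x + \<psi> k x - (u x + v x)))) \<le>
        nrm (cutf (ball 0 (real n)) (\<lambda>x. \<phi> k x - u x)) + nrm (cutf (ball 0 (real n)) (\<lambda>x. \<psi> k x - v x))"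
    proof
      fix k
      have "cutf (ball 0 (real n)) (\<lambda>x. \<phi> k x + \<psi> k x - (u x + v x)) =
          (\<lambda>x. cutf (ball 0 (real n)) (\<lambda>x. \<phi> k x - u x) x + cutf (ball 0 (real n)) (\<lambda>x. \<psi> k x - v x) x)"
        by (simp add: fun_eq_iff cutf_def algebra_simps)
      then show "norm (nrm (cutf (ball 0 (real n)) (\<lambda>x. \<phi> k x + \<psi> k x - (u x + v x)))) \<le>
          nrm (cutf (ball 0 (real n)) (\<lambda>x. \<phi> k x - u x)) + nrm (cutf (ball 0 (real n)) (\<lambda>x. \<psi> k x - v x))"
        using nrm_triangle[OF d(11) d'(11)] by simp
    qed
    show "(\<lambda>k. nrm (cutf (ball 0 (real n)) (\<lambda>x. \<phi> k x - u x)) + nrm (cutf (ball 0 (real n)) (\<lambda>x. \<psi> k x - v x))) \<longlonglongrightarrow> 0"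
      using tendsto_add[OF d(7) d'(7)] by simp
  qed
qed

lemma conv_scaleR:
  assumes c: "conv \<Omega> \<phi> u G"
  shows "conv \<Omega> (\<lambda>n x. a *\<^sub>R \<phi> n x) (\<lambda>x. a *\<^sub>R u x) (\<lambda>x. a *\<^sub>R G x)"
  unfolding conv_def
proof (intro conjI allI)
  note d = convD[OF c]
  show "(\<lambda>x. a *\<^sub>R \<phi> n x) \<in> test_funs_sol \<Omega>" for n using d by (intro sol_scaleR)
  show "sqint (\<lambda>x. a *\<^sub>R G x)" using d by (intro sqint_scaleR)
  show "(\<lambda>x. a *\<^sub>R u x) \<in> borel_measurable lebesgue" using d(4) by measurable
  show "sqint (cutf (ball 0 (real n)) (\<lambda>x. a *\<^sub>R u x))" for n
    using sqint_scaleR[OF d(5), of a n] by (simp add: cutf_def[abs_def] mult.commute)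
  have g: "grad (\<lambda>x. a *\<^sub>R \<phi> k x) x = a *\<^sub>R grad (\<phi> k) x" for k x
    using d by (intro grad_scaleR sol_Ck)
  have "nrm (\<lambda>x. grad (\<lambda>x. a *\<^sub>R \<phi> k x) x - a *\<^sub>R G x) = \<bar>a\<bar> * nrm (\<lambda>x. grad (\<phi> k) x - G x)" for k
    by (simp add: g scaleR_diff_right[symmetric] nrm_scaleR)
  then show "(\<lambda>k. nrm (\<lambda>x. grad (\<lambda>x. a *\<^sub>R \<phi> k x) x - a *\<^sub>R G x)) \<longlonglongrightarrow> 0"
    using tendsto_mult_left[OF d(6), of "\<bar>a\<bar>"] by simp
  have "cutf (ball 0 (real n)) (\<lambda>x. a *\<^sub>R \<phi> k x - a *\<^sub>R u x) = (\<lambda>x. a *\<^sub>R cutf (ball 0 (real n)) (\<lambda>x. \<phi> k x - u x) x)" for k n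
    by (simp add: fun_eq_iff cutf_def algebra_simps)
  then show "(\<lambda>k. nrm (cutf (ball 0 (real n)) (\<lambda>x. a *\<^sub>R \<phi> k x - a *\<^sub>R u x))) \<longlonglongrightarrow> 0" for n
    using tendsto_mult_left[OF d(7), of "\<bar>a\<bar>" n] by (simp add: nrm_scaleR)
qed

lemma conv_diff:
  assumes c: "conv \<Omega> \<phi> u G" and c': "conv \<Omega> \<psi> v H"
  shows "conv \<Omega> (\<lambda>n x. \<phi> n x - \<psi> n x) (\<lambda>x. u x - v x) (\<lambda>x. G x - H x)"
  using conv_add[OF c conv_scaleR[OF c', of "-1"]] by simp

text \<open>Subtracting a convergent sequence from a constant one puts the approximation error
  itself into the class \<open>conv\<close>.\<close>

lemma conv_const: "\<phi> \<in> test_funs_sol \<Omega> \<Longrightarrow> conv \<Omega> (\<lambda>_. \<phi>) \<phi> (grad \<phi>)"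
proof -
  assume p: "\<phi> \<in> test_funs_sol \<Omega>"
  note t = sol_test[OF p]
  have "cutf A (\<lambda>x. 0 :: real^2) = (\<lambda>x. 0)" for A by (simp add: cutf_def[abs_def])
  then show ?thesis using p
    by (auto simp: conv_def intro!: grad_sqint[OF t] sqint_cutf test_funs_sqint[OF t] sqint_measurable[OF test_funs_sqint[OF t]])
qed

lemma cs_in_ball:
  assumes "\<And>x. R < norm x \<Longrightarrow> f x = 0"
  shows "\<exists>m::nat. \<forall>x. x \<notin> ball 0 (real m) \<longrightarrow> f x = 0"
proof -
  obtain m :: nat where m: "R < real m" using reals_Archimedean2 by blast
  show ?thesis by (rule exI[of _ m]) (use m in \<open>auto simp: not_less intro!: assms\<close>)
qed

lemma integral_by_parts:
  fixes f g :: "real^2 \<Rightarrow> real"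
  assumes f: "f \<in> test_funs \<Omega>" and g: "\<And>k. Ck k g"
  shows "(\<integral>x. f x * partial_deriv i g x \<partial>lebesgue) = - (\<integral>x. partial_deriv i f x * g x \<partial>lebesgue)"
proof -
  obtain R where R: "\<And>x. R < norm x \<Longrightarrow> f x = 0" using test_funs_far[OF f] by metis
  note cf = test_funs_continuous[OF f] and cf' = test_funs_continuous[OF test_funs_partial_deriv[OF f]]
  note cg = Ck_imp_continuous[OF g] and cg' = continuous_partial_deriv[OF g]
  have c: "continuous_on UNIV (\<lambda>x. f x * partial_deriv i g x)" "continuous_on UNIV (\<lambda>x. partial_deriv i f x * g x)"
    using cf cf' cg cg' by (auto intro!: continuous_intros)
  have i: "integrable lborel (\<lambda>x. f x * partial_deriv i g x)" "integrable lborel (\<lambda>x. partial_deriv i f x * g x)"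
    using integrable_cs[OF c(1), of R] integrable_cs[OF c(2), of R] R partial_deriv_zero_far[OF R] by auto
  have "0 = (\<integral>x. partial_deriv i (\<lambda>x. f x * g x) x \<partial>lborel)"
    using R by (intro integral_partial_deriv_zero[symmetric, where R=R] Ck_mult test_funs_Ck[OF f] g) auto
  also have "\<dots> = (\<integral>x. f x * partial_deriv i g x + partial_deriv i f x * g x \<partial>lborel)"
    using partial_deriv_mult[OF test_funs_Ck[OF f] g] by simp
  also have "\<dots> = (\<integral>x. f x * partial_deriv i g x \<partial>lborel) + (\<integral>x. partial_deriv i f x * g x \<partial>lborel)"
    using i by simp
  finally show ?thesis using c by (simp add: integral_lebesgue_continuous)
qed

text \<open>The test function need not be supported in \<Omega>: the approximating fields vanish
  near the boundary, so integration by parts produces no boundary term and \<open>G\<close> is the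
  weak gradient of \<open>u\<close> on the whole plane.\<close>

lemma conv_weak:
  assumes c: "conv \<Omega> \<phi> u G" and \<psi>: "\<psi> \<in> test_funs UNIV"
  shows "(\<integral>x. G x $ j $ i * \<psi> x \<partial>lebesgue) = - (\<integral>x. u x $ j * partial_deriv i \<psi> x \<partial>lebesgue)"
proof -
  note d = convD[OF c]
  obtain R where R: "\<And>x. R < norm x \<Longrightarrow> \<psi> x = 0" using test_funs_far[OF \<psi>] by metis
  obtain m :: nat where m: "\<forall>x. x \<notin> ball 0 (real m) \<longrightarrow> partial_deriv i \<psi> x = 0"
    using cs_in_ball[of R "partial_deriv i \<psi>", OF partial_deriv_zero_far[of R, OF R]] by blast
  have B1: "bounded_bilinear (\<lambda>(M::real^2^2) (r::real). M $ j $ i * r)"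
    using bounded_bilinear.comp1[OF bounded_bilinear_mult bounded_linear_compose[OF bounded_linear_vec_nth bounded_linear_vec_nth]] .
  have B2: "bounded_bilinear (\<lambda>(M::real^2) (r::real). M $ j * r)"
    using bounded_bilinear.comp1[OF bounded_bilinear_mult bounded_linear_vec_nth] .
  have s: "sqint \<psi>" "sqint (partial_deriv i \<psi>)"
    by (auto intro!: test_funs_sqint[of _ UNIV] test_funs_partial_deriv \<psi>)
  have l1: "(\<lambda>k. \<integral>x. grad (\<phi> k) x $ j $ i * \<psi> x \<partial>lebesgue) \<longlonglongrightarrow> (\<integral>x. G x $ j $ i * \<psi> x \<partial>lebesgue)"
    using integral_bilinear_tendsto[OF B1 d(8) d(3) d(6) s(1) s(1)] by simp
  have l2: "(\<lambda>k. \<integral>x. cutf (ball 0 (real m)) (\<phi> k) x $ j * partial_deriv i \<psi> x \<partial>lebesgue)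
      \<longlonglongrightarrow> (\<integral>x. cutf (ball 0 (real m)) u x $ j * partial_deriv i \<psi> x \<partial>lebesgue)"
  proof -
    have "(\<lambda>k. nrm (\<lambda>x. cutf (ball 0 (real m)) (\<phi> k) x - cutf (ball 0 (real m)) u x)) \<longlonglongrightarrow> 0"
      using d(7)[of m] by (simp add: cutf_def[abs_def] scaleR_diff_right)
    from integral_bilinear_tendsto[OF B2 d(10) d(5) this s(2) s(2)] show ?thesis by simp
  qed
  have "(\<integral>x. grad (\<phi> k) x $ j $ i * \<psi> x \<partial>lebesgue) = - (\<integral>x. cutf (ball 0 (real m)) (\<phi> k) x $ j * partial_deriv i \<psi> x \<partial>lebesgue)" for k
  proof -
    have "(\<integral>x. \<phi> k x $ j * partial_deriv i \<psi> x \<partial>lebesgue) = - (\<integral>x. partial_deriv i (\<lambda>x. \<phi> k x $ j) x * \<psi> x \<partial>lebesgue)"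
      using d(2)[of k] test_funs_Ck[OF \<psi>] by (intro integral_by_parts[where \<Omega>=\<Omega>] test_funs_nth)
    moreover have "(\<integral>x. cutf (ball 0 (real m)) (\<phi> k) x $ j * partial_deriv i \<psi> x \<partial>lebesgue) = (\<integral>x. \<phi> k x $ j * partial_deriv i \<psi> x \<partial>lebesgue)"
      using m by (intro Bochner_Integration.integral_cong) (auto simp: cutf_def indicator_def)
    ultimately show ?thesis by (simp add: grad_nth)
  qed
  then have "(\<lambda>k. - (\<integral>x. cutf (ball 0 (real m)) (\<phi> k) x $ j * partial_deriv i \<psi> x \<partial>lebesgue)) \<longlonglongrightarrow> (\<integral>x. G x $ j $ i * \<psi> x \<partial>lebesgue)"
    using l1 by simp
  from LIMSEQ_unique[OF this tendsto_minus[OF l2]]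
  have "(\<integral>x. G x $ j $ i * \<psi> x \<partial>lebesgue) = - (\<integral>x. cutf (ball 0 (real m)) u x $ j * partial_deriv i \<psi> x \<partial>lebesgue)" .
  also have "(\<integral>x. cutf (ball 0 (real m)) u x $ j * partial_deriv i \<psi> x \<partial>lebesgue) = (\<integral>x. u x $ j * partial_deriv i \<psi> x \<partial>lebesgue)"
    using m by (intro Bochner_Integration.integral_cong) (auto simp: cutf_def indicator_def)
  finally show ?thesis .
qed

lemma sqint_locally_integrable:
  fixes g :: "real^2 \<Rightarrow> 'b::euclidean_space"
  assumes "sqint g" shows "locally_integrable A g"
  unfolding locally_integrable_def
proof (intro allI impI, elim conjE)
  fix K :: "(real^2) set" assume K: "compact K"
  then have Ks: "K \<in> sets lebesgue" by (intro lmeasurable_compact fmeasurableD)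
  have ind: "sqint (indicator K :: real^2 \<Rightarrow> real)"
  proof -
    have "integrable lebesgue (indicator K :: real^2 \<Rightarrow> real)"
      using lmeasurable_compact[OF K] lmeasurable_iff_integrable by blast
    moreover have "(norm (indicator K x :: real))\<^sup>2 = indicator K x" for x by (simp add: indicator_def)
    ultimately show ?thesis unfolding sqint_def using Ks by (auto intro!: borel_measurable_indicator)
  qed
  have "integrable lebesgue (cutf K g)"
    using assms Ks by (intro sqint_product(1)[OF ind assms, of _ 1] measurable_cutf) (auto simp: cutf_def sqint_def)
  then show "integrable (lebesgue_on K) g" by (simp add: integrable_lebesgue_on Ks)
qed

lemma sqint_bounded_linear:
  fixes L :: "'a::euclidean_space \<Rightarrow> 'b::euclidean_space"
  assumes L: "bounded_linear L" and f: "sqint f" shows "sqint (\<lambda>x. L (f x))"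
proof -
  obtain K where K: "0 < K" "\<And>x. norm (L x) \<le> norm x * K" using bounded_linear.pos_bounded[OF L] by blast
  have "L \<in> borel_measurable borel"
    by (intro borel_measurable_continuous_onI bounded_linear.continuous_on[OF L] continuous_intros)
  then have "(\<lambda>x. L (f x)) \<in> borel_measurable lebesgue"
    using sqint_measurable[OF f] by (rule measurable_compose[rotated])
  then show ?thesis using K(2) by (intro sqint_dominated[OF f, of _ K] AE_I2) (auto simp: mult.commute)
qed

lemmas sqint_nth = sqint_bounded_linear[OF bounded_linear_vec_nth]

lemma nrm_nth_le: "sqint f \<Longrightarrow> nrm (\<lambda>x. f x $ i) \<le> nrm f"
  for f :: "real^2 \<Rightarrow> 'b::euclidean_space^2"
  using nrm_dominated[of f "\<lambda>x. f x $ i" 1] sqint_measurable[OF sqint_nth[of f i]]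
  by (simp add: Finite_Cartesian_Product.norm_nth_le)

lemma fundamental_lemma_sqint:
  fixes g :: "real^2 \<Rightarrow> real"
  assumes "sqint g" "\<And>\<psi>. \<psi> \<in> test_funs UNIV \<Longrightarrow> (\<integral>x. g x * \<psi> x \<partial>lebesgue) = 0"
  shows "AE x in lebesgue. g x = 0"
proof -
  have "AE x in lebesgue. x \<in> UNIV \<longrightarrow> g x = 0"
    by (rule fundamental_lemma[OF open_UNIV sqint_locally_integrable[OF assms(1)]])
      (simp add: integral_lebesgue_on cutf_def assms(2))
  then show ?thesis by simp
qed

text \<open>Both gradients satisfy the same weak identity, so the fundamental lemma applies to the
  difference. It ensures that changing the approximating sequence does not change the
  gradient.\<close>

lemma conv_unique:
  assumes c: "conv \<Omega> \<phi> u G" and c': "conv \<Omega> \<psi> u H"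
  shows "AE x in lebesgue. G x = H x"
proof -
  note d = convD[OF c] and d' = convD[OF c']
  have "AE x in lebesgue. G x $ j $ i - H x $ j $ i = 0" for j i
  proof (rule fundamental_lemma_sqint)
    have n: "sqint (\<lambda>x. G x $ j $ i)" "sqint (\<lambda>x. H x $ j $ i)"
      using sqint_nth[OF sqint_nth[OF d(3)]] sqint_nth[OF sqint_nth[OF d'(3)]] .
    then show "sqint (\<lambda>x. G x $ j $ i - H x $ j $ i)" by (rule sqint_diff)
    fix \<psi> :: "real^2 \<Rightarrow> real" assume \<psi>: "\<psi> \<in> test_funs UNIV"
    have "integrable lebesgue (\<lambda>x. G x $ j $ i * \<psi> x)" "integrable lebesgue (\<lambda>x. H x $ j $ i * \<psi> x)"
      using sqint_product(1)[OF n(1) test_funs_sqint[OF \<psi>], of "\<lambda>x. G x $ j $ i * \<psi> x" 1]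
        sqint_product(1)[OF n(2) test_funs_sqint[OF \<psi>], of "\<lambda>x. H x $ j $ i * \<psi> x" 1]
        n[THEN sqint_measurable] sqint_measurable[OF test_funs_sqint[OF \<psi>]]
      by (auto simp: abs_mult)
    then show "(\<integral>x. (G x $ j $ i - H x $ j $ i) * \<psi> x \<partial>lebesgue) = 0"
      by (simp add: left_diff_distrib conv_weak[OF c \<psi>] conv_weak[OF c' \<psi>])
  qed
  then have "AE x in lebesgue. \<forall>j i. G x $ j $ i - H x $ j $ i = 0"
    by (simp add: AE_all_countable)
  then show ?thesis by eventually_elim (simp add: vec_eq_iff)
qed

section \<open>Symmetry\<close>

text \<open>A reflection is a diagonal linear map with entries 1 and -1, so the determinant factor
  in the transformation formula is 1 in absolute value.\<close>

lemma flip_lebesgue: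
  "flip i \<in> lebesgue \<rightarrow>\<^sub>M lebesgue" "distr lebesgue lebesgue (flip i) = lebesgue"
proof -
  define c :: "real^2 \<Rightarrow> real" where "c j = (if j = axis i 1 then - 1 else 1)" for j
  have c: "c j \<noteq> 0" for j by (simp add: c_def)
  have T: "(\<lambda>x. 0 + (\<Sum>j\<in>Basis. (c j * (x \<bullet> j)) *\<^sub>R j)) = flip i"
  proof
    fix x
    have "((\<Sum>j\<in>Basis. (c j * (x \<bullet> j)) *\<^sub>R j)) \<bullet> b = flip i x \<bullet> b" if b: "b \<in> Basis" for b
    proof -
      obtain k where k: "b = axis k 1" using b by (auto simp: Basis_vec_def)
      have "((\<Sum>j\<in>Basis. (c j * (x \<bullet> j)) *\<^sub>R j)) \<bullet> b = c b * (x \<bullet> b)"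
        using b by (rule inner_sum_left_Basis)
      then show ?thesis by (simp add: k c_def inner_axis flip_nth axis_eq_axis)
    qed
    then show "0 + (\<Sum>j\<in>Basis. (c j * (x \<bullet> j)) *\<^sub>R j) = flip i x"
      by (simp add: euclidean_eq_iff[where 'a="real^2"])
  qed
  show "flip i \<in> lebesgue \<rightarrow>\<^sub>M lebesgue"
    using lebesgue_affine_measurable[of c 0] c unfolding T by simp
  have "lebesgue = density (distr lebesgue lebesgue (flip i)) (\<lambda>_. (\<Prod>j\<in>Basis. \<bar>c j\<bar>))"
    using lebesgue_affine_euclidean[of c 0] c unfolding T by simp
  moreover have "(\<Prod>j\<in>Basis. \<bar>c j\<bar>) = 1" by (intro prod.neutral) (simp add: c_def)
  ultimately show "distr lebesgue lebesgue (flip i) = lebesgue" by (simp add: density_1)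
qed

lemma AE_flip:
  assumes "AE x in lebesgue. P x" shows "AE x in lebesgue. P (flip i x)"
proof -
  have "AE x in distr lebesgue lebesgue (flip i). P x" using assms by (simp only: flip_lebesgue(2))
  then show ?thesis by (rule AE_distrD[OF flip_lebesgue(1)])
qed

lemma measurable_flip: "f \<in> borel_measurable lebesgue \<Longrightarrow> (\<lambda>x. f (flip i x)) \<in> borel_measurable lebesgue"
  by (rule measurable_compose[OF flip_lebesgue(1)])

lemma integral_flip:
  fixes f :: "real^2 \<Rightarrow> real"
  assumes "f \<in> borel_measurable lebesgue"
  shows "(\<integral>x. f (flip i x) \<partial>lebesgue) = (\<integral>x. f x \<partial>lebesgue)"
  using integral_distr[OF flip_lebesgue(1)[of i] assms] by (simp add: flip_lebesgue)

lemma nrm_flip: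
  "f \<in> borel_measurable lebesgue \<Longrightarrow> nrm (\<lambda>x. f (flip i x)) = nrm f"
  unfolding nrm_def by (subst integral_flip[of "\<lambda>x. (norm (f x))\<^sup>2"]) auto

lemma sqint_flip:
  assumes "sqint f" shows "sqint (\<lambda>x. f (flip i x))"
proof -
  have "integrable (distr lebesgue lebesgue (flip i)) (\<lambda>x. (norm (f x))\<^sup>2)"
    using assms by (simp add: flip_lebesgue sqint_def)
  then have "integrable lebesgue (\<lambda>x. (norm (f (flip i x)))\<^sup>2)"
    by (rule integrable_distr[OF flip_lebesgue(1)])
  then show ?thesis using assms by (simp add: sqint_def measurable_flip)
qed

text \<open>Both the point and the vector are reflected. In this form the divergence is merely
  composed with the reflection.\<close>

definition refl_vf :: "2 \<Rightarrow> (real^2 \<Rightarrow> real^2) \<Rightarrow> real^2 \<Rightarrow> real^2" where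
  "refl_vf i u x = flip i (u (flip i x))"

text \<open>Conjugation by the diagonal matrix of the reflection, the way gradients transform under
  \<open>refl_vf\<close>; it keeps the diagonal and the norm.\<close>

definition flip_mat :: "2 \<Rightarrow> real^2^2 \<Rightarrow> real^2^2" where
  "flip_mat i M = (\<chi> j l. (if j = i then -1 else 1) * (if l = i then -1 else 1) * M $ j $ l)"

lemma flip_diff: "flip i x - flip i y = flip i (x - y)"
  by (simp add: vec_eq_iff flip_nth)

lemma flip_mat_diff: "flip_mat i x - flip_mat i y = flip_mat i (x - y)"
  by (simp add: vec_eq_iff flip_mat_def algebra_simps)

lemma norm_flip_mat: "norm (flip_mat i M) = norm M"
  unfolding norm_vec_def L2_set_def flip_mat_def
  by (simp add: sum_2 if_distrib power_mult_distrib cong: if_cong)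

lemma bounded_linear_flip_mat: "bounded_linear (flip_mat i)"
proof (rule bounded_linear_intro[where K=1])
  show "norm (flip_mat i M) \<le> norm M * 1" for M by (simp add: norm_flip_mat)
qed (auto simp: vec_eq_iff flip_mat_def algebra_simps)

lemma refl_vf_nth: "refl_vf i u x $ j = (if j = i then - u (flip i x) $ j else u (flip i x) $ j)"
  by (simp add: refl_vf_def flip_nth)

lemma refl_vf_commute: "refl_vf i (refl_vf j u) = refl_vf j (refl_vf i u)"
  by (auto simp: refl_vf_def fun_eq_iff flip_commute[of i j])

lemma refl_vf_refl_vf [simp]: "refl_vf i (refl_vf i u) = u"
  by (simp add: refl_vf_def fun_eq_iff)

lemma refl_vf_add: "refl_vf i (\<lambda>x. u x + v x) x = refl_vf i u x + refl_vf i v x"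
  by (auto simp: refl_vf_nth vec_eq_iff)

lemma refl_vf_scaleR: "refl_vf i (\<lambda>x. c *\<^sub>R u x) x = c *\<^sub>R refl_vf i u x"
  by (auto simp: refl_vf_nth vec_eq_iff)

lemma grad_refl:
  assumes "Ck (Suc 0) u"
  shows "grad (refl_vf i u) x = flip_mat i (grad u (flip i x))"
proof -
  have "partial_deriv l (\<lambda>y. refl_vf i u y $ j) x = (if j = i then -1 else 1) * (if l = i then -1 else 1) * partial_deriv l (\<lambda>y. u y $ j) (flip i x)" for j l
  proof -
    have "(\<lambda>y. refl_vf i u y $ j) = (\<lambda>y. (if j = i then -1 else 1) *\<^sub>R u (flip i y) $ j)"
      by (auto simp: refl_vf_nth)
    then have "partial_deriv l (\<lambda>y. refl_vf i u y $ j) x = (if j = i then -1 else 1) *\<^sub>R partial_deriv l (\<lambda>y. u (flip i y) $ j) x"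
      using partial_deriv_cmult[OF Ck_flip[OF Ck_nth[OF assms, of j], of i], of l] by metis
    also have "partial_deriv l (\<lambda>y. u (flip i y) $ j) x = (if l = i then -1 else 1) *\<^sub>R partial_deriv l (\<lambda>y. u y $ j) (flip i x)"
      by (rule partial_deriv_flip[OF Ck_nth[OF assms]])
    finally show ?thesis by simp
  qed
  then show ?thesis by (simp add: vec_eq_iff grad_nth flip_mat_def)
qed

text \<open>Each diagonal entry of the gradient is multiplied by the square of a sign, so zero
  divergence is preserved; the support moves to its mirror image.\<close>

lemma sol_refl:
  assumes \<Omega>: "\<And>x. x \<in> \<Omega> \<Longrightarrow> flip i x \<in> \<Omega>" and \<phi>: "\<phi> \<in> test_funs_sol \<Omega>"
  shows "refl_vf i \<phi> \<in> test_funs_sol \<Omega>"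
proof -
  obtain K where K: "compact K" "K \<subseteq> \<Omega>" "\<And>x. x \<notin> K \<Longrightarrow> \<phi> x = 0"
    using test_funsE[OF sol_test[OF \<phi>]] by metis
  have c: "compact (flip i ` K)"
    using K(1) by (intro compact_continuous_image bounded_linear.continuous_on[OF bounded_linear_flip] continuous_intros)
  have t: "refl_vf i \<phi> \<in> test_funs \<Omega>"
  proof (rule test_funsI[OF _ c])
    show "Ck k (refl_vf i \<phi>)" for k
      unfolding refl_vf_def[abs_def] by (intro Ck_linear[OF bounded_linear_flip] Ck_flip sol_Ck[OF \<phi>])
    show "flip i ` K \<subseteq> \<Omega>" using K(2) \<Omega> by auto
    show "refl_vf i \<phi> x = 0" if "x \<notin> flip i ` K" for x
    proof -
      have "flip i x \<notin> K" using that by (metis flip_flip image_eqI)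
      then show ?thesis using K(3) by (simp add: refl_vf_def vec_eq_iff flip_nth)
    qed
  qed
  have "(\<Sum>j\<in>UNIV. grad (refl_vf i \<phi>) x $ j $ j) = 0" for x
  proof -
    have "(\<Sum>j\<in>UNIV. grad (refl_vf i \<phi>) x $ j $ j) = (\<Sum>j\<in>UNIV. grad \<phi> (flip i x) $ j $ j)"
      by (intro sum.cong) (auto simp: grad_refl[OF sol_Ck[OF \<phi>]] flip_mat_def)
    then show ?thesis using sol_div[OF \<phi>] by simp
  qed
  with t show ?thesis by (simp add: test_funs_sol_def)
qed

lemma conv_refl:
  assumes \<Omega>: "\<And>x. x \<in> \<Omega> \<Longrightarrow> flip i x \<in> \<Omega>" and c: "conv \<Omega> \<phi> u G"
  shows "conv \<Omega> (\<lambda>n. refl_vf i (\<phi> n)) (refl_vf i u) (\<lambda>x. flip_mat i (G (flip i x)))"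
  unfolding conv_def
proof (intro conjI allI)
  note d = convD[OF c]
  show "refl_vf i (\<phi> n) \<in> test_funs_sol \<Omega>" for n using \<Omega> d(1) by (rule sol_refl)
  show "sqint (\<lambda>x. flip_mat i (G (flip i x)))"
    by (intro sqint_bounded_linear[OF bounded_linear_flip_mat] sqint_flip d(3))
  have bm: "flip i \<in> borel_measurable borel"
    by (intro borel_measurable_continuous_onI bounded_linear.continuous_on[OF bounded_linear_flip] continuous_intros)
  show "refl_vf i u \<in> borel_measurable lebesgue"
    unfolding refl_vf_def[abs_def] by (rule measurable_compose[OF measurable_flip[OF d(4)] bm])
  have ctf: "cutf (ball 0 r) (\<lambda>x. flip i (v (flip i x))) = (\<lambda>x. flip i (cutf (ball 0 r) v (flip i x)))" for r and v :: "real^2 \<Rightarrow> real^2"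
    by (simp add: fun_eq_iff cutf_def indicator_def vec_eq_iff flip_nth)
  show "sqint (cutf (ball 0 (real n)) (refl_vf i u))" for n
    unfolding refl_vf_def[abs_def] ctf
    by (intro sqint_bounded_linear[OF bounded_linear_flip] sqint_flip d(5))
  have "nrm (\<lambda>x. grad (refl_vf i (\<phi> k)) x - flip_mat i (G (flip i x))) = nrm (\<lambda>x. grad (\<phi> k) x - G x)" for k
  proof -
    have "nrm (\<lambda>x. grad (refl_vf i (\<phi> k)) x - flip_mat i (G (flip i x))) = nrm (\<lambda>x. grad (\<phi> k) (flip i x) - G (flip i x))"
      by (intro nrm_cong_norm) (simp add: grad_refl[OF sol_Ck[OF d(1)]] flip_mat_diff norm_flip_mat)
    also have "\<dots> = nrm (\<lambda>x. grad (\<phi> k) x - G x)"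
      using nrm_flip[OF sqint_measurable[OF d(9)]] .
    finally show ?thesis .
  qed
  then show "(\<lambda>k. nrm (\<lambda>x. grad (refl_vf i (\<phi> k)) x - flip_mat i (G (flip i x)))) \<longlonglongrightarrow> 0"
    using d(6) by simp
  have "nrm (cutf (ball 0 (real n)) (\<lambda>x. refl_vf i (\<phi> k) x - refl_vf i u x)) = nrm (cutf (ball 0 (real n)) (\<lambda>x. \<phi> k x - u x))" for k n
  proof -
    have "nrm (cutf (ball 0 (real n)) (\<lambda>x. refl_vf i (\<phi> k) x - refl_vf i u x)) = nrm (\<lambda>x. cutf (ball 0 (real n)) (\<lambda>x. \<phi> k x - u x) (flip i x))"
      unfolding refl_vf_def flip_diff ctf[of _ "\<lambda>x. \<phi> k x - u x"] by (intro nrm_cong_norm) simp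
    also have "\<dots> = nrm (cutf (ball 0 (real n)) (\<lambda>x. \<phi> k x - u x))"
      using nrm_flip[OF sqint_measurable[OF d(11)]] .
    finally show ?thesis .
  qed
  then show "(\<lambda>k. nrm (cutf (ball 0 (real n)) (\<lambda>x. refl_vf i (\<phi> k) x - refl_vf i u x))) \<longlonglongrightarrow> 0" for n
    using d(7) by simp
qed

subsection \<open>Hardy's inequality for antisymmetric fields\<close>

text \<open>The 1 added to the norm keeps the weight of Hardy's inequality bounded at the origin, so
  multiplication by it preserves square integrability.\<close>

definition wt :: "(real^2 \<Rightarrow> 'b::real_vector) \<Rightarrow> real^2 \<Rightarrow> 'b" where
  "wt f x = (1 / (1 + norm x)) *\<^sub>R f x"

lemma norm_wt: "norm (wt f x) = norm (f x) / (1 + norm x)"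
  by (simp add: wt_def)

lemma norm_wt_le: "norm (wt f x) \<le> norm (f x)"
  using divide_left_mono[of 1 "1 + norm x" "norm (f x)"] by (simp add: norm_wt add_pos_nonneg)

lemma one_plus_norm_neq_0: "1 + norm x \<noteq> 0"
  using norm_ge_zero[of x] by linarith

lemma measurable_wt:
  fixes f :: "real^2 \<Rightarrow> 'b::euclidean_space"
  assumes "f \<in> borel_measurable lebesgue" shows "wt f \<in> borel_measurable lebesgue"
proof -
  have "(\<lambda>x::real^2. 1 / (1 + norm x)) \<in> borel_measurable lebesgue"
    by (intro borel_measurable_lebesgue_continuous continuous_intros) (simp add: one_plus_norm_neq_0)
  then show ?thesis unfolding wt_def[abs_def] using assms by (rule borel_measurable_scaleR)
qed

lemma sqint_wt: "sqint f \<Longrightarrow> sqint (wt f)"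
  by (rule sqint_dominated[where C=1 and g=f]) (simp_all add: norm_wt_le measurable_wt sqint_measurable)

lemma hardy_scalar:
  fixes g :: "real^2 \<Rightarrow> real"
  assumes g: "g \<in> test_funs \<Omega>" and odd: "\<And>x. g (flip i x) = - g x"
  shows "nrm (wt g) \<le> 2 * nrm (partial_deriv i g)"
proof (rule nrm_leI)
  obtain R where R: "\<And>x. R < norm x \<Longrightarrow> g x = 0" using test_funs_far[OF g] by metis
  note cg = test_funs_continuous[OF g, of UNIV]
  note cp = test_funs_continuous[OF test_funs_partial_deriv[OF g], of UNIV]
  have "(\<integral>x. (norm (wt g x))\<^sup>2 \<partial>lebesgue) = (\<integral>x. (g x)\<^sup>2 / (1 + norm x)\<^sup>2 \<partial>lebesgue)"
    by (simp add: wt_def power_divide)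
  also have "\<dots> = (\<integral>x. (g x)\<^sup>2 / (1 + norm x)\<^sup>2 \<partial>lborel)"
    by (intro integral_lebesgue_continuous continuous_intros cg) (auto simp: one_plus_norm_neq_0)
  also have "\<dots> \<le> 4 * (\<integral>x. (partial_deriv i g x)\<^sup>2 \<partial>lborel)"
    by (rule hardy_plane[OF test_funs_Ck[OF g] R odd])
  also have "(\<integral>x. (partial_deriv i g x)\<^sup>2 \<partial>lborel) = (nrm (partial_deriv i g))\<^sup>2"
    by (simp add: nrm_sq, intro integral_lebesgue_continuous[symmetric] continuous_intros cp)
  finally show "(\<integral>x. (norm (wt g x))\<^sup>2 \<partial>lebesgue) \<le> (2 * nrm (partial_deriv i g))\<^sup>2"
    by (simp add: power_mult_distrib)
qed auto

text \<open>\<open>d j\<close> names the reflection under which component \<open>j\<close> is odd.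
  The identity is pointwise, for test fields; \<open>AE_odd\<close> is the version for
  limits.\<close>

definition odd_vf :: "(2 \<Rightarrow> 2) \<Rightarrow> (real^2 \<Rightarrow> real^2) \<Rightarrow> bool" where
  "odd_vf d u \<longleftrightarrow> (\<forall>j x. u (flip (d j) x) $ j = - u x $ j)"

lemma norm_vec_sq: "(norm (x :: 'b::euclidean_space^2))\<^sup>2 = (\<Sum>j\<in>UNIV. (norm (x $ j))\<^sup>2)"
  by (simp add: norm_vec_def L2_set_def sum_nonneg)

lemma nrm_vec_sq:
  fixes f :: "real^2 \<Rightarrow> 'b::euclidean_space^2"
  assumes "sqint f" shows "(nrm f)\<^sup>2 = (\<Sum>j\<in>UNIV. (nrm (\<lambda>x. f x $ j))\<^sup>2)"
proof -
  have "integrable lebesgue (\<lambda>x. (norm (f x $ j))\<^sup>2)" for j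
    using sqint_nth[OF assms] by (simp add: sqint_def)
  then show ?thesis by (simp add: nrm_sq norm_vec_sq)
qed

text \<open>Each component is treated in its own direction of oddness \<open>d j\<close>, using only
  one entry of the corresponding gradient row; the squares are then added.\<close>

lemma hardy_vector:
  assumes \<phi>: "\<phi> \<in> test_funs \<Omega>" and odd: "odd_vf d \<phi>"
  shows "nrm (wt \<phi>) \<le> 2 * nrm (grad \<phi>)"
proof (rule power2_le_imp_le)
  have s: "sqint (wt \<phi>)" "sqint (grad \<phi>)" by (auto intro: sqint_wt test_funs_sqint grad_sqint \<phi>)
  have "(nrm (wt \<phi>))\<^sup>2 = (\<Sum>j\<in>UNIV. (nrm (wt (\<lambda>x. \<phi> x $ j)))\<^sup>2)"
    using nrm_vec_sq[OF s(1)] by (simp add: wt_def[abs_def])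
  also have "\<dots> \<le> (\<Sum>j\<in>UNIV. 4 * (nrm (\<lambda>x. grad \<phi> x $ j))\<^sup>2)"
  proof (rule sum_mono)
    fix j
    have "nrm (wt (\<lambda>x. \<phi> x $ j)) \<le> 2 * nrm (partial_deriv (d j) (\<lambda>x. \<phi> x $ j))"
      using odd by (intro hardy_scalar[OF test_funs_nth[OF \<phi>]]) (simp add: odd_vf_def)
    also have "nrm (partial_deriv (d j) (\<lambda>x. \<phi> x $ j)) = nrm (\<lambda>x. grad \<phi> x $ j $ d j)"
      by (intro nrm_cong_norm) (simp add: grad_nth)
    also have "\<dots> \<le> nrm (\<lambda>x. grad \<phi> x $ j)"
      by (rule nrm_nth_le[OF sqint_nth[OF s(2)]])
    finally have "nrm (wt (\<lambda>x. \<phi> x $ j)) \<le> 2 * nrm (\<lambda>x. grad \<phi> x $ j)" by simp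
    then have "(nrm (wt (\<lambda>x. \<phi> x $ j)))\<^sup>2 \<le> (2 * nrm (\<lambda>x. grad \<phi> x $ j))\<^sup>2" by (intro power_mono) auto
    then show "(nrm (wt (\<lambda>x. \<phi> x $ j)))\<^sup>2 \<le> 4 * (nrm (\<lambda>x. grad \<phi> x $ j))\<^sup>2" by (simp add: power_mult_distrib)
  qed
  also have "\<dots> = (2 * nrm (grad \<phi>))\<^sup>2"
    by (simp add: nrm_vec_sq[OF s(2)] power_mult_distrib sum_distrib_left)
  finally show "(nrm (wt \<phi>))\<^sup>2 \<le> (2 * nrm (grad \<phi>))\<^sup>2" .
qed auto

lemma conv_wt_ball:
  assumes c: "conv \<Omega> \<phi> u G"
  shows "sqint (cutf (ball 0 (real n)) (wt u))"
    "(\<lambda>k. nrm (cutf (ball 0 (real n)) (wt (\<phi> k)))) \<longlonglongrightarrow> nrm (cutf (ball 0 (real n)) (wt u))"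
    "(\<lambda>k. nrm (\<lambda>x. cutf (ball 0 (real n)) (wt (\<phi> k)) x - cutf (ball 0 (real n)) (wt u) x)) \<longlonglongrightarrow> 0"
proof -
  note d = convD[OF c]
  have e: "cutf A (wt f) = wt (cutf A f)" for A and f :: "real^2 \<Rightarrow> real^2"
    by (simp add: fun_eq_iff cutf_def wt_def)
  show s: "sqint (cutf (ball 0 (real n)) (wt u))" unfolding e by (rule sqint_wt[OF d(5)])
  have s': "sqint (cutf (ball 0 (real n)) (wt (\<phi> k)))" for k unfolding e by (rule sqint_wt[OF d(10)])
  show l: "(\<lambda>k. nrm (\<lambda>x. cutf (ball 0 (real n)) (wt (\<phi> k)) x - cutf (ball 0 (real n)) (wt u) x)) \<longlonglongrightarrow> 0"
  proof (rule Lim_null_comparison[OF always_eventually d(7)[of n]], rule allI)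
    fix k
    have "norm (cutf (ball 0 (real n)) (wt (\<phi> k)) x - cutf (ball 0 (real n)) (wt u) x)
        \<le> 1 * norm (cutf (ball 0 (real n)) (\<lambda>x. \<phi> k x - u x) x)" for x
    proof -
      have "cutf (ball 0 (real n)) (wt (\<phi> k)) x - cutf (ball 0 (real n)) (wt u) x = wt (cutf (ball 0 (real n)) (\<lambda>x. \<phi> k x - u x)) x"
        by (simp add: cutf_def wt_def algebra_simps)
      then show ?thesis using norm_wt_le[of "cutf (ball 0 (real n)) (\<lambda>x. \<phi> k x - u x)" x] by (simp del: ball_trivial)
    qed
    then have "nrm (\<lambda>x. cutf (ball 0 (real n)) (wt (\<phi> k)) x - cutf (ball 0 (real n)) (wt u) x)
        \<le> 1 * nrm (cutf (ball 0 (real n)) (\<lambda>x. \<phi> k x - u x))"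
      using sqint_measurable[OF sqint_diff[OF s' s]] by (intro nrm_dominated[OF d(11)] AE_I2) auto
    then show "norm (nrm (\<lambda>x. cutf (ball 0 (real n)) (wt (\<phi> k)) x - cutf (ball 0 (real n)) (wt u) x))
        \<le> nrm (cutf (ball 0 (real n)) (\<lambda>x. \<phi> k x - u x))" by simp
  qed
  show "(\<lambda>k. nrm (cutf (ball 0 (real n)) (wt (\<phi> k)))) \<longlonglongrightarrow> nrm (cutf (ball 0 (real n)) (wt u))"
    by (rule nrm_tendsto[OF s' s l])
qed

text \<open>The estimate for test fields passes to the limit on each ball, where the fields
  converge, and \<open>sqint_if_balls_bounded\<close> removes the ball.\<close>

lemma hardy_conv:
  assumes c: "conv \<Omega> \<phi> u G" and odd: "\<And>n. odd_vf d (\<phi> n)"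
  shows "sqint (wt u)" and "nrm (wt u) \<le> 2 * nrm G"
proof -
  note d = convD[OF c]
  have b: "nrm (cutf (ball 0 (real n)) (wt u)) \<le> 2 * nrm G" for n
  proof (rule LIMSEQ_le[OF conv_wt_ball(2)[OF c]])
    show "(\<lambda>k. 2 * nrm (grad (\<phi> k))) \<longlonglongrightarrow> 2 * nrm G"
      by (intro tendsto_intros nrm_tendsto d)
    have "nrm (cutf (ball 0 (real n)) (wt (\<phi> k))) \<le> 2 * nrm (grad (\<phi> k))" for k
      using nrm_cutf_le[of "ball 0 (real n)" "wt (\<phi> k)"] hardy_vector[OF d(2) odd, of k]
        sqint_wt[OF test_funs_sqint[OF d(2)], of k] by (auto intro: order_trans)
    then show "\<exists>N. \<forall>k\<ge>N. nrm (cutf (ball 0 (real n)) (wt (\<phi> k))) \<le> 2 * nrm (grad (\<phi> k))" by blast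
  qed
  note r = sqint_if_balls_bounded[OF measurable_wt[OF d(4)] conv_wt_ball(1)[OF c] b]
  show "sqint (wt u)" "nrm (wt u) \<le> 2 * nrm G" by (rule r)+
qed

text \<open>Differences of fields with the same symmetry are again odd, so the weighted
  approximation error is controlled by the error of the gradients. This replaces L2 convergence near
  infinity.\<close>

lemma hardy_conv_diff:
  assumes c: "conv \<Omega> \<phi> u G" and odd: "\<And>n. odd_vf d (\<phi> n)"
  shows "sqint (wt (\<lambda>x. \<phi> n x - u x))" "nrm (wt (\<lambda>x. \<phi> n x - u x)) \<le> 2 * nrm (\<lambda>x. grad (\<phi> n) x - G x)"
proof -
  have o: "odd_vf d (\<lambda>x. \<phi> n x - \<phi> k x)" for k using odd by (simp add: odd_vf_def)
  note c' = conv_diff[OF conv_const[OF convD(1)[OF c, of n]] c]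
  show "sqint (wt (\<lambda>x. \<phi> n x - u x))" "nrm (wt (\<lambda>x. \<phi> n x - u x)) \<le> 2 * nrm (\<lambda>x. grad (\<phi> n) x - G x)"
    by (rule hardy_conv[OF c' o])+
qed

subsection \<open>Antisymmetric fields are limits of antisymmetric test fields\<close>

lemma conv_grad_zero:
  assumes c: "conv \<Omega> \<phi> u G" and u: "AE x in lebesgue. u x $ k = 0"
  shows "AE x in lebesgue. G x $ k $ i = 0"
proof (rule fundamental_lemma_sqint)
  note d = convD[OF c]
  show "sqint (\<lambda>x. G x $ k $ i)" using sqint_nth[OF sqint_nth[OF d(3)]] .
  fix \<psi> :: "real^2 \<Rightarrow> real" assume \<psi>: "\<psi> \<in> test_funs UNIV"
  have "(\<integral>x. u x $ k * partial_deriv i \<psi> x \<partial>lebesgue) = (\<integral>x. 0 \<partial>(lebesgue :: (real^2) measure))"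
  proof (rule integral_cong_AE)
    have "(\<lambda>x. u x $ k) \<in> borel_measurable lebesgue"
      by (rule measurable_compose[OF d(4)]) (intro borel_measurable_continuous_onI continuous_intros)
    then show "(\<lambda>x. u x $ k * partial_deriv i \<psi> x) \<in> borel_measurable lebesgue"
      using sqint_measurable[OF test_funs_sqint[OF test_funs_partial_deriv[OF \<psi>]]] by (rule borel_measurable_times)
    show "AE x in lebesgue. u x $ k * partial_deriv i \<psi> x = 0"
      using u by eventually_elim simp
  qed simp
  then show "(\<integral>x. G x $ k $ i * \<psi> x \<partial>lebesgue) = 0"
    by (simp add: conv_weak[OF c \<psi>])
qed

text \<open>The solenoidal constraint turns the vanishing of one component into
  \<open>\<partial>\<^sub>i u\<^sub>i = 0\<close> for the other one.\<close>

lemma conv_component_zero: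
  assumes \<Omega>: "\<And>x. x \<in> \<Omega> \<Longrightarrow> flip i x \<in> \<Omega>" and c: "conv \<Omega> \<phi> u G"
    and k: "AE x in lebesgue. u x $ oth i = 0"
    and odd: "AE x in lebesgue. u (flip i x) $ i = - u x $ i"
  shows "AE x in lebesgue. u x = 0"
proof -
  define k where "k = oth i"
  \<comment> \<open>Averaging with the reflection makes component \<open>i\<close> exactly odd under
    \<open>flip i\<close>, as \<open>hardy_scalar\<close> demands. By the assumptions on
    \<open>u\<close> the limit changes only on a null set.\<close>
  define \<psi> where "\<psi> n x = (1/2) *\<^sub>R (\<phi> n x + refl_vf i (\<phi> n) x)" for n x
  define w where "w x = (1/2) *\<^sub>R (u x + refl_vf i u x)" for x
  define H where "H x = (1/2) *\<^sub>R (G x + flip_mat i (G (flip i x)))" for x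
  have c2: "conv \<Omega> \<psi> w H"
    unfolding \<psi>_def[abs_def] w_def[abs_def] H_def[abs_def]
    by (intro conv_scaleR conv_add c conv_refl \<Omega>)
  note d = convD[OF c2]
  have wu: "AE x in lebesgue. w x = u x"
    using k AE_flip[OF k, of i] odd
  proof eventually_elim
    case (elim x)
    have "w x $ j = u x $ j" for j
      using elim eq_oth[of j i] by (cases "j = i") (auto simp: w_def refl_vf_nth)
    then show ?case by (simp add: vec_eq_iff)
  qed
  have wk: "AE x in lebesgue. w x $ k = 0"
    using wu k by eventually_elim (simp add: k_def)
  have Hk: "nrm (\<lambda>x. H x $ k $ k) = 0"
    using nrm_cong_AE[OF conv_grad_zero[OF c2 wk, of k]] sqint_measurable[OF sqint_nth[OF sqint_nth[OF d(3)]], of k k]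
    by simp
  have div: "grad (\<psi> n) x $ i $ i = - grad (\<psi> n) x $ k $ k" for n x
  proof -
    have "(\<Sum>j\<in>UNIV. grad (\<psi> n) x $ j $ j) = grad (\<psi> n) x $ i $ i + grad (\<psi> n) x $ k $ k"
      unfolding UNIV_oth[of i] k_def by simp
    then show ?thesis using sol_div[OF d(1)[of n], of x] by simp
  qed
  \<comment> \<open>Zero divergence trades the derivative of component \<open>i\<close> in its own
    direction for the diagonal entry \<open>k\<close>, whose norm tends to 0.\<close>
  have hardy: "nrm (wt (\<lambda>x. \<psi> n x $ i)) \<le> 2 * nrm (\<lambda>x. grad (\<psi> n) x $ k $ k)" for n
  proof -
    have "nrm (wt (\<lambda>x. \<psi> n x $ i)) \<le> 2 * nrm (partial_deriv i (\<lambda>x. \<psi> n x $ i))"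
      by (intro hardy_scalar[OF test_funs_nth[OF d(2)]]) (simp add: \<psi>_def refl_vf_nth field_simps)
    also have "nrm (partial_deriv i (\<lambda>x. \<psi> n x $ i)) = nrm (\<lambda>x. grad (\<psi> n) x $ k $ k)"
      using div[of n] by (intro nrm_cong_norm) (simp add: grad_nth)
    finally show ?thesis .
  qed
  have lim: "(\<lambda>n. nrm (\<lambda>x. grad (\<psi> n) x $ k $ k)) \<longlonglongrightarrow> 0"
  proof -
    have n: "nrm (\<lambda>x. f x $ k $ k) \<le> nrm f" if "sqint f" for f :: "real^2 \<Rightarrow> real^2^2"
      using nrm_nth_le[OF sqint_nth[OF that, of k], of k] nrm_nth_le[OF that, of k] by simp
    have "(\<lambda>n. nrm (\<lambda>x. grad (\<psi> n) x $ k $ k)) \<longlonglongrightarrow> nrm (\<lambda>x. H x $ k $ k)"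
    proof (rule nrm_tendsto[OF sqint_nth[OF sqint_nth[OF d(8)]] sqint_nth[OF sqint_nth[OF d(3)]]])
      show "(\<lambda>n. nrm (\<lambda>x. grad (\<psi> n) x $ k $ k - H x $ k $ k)) \<longlonglongrightarrow> 0"
        using n[OF d(9)] by (intro Lim_null_comparison[OF always_eventually d(6)]) auto
    qed
    then show ?thesis using Hk by simp
  qed
  have "nrm (cutf (ball 0 (real m)) (\<lambda>x. wt w x $ i)) = 0" for m
  proof -
    let ?B = "ball 0 (real m) :: (real^2) set"
    have e: "cutf ?B (\<lambda>x. wt f x $ i) = (\<lambda>x. cutf ?B (wt f) x $ i)" for f :: "real^2 \<Rightarrow> real^2"
      by (simp add: fun_eq_iff cutf_def)
    have s1: "sqint (cutf ?B (wt (\<psi> n)))" for n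
      by (intro sqint_cutf sqint_wt test_funs_sqint[OF d(2)]) auto
    have s2: "sqint (cutf ?B (wt w))" by (rule conv_wt_ball(1)[OF c2])
    have "(\<lambda>n. nrm (\<lambda>x. cutf ?B (wt (\<psi> n)) x $ i)) \<longlonglongrightarrow> nrm (\<lambda>x. cutf ?B (wt w) x $ i)"
    proof (rule nrm_tendsto[OF sqint_nth[OF s1] sqint_nth[OF s2]])
      show "(\<lambda>n. nrm (\<lambda>x. cutf ?B (wt (\<psi> n)) x $ i - cutf ?B (wt w) x $ i)) \<longlonglongrightarrow> 0"
      proof (rule Lim_null_comparison[OF always_eventually conv_wt_ball(3)[OF c2, of m]], rule allI)
        fix n
        show "norm (nrm (\<lambda>x. cutf ?B (wt (\<psi> n)) x $ i - cutf ?B (wt w) x $ i)) \<le> nrm (\<lambda>x. cutf ?B (wt (\<psi> n)) x - cutf ?B (wt w) x)"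
          using nrm_nth_le[OF sqint_diff[OF s1 s2], of n i] by simp
      qed
    qed
    moreover have "(\<lambda>n. nrm (\<lambda>x. cutf ?B (wt (\<psi> n)) x $ i)) \<longlonglongrightarrow> 0"
    proof (rule Lim_null_comparison[OF always_eventually])
      show "(\<lambda>n. 2 * nrm (\<lambda>x. grad (\<psi> n) x $ k $ k)) \<longlonglongrightarrow> 0"
        using tendsto_mult_left[OF lim, of 2] by simp
      show "\<forall>n. norm (nrm (\<lambda>x. cutf ?B (wt (\<psi> n)) x $ i)) \<le> 2 * nrm (\<lambda>x. grad (\<psi> n) x $ k $ k)"
      proof
        fix n
        have "nrm (cutf ?B (wt (\<lambda>x. \<psi> n x $ i))) \<le> nrm (wt (\<lambda>x. \<psi> n x $ i))"
          by (intro nrm_cutf_le sqint_wt test_funs_sqint[OF test_funs_nth[OF d(2)]]) auto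
        moreover have "cutf ?B (wt (\<lambda>x. \<psi> n x $ i)) = (\<lambda>x. cutf ?B (wt (\<psi> n)) x $ i)"
          by (simp add: fun_eq_iff cutf_def wt_def)
        ultimately show "norm (nrm (\<lambda>x. cutf ?B (wt (\<psi> n)) x $ i)) \<le> 2 * nrm (\<lambda>x. grad (\<psi> n) x $ k $ k)"
          using hardy[of n] by simp
      qed
    qed
    ultimately show ?thesis unfolding e by (rule LIMSEQ_unique)
  qed
  then have "AE x in lebesgue. cutf (ball 0 (real m)) (\<lambda>x. wt w x $ i) x = 0" for m
  proof (rule nrm_eq_0[rotated])
    have "sqint (\<lambda>x. cutf (ball 0 (real m)) (wt w) x $ i)" by (rule sqint_nth[OF conv_wt_ball(1)[OF c2]])
    then show "sqint (cutf (ball 0 (real m)) (\<lambda>x. wt w x $ i))" by (simp add: cutf_def[abs_def])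
  qed
  then have "AE x in lebesgue. \<forall>m::nat. cutf (ball 0 (real m)) (\<lambda>x. wt w x $ i) x = 0"
    by (simp add: AE_all_countable)
  then show ?thesis using wu wk
  proof eventually_elim
    case (elim x)
    obtain m :: nat where "norm x < real m" using reals_Archimedean2 by blast
    then have "w x $ i = 0" using elim(1)[rule_format, of m] by (auto simp: cutf_def wt_def one_plus_norm_neq_0)
    then have "w x $ j = 0" for j using elim(3) eq_oth[of j i] by (cases "j = i") (auto simp: k_def)
    then show ?case using elim(2) by (simp add: vec_eq_iff)
  qed
qed

definition AE_odd :: "(2 \<Rightarrow> 2) \<Rightarrow> (real^2 \<Rightarrow> real^2) \<Rightarrow> bool" where
  "AE_odd d u \<longleftrightarrow> (\<forall>j. AE x in lebesgue. u (flip (d j) x) $ j = - u x $ j)"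

lemma AE_oddD: "AE_odd d u \<Longrightarrow> AE x in lebesgue. u (flip (d j) x) $ j = - u x $ j"
  by (simp add: AE_odd_def)

text \<open>The part \<open>w\<close> of \<open>u\<close> that changes sign under reflection
  \<open>i\<close> has vanishing component \<open>i\<close>, since that component of
  \<open>u\<close> is odd there, and its other component is odd in its own variable. Then
  \<open>conv_component_zero\<close> gives \<open>w = 0\<close> almost everywhere.\<close>

lemma refl_invariant_id:
  assumes \<Omega>: "\<And>i x. x \<in> \<Omega> \<Longrightarrow> flip i x \<in> \<Omega>" and c: "conv \<Omega> \<phi> u G" and o: "AE_odd (\<lambda>j. j) u"
  shows "AE x in lebesgue. refl_vf i u x = u x"
proof -
  define w where "w x = (1/2) *\<^sub>R (u x - refl_vf i u x)" for x
  have c2: "conv \<Omega> (\<lambda>n x. (1/2) *\<^sub>R (\<phi> n x - refl_vf i (\<phi> n) x)) w (\<lambda>x. (1/2) *\<^sub>R (G x - flip_mat i (G (flip i x))))"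
    unfolding w_def[abs_def] by (intro conv_scaleR conv_diff c conv_refl \<Omega>)
  have "AE x in lebesgue. w x = 0"
  proof (rule conv_component_zero[where i="oth i", OF \<Omega> c2])
    show "AE x in lebesgue. w x $ oth (oth i) = 0"
      using AE_oddD[OF o, of i] by eventually_elim (simp add: w_def refl_vf_nth field_simps)
    show "AE x in lebesgue. w (flip (oth i) x) $ oth i = - w x $ oth i"
      using AE_oddD[OF o, of "oth i"] AE_flip[OF AE_oddD[OF o, of "oth i"], of i]
      by eventually_elim (simp add: w_def refl_vf_nth flip_commute[of i "oth i"] field_simps)
  qed
  then show ?thesis by eventually_elim (simp add: w_def)
qed

text \<open>Here it is the part unchanged by the reflection that loses component
  \<open>oth i\<close> by assumption, while its component \<open>i\<close> is odd by construction,
  so \<open>conv_component_zero\<close> applies again.\<close>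

lemma refl_invariant_oth:
  assumes \<Omega>: "\<And>i x. x \<in> \<Omega> \<Longrightarrow> flip i x \<in> \<Omega>" and c: "conv \<Omega> \<phi> u G" and o: "AE_odd oth u"
  shows "AE x in lebesgue. refl_vf i u x = - u x"
proof -
  define w where "w x = (1/2) *\<^sub>R (u x + refl_vf i u x)" for x
  have c2: "conv \<Omega> (\<lambda>n x. (1/2) *\<^sub>R (\<phi> n x + refl_vf i (\<phi> n) x)) w (\<lambda>x. (1/2) *\<^sub>R (G x + flip_mat i (G (flip i x))))"
    unfolding w_def[abs_def] by (intro conv_scaleR conv_add c conv_refl \<Omega>)
  have "AE x in lebesgue. w x = 0"
  proof (rule conv_component_zero[where i=i, OF \<Omega> c2])
    show "AE x in lebesgue. w x $ oth i = 0"
      using AE_oddD[OF o, of "oth i"] by eventually_elim (simp add: w_def refl_vf_nth field_simps)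
    show "AE x in lebesgue. w (flip i x) $ i = - w x $ i"
      by (intro AE_I2) (simp add: w_def refl_vf_nth field_simps)
  qed
  then show ?thesis by eventually_elim (simp add: w_def add_eq_0_iff2)
qed

text \<open>If both components are odd under the same reflection, \<open>conv_component_zero\<close>
  applied to the reflection-invariant part shows that component \<open>i\<close> vanishes. A zero
  component is odd under every reflection, so the symmetry may be relabelled as
  \<open>oth\<close>.\<close>

lemma AE_odd_degenerate:
  assumes \<Omega>: "\<And>i x. x \<in> \<Omega> \<Longrightarrow> flip i x \<in> \<Omega>" and c: "conv \<Omega> \<phi> u G" and o: "AE_odd (\<lambda>j. i) u"
  shows "AE_odd oth u"
proof -
  define w where "w x = (1/2) *\<^sub>R (u x + refl_vf i u x)" for x
  have c2: "conv \<Omega> (\<lambda>n x. (1/2) *\<^sub>R (\<phi> n x + refl_vf i (\<phi> n) x)) w (\<lambda>x. (1/2) *\<^sub>R (G x + flip_mat i (G (flip i x))))"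
    unfolding w_def[abs_def] by (intro conv_scaleR conv_add c conv_refl \<Omega>)
  have "AE x in lebesgue. w x = 0"
  proof (rule conv_component_zero[where i=i, OF \<Omega> c2])
    show "AE x in lebesgue. w x $ oth i = 0"
      using AE_oddD[OF o, of "oth i"] by eventually_elim (simp add: w_def refl_vf_nth field_simps)
    show "AE x in lebesgue. w (flip i x) $ i = - w x $ i"
      by (intro AE_I2) (simp add: w_def refl_vf_nth field_simps)
  qed
  then have ui: "AE x in lebesgue. u x $ i = 0"
    using AE_oddD[OF o, of i]
  proof eventually_elim
    case (elim x)
    have "w x $ i = u x $ i" using elim(2) by (simp add: w_def refl_vf_nth field_simps)
    with elim(1) show ?case by simp
  qed
  show ?thesis
    unfolding AE_odd_def
  proof
    fix j
    show "AE x in lebesgue. u (flip (oth j) x) $ j = - u x $ j"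
    proof (cases "j = i")
      case True
      show ?thesis using ui AE_flip[OF ui, of "oth j"] by eventually_elim (simp add: True)
    next
      case False
      then have "oth j = i" using eq_oth[of j i] by simp
      then show ?thesis using AE_oddD[OF o, of j] by simp
    qed
  qed
qed

text \<open>\<open>P i\<close> projects onto the fields with sign \<open>s\<close> under reflection
  \<open>i\<close>. The reflections commute, so \<open>P 2\<close> preserves what \<open>P 1\<close>
  has achieved; \<open>conv_unique\<close> shows that the limit gradient is still
  \<open>G\<close>.\<close>

lemma conv_symmetrize:
  assumes \<Omega>: "\<And>i x. x \<in> \<Omega> \<Longrightarrow> flip i x \<in> \<Omega>" and c: "conv \<Omega> \<phi> u G" and s: "s * s = (1::real)"
    and r: "\<And>i. AE x in lebesgue. refl_vf i u x = s *\<^sub>R u x"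
  shows "\<exists>\<psi>. conv \<Omega> \<psi> u G \<and> (\<forall>n i x. refl_vf i (\<psi> n) x = s *\<^sub>R \<psi> n x)"
proof -
  define P where "P i f x = (1/2) *\<^sub>R (f x + s *\<^sub>R refl_vf i f x)" for i and f :: "real^2 \<Rightarrow> real^2" and x
  have step: "conv \<Omega> (\<lambda>n. P i (\<eta> n)) u G" if c: "conv \<Omega> \<eta> u G" for \<eta> i
  proof -
    have "conv \<Omega> (\<lambda>n. P i (\<eta> n)) (P i u) (\<lambda>x. (1/2) *\<^sub>R (G x + s *\<^sub>R flip_mat i (G (flip i x))))"
      unfolding P_def[abs_def] by (intro conv_scaleR conv_add c conv_refl \<Omega>)
    moreover have "AE x in lebesgue. P i u x = u x"
      using r[of i]
    proof eventually_elim
      case (elim x)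
      have "P i u x = (1/2) *\<^sub>R (u x + (s * s) *\<^sub>R u x)" using elim by (simp add: P_def)
      then show ?case by (simp add: s scaleR_2[symmetric])
    qed
    ultimately have 1: "conv \<Omega> (\<lambda>n. P i (\<eta> n)) u (\<lambda>x. (1/2) *\<^sub>R (G x + s *\<^sub>R flip_mat i (G (flip i x))))"
      by (rule conv_cong_AE) simp
    from conv_cong_AE[OF 1 _ conv_unique[OF 1 c]] show ?thesis by simp
  qed
  have inv: "refl_vf i (P i f) x = s *\<^sub>R P i f x" for i f x
  proof -
    have "refl_vf i (P i f) x = (1/2) *\<^sub>R (refl_vf i f x + s *\<^sub>R refl_vf i (refl_vf i f) x)"
      unfolding P_def[abs_def] by (simp only: refl_vf_scaleR refl_vf_add)
    also have "\<dots> = (1/2) *\<^sub>R (s *\<^sub>R f x + (s * s) *\<^sub>R refl_vf i f x)"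
      by (simp only: refl_vf_refl_vf s scaleR_one add.commute)
    also have "\<dots> = s *\<^sub>R P i f x"
      by (simp add: P_def scaleR_add_right)
    finally show ?thesis .
  qed
  have keep: "refl_vf j (P i f) x = s *\<^sub>R P i f x" if "\<And>x. refl_vf j f x = s *\<^sub>R f x" for i j f x
  proof -
    have f: "refl_vf j f = (\<lambda>x. s *\<^sub>R f x)" using that by auto
    have "refl_vf j (P i f) x = (1/2) *\<^sub>R (refl_vf j f x + s *\<^sub>R refl_vf j (refl_vf i f) x)"
      unfolding P_def[abs_def] by (simp only: refl_vf_scaleR refl_vf_add)
    also have "refl_vf j (refl_vf i f) x = s *\<^sub>R refl_vf i f x"
      by (subst refl_vf_commute, subst f) (rule refl_vf_scaleR)
    also have "(1/2) *\<^sub>R (refl_vf j f x + s *\<^sub>R s *\<^sub>R refl_vf i f x) = s *\<^sub>R P i f x"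
      by (simp add: P_def f scaleR_add_right)
    finally show ?thesis .
  qed
  have "refl_vf i (P 2 (P 1 (\<phi> n))) x = s *\<^sub>R P 2 (P 1 (\<phi> n)) x" for n i x
    using exhaust_2[of i] inv keep[OF inv] by auto
  then show ?thesis using step[OF step[OF c]] by blast
qed

text \<open>Of the four maps \<open>d\<close>, the identity and \<open>oth\<close> force a definite
  sign under both reflections, and the two constant maps are reduced to \<open>oth\<close>. The
  resulting type depends on \<open>d\<close> alone, so two fields with the same \<open>d\<close> get
  approximations of the same type.\<close>

lemma conv_odd_approx:
  assumes \<Omega>: "\<And>i x. x \<in> \<Omega> \<Longrightarrow> flip i x \<in> \<Omega>" and c: "conv \<Omega> \<phi> u G" and o: "AE_odd d u"
  shows "\<exists>\<psi>. conv \<Omega> \<psi> u G \<and> (\<forall>n. odd_vf (if d = (\<lambda>j. j) then (\<lambda>j. j) else oth) (\<psi> n))"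
proof (cases "d = (\<lambda>j. j)")
  case True
  obtain \<psi> where \<psi>: "conv \<Omega> \<psi> u G" "\<And>n i x. refl_vf i (\<psi> n) x = 1 *\<^sub>R \<psi> n x"
    using conv_symmetrize[OF \<Omega> c, of 1] refl_invariant_id[OF \<Omega> c o[unfolded True]] by auto
  have "\<psi> n (flip j x) $ j = - \<psi> n x $ j" for n j x
  proof -
    have "refl_vf j (\<psi> n) x $ j = \<psi> n x $ j" using \<psi>(2) by simp
    then show ?thesis by (simp add: refl_vf_nth)
  qed
  then show ?thesis using \<psi>(1) True by (auto simp: odd_vf_def)
next
  case False
  have "AE_odd oth u"
  proof -
    have "d = oth \<or> (\<exists>i. d = (\<lambda>j. i))"
    proof -
      have "d 1 = 1 \<or> d 1 = 2" "d 2 = 1 \<or> d 2 = 2" using exhaust_2 by blast+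
      moreover have "\<not> (d 1 = 1 \<and> d 2 = 2)" using False exhaust_2 by (metis ext)
      ultimately consider "d 1 = 1" "d 2 = 1" | "d 1 = 2" "d 2 = 1" | "d 1 = 2" "d 2 = 2" by blast
      then show ?thesis
      proof cases
        case 1 then have "d = (\<lambda>j. 1)" using exhaust_2 by (metis ext)
        then show ?thesis by blast
      next
        case 2
        have "d j = oth j" for j using exhaust_2[of j] 2 by (auto simp: oth_def)
        then show ?thesis by auto
      next
        case 3 then have "d = (\<lambda>j. 2)" using exhaust_2 by (metis ext)
        then show ?thesis by blast
      qed
    qed
    then show ?thesis using o AE_odd_degenerate[OF \<Omega> c] by auto
  qed
  then have r: "AE x in lebesgue. refl_vf i u x = (-1) *\<^sub>R u x" for i
    using refl_invariant_oth[OF \<Omega> c] by simp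
  obtain \<psi> where \<psi>: "conv \<Omega> \<psi> u G" "\<And>n i x. refl_vf i (\<psi> n) x = (-1) *\<^sub>R \<psi> n x"
    using conv_symmetrize[OF \<Omega> c _ r] by auto
  have "\<psi> n (flip (oth j) x) $ j = - \<psi> n x $ j" for n j x
  proof -
    have "refl_vf (oth j) (\<psi> n) x $ j = - \<psi> n x $ j" using \<psi>(2) by simp
    then show ?thesis by (simp add: refl_vf_nth)
  qed
  then show ?thesis using \<psi>(1) False by (auto simp: odd_vf_def)
qed

section \<open>The space \<open>hdot\<close> and its dual\<close>

lemma L2_space_iff:
  fixes g :: "real^2 \<Rightarrow> 'b::euclidean_space"
  assumes S: "S \<in> sets lebesgue"
  shows "g \<in> L2_space S \<longleftrightarrow> sqint (cutf S g)"
proof -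
  have "(norm (cutf S g x))\<^sup>2 = indicator S x *\<^sub>R (norm (g x))\<^sup>2" for x
    by (simp add: cutf_def indicator_def)
  then show ?thesis using S
    by (simp add: L2_space_def sqint_def borel_measurable_restrict_space_iff integrable_restrict_space cutf_def[abs_def])
qed

lemma L2_norm_eq:
  fixes g :: "real^2 \<Rightarrow> 'b::euclidean_space"
  assumes S: "S \<in> sets lebesgue"
  shows "L2_norm S g = nrm (cutf S g)"
proof -
  have "(norm (cutf S g x))\<^sup>2 = indicator S x *\<^sub>R (norm (g x))\<^sup>2" for x
    by (simp add: cutf_def indicator_def)
  then show ?thesis using S by (simp add: L2_norm_def nrm_def integral_restrict_space)
qed

lemma hdot_conv:
  assumes \<Omega>: "open \<Omega>" and u: "u \<in> hdot \<Omega>"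
  shows "\<exists>\<phi>. conv \<Omega> \<phi> (cutf \<Omega> u) (cutf \<Omega> (weak_grad \<Omega> u))"
proof -
  have sb: "\<Omega> \<inter> ball 0 r \<in> sets lebesgue" "\<Omega> \<in> sets lebesgue" for r
    using \<Omega> by (auto intro: open_Int)
  obtain \<phi> where \<phi>: "\<And>n. \<phi> n \<in> test_funs_sol \<Omega>"
      "(\<lambda>n. L2_norm \<Omega> (\<lambda>x. grad (\<phi> n) x - weak_grad \<Omega> u x)) \<longlonglongrightarrow> 0"
      "\<And>R. R > 0 \<Longrightarrow> (\<lambda>n. L2_norm (\<Omega> \<inter> ball 0 R) (\<lambda>x. \<phi> n x - u x)) \<longlonglongrightarrow> 0"
    using u unfolding hdot_def by blast
  have s: "R > 0 \<Longrightarrow> sqint (cutf (\<Omega> \<inter> ball 0 R) u)" "sqint (cutf \<Omega> (weak_grad \<Omega> u))" for R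
    using u sb by (auto simp: hdot_def L2_space_iff)
  have c1: "cutf (\<Omega> \<inter> A) f = cutf A (cutf \<Omega> f)" for A and f :: "real^2 \<Rightarrow> real^2"
    by (auto simp: fun_eq_iff cutf_def indicator_def)
  \<comment> \<open>\<open>hdot\<close> speaks of positive radii only, while \<open>conv\<close>
    includes the ball of radius 0, which is empty.\<close>
  have c0: "cutf (ball 0 (real 0)) f = (\<lambda>x. 0)" for f :: "real^2 \<Rightarrow> real^2"
    by (simp add: fun_eq_iff cutf_def)
  have s2: "sqint (cutf (ball 0 (real n)) (cutf \<Omega> u))" for n
    using s(1)[of "real n"] by (cases "n = 0") (auto simp: c1 c0[simplified])
  have m: "cutf \<Omega> u \<in> borel_measurable lebesgue"
  proof (rule borel_measurable_LIMSEQ_metric)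
    show "cutf (ball 0 (real n)) (cutf \<Omega> u) \<in> borel_measurable lebesgue" for n
      by (rule sqint_measurable[OF s2])
    show "(\<lambda>n. cutf (ball 0 (real n)) (cutf \<Omega> u) x) \<longlonglongrightarrow> cutf \<Omega> u x" for x
    proof (rule tendsto_eventually)
      obtain N :: nat where "norm x < N" using reals_Archimedean2 by blast
      then show "\<forall>\<^sub>F n in sequentially. cutf (ball 0 (real n)) (cutf \<Omega> u) x = cutf \<Omega> u x"
        by (intro eventually_sequentiallyI[of N]) (auto simp: cutf_def indicator_def)
    qed
  qed
  have e1: "cutf \<Omega> (\<lambda>x. grad (\<phi> n) x - weak_grad \<Omega> u x) = (\<lambda>x. grad (\<phi> n) x - cutf \<Omega> (weak_grad \<Omega> u) x)" for n
    using grad_zero[OF sol_test[OF \<phi>(1)[of n]]] by (auto simp: fun_eq_iff cutf_def indicator_def)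
  have e2: "cutf \<Omega> (\<lambda>x. \<phi> n x - u x) = (\<lambda>x. \<phi> n x - cutf \<Omega> u x)" for n
    using test_funs_zero[OF sol_test[OF \<phi>(1)[of n]]] by (auto simp: fun_eq_iff cutf_def indicator_def)
  have l: "(\<lambda>k. nrm (cutf (ball 0 (real n)) (\<lambda>x. \<phi> k x - cutf \<Omega> u x))) \<longlonglongrightarrow> 0" for n
    using \<phi>(3)[of "real n"] by (cases "n = 0") (auto simp: L2_norm_eq[OF sb(1)] c1 e2 c0[simplified])
  show ?thesis
    using \<phi>(1,2) s s2 m l by (intro exI[of _ \<phi>]) (simp add: conv_def L2_norm_eq[OF sb(2)] e1)
qed

lemma locally_integrable_nth:
  fixes g :: "real^2 \<Rightarrow> 'b::euclidean_space^2"
  assumes "locally_integrable \<Omega> g" shows "locally_integrable \<Omega> (\<lambda>x. g x $ j)"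
  using assms integrable_bounded_linear[OF bounded_linear_vec_nth]
  by (auto simp: locally_integrable_def)

lemma locally_integrable_diff:
  "locally_integrable \<Omega> f \<Longrightarrow> locally_integrable \<Omega> g \<Longrightarrow> locally_integrable \<Omega> (\<lambda>x. f x - g x)"
  by (auto simp: locally_integrable_def)

lemma locally_integrable_mult_test:
  fixes g \<psi> :: "real^2 \<Rightarrow> real"
  assumes \<Omega>: "open \<Omega>" and g: "locally_integrable \<Omega> g" and \<psi>: "\<psi> \<in> test_funs \<Omega>"
  shows "integrable (lebesgue_on \<Omega>) (\<lambda>x. g x * \<psi> x)"
proof -
  obtain K where K: "compact K" "K \<subseteq> \<Omega>" "\<And>x. x \<notin> K \<Longrightarrow> \<psi> x = 0" using test_funsE[OF \<psi>] by metis
  obtain B where B: "0 \<le> B" "\<And>x. norm (\<psi> x) \<le> B" using test_funs_bounded[OF \<psi>] by metis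
  have Ks: "K \<in> sets lebesgue" using K(1) by (intro lmeasurable_compact fmeasurableD)
  have i: "integrable lebesgue (cutf K g)"
    using g K by (simp add: locally_integrable_def integrable_lebesgue_on[OF Ks, symmetric])
  have "integrable lebesgue (\<lambda>x. cutf K g x * \<psi> x)"
  proof (rule Bochner_Integration.integrable_bound)
    show "integrable lebesgue (\<lambda>x. B * cutf K g x)" using i by simp
    show "(\<lambda>x. cutf K g x * \<psi> x) \<in> borel_measurable lebesgue"
      using i sqint_measurable[OF test_funs_sqint[OF \<psi>]] by (intro borel_measurable_times) auto
    show "AE x in lebesgue. norm (cutf K g x * \<psi> x) \<le> norm (B * cutf K g x)"
      using B by (intro AE_I2) (simp add: abs_mult mult.commute mult_right_mono)
  qed
  moreover have "cutf \<Omega> (\<lambda>x. g x * \<psi> x) = (\<lambda>x. cutf K g x * \<psi> x)"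
    using K by (auto simp: fun_eq_iff cutf_def indicator_def)
  ultimately show ?thesis using \<Omega> by (simp add: integrable_lebesgue_on)
qed

text \<open>The representative in \<open>weak_grad\<close> is arbitrary, so a computed weak gradient
  must be compared with it; the fundamental lemma does this entry by entry.\<close>

lemma has_weak_grad_unique:
  assumes \<Omega>: "open \<Omega>" and G: "has_weak_grad \<Omega> u G" and H: "has_weak_grad \<Omega> u H"
  shows "AE x in lebesgue. x \<in> \<Omega> \<longrightarrow> G x = H x"
proof -
  have "AE x in lebesgue. x \<in> \<Omega> \<longrightarrow> G x $ j $ i - H x $ j $ i = 0" for j i
  proof (rule fundamental_lemma[OF \<Omega>])
    have l: "locally_integrable \<Omega> (\<lambda>x. G x $ j $ i)" "locally_integrable \<Omega> (\<lambda>x. H x $ j $ i)"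
    proof -
      have "locally_integrable \<Omega> (\<lambda>x. G x $ j)" "locally_integrable \<Omega> (\<lambda>x. H x $ j)"
        using G H by (auto simp: has_weak_grad_def intro!: locally_integrable_nth)
      then show "locally_integrable \<Omega> (\<lambda>x. G x $ j $ i)" "locally_integrable \<Omega> (\<lambda>x. H x $ j $ i)"
        by (auto intro!: locally_integrable_nth)
    qed
    then show "locally_integrable \<Omega> (\<lambda>x. G x $ j $ i - H x $ j $ i)" by (rule locally_integrable_diff)
    fix \<psi> :: "real^2 \<Rightarrow> real" assume \<psi>: "\<psi> \<in> test_funs \<Omega>"
    have "(\<integral>x. G x $ j $ i * \<psi> x \<partial>lebesgue_on \<Omega>) = (\<integral>x. H x $ j $ i * \<psi> x \<partial>lebesgue_on \<Omega>)"
    proof -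
      have "(\<integral>x. u x $ j * partial_deriv i \<psi> x \<partial>lebesgue_on \<Omega>) = - (\<integral>x. G x $ j $ i * \<psi> x \<partial>lebesgue_on \<Omega>)"
        "(\<integral>x. u x $ j * partial_deriv i \<psi> x \<partial>lebesgue_on \<Omega>) = - (\<integral>x. H x $ j $ i * \<psi> x \<partial>lebesgue_on \<Omega>)"
        using G H \<psi> unfolding has_weak_grad_def by blast+
      then show ?thesis by linarith
    qed
    then show "(\<integral>x. (G x $ j $ i - H x $ j $ i) * \<psi> x \<partial>lebesgue_on \<Omega>) = 0"
      using locally_integrable_mult_test[OF \<Omega> l(1) \<psi>] locally_integrable_mult_test[OF \<Omega> l(2) \<psi>]
      by (simp add: left_diff_distrib)
  qed
  then have "AE x in lebesgue. \<forall>j i. x \<in> \<Omega> \<longrightarrow> G x $ j $ i - H x $ j $ i = 0"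
    by (intro AE_all_countable[THEN iffD2] allI)
  then show ?thesis by eventually_elim (simp add: vec_eq_iff)
qed

lemma has_weak_grad_weak_grad: "u \<in> hdot \<Omega> \<Longrightarrow> has_weak_grad \<Omega> u (weak_grad \<Omega> u)"
  unfolding weak_grad_def by (rule someI_ex[of "has_weak_grad \<Omega> u"]) (simp add: hdot_def)

lemma has_weak_grad_grad:
  assumes \<Omega>: "open \<Omega>" and \<phi>: "\<phi> \<in> test_funs \<Omega>"
  shows "has_weak_grad \<Omega> \<phi> (grad \<phi>)"
  unfolding has_weak_grad_def
proof (intro conjI ballI allI)
  show "locally_integrable \<Omega> \<phi>" "locally_integrable \<Omega> (grad \<phi>)"
    by (intro sqint_locally_integrable test_funs_sqint[OF \<phi>] grad_sqint[OF \<phi>])+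
  fix \<psi> :: "real^2 \<Rightarrow> real" and i j assume \<psi>: "\<psi> \<in> test_funs \<Omega>"
  have "(\<integral>x. \<phi> x $ j * partial_deriv i \<psi> x \<partial>lebesgue) = - (\<integral>x. partial_deriv i (\<lambda>x. \<phi> x $ j) x * \<psi> x \<partial>lebesgue)"
    by (rule integral_by_parts[OF test_funs_nth[OF \<phi>] test_funs_Ck[OF \<psi>]])
  moreover have "cutf \<Omega> (\<lambda>x. \<phi> x $ j * partial_deriv i \<psi> x) = (\<lambda>x. \<phi> x $ j * partial_deriv i \<psi> x)"
    "cutf \<Omega> (\<lambda>x. grad \<phi> x $ j $ i * \<psi> x) = (\<lambda>x. grad \<phi> x $ j $ i * \<psi> x)"
    using test_funs_zero[OF \<phi>] test_funs_zero[OF \<psi>] by (auto simp: fun_eq_iff cutf_def indicator_def)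
  ultimately show "(\<integral>x. \<phi> x $ j * partial_deriv i \<psi> x \<partial>lebesgue_on \<Omega>) = - (\<integral>x. grad \<phi> x $ j $ i * \<psi> x \<partial>lebesgue_on \<Omega>)"
    using \<Omega> by (simp add: integral_lebesgue_on grad_nth)
qed

lemma has_weak_grad_diff:
  assumes \<Omega>: "open \<Omega>" and u: "has_weak_grad \<Omega> u G" and v: "has_weak_grad \<Omega> v H"
  shows "has_weak_grad \<Omega> (\<lambda>x. u x - v x) (\<lambda>x. G x - H x)"
  unfolding has_weak_grad_def
proof (intro conjI ballI allI)
  have l: "locally_integrable \<Omega> u" "locally_integrable \<Omega> v" "locally_integrable \<Omega> G" "locally_integrable \<Omega> H"
    using u v by (auto simp: has_weak_grad_def)
  show "locally_integrable \<Omega> (\<lambda>x. u x - v x)" "locally_integrable \<Omega> (\<lambda>x. G x - H x)"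
    by (intro locally_integrable_diff l)+
  fix \<psi> :: "real^2 \<Rightarrow> real" and i j assume \<psi>: "\<psi> \<in> test_funs \<Omega>"
  note \<psi>' = test_funs_partial_deriv[OF \<psi>, of i]
  note n = locally_integrable_nth
  have "(\<integral>x. u x $ j * partial_deriv i \<psi> x \<partial>lebesgue_on \<Omega>) = - (\<integral>x. G x $ j $ i * \<psi> x \<partial>lebesgue_on \<Omega>)"
    "(\<integral>x. v x $ j * partial_deriv i \<psi> x \<partial>lebesgue_on \<Omega>) = - (\<integral>x. H x $ j $ i * \<psi> x \<partial>lebesgue_on \<Omega>)"
    using u v \<psi> unfolding has_weak_grad_def by blast+
  then show "(\<integral>x. (u x - v x) $ j * partial_deriv i \<psi> x \<partial>lebesgue_on \<Omega>) = - (\<integral>x. (G x - H x) $ j $ i * \<psi> x \<partial>lebesgue_on \<Omega>)"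
    using locally_integrable_mult_test[OF \<Omega> n[OF l(1), of j] \<psi>'] locally_integrable_mult_test[OF \<Omega> n[OF l(2), of j] \<psi>']
      locally_integrable_mult_test[OF \<Omega> n[OF n[OF l(3), of j], of i] \<psi>] locally_integrable_mult_test[OF \<Omega> n[OF n[OF l(4), of j], of i] \<psi>]
    by (simp add: left_diff_distrib)
qed

text \<open>Converse of \<open>hdot_conv\<close> for a field whose weak gradient is known. It brings
  differences of test fields and solutions back into \<open>hdot\<close>, where the functionals
  live.\<close>

lemma conv_hdot:
  assumes \<Omega>: "open \<Omega>" and c: "conv \<Omega> \<phi> (cutf \<Omega> u) (cutf \<Omega> G)" and G: "has_weak_grad \<Omega> u G"
  shows "u \<in> hdot \<Omega>" and "L2_norm \<Omega> (weak_grad \<Omega> u) = nrm (cutf \<Omega> G)"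
proof -
  have sb: "\<Omega> \<inter> ball 0 r \<in> sets lebesgue" "\<Omega> \<in> sets lebesgue" for r
    using \<Omega> by (auto intro: open_Int)
  note d = convD[OF c]
  have w: "has_weak_grad \<Omega> u (weak_grad \<Omega> u)"
    unfolding weak_grad_def by (rule someI[of "has_weak_grad \<Omega> u", OF G])
  have ae: "AE x in lebesgue. cutf \<Omega> G x = cutf \<Omega> (weak_grad \<Omega> u) x"
    using has_weak_grad_unique[OF \<Omega> G w] by eventually_elim (auto simp: cutf_def indicator_def)
  have c': "conv \<Omega> \<phi> (cutf \<Omega> u) (cutf \<Omega> (weak_grad \<Omega> u))"
    by (rule conv_cong_AE[OF c _ ae]) simp
  note d' = convD[OF c']
  have c1: "cutf (\<Omega> \<inter> A) f = cutf A (cutf \<Omega> f)" for A and f :: "real^2 \<Rightarrow> real^2"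
    by (auto simp: fun_eq_iff cutf_def indicator_def)
  have e1: "cutf \<Omega> (\<lambda>x. grad (\<phi> n) x - weak_grad \<Omega> u x) = (\<lambda>x. grad (\<phi> n) x - cutf \<Omega> (weak_grad \<Omega> u) x)" for n
    using grad_zero[OF d(2)[of n]] by (auto simp: fun_eq_iff cutf_def indicator_def)
  have e2: "cutf \<Omega> (\<lambda>x. \<phi> n x - u x) = (\<lambda>x. \<phi> n x - cutf \<Omega> u x)" for n
    using test_funs_zero[OF d(2)[of n]] by (auto simp: fun_eq_iff cutf_def indicator_def)
  show "L2_norm \<Omega> (weak_grad \<Omega> u) = nrm (cutf \<Omega> G)"
    using nrm_cong_AE[OF ae] sqint_measurable[OF d(3)] sqint_measurable[OF d'(3)] by (simp add: L2_norm_eq[OF sb(2)])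
  have 1: "u \<in> L2_space (\<Omega> \<inter> ball 0 R)" if R: "R > 0" for R
  proof -
    obtain n :: nat where n: "R < real n" using reals_Archimedean2 by blast
    have "sqint (cutf (ball 0 R) (cutf \<Omega> u))"
      using n by (intro sqint_cutf_mono[OF _ _ d(5)[of n] d(4)]) auto
    then show ?thesis unfolding L2_space_iff[OF sb(1)] c1 .
  qed
  have 2: "(\<lambda>k. L2_norm (\<Omega> \<inter> ball 0 R) (\<lambda>x. \<phi> k x - u x)) \<longlonglongrightarrow> 0" if R: "R > 0" for R
  proof -
    obtain n :: nat where n: "R < real n" using reals_Archimedean2 by blast
    show ?thesis
    proof (rule Lim_null_comparison[OF always_eventually d(7)[of n]], rule allI)
      fix k
      have m: "(\<lambda>x. \<phi> k x - cutf \<Omega> u x) \<in> borel_measurable lebesgue"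
        using sqint_measurable[OF test_funs_sqint[OF d(2)[of k]]] d(4) by (rule borel_measurable_diff)
      show "norm (L2_norm (\<Omega> \<inter> ball 0 R) (\<lambda>x. \<phi> k x - u x)) \<le> nrm (cutf (ball 0 (real n)) (\<lambda>x. \<phi> k x - cutf \<Omega> u x))"
        unfolding L2_norm_eq[OF sb(1)] c1 e2
        using nrm_cutf_mono[OF subset_ball[of R "real n" 0] _ d(11)[of n k] m] n by auto
    qed
  qed
  show "u \<in> hdot \<Omega>"
    unfolding hdot_def
  proof (intro CollectI conjI allI impI exI[of _ \<phi>])
    show "\<exists>G. has_weak_grad \<Omega> u G" using G by blast
    show "weak_grad \<Omega> u \<in> L2_space \<Omega>" using d'(3) by (simp add: L2_space_iff[OF sb(2)])
    show "(\<lambda>n. L2_norm \<Omega> (\<lambda>x. grad (\<phi> n) x - weak_grad \<Omega> u x)) \<longlonglongrightarrow> 0"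
      using d'(6) by (simp add: L2_norm_eq[OF sb(2)] e1)
  qed (use 1 2 d(1) in auto)
qed

text \<open>Functionals are additive only on \<open>hdot\<close>, so the difference of a test field
  and \<open>u\<close> is shown to lie there, and its image is bounded by its Dirichlet norm. The
  bound of a functional comes without a sign, hence \<open>max 0 C\<close>.\<close>

lemma dual_continuous:
  assumes \<Omega>: "open \<Omega>" and f: "f \<in> hdot_dual \<Omega>" and u: "u \<in> hdot \<Omega>"
  shows "\<exists>C\<ge>0. \<forall>\<phi>\<in>test_funs_sol \<Omega>. \<bar>f \<phi> - f u\<bar> \<le> C * nrm (\<lambda>x. grad \<phi> x - cutf \<Omega> (weak_grad \<Omega> u) x)"
proof -
  have "\<exists>C. \<forall>w\<in>hdot \<Omega>. \<bar>f w\<bar> \<le> C * L2_norm \<Omega> (weak_grad \<Omega> w)"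
    using f by (simp add: hdot_dual_def)
  then obtain C where C: "\<And>w. w \<in> hdot \<Omega> \<Longrightarrow> \<bar>f w\<bar> \<le> C * L2_norm \<Omega> (weak_grad \<Omega> w)"
    by blast
  obtain \<eta> where \<eta>: "conv \<Omega> \<eta> (cutf \<Omega> u) (cutf \<Omega> (weak_grad \<Omega> u))" using hdot_conv[OF \<Omega> u] by blast
  have "\<bar>f \<phi> - f u\<bar> \<le> max 0 C * nrm (\<lambda>x. grad \<phi> x - cutf \<Omega> (weak_grad \<Omega> u) x)" if \<phi>: "\<phi> \<in> test_funs_sol \<Omega>" for \<phi>
  proof -
    define w where "w x = \<phi> x - u x" for x
    define H where "H x = grad \<phi> x - weak_grad \<Omega> u x" for x
    have e: "cutf \<Omega> w = (\<lambda>x. \<phi> x - cutf \<Omega> u x)" "cutf \<Omega> H = (\<lambda>x. grad \<phi> x - cutf \<Omega> (weak_grad \<Omega> u) x)"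
      using test_funs_zero[OF sol_test[OF \<phi>]] grad_zero[OF sol_test[OF \<phi>]]
      by (auto simp: fun_eq_iff cutf_def indicator_def w_def H_def)
    have "conv \<Omega> (\<lambda>n x. \<phi> x - \<eta> n x) (cutf \<Omega> w) (cutf \<Omega> H)"
      unfolding e by (rule conv_diff[OF conv_const[OF \<phi>] \<eta>])
    moreover have "has_weak_grad \<Omega> w H"
      unfolding w_def[abs_def] H_def[abs_def]
      by (intro has_weak_grad_diff \<Omega> has_weak_grad_grad sol_test \<phi> has_weak_grad_weak_grad u)
    ultimately have w: "w \<in> hdot \<Omega>" "L2_norm \<Omega> (weak_grad \<Omega> w) = nrm (cutf \<Omega> H)"
      using conv_hdot[OF \<Omega>] by blast+
    have "f (\<lambda>x. w x + u x) = f w + f u" using f w(1) u by (auto simp: hdot_dual_def)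
    then have "f \<phi> - f u = f w" by (simp add: w_def)
    then have "\<bar>f \<phi> - f u\<bar> \<le> C * nrm (cutf \<Omega> H)" using C[OF w(1)] w(2) by simp
    also have "\<dots> \<le> max 0 C * nrm (cutf \<Omega> H)" by (intro mult_right_mono) auto
    finally show ?thesis by (simp add: e)
  qed
  then show ?thesis by (intro exI[of _ "max 0 C"]) auto
qed

lemma AE_lebesgue_on: "open \<Omega> \<Longrightarrow> (AE x in lebesgue_on \<Omega>. P x) \<longleftrightarrow> (AE x in lebesgue. x \<in> \<Omega> \<longrightarrow> P x)"
  by (subst AE_restrict_space_iff) auto

text \<open>The reflections available to both fields at once, one for each component, are collected
  in a map \<open>d\<close>. Extension by zero keeps oddness because the domain is invariant under
  reflections.\<close>

lemma same_symmetry_AE_odd: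
  assumes \<Omega>: "open \<Omega>" "\<And>i x. x \<in> \<Omega> \<Longrightarrow> flip i x \<in> \<Omega>" and s: "same_symmetry \<Omega> u v"
  shows "\<exists>d. AE_odd d (cutf \<Omega> u) \<and> AE_odd d (cutf \<Omega> v)"
proof -
  have inv: "flip i x \<in> \<Omega> \<longleftrightarrow> x \<in> \<Omega>" for i x using \<Omega>(2)[of x i] \<Omega>(2)[of "flip i x" i] by auto
  have o: "AE x in lebesgue. cutf \<Omega> w (flip k x) $ i = - cutf \<Omega> w x $ i"
    if "AE x in lebesgue_on \<Omega>. w x $ i = - w (flip k x) $ i" for w :: "real^2 \<Rightarrow> real^2" and i k
    using that unfolding AE_lebesgue_on[OF \<Omega>(1)]
    by eventually_elim (auto simp: cutf_def indicator_def inv)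
  have "\<exists>k. (AE x in lebesgue. cutf \<Omega> u (flip k x) $ i = - cutf \<Omega> u x $ i) \<and> (AE x in lebesgue. cutf \<Omega> v (flip k x) $ i = - cutf \<Omega> v x $ i)" for i
    using s o unfolding same_symmetry_def odd1_def odd2_def flip1_eq flip2_eq by blast
  then have "\<exists>d. \<forall>i. (AE x in lebesgue. cutf \<Omega> u (flip (d i) x) $ i = - cutf \<Omega> u x $ i) \<and> (AE x in lebesgue. cutf \<Omega> v (flip (d i) x) $ i = - cutf \<Omega> v x $ i)"
    by (rule choice[OF allI])
  then obtain d where "\<And>i. (AE x in lebesgue. cutf \<Omega> u (flip (d i) x) $ i = - cutf \<Omega> u x $ i) \<and> (AE x in lebesgue. cutf \<Omega> v (flip (d i) x) $ i = - cutf \<Omega> v x $ i)"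
    by blast
  then show ?thesis by (auto simp: AE_odd_def)
qed

lemma convection_eq: "convection \<Omega> u x = weak_grad \<Omega> u x *v u x"
  by (simp add: convection_def matrix_vector_mult_def mult.commute)

lemma weak_solution_eq:
  assumes \<Omega>: "open \<Omega>" and s: "symmetric_weak_solution \<Omega> f u" and \<phi>: "\<phi> \<in> test_funs_sol \<Omega>"
  shows "(\<integral>x. cutf \<Omega> (weak_grad \<Omega> u) x \<bullet> grad \<phi> x \<partial>lebesgue) + (\<integral>x. (cutf \<Omega> (weak_grad \<Omega> u) x *v cutf \<Omega> u x) \<bullet> \<phi> x \<partial>lebesgue) = f \<phi>"
proof -
  have "cutf \<Omega> (\<lambda>x. weak_grad \<Omega> u x \<bullet> grad \<phi> x) = (\<lambda>x. cutf \<Omega> (weak_grad \<Omega> u) x \<bullet> grad \<phi> x)"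
    "cutf \<Omega> (\<lambda>x. convection \<Omega> u x \<bullet> \<phi> x) = (\<lambda>x. (cutf \<Omega> (weak_grad \<Omega> u) x *v cutf \<Omega> u x) \<bullet> \<phi> x)"
    using test_funs_zero[OF sol_test[OF \<phi>]] by (auto simp: fun_eq_iff cutf_def convection_eq indicator_def)
  moreover have "\<Omega> \<in> sets lebesgue" using \<Omega> by auto
  ultimately show ?thesis using s \<phi> by (auto simp: symmetric_weak_solution_def integral_lebesgue_on)
qed

section \<open>Solenoidal truncation\<close>

subsection \<open>Cut-off functions\<close>

text \<open>The integral over \<open>{0..s}\<close> is 0 for negative \<open>s\<close>, so the
  vanishing of \<open>b\<close> is what makes the formula differentiable there; from 1 on the
  fundamental theorem applies on an interval around \<open>s\<close>.\<close>

lemma antiderivative_Ck_line: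
  assumes b: "\<And>k. Ck_line k b" and z: "\<And>s. s \<le> 1 \<Longrightarrow> b s = 0"
  shows "Ck_line k (\<lambda>s. integral {0..s} b)"
proof -
  have c: "continuous_on UNIV b" using b[of 0] by simp
  have D: "((\<lambda>s. integral {0..s} b) has_real_derivative b s) (at s)" for s
  proof (cases "s < 1")
    case True
    have "\<forall>\<^sub>F t in nhds s. t < 1" using True by (intro order_tendstoD[OF _ True]) (auto intro: filterlim_ident)
    then have "\<forall>\<^sub>F t in nhds s. integral {0..t} b = 0"
    proof eventually_elim
      case (elim t)
      have "integral {0..t} b = integral {0..t} (\<lambda>_. 0)"
        using elim z by (intro integral_cong) auto
      then show ?case by simp
    qed
    then have "((\<lambda>s. integral {0..s} b) has_real_derivative 0) (at s) \<longleftrightarrow> ((\<lambda>s. 0) has_real_derivative 0) (at s)"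
      by (rule DERIV_cong_ev[OF refl _ refl])
    then show ?thesis using True z by simp
  next
    case False
    have "((\<lambda>s. integral {0..s} b) has_real_derivative b s) (at s within {0..s+1})"
      using c False by (intro integral_has_real_derivative continuous_on_subset[OF c]) auto
    then have "((\<lambda>s. integral {0..s} b) has_real_derivative b s) (at s within {0<..<s+1})"
      by (rule DERIV_subset) auto
    then show ?thesis using False by (simp add: at_within_open[of s "{0<..<s+1}"])
  qed
  show ?thesis
  proof (cases k)
    case 0
    have "continuous_on UNIV (\<lambda>s. integral {0..s} b)"
      using D by (auto intro!: DERIV_continuous_on)
    then show ?thesis by (simp add: 0)
  next
    case (Suc l)
    show ?thesis unfolding Suc by (rule Ck_line_SucI[OF D b])
  qed
qed

text \<open>A bump supported in [1, 2] is integrated and normalised to a step \<open>J\<close> from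
  0 to 1, which is subtracted from 1 on both sides of the origin.\<close>

lemma cutoff_line:
  obtains \<eta> :: "real \<Rightarrow> real" where "\<And>k. Ck_line k \<eta>" "\<And>s. \<bar>s\<bar> \<le> 1 \<Longrightarrow> \<eta> s = 1" "\<And>s. 2 \<le> \<bar>s\<bar> \<Longrightarrow> \<eta> s = 0"
    "\<And>s. 0 \<le> \<eta> s" "\<And>s. \<eta> s \<le> 1"
proof -
  \<comment> \<open>Positive exactly on the open interval from 1 to 2. The arguments are written in
    the affine shape that \<open>Ck_line_affine\<close> requires.\<close>
  define b where "b s = bump_e (-1 + 1 * s) * bump_e (2 + (-1) * s)" for s
  have b: "Ck_line k b" for k
    unfolding b_def[abs_def] by (intro Ck_line_mult Ck_line_affine Ck_line_bump_e)
  have cb: "continuous_on UNIV b" using b[of 0] by simp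
  have b0: "b s = 0" if "s \<le> 1 \<or> 2 \<le> s" for s
    using that by (auto simp: b_def bump_e_bounds)
  have bn: "0 \<le> b s" for s by (simp add: b_def bump_e_bounds)
  have bi: "b integrable_on {u..v}" for u v
    using continuous_on_subset[OF cb] by (intro integrable_continuous_interval) auto
  define c where "c = integral {0..2} b"
  have c: "c > 0"
  proof -
    have "c \<noteq> 0"
    proof
      assume "c = 0"
      then have "(b has_integral 0) (cbox 0 2)" using bi[of 0 2] by (simp add: c_def has_integral_integrable_integral)
      then have "b (3/2) = 0"
        using bn by (intro has_integral_0_cbox_imp_0[where f=b and a=0 and b=2] continuous_on_subset[OF cb]) auto
      then show False by (simp add: b_def bump_e_def)
    qed
    moreover have "0 \<le> c" unfolding c_def by (intro integral_nonneg bi bn)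
    ultimately show ?thesis by simp
  qed
  define J where "J s = (1 / c) * integral {0..s} b" for s
  have J: "Ck_line k J" for k
    unfolding J_def[abs_def] using b b0 by (intro Ck_line_mult Ck_line_const antiderivative_Ck_line) auto
  have J0: "J s = 0" if "s \<le> 1" for s
  proof -
    have "integral {0..s} b = integral {0..s} (\<lambda>_. 0)" using that b0 by (intro integral_cong) auto
    then show ?thesis by (simp add: J_def)
  qed
  have J1: "J s = 1" if "2 \<le> s" for s
  proof -
    have "integral {0..s} b = integral {0..2} b + integral {2..s} b"
      using that bi by (intro Henstock_Kurzweil_Integration.integral_combine[symmetric]) auto
    also have "integral {2..s} b = integral {2..s} (\<lambda>_. 0)" using b0 by (intro integral_cong) auto
    finally show ?thesis using c by (simp add: J_def c_def)
  qed
  have Jn: "0 \<le> J s" for s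
    unfolding J_def using c bn bi by (intro mult_nonneg_nonneg integral_nonneg) auto
  have Jl: "J s \<le> 1" for s
  proof (cases "2 \<le> s")
    case False
    then have "integral {0..s} b \<le> c" unfolding c_def using bn bi by (intro integral_subset_le) auto
    then show ?thesis using c by (simp add: J_def)
  qed (simp add: J1)
  \<comment> \<open>At most one of the two steps is nonzero at any point, so the value stays between
    0 and 1.\<close>
  define \<eta> where "\<eta> s = 1 + (-1) * (J s + J (0 + (-1) * s))" for s
  show ?thesis
  proof (rule that[of \<eta>])
    show "Ck_line k \<eta>" for k
      unfolding \<eta>_def[abs_def] by (intro Ck_line_add Ck_line_mult Ck_line_const J Ck_line_affine)
    show "\<eta> s = 1" if "\<bar>s\<bar> \<le> 1" for s using that by (simp add: \<eta>_def J0)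
    show "\<eta> s = 0" if "2 \<le> \<bar>s\<bar>" for s using that by (cases "0 \<le> s") (auto simp: \<eta>_def J0 J1)
    show "0 \<le> \<eta> s" for s
      using Jl[of s] Jl[of "-s"] by (cases "0 \<le> s") (auto simp: \<eta>_def J0)
    show "\<eta> s \<le> 1" for s
      using Jn[of s] Jn[of "-s"] by (auto simp: \<eta>_def)
  qed
qed

lemma partial_deriv_coord:
  assumes "\<And>s. (f has_real_derivative f' s) (at s)"
  shows "partial_deriv j (\<lambda>x. f (x $ i)) x = (if i = j then f' (x $ i) else 0)"
proof -
  have "((\<lambda>x. f (x $ i)) has_derivative (\<lambda>h. f' (x $ i) * h $ i)) (at x)"
    using has_derivative_compose[OF bounded_linear_imp_has_derivative[OF bounded_linear_vec_nth]
       assms[unfolded has_field_derivative_def]] .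
  from partial_deriv_eqI[OF this] show ?thesis by (auto simp: axis_def)
qed

text \<open>A product of one-variable cut-offs matches the square frames and makes the mixed second
  derivatives visibly equal; this equality is needed for the divergence of the truncated
  fields.\<close>

lemma cutoff_plane:
  "\<exists>\<rho> :: real^2 \<Rightarrow> real. (\<forall>k. Ck k \<rho>) \<and> (\<forall>x. 0 \<le> \<rho> x \<and> \<rho> x \<le> 1) \<and> (\<forall>x. (\<forall>j. \<bar>x $ j\<bar> \<le> 1) \<longrightarrow> \<rho> x = 1) \<and>
     (\<forall>x. (\<exists>j. 2 \<le> \<bar>x $ j\<bar>) \<longrightarrow> \<rho> x = 0) \<and>
     (\<forall>x. partial_deriv 1 (partial_deriv 2 \<rho>) x = partial_deriv 2 (partial_deriv 1 \<rho>) x)"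
proof -
  obtain \<eta> :: "real \<Rightarrow> real" where \<eta>: "\<And>k. Ck_line k \<eta>" "\<And>s. \<bar>s\<bar> \<le> 1 \<Longrightarrow> \<eta> s = 1" "\<And>s. 2 \<le> \<bar>s\<bar> \<Longrightarrow> \<eta> s = 0"
    "\<And>s. 0 \<le> \<eta> s" "\<And>s. \<eta> s \<le> 1" using cutoff_line by metis
  obtain \<eta>' where \<eta>': "\<And>s. (\<eta> has_real_derivative \<eta>' s) (at s)" "Ck_line 1 \<eta>'"
    using \<eta>(1)[of "Suc 1"] by (subst (asm) Ck_line.simps(2)) blast
  obtain \<eta>'' where \<eta>'': "\<And>s. (\<eta>' has_real_derivative \<eta>'' s) (at s)"
    using \<eta>'(2) unfolding One_nat_def Ck_line.simps(2) by blast
  define \<rho> where "\<rho> x = \<eta> (x $ 1) * \<eta> (x $ 2)" for x :: "real^2"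
  have c: "Ck k (\<lambda>x. \<eta> (x $ i))" for k i by (intro Ck_coord \<eta>)
  have c': "Ck (Suc 0) (\<lambda>x. \<eta>' (x $ i))" for i using \<eta>'(2) by (intro Ck_coord) simp
  have p1: "partial_deriv 1 \<rho> = (\<lambda>x. \<eta>' (x $ 1) * \<eta> (x $ 2))"
    unfolding \<rho>_def[abs_def] by (rule ext, subst partial_deriv_mult[OF c c]) (simp add: partial_deriv_coord[OF \<eta>'(1)])
  have p2: "partial_deriv 2 \<rho> = (\<lambda>x. \<eta> (x $ 1) * \<eta>' (x $ 2))"
    unfolding \<rho>_def[abs_def] by (rule ext, subst partial_deriv_mult[OF c c]) (simp add: partial_deriv_coord[OF \<eta>'(1)])
  have p21: "partial_deriv 2 (partial_deriv 1 \<rho>) x = \<eta>' (x $ 1) * \<eta>' (x $ 2)" for x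
    unfolding p1 by (subst partial_deriv_mult[OF c' c]) (simp add: partial_deriv_coord[OF \<eta>'(1)] partial_deriv_coord[OF \<eta>''])
  have p12: "partial_deriv 1 (partial_deriv 2 \<rho>) x = \<eta>' (x $ 1) * \<eta>' (x $ 2)" for x
    unfolding p2 by (subst partial_deriv_mult[OF c c']) (simp add: partial_deriv_coord[OF \<eta>'(1)] partial_deriv_coord[OF \<eta>''])
  show ?thesis
  proof (intro exI[of _ \<rho>] conjI allI impI)
    show "Ck k \<rho>" for k unfolding \<rho>_def[abs_def] by (intro Ck_mult c)
    show "0 \<le> \<rho> x" "\<rho> x \<le> 1" for x unfolding \<rho>_def by (intro mult_nonneg_nonneg mult_le_one \<eta>)+
    show "\<rho> x = 1" if "\<forall>j. \<bar>x $ j\<bar> \<le> 1" for x using that by (simp add: \<rho>_def \<eta>)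
    show "\<rho> x = 0" if "\<exists>j. 2 \<le> \<bar>x $ j\<bar>" for x using that by (auto simp: \<rho>_def \<eta> ex_2)
    show "partial_deriv 1 (partial_deriv 2 \<rho>) x = partial_deriv 2 (partial_deriv 1 \<rho>) x" for x
      by (simp add: p12 p21)
  qed
qed

text \<open>One profile is fixed once and for all, so the derivative bounds for its dilations
  \<open>chi R\<close> have constants independent of \<open>R\<close>.\<close>

definition chi1 :: "real^2 \<Rightarrow> real" where
  "chi1 = (SOME \<rho>. (\<forall>k. Ck k \<rho>) \<and> (\<forall>x. 0 \<le> \<rho> x \<and> \<rho> x \<le> 1) \<and> (\<forall>x. (\<forall>j. \<bar>x $ j\<bar> \<le> 1) \<longrightarrow> \<rho> x = 1) \<and>
     (\<forall>x. (\<exists>j. 2 \<le> \<bar>x $ j\<bar>) \<longrightarrow> \<rho> x = 0) \<and>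
     (\<forall>x. partial_deriv 1 (partial_deriv 2 \<rho>) x = partial_deriv 2 (partial_deriv 1 \<rho>) x))"

lemma chi1: "Ck k chi1" "0 \<le> chi1 x" "chi1 x \<le> 1" "(\<And>j. \<bar>x $ j\<bar> \<le> 1) \<Longrightarrow> chi1 x = 1"
  "2 \<le> \<bar>x $ j\<bar> \<Longrightarrow> chi1 x = 0"
  "partial_deriv 1 (partial_deriv 2 chi1) x = partial_deriv 2 (partial_deriv 1 chi1) x"
  using someI_ex[OF cutoff_plane, folded chi1_def] by blast+

lemma Ck_scale: "Ck k f \<Longrightarrow> Ck k (\<lambda>x. f (a *\<^sub>R x))"
proof (induction k arbitrary: f)
  case 0
  then have "continuous_on UNIV f" by simp
  have "continuous_on UNIV (\<lambda>x::real^2. a *\<^sub>R x)" by (intro continuous_intros)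
  from continuous_on_compose2[OF \<open>continuous_on UNIV f\<close> this] show ?case by simp
next
  case (Suc k)
  have D: "((\<lambda>x. f (a *\<^sub>R x)) has_derivative
       (\<lambda>h. (\<Sum>j\<in>UNIV. ((a *\<^sub>R h) $ j) *\<^sub>R partial_deriv j f (a *\<^sub>R x)))) (at x)" for x
    using has_derivative_compose[OF bounded_linear_imp_has_derivative[OF bounded_linear_scaleR_right] Ck_has_derivative[OF Suc.prems]] .
  show ?case
  proof (rule Ck_SucI[OF D])
    show "Ck k (\<lambda>x. \<Sum>j\<in>UNIV. ((a *\<^sub>R axis l 1) $ j) *\<^sub>R partial_deriv j f (a *\<^sub>R x))" for l
      using Suc by (intro Ck_sum Ck_cmult) (auto simp: Ck.simps)
  qed
qed

lemma partial_deriv_scale: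
  assumes "Ck (Suc 0) f"
  shows "partial_deriv i (\<lambda>x. f (a *\<^sub>R x)) x = a *\<^sub>R partial_deriv i f (a *\<^sub>R x)"
proof -
  have D: "((\<lambda>x. f (a *\<^sub>R x)) has_derivative
       (\<lambda>h. (\<Sum>j\<in>UNIV. ((a *\<^sub>R h) $ j) *\<^sub>R partial_deriv j f (a *\<^sub>R x)))) (at x)"
    using has_derivative_compose[OF bounded_linear_imp_has_derivative[OF bounded_linear_scaleR_right] Ck_has_derivative[OF assms]] .
  have "(\<Sum>j\<in>UNIV. ((a *\<^sub>R axis i 1) $ j) *\<^sub>R partial_deriv j f (a *\<^sub>R x)) = a *\<^sub>R (\<Sum>j\<in>UNIV. (axis i 1 $ j) *\<^sub>R partial_deriv j f (a *\<^sub>R x))"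
    by (simp add: scaleR_sum_right)
  then show ?thesis by (simp add: partial_deriv_eqI[OF D] sum_axis_scaleR)
qed

definition chi :: "real \<Rightarrow> real^2 \<Rightarrow> real" where
  "chi R x = chi1 ((1 / R) *\<^sub>R x)"

lemma Ck_partial_deriv: "(\<And>k. Ck k g) \<Longrightarrow> Ck k (partial_deriv i g)"
  using Ck.simps(2)[of k g] by blast

lemma Ck_chi: "Ck k (chi R)"
  unfolding chi_def[abs_def] by (intro Ck_scale chi1)

lemma chi_bounds: "0 \<le> chi R x" "chi R x \<le> 1"
  by (simp_all add: chi_def chi1)

lemma chi_eq_1: "R > 0 \<Longrightarrow> (\<And>j. \<bar>x $ j\<bar> \<le> R) \<Longrightarrow> chi R x = 1"
  unfolding chi_def by (rule chi1) (simp add: divide_le_eq)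

lemma chi_eq_0: "R > 0 \<Longrightarrow> 2 * R \<le> \<bar>x $ j\<bar> \<Longrightarrow> chi R x = 0"
  unfolding chi_def by (rule chi1(5)[of _ j]) (simp add: le_divide_eq)

lemma chi_deriv: "partial_deriv i (chi R) x = (1 / R) * partial_deriv i chi1 ((1 / R) *\<^sub>R x)"
  unfolding chi_def[abs_def] using partial_deriv_scale[OF chi1(1)] by simp

lemma chi_deriv2: "partial_deriv j (partial_deriv i (chi R)) x = (1 / R)\<^sup>2 * partial_deriv j (partial_deriv i chi1) ((1 / R) *\<^sub>R x)"
proof -
  have "partial_deriv i (chi R) = (\<lambda>x. (1 / R) *\<^sub>R partial_deriv i chi1 ((1 / R) *\<^sub>R x))"
    by (simp add: fun_eq_iff chi_deriv)
  moreover have "partial_deriv j (\<lambda>x. (1 / R) *\<^sub>R partial_deriv i chi1 ((1 / R) *\<^sub>R x)) x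
      = (1 / R) *\<^sub>R partial_deriv j (\<lambda>x. partial_deriv i chi1 ((1 / R) *\<^sub>R x)) x"
    by (rule partial_deriv_cmult[OF Ck_scale[OF Ck_partial_deriv[OF chi1(1)]]])
  moreover have "partial_deriv j (\<lambda>x. partial_deriv i chi1 ((1 / R) *\<^sub>R x)) x
      = (1 / R) *\<^sub>R partial_deriv j (partial_deriv i chi1) ((1 / R) *\<^sub>R x)"
    by (rule partial_deriv_scale[OF Ck_partial_deriv[OF chi1(1)]])
  ultimately show ?thesis by (simp add: power2_eq_square)
qed

lemma chi_mixed: "partial_deriv 1 (partial_deriv 2 (chi R)) x = partial_deriv 2 (partial_deriv 1 (chi R)) x"
  by (simp add: chi_deriv2 chi1)

lemma chi1_test: "chi1 \<in> test_funs UNIV"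
proof (rule test_funsI[where K="cbox (- 2) 2"])
  show "chi1 x = 0" if "x \<notin> cbox (- 2) 2" for x
  proof -
    obtain j where "\<not> (- 2 \<le> x $ j \<and> x $ j \<le> 2)" using \<open>x \<notin> cbox (- 2) 2\<close> by (auto simp: mem_box_cart)
    then have "2 \<le> \<bar>x $ j\<bar>" by linarith
    then show ?thesis by (rule chi1)
  qed
qed (auto intro: chi1)

text \<open>Each derivative of the dilation brings a factor 1 / R, and the derivatives of the
  profile are continuous with compact support, hence bounded. Summing over the indices gives one
  constant.\<close>

lemma chi_deriv_bounds:
  obtains K where "K \<ge> 1" "\<And>R i x. R > 0 \<Longrightarrow> \<bar>partial_deriv i (chi R) x\<bar> \<le> K / R"
    "\<And>R i j x. R > 0 \<Longrightarrow> \<bar>partial_deriv j (partial_deriv i (chi R)) x\<bar> \<le> K / R\<^sup>2"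
proof -
  have "\<exists>B. \<forall>x. \<bar>partial_deriv i chi1 x\<bar> \<le> B" for i
    using test_funs_bounded[OF test_funs_partial_deriv[OF chi1_test, of i]] by (metis real_norm_def)
  then obtain B where B: "\<And>i x. \<bar>partial_deriv i chi1 x\<bar> \<le> B i" by metis
  have "\<exists>B. \<forall>x. \<bar>partial_deriv j (partial_deriv i chi1) x\<bar> \<le> B" for i j
    using test_funs_bounded[OF test_funs_partial_deriv[OF test_funs_partial_deriv[OF chi1_test, of i], of j]] by (metis real_norm_def)
  then have "\<forall>i. \<exists>g. \<forall>j. \<forall>x. \<bar>partial_deriv j (partial_deriv i chi1) x\<bar> \<le> g j"
    by (intro allI choice)
  then have "\<exists>D. \<forall>i. \<forall>j. \<forall>x. \<bar>partial_deriv j (partial_deriv i chi1) x\<bar> \<le> D i j"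
    by (rule choice)
  then obtain D where D: "\<And>i j x. \<bar>partial_deriv j (partial_deriv i chi1) x\<bar> \<le> D i j" by blast
  have Bn: "0 \<le> B i" for i using B[of i 0] by linarith
  have Dn: "0 \<le> D i j" for i j using D[where i=i and j=j and x=0] by linarith
  define K where "K = 1 + (\<Sum>i\<in>UNIV. B i) + (\<Sum>i\<in>UNIV. \<Sum>j\<in>UNIV. D i j)"
  have SD: "0 \<le> (\<Sum>i\<in>UNIV. \<Sum>j\<in>UNIV. D i j)" by (intro sum_nonneg Dn)
  have SB: "0 \<le> (\<Sum>i\<in>UNIV. B i)" by (intro sum_nonneg Bn)
  have BK: "B i \<le> K" for i
    using member_le_sum[of i UNIV B] Bn SD unfolding K_def by simp
  have DK: "D i j \<le> K" for i j
  proof -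
    have "D i j \<le> (\<Sum>j\<in>UNIV. D i j)" using Dn by (intro member_le_sum) auto
    also have "\<dots> \<le> (\<Sum>i\<in>UNIV. \<Sum>j\<in>UNIV. D i j)" using Dn by (intro member_le_sum[of i UNIV "\<lambda>i. \<Sum>j\<in>UNIV. D i j"]) (auto intro: sum_nonneg)
    also have "\<dots> \<le> K" using SB by (simp add: K_def)
    finally show ?thesis .
  qed
  show ?thesis
  proof (rule that)
    show "1 \<le> K" using SB SD unfolding K_def by linarith
    show "\<bar>partial_deriv i (chi R) x\<bar> \<le> K / R" if "R > 0" for R i x
      using order_trans[OF B[of i "(1/R) *\<^sub>R x"] BK] that by (simp add: chi_deriv abs_mult divide_right_mono)
    show "\<bar>partial_deriv j (partial_deriv i (chi R)) x\<bar> \<le> K / R\<^sup>2" if "R > 0" for R i j x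
      using order_trans[OF D[where i=i and j=j and x="(1/R) *\<^sub>R x"] DK] that by (simp add: chi_deriv2 abs_mult divide_right_mono power_divide)
  qed
qed

text \<open>\<open>chi R\<close> is locally constant off the frame, 0 outside the large square and 1
  inside the small one; vanishing of the first derivatives on a neighbourhood also settles the
  second ones.\<close>

lemma chi_deriv_frame:
  assumes R: "R > 0" and x: "x \<notin> frame R"
  shows "partial_deriv i (chi R) x = 0" and "partial_deriv j (partial_deriv i (chi R)) x = 0"
proof -
  have "\<exists>U. open U \<and> x \<in> U \<and> (\<forall>y\<in>U. partial_deriv i (chi R) y = 0)"
  proof (cases "\<exists>l. 2 * R < \<bar>x $ l\<bar>")
    case True
    then obtain l where l: "2 * R < \<bar>x $ l\<bar>" by blast
    let ?U = "{y::real^2. 2 * R < \<bar>y $ l\<bar>}"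
    have o: "open ?U" by (intro open_Collect_less continuous_intros)
    have "partial_deriv i (chi R) y = 0" if "y \<in> ?U" for y
      using that R by (intro partial_deriv_zero_open[OF o that]) (auto intro!: chi_eq_0[of R _ l])
    then show ?thesis using o l by blast
  next
    case False
    then have lt: "\<bar>x $ l\<bar> < R" for l using x by (auto simp: frame_def not_le not_less)
    let ?U = "{y::real^2. \<bar>y $ 1\<bar> < R} \<inter> {y. \<bar>y $ 2\<bar> < R}"
    have o: "open ?U" by (intro open_Int open_Collect_less continuous_intros)
    have "partial_deriv i (chi R) y = 0" if y: "y \<in> ?U" for y
    proof -
      have z: "chi R z = 1" if "z \<in> ?U" for z
      proof (rule chi_eq_1[OF R])
        fix l show "\<bar>z $ l\<bar> \<le> R" using that exhaust_2[of l] by auto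
      qed
      have "partial_deriv i (\<lambda>z. chi R z - 1) y = 0"
        by (rule partial_deriv_zero_open[OF o y]) (simp add: z)
      then show ?thesis using partial_deriv_diff[OF Ck_chi Ck_const, of i R 1 y] by simp
    qed
    then show ?thesis using o lt by blast
  qed
  then obtain U where U: "open U" "x \<in> U" "\<And>y. y \<in> U \<Longrightarrow> partial_deriv i (chi R) y = 0" by blast
  show "partial_deriv i (chi R) x = 0" by (rule U(3)[OF U(2)])
  show "partial_deriv j (partial_deriv i (chi R)) x = 0" by (rule partial_deriv_zero_open[OF U])
qed

subsection \<open>Stream functions\<close>

text \<open>The homotopy formula of the Poincare lemma,
  \<open>\<psi> x = \<integral>\<^sub>0\<^sup>1 (\<phi>\<^sub>1 (t x) x\<^sub>2 - \<phi>\<^sub>2 (t x) x\<^sub>1) dt\<close>.\<close>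

lemma stream_function:
  assumes \<phi>: "\<phi> \<in> test_funs_sol \<Omega>"
  obtains \<psi> where "\<And>k. Ck k \<psi>" "\<And>x. partial_deriv 1 \<psi> x = - \<phi> x $ 2" "\<And>x. partial_deriv 2 \<psi> x = \<phi> x $ 1"
proof -
  have Ckn: "Ck k (\<lambda>x. \<phi> x $ j)" for k j by (intro Ck_nth sol_Ck[OF \<phi>])
  define p where "p i j x = partial_deriv i (\<lambda>x. \<phi> x $ j) x" for i j x
  have div: "p 1 1 x = - p 2 2 x" for x
    using sol_div[OF \<phi>, of x] by (simp add: sum_2 grad_nth p_def)
  have cp: "continuous_on UNIV (p i j)" for i j
    unfolding p_def[abs_def] by (rule continuous_partial_deriv[OF Ckn])
  have cn: "continuous_on UNIV (\<lambda>x. \<phi> x $ j)" for j by (rule Ck_imp_continuous[OF Ckn])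
  have dphi: "((\<lambda>x. \<phi> x $ j) has_derivative (\<lambda>h. h $ 1 * p 1 j x + h $ 2 * p 2 j x)) (at x)" for j x
    using Ck1_has_derivative[OF Ckn, of j x] by (simp add: sum_2 p_def)
  define F where "F x t = \<phi> (t *\<^sub>R x) $ 1 * x $ 2 - \<phi> (t *\<^sub>R x) $ 2 * x $ 1" for x :: "real^2" and t :: real
  \<comment> \<open>The derivative in \<open>t\<close> of
    \<open>t * \<phi> (t *\<^sub>R x) $ j\<close>; integrated over the unit interval it returns
    \<open>\<phi> x $ j\<close>.\<close>
  define E where "E j x t = \<phi> (t *\<^sub>R x) $ j + t * (x $ 1 * p 1 j (t *\<^sub>R x) + x $ 2 * p 2 j (t *\<^sub>R x))" for j x and t :: real
  \<comment> \<open>\<open>leibniz_rule\<close> expects the derivative as a bounded linear function,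
    so the coordinate functionals are taken in that type.\<close>
  define B where "B j = Blinfun (\<lambda>h::real^2. h $ j)" for j
  have B: "blinfun_apply (B j) h = h $ j" for j h
    unfolding B_def by (simp add: bounded_linear_Blinfun_apply bounded_linear_vec_nth)
  define FX where "FX x t = E 1 x t *\<^sub>R B 2 - E 2 x t *\<^sub>R B 1" for x t
  have dscale: "((\<lambda>x. \<phi> (t *\<^sub>R x) $ j) has_derivative (\<lambda>h. (t *\<^sub>R h) $ 1 * p 1 j (t *\<^sub>R x) + (t *\<^sub>R h) $ 2 * p 2 j (t *\<^sub>R x))) (at x)" for t j x
    using has_derivative_compose[OF bounded_linear_imp_has_derivative[OF bounded_linear_scaleR_right] dphi] .
  have FD: "((\<lambda>x. F x t) has_derivative blinfun_apply (FX x t)) (at x)" for x t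
  proof -
    have "((\<lambda>x. F x t) has_derivative (\<lambda>h.
        (\<phi> (t *\<^sub>R x) $ 1 * h $ 2 + ((t *\<^sub>R h) $ 1 * p 1 1 (t *\<^sub>R x) + (t *\<^sub>R h) $ 2 * p 2 1 (t *\<^sub>R x)) * x $ 2)
      - (\<phi> (t *\<^sub>R x) $ 2 * h $ 1 + ((t *\<^sub>R h) $ 1 * p 1 2 (t *\<^sub>R x) + (t *\<^sub>R h) $ 2 * p 2 2 (t *\<^sub>R x)) * x $ 1))) (at x)"
      unfolding F_def
      by (intro has_derivative_diff has_derivative_mult dscale bounded_linear_imp_has_derivative bounded_linear_vec_nth)
    moreover have "(\<phi> (t *\<^sub>R x) $ 1 * h $ 2 + ((t *\<^sub>R h) $ 1 * p 1 1 (t *\<^sub>R x) + (t *\<^sub>R h) $ 2 * p 2 1 (t *\<^sub>R x)) * x $ 2)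
      - (\<phi> (t *\<^sub>R x) $ 2 * h $ 1 + ((t *\<^sub>R h) $ 1 * p 1 2 (t *\<^sub>R x) + (t *\<^sub>R h) $ 2 * p 2 2 (t *\<^sub>R x)) * x $ 1)
      = blinfun_apply (FX x t) h" for h
    proof -
      \<comment> \<open>Zero divergence enters here: it turns the derivative of the integrand into a
        combination of \<open>E 1\<close> and \<open>E 2\<close>.\<close>
      have "p 2 2 (t *\<^sub>R x) = - p 1 1 (t *\<^sub>R x)" using div by simp
      moreover have "blinfun_apply (FX x t) h = E 1 x t * h $ 2 - E 2 x t * h $ 1"
        by (simp add: FX_def B blinfun.diff_left blinfun.scaleR_left)
      ultimately show ?thesis
        by (simp add: E_def algebra_simps)
    qed
    ultimately show ?thesis by simp
  qed
  have c2: "continuous_on S (\<lambda>z. g (f z))" if "continuous_on UNIV g" "continuous_on S f" for S :: "'z::topological_space set" and f :: "'z \<Rightarrow> real^2" and g :: "real^2 \<Rightarrow> real"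
    using continuous_on_compose2[OF that] by simp
  have cF: "continuous_on {0..1} (F x)" for x
    unfolding F_def[abs_def] by (intro continuous_intros c2[OF cn])
  have cE: "continuous_on S (\<lambda>z. E j (fst z) (snd z))" for S j
    unfolding E_def by (intro continuous_intros c2[OF cn] c2[OF cp])
  have cE1: "continuous_on S (E j x)" for S j x
    unfolding E_def[abs_def] by (intro continuous_intros c2[OF cn] c2[OF cp])
  define \<psi> where "\<psi> x = integral (cbox 0 1) (F x)" for x
  have intE: "integral (cbox 0 1) (E j x) = \<phi> x $ j" for j x
  proof -
    have "(E j x has_integral (1 * \<phi> (1 *\<^sub>R x) $ j - 0 * \<phi> (0 *\<^sub>R x) $ j)) {0..1}"
    proof (rule fundamental_theorem_of_calculus)
      fix t :: real
      have "((\<lambda>t. t *\<^sub>R x) has_derivative (\<lambda>s. s *\<^sub>R x)) (at t)"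
        by (auto intro!: derivative_eq_intros)
      from has_derivative_compose[OF this dphi, of j]
      have "((\<lambda>t. t * \<phi> (t *\<^sub>R x) $ j) has_derivative (\<lambda>s. t * ((s *\<^sub>R x) $ 1 * p 1 j (t *\<^sub>R x) + (s *\<^sub>R x) $ 2 * p 2 j (t *\<^sub>R x)) + s * \<phi> (t *\<^sub>R x) $ j)) (at t)"
        by (intro has_derivative_mult has_derivative_ident)
      also have "(\<lambda>s. t * ((s *\<^sub>R x) $ 1 * p 1 j (t *\<^sub>R x) + (s *\<^sub>R x) $ 2 * p 2 j (t *\<^sub>R x)) + s * \<phi> (t *\<^sub>R x) $ j) = (\<lambda>s. s *\<^sub>R E j x t)"
        by (simp add: fun_eq_iff E_def algebra_simps)
      finally show "((\<lambda>t. t * \<phi> (t *\<^sub>R x) $ j) has_vector_derivative E j x t) (at t within {0..1})"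
        unfolding has_vector_derivative_def by (rule has_derivative_at_withinI)
    qed simp
    then show ?thesis by (simp add: integral_unique)
  qed
  have D: "(\<psi> has_derivative (\<lambda>h. \<phi> x $ 1 * h $ 2 - \<phi> x $ 2 * h $ 1)) (at x)" for x
  proof -
    have "((\<lambda>x. integral (cbox 0 1) (F x)) has_derivative blinfun_apply (integral (cbox 0 1) (FX x))) (at x within UNIV)"
    proof (rule leibniz_rule)
      show "((\<lambda>x. F x t) has_derivative blinfun_apply (FX x t)) (at x within UNIV)" for x t using FD by simp
      show "F x integrable_on cbox 0 1" for x using cF by (simp add: integrable_continuous_interval)
      show "continuous_on (UNIV \<times> cbox 0 1) (\<lambda>(x, t). FX x t)"
        unfolding FX_def case_prod_beta' by (intro continuous_intros cE)
    qed auto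
    moreover have "integral (cbox 0 1) (FX x) = \<phi> x $ 1 *\<^sub>R B 2 - \<phi> x $ 2 *\<^sub>R B 1"
    proof -
      have i: "(\<lambda>t. E j x t *\<^sub>R b) integrable_on cbox 0 1" for j and b :: "(real^2) \<Rightarrow>\<^sub>L real"
        by (intro integrable_continuous continuous_intros cE1)
      have "E j x integrable_on cbox 0 1" for j by (intro integrable_continuous cE1)
      then have "integral (cbox 0 1) (\<lambda>t. E j x t *\<^sub>R b) = \<phi> x $ j *\<^sub>R b" for j and b :: "(real^2) \<Rightarrow>\<^sub>L real"
        by (subst intE[symmetric], intro integral_unique has_integral_scaleR_left) (simp add: integrable_integral)
      then show ?thesis unfolding FX_def[abs_def] using i by (simp add: integral_diff)
    qed
    moreover have "blinfun_apply (\<phi> x $ 1 *\<^sub>R B 2 - \<phi> x $ 2 *\<^sub>R B 1) = (\<lambda>h. \<phi> x $ 1 * h $ 2 - \<phi> x $ 2 * h $ 1)"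
      by (simp add: fun_eq_iff B blinfun.diff_left blinfun.scaleR_left)
    ultimately show ?thesis by (simp add: \<psi>_def[abs_def])
  qed
  show ?thesis
  proof (rule that[of \<psi>])
    show "Ck k \<psi>" for k
    proof -
      have "Ck (Suc k) \<psi>"
      proof (rule Ck_SucI[OF D])
        show "Ck k (\<lambda>x. \<phi> x $ 1 * axis i 1 $ 2 - \<phi> x $ 2 * axis i 1 $ 1)" for i
          by (intro Ck_diff Ck_mult Ckn Ck_const)
      qed
      then show ?thesis by (rule Ck_SucD)
    qed
    show "partial_deriv 1 \<psi> x = - \<phi> x $ 2" "partial_deriv 2 \<psi> x = \<phi> x $ 1" for x
      by (simp_all add: partial_deriv_eqI[OF D] axis_def)
  qed
qed

subsection \<open>Estimates for truncated fields\<close>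

definition chiK :: real where
  "chiK = (SOME K. K \<ge> 1 \<and> (\<forall>R i x. R > 0 \<longrightarrow> \<bar>partial_deriv i (chi R) x\<bar> \<le> K / R) \<and>
    (\<forall>R i j x. R > 0 \<longrightarrow> \<bar>partial_deriv j (partial_deriv i (chi R)) x\<bar> \<le> K / R\<^sup>2))"

lemma chiK: "chiK \<ge> 1" "R > 0 \<Longrightarrow> \<bar>partial_deriv i (chi R) x\<bar> \<le> chiK / R"
  "R > 0 \<Longrightarrow> \<bar>partial_deriv j (partial_deriv i (chi R)) x\<bar> \<le> chiK / R\<^sup>2"
proof -
  obtain K where "K \<ge> 1 \<and> (\<forall>R i x. R > 0 \<longrightarrow> \<bar>partial_deriv i (chi R) x\<bar> \<le> K / R) \<and>
    (\<forall>R i j x. R > 0 \<longrightarrow> \<bar>partial_deriv j (partial_deriv i (chi R)) x\<bar> \<le> K / R\<^sup>2)"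
    using chi_deriv_bounds by metis
  from someI[of "\<lambda>K. K \<ge> 1 \<and> (\<forall>R i x. R > 0 \<longrightarrow> \<bar>partial_deriv i (chi R) x\<bar> \<le> K / R) \<and>
    (\<forall>R i j x. R > 0 \<longrightarrow> \<bar>partial_deriv j (partial_deriv i (chi R)) x\<bar> \<le> K / R\<^sup>2)", OF this]
  show "chiK \<ge> 1" "R > 0 \<Longrightarrow> \<bar>partial_deriv i (chi R) x\<bar> \<le> chiK / R"
    "R > 0 \<Longrightarrow> \<bar>partial_deriv j (partial_deriv i (chi R)) x\<bar> \<le> chiK / R\<^sup>2"
    unfolding chiK_def[symmetric] by blast+
qed

lemma norm_le_sum_nth: "norm (x :: 'b::euclidean_space^2) \<le> (\<Sum>j\<in>UNIV. norm (x $ j))"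
  unfolding norm_vec_def by (rule L2_set_le_sum) simp

lemma norm_plane_le: "(\<And>j. \<bar>x $ j\<bar> \<le> r) \<Longrightarrow> norm (x :: real^2) \<le> 2 * r"
  using norm_le_sum_nth[of x] sum_mono[of UNIV "\<lambda>j. norm (x $ j)" "\<lambda>_. r"] by simp

lemma chi_supp: "R > 0 \<Longrightarrow> chi R x \<noteq> 0 \<Longrightarrow> norm x \<le> 4 * R"
proof -
  assume R: "R > 0" "chi R x \<noteq> 0"
  have "\<bar>x $ j\<bar> \<le> 2 * R" for j
    using chi_eq_0[OF R(1), of x j] R(2) by (cases "2 * R \<le> \<bar>x $ j\<bar>") auto
  then show ?thesis using norm_plane_le[of x "2 * R"] by simp
qed

lemma frame_norm: "x \<in> frame R \<Longrightarrow> norm x \<le> 4 * R" "x \<in> frame R \<Longrightarrow> R \<le> norm x"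
proof -
  show "x \<in> frame R \<Longrightarrow> norm x \<le> 4 * R" using norm_plane_le[of x "2 * R"] by (auto simp: frame_def)
  show "x \<in> frame R \<Longrightarrow> R \<le> norm x" using component_le_norm_cart[of x] by (auto simp: frame_def intro: order_trans)
qed

lemma continuous_chi: "continuous_on A (chi R)"
  using continuous_on_subset[OF Ck_imp_continuous[OF Ck_chi[of 0]]] by blast

lemma norm_wt_eq: "norm (f x) = (1 + norm x) * norm (wt f x)"
  using one_plus_norm_neq_0[of x] by (simp add: norm_wt)

text \<open>On the support of \<open>chi R\<close> one has \<open>1 + norm x \<le> 5 * R\<close>, so
  passing to the weighted norm loses a factor R, and Hardy's inequality adds the factor 2. In the
  derivative this loss is cancelled by the factor 1 / R from \<open>chi R\<close>, so the gradient
  bound is uniform in \<open>R\<close>.\<close>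

lemma chi_component_bounds:
  assumes \<phi>: "\<phi> \<in> test_funs \<Omega>" and odd: "odd_vf d \<phi>" and R: "R \<ge> 1"
  shows "(\<lambda>x. \<phi> x $ j * chi R x) \<in> test_funs \<Omega>"
    "nrm (\<lambda>x. \<phi> x $ j * chi R x) \<le> 10 * R * nrm (grad \<phi>)"
    "nrm (partial_deriv i (\<lambda>x. \<phi> x $ j * chi R x)) \<le> (1 + 10 * chiK) * nrm (grad \<phi>)"
proof -
  have R0: "R > 0" using R by simp
  show t: "(\<lambda>x. \<phi> x $ j * chi R x) \<in> test_funs \<Omega>"
    by (intro test_funs_mult test_funs_nth \<phi> Ck_chi)
  have sw: "sqint (wt \<phi>)" by (intro sqint_wt test_funs_sqint[OF \<phi>])
  have h: "nrm (wt \<phi>) \<le> 2 * nrm (grad \<phi>)" by (rule hardy_vector[OF \<phi> odd])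
  have "norm (\<phi> x $ j * chi R x) \<le> (5 * R) * norm (wt \<phi> x)" for x
  proof (cases "chi R x = 0")
    case False
    have "\<bar>\<phi> x $ j\<bar> * chi R x \<le> norm (\<phi> x) * 1"
      using chi_bounds[of R x] component_le_norm_cart[of "\<phi> x" j] by (intro mult_mono) auto
    also have "\<dots> = (1 + norm x) * norm (wt \<phi> x)" using norm_wt_eq[of \<phi> x] by simp
    also have "\<dots> \<le> (5 * R) * norm (wt \<phi> x)"
      using chi_supp[OF R0 False] R by (intro mult_right_mono) auto
    finally show ?thesis using chi_bounds[of R x] by (simp add: abs_mult)
  qed (use R in simp)
  then have "nrm (\<lambda>x. \<phi> x $ j * chi R x) \<le> (5 * R) * nrm (wt \<phi>)"
    using R by (intro nrm_dominated[OF sw sqint_measurable[OF test_funs_sqint[OF t]]] AE_I2) auto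
  also have "\<dots> \<le> (5 * R) * (2 * nrm (grad \<phi>))" using h R by (intro mult_left_mono) auto
  finally show "nrm (\<lambda>x. \<phi> x $ j * chi R x) \<le> 10 * R * nrm (grad \<phi>)" by simp
  have pd: "partial_deriv i (\<lambda>x. \<phi> x $ j * chi R x) = (\<lambda>x. \<phi> x $ j * partial_deriv i (chi R) x + grad \<phi> x $ j $ i * chi R x)"
    by (rule ext, subst partial_deriv_mult[OF Ck_nth[OF test_funs_Ck[OF \<phi>]] Ck_chi]) (simp add: grad_nth)
  have c1: "continuous_on UNIV (\<lambda>x. \<phi> x $ j * partial_deriv i (chi R) x)" "continuous_on UNIV (\<lambda>x. grad \<phi> x $ j $ i * chi R x)"
    by (intro continuous_intros test_funs_continuous[OF \<phi>] grad_continuous[OF \<phi>] continuous_chi continuous_partial_deriv[OF Ck_chi])+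
  have b1: "norm (\<phi> x $ j * partial_deriv i (chi R) x) \<le> (5 * chiK) * norm (wt \<phi> x)" for x
  proof (cases "x \<in> frame R")
    case True
    have "\<bar>\<phi> x $ j\<bar> * \<bar>partial_deriv i (chi R) x\<bar> \<le> norm (\<phi> x) * (chiK / R)"
      using chiK(2)[OF R0, of i x] component_le_norm_cart[of "\<phi> x" j] by (intro mult_mono) auto
    also have "\<dots> = (1 + norm x) * (chiK / R) * norm (wt \<phi> x)" using norm_wt_eq[of \<phi> x] by simp
    also have "\<dots> \<le> (5 * R) * (chiK / R) * norm (wt \<phi> x)"
      using frame_norm(1)[OF True] R chiK(1) by (intro mult_right_mono) auto
    finally show ?thesis using R by (simp add: abs_mult)
  next
    case False
    then show ?thesis using chi_deriv_frame(1)[OF R0 False, of i] chiK(1) by simp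
  qed
  have b2: "norm (grad \<phi> x $ j $ i * chi R x) \<le> 1 * norm (grad \<phi> x)" for x
  proof -
    have "\<bar>grad \<phi> x $ j $ i\<bar> \<le> norm (grad \<phi> x)"
      using component_le_norm_cart[of "grad \<phi> x $ j" i] Finite_Cartesian_Product.norm_nth_le[of "grad \<phi> x" j] by linarith
    then have "\<bar>grad \<phi> x $ j $ i\<bar> * chi R x \<le> norm (grad \<phi> x) * 1"
      using chi_bounds[of R x] by (intro mult_mono) auto
    then show ?thesis using chi_bounds[of R x] by (simp add: abs_mult)
  qed
  have s1: "sqint (\<lambda>x. \<phi> x $ j * partial_deriv i (chi R) x)"
    by (rule sqint_dominated[OF sw borel_measurable_lebesgue_continuous[OF c1(1)] AE_I2[OF b1]])
  have s2: "sqint (\<lambda>x. grad \<phi> x $ j $ i * chi R x)"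
    by (rule sqint_dominated[OF grad_sqint[OF \<phi>] borel_measurable_lebesgue_continuous[OF c1(2)] AE_I2[OF b2]])
  have "nrm (partial_deriv i (\<lambda>x. \<phi> x $ j * chi R x)) \<le> nrm (\<lambda>x. \<phi> x $ j * partial_deriv i (chi R) x) + nrm (\<lambda>x. grad \<phi> x $ j $ i * chi R x)"
    unfolding pd by (rule nrm_triangle[OF s1 s2])
  also have "\<dots> \<le> (5 * chiK) * nrm (wt \<phi>) + 1 * nrm (grad \<phi>)"
    using chiK(1) by (intro add_mono nrm_dominated[OF sw borel_measurable_lebesgue_continuous[OF c1(1)] AE_I2[OF b1]]
      nrm_dominated[OF grad_sqint[OF \<phi>] borel_measurable_lebesgue_continuous[OF c1(2)] AE_I2[OF b2]]) auto
  also have "\<dots> \<le> (5 * chiK) * (2 * nrm (grad \<phi>)) + 1 * nrm (grad \<phi>)"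
    using h chiK(1) by (intro add_mono mult_left_mono) auto
  finally show "nrm (partial_deriv i (\<lambda>x. \<phi> x $ j * chi R x)) \<le> (1 + 10 * chiK) * nrm (grad \<phi>)"
    by (simp add: algebra_simps)
qed

lemma integral_abs_mult_le:
  fixes f g :: "real^2 \<Rightarrow> real"
  assumes "f \<in> test_funs \<Omega>" "g \<in> test_funs \<Omega>"
  shows "(\<integral>x. \<bar>f x * g x\<bar> \<partial>lborel) \<le> nrm f * nrm g"
proof -
  have "(\<integral>x. \<bar>f x * g x\<bar> \<partial>lborel) = (\<integral>x. \<bar>f x * g x\<bar> \<partial>lebesgue)"
    by (intro integral_lebesgue_continuous[symmetric] continuous_intros test_funs_continuous[OF assms(1)] test_funs_continuous[OF assms(2)])
  also have "\<dots> \<le> nrm f * nrm g"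
    using sqint_norm_mult(2)[OF test_funs_sqint[OF assms(1)] test_funs_sqint[OF assms(2)]] by (simp add: abs_mult)
  finally show ?thesis .
qed

text \<open>Ladyzhenskaya's estimate \<open>product_plane\<close> for \<open>b\<close> and a
  component of \<open>\<phi>\<close> multiplied by \<open>chi (2 * R)\<close>, which is 1 where
  \<open>b\<close> is nonzero. The factor R comes from \<open>chi_component_bounds\<close> at the
  radius \<open>2 * R\<close>; 160 is 2 components times 4 times 10 * 2.\<close>

lemma product_bound_test:
  fixes b :: "real^2 \<Rightarrow> real"
  assumes \<phi>: "\<phi> \<in> test_funs \<Omega>" and odd: "odd_vf d \<phi>" and R: "R \<ge> 1"
    and b: "b \<in> test_funs UNIV" "\<And>x j. 2 * R < \<bar>x $ j\<bar> \<Longrightarrow> b x = 0"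
  shows "(nrm (\<lambda>x. b x *\<^sub>R \<phi> x))\<^sup>2 \<le> 160 * (1 + 10 * chiK) * R * (nrm (grad \<phi>))\<^sup>2 * (nrm b * nrm (partial_deriv 1 b))"
proof -
  have R2: "2 * R \<ge> 1" "2 * R > 0" using R by auto
  have cb: "continuous_on UNIV b" by (rule test_funs_continuous[OF b(1)])
  have "sqint (\<lambda>x. b x *\<^sub>R \<phi> x)"
  proof -
    obtain r where r: "\<And>x. r < norm x \<Longrightarrow> \<phi> x = 0" using test_funs_far[OF \<phi>] by metis
    show ?thesis by (rule sqint_cs[where R=r]) (auto intro!: continuous_intros cb test_funs_continuous[OF \<phi>] simp: r)
  qed
  from nrm_vec_sq[OF this]
  have "(nrm (\<lambda>x. b x *\<^sub>R \<phi> x))\<^sup>2 = (\<Sum>j\<in>UNIV. (nrm (\<lambda>x. b x * \<phi> x $ j))\<^sup>2)" by simp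
  also have "\<dots> \<le> (\<Sum>j\<in>(UNIV::2 set). 4 * (20 * R * nrm (grad \<phi>) * ((1 + 10 * chiK) * nrm (grad \<phi>))) * (nrm b * nrm (partial_deriv 1 b)))"
  proof (rule sum_mono)
    fix j
    define a where "a x = \<phi> x $ j * chi (2 * R) x" for x
    note e = chi_component_bounds[OF \<phi> odd R2(1), where j=j]
    have at: "a \<in> test_funs \<Omega>" using e(1) by (simp add: a_def[abs_def])
    obtain ra where ra: "\<And>x. ra < norm x \<Longrightarrow> a x = 0" using test_funs_far[OF at] by metis
    obtain rb where rb: "\<And>x. rb < norm x \<Longrightarrow> b x = 0" using test_funs_far[OF b(1)] by metis
    have "norm (b x * \<phi> x $ j) = \<bar>a x * b x\<bar>" for x
    proof (cases "b x = 0")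
      case False
      then have "chi (2 * R) x = 1" using b(2) R by (intro chi_eq_1) (auto simp: not_less[symmetric])
      then show ?thesis by (simp add: a_def mult.commute)
    qed simp
    then have "(nrm (\<lambda>x. b x * \<phi> x $ j))\<^sup>2 = (\<integral>x. (a x * b x)\<^sup>2 \<partial>lebesgue)"
      by (simp add: nrm_sq)
    also have "\<dots> = (\<integral>x. (a x * b x)\<^sup>2 \<partial>lborel)"
      by (intro integral_lebesgue_continuous continuous_intros cb test_funs_continuous[OF at])
    also have "\<dots> \<le> 4 * (\<integral>x. \<bar>a x * partial_deriv 2 a x\<bar> \<partial>lborel) * (\<integral>x. \<bar>b x * partial_deriv 1 b x\<bar> \<partial>lborel)"
      by (rule product_plane[where R="max ra rb"]) (auto intro: test_funs_Ck[OF at] test_funs_Ck[OF b(1)] ra rb)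
    also have "\<dots> \<le> 4 * (nrm a * nrm (partial_deriv 2 a)) * (nrm b * nrm (partial_deriv 1 b))"
      by (intro mult_mono integral_abs_mult_le[OF at test_funs_partial_deriv[OF at]] integral_abs_mult_le[OF b(1) test_funs_partial_deriv[OF b(1)]])
         (auto intro!: integral_nonneg)
    also have "\<dots> \<le> 4 * (20 * R * nrm (grad \<phi>) * ((1 + 10 * chiK) * nrm (grad \<phi>))) * (nrm b * nrm (partial_deriv 1 b))"
      using e(2) e(3)[where i=2] R chiK(1) by (intro mult_right_mono mult_left_mono mult_mono) (auto simp: a_def[abs_def])
    finally show "(nrm (\<lambda>x. b x * \<phi> x $ j))\<^sup>2 \<le> 4 * (20 * R * nrm (grad \<phi>) * ((1 + 10 * chiK) * nrm (grad \<phi>))) * (nrm b * nrm (partial_deriv 1 b))" .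
  qed
  also have "\<dots> = 160 * (1 + 10 * chiK) * R * (nrm (grad \<phi>))\<^sup>2 * (nrm b * nrm (partial_deriv 1 b))"
    by (simp add: power2_eq_square)
  finally show ?thesis .
qed

lemma conv_mult_tendsto:
  fixes b :: "real^2 \<Rightarrow> real"
  assumes c: "conv \<Omega> \<phi> u G" and b: "b \<in> test_funs UNIV"
  shows "sqint (\<lambda>x. b x *\<^sub>R u x)" "(\<lambda>n. nrm (\<lambda>x. b x *\<^sub>R \<phi> n x)) \<longlonglongrightarrow> nrm (\<lambda>x. b x *\<^sub>R u x)"
proof -
  note d = convD[OF c]
  obtain r where r: "\<And>x. r < norm x \<Longrightarrow> b x = 0" using test_funs_far[OF b] by metis
  obtain m :: nat where m: "\<forall>x. x \<notin> ball 0 (real m) \<longrightarrow> b x = 0" using cs_in_ball[of r b, OF r] by blast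
  obtain B where B: "0 \<le> B" "\<And>x. norm (b x) \<le> B" using test_funs_bounded[OF b] by metis
  have bm: "b \<in> borel_measurable lebesgue" by (rule sqint_measurable[OF test_funs_sqint[OF b]])
  have bd: "norm (b x *\<^sub>R w x) \<le> B * norm (cutf (ball 0 (real m)) w x)" for w :: "real^2 \<Rightarrow> real^2" and x
    using m B by (cases "x \<in> ball 0 (real m)") (auto simp: cutf_def intro: mult_right_mono)
  show s: "sqint (\<lambda>x. b x *\<^sub>R u x)"
    by (rule sqint_dominated[OF d(5)[of m] borel_measurable_scaleR[OF bm d(4)] AE_I2[OF bd]])
  have s': "sqint (\<lambda>x. b x *\<^sub>R \<phi> n x)" for n
    by (rule sqint_dominated[OF d(10)[of m n] borel_measurable_scaleR[OF bm sqint_measurable[OF test_funs_sqint[OF d(2)]]] AE_I2[OF bd]])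
  show "(\<lambda>n. nrm (\<lambda>x. b x *\<^sub>R \<phi> n x)) \<longlonglongrightarrow> nrm (\<lambda>x. b x *\<^sub>R u x)"
  proof (rule nrm_tendsto[OF s' s])
    show "(\<lambda>n. nrm (\<lambda>x. b x *\<^sub>R \<phi> n x - b x *\<^sub>R u x)) \<longlonglongrightarrow> 0"
    proof (rule Lim_null_comparison[OF always_eventually])
      show "(\<lambda>n. B * nrm (cutf (ball 0 (real m)) (\<lambda>x. \<phi> n x - u x))) \<longlonglongrightarrow> 0"
        using tendsto_mult_left[OF d(7)[of m], of B] by simp
      have "nrm (\<lambda>x. b x *\<^sub>R (\<phi> n x - u x)) \<le> B * nrm (cutf (ball 0 (real m)) (\<lambda>x. \<phi> n x - u x))" for n
        by (rule nrm_dominated[OF d(11) _ AE_I2[OF bd] B(1)])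
          (intro borel_measurable_scaleR[OF bm] borel_measurable_diff d(4) sqint_measurable[OF test_funs_sqint[OF d(2)]])
      then show "\<forall>n. norm (nrm (\<lambda>x. b x *\<^sub>R \<phi> n x - b x *\<^sub>R u x)) \<le> B * nrm (cutf (ball 0 (real m)) (\<lambda>x. \<phi> n x - u x))"
        by (simp add: scaleR_diff_right)
    qed
  qed
qed

text \<open>Of the approximating fields only the gradient norm enters the right-hand side, and on
  the left a bounded \<open>b\<close> with compact support needs convergence on one ball only, so
  the bound survives the limit.\<close>

lemma product_bound:
  fixes b :: "real^2 \<Rightarrow> real"
  assumes c: "conv \<Omega> \<phi> u G" and odd: "\<And>n. odd_vf d (\<phi> n)" and R: "R \<ge> 1"
    and b: "b \<in> test_funs UNIV" "\<And>x j. 2 * R < \<bar>x $ j\<bar> \<Longrightarrow> b x = 0"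
  shows "(nrm (\<lambda>x. b x *\<^sub>R u x))\<^sup>2 \<le> 160 * (1 + 10 * chiK) * R * (nrm G)\<^sup>2 * (nrm b * nrm (partial_deriv 1 b))"
proof (rule LIMSEQ_le)
  note d = convD[OF c]
  show "(\<lambda>n. (nrm (\<lambda>x. b x *\<^sub>R \<phi> n x))\<^sup>2) \<longlonglongrightarrow> (nrm (\<lambda>x. b x *\<^sub>R u x))\<^sup>2"
    by (intro tendsto_power conv_mult_tendsto[OF c b(1)])
  show "(\<lambda>n. 160 * (1 + 10 * chiK) * R * (nrm (grad (\<phi> n)))\<^sup>2 * (nrm b * nrm (partial_deriv 1 b))) \<longlonglongrightarrow>
     160 * (1 + 10 * chiK) * R * (nrm G)\<^sup>2 * (nrm b * nrm (partial_deriv 1 b))"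
    by (intro tendsto_intros nrm_tendsto d)
  show "\<exists>N. \<forall>n\<ge>N. (nrm (\<lambda>x. b x *\<^sub>R \<phi> n x))\<^sup>2 \<le> 160 * (1 + 10 * chiK) * R * (nrm (grad (\<phi> n)))\<^sup>2 * (nrm b * nrm (partial_deriv 1 b))"
  proof (intro exI allI impI)
    fix n show "(nrm (\<lambda>x. b x *\<^sub>R \<phi> n x))\<^sup>2 \<le> 160 * (1 + 10 * chiK) * R * (nrm (grad (\<phi> n)))\<^sup>2 * (nrm b * nrm (partial_deriv 1 b))"
      by (rule product_bound_test[OF d(2) odd R b])
  qed
qed

text \<open>The truncated field is the perpendicular gradient of \<open>\<chi>\<^sub>R (\<psi> - c)\<close>, with \<open>\<psi>\<close> a stream
  function of \<open>\<phi>\<close> and \<open>c\<close> from Poincare's inequality on the frame.\<close>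

lemma solenoidal_truncation:
  assumes \<phi>: "\<phi> \<in> test_funs_sol \<Omega>" and R: "R > 0" and fr: "frame R \<subseteq> \<Omega>"
  obtains g where "(\<lambda>x. chi R x *\<^sub>R \<phi> x + g x) \<in> test_funs_sol \<Omega>" "g \<in> test_funs \<Omega>" "\<And>x. x \<notin> frame R \<Longrightarrow> g x = 0"
    "nrm g \<le> 4692 * chiK * nrm (cutf (frame R) \<phi>)" "nrm (grad g) \<le> 4692 * chiK / R * nrm (cutf (frame R) \<phi>)"
proof -
  note t = sol_test[OF \<phi>]
  define M where "M = nrm (cutf (frame R) \<phi>)"
  obtain \<psi> where \<psi>: "\<And>k. Ck k \<psi>" "\<And>x. partial_deriv 1 \<psi> x = - \<phi> x $ 2" "\<And>x. partial_deriv 2 \<psi> x = \<phi> x $ 1"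
    using stream_function[OF \<phi>] by blast
  obtain c where c: "(\<integral>\<^sup>+x. ennreal ((\<psi> x - c)\<^sup>2) * indicator (frame R) x \<partial>lborel)
    \<le> ennreal (1372000 * R\<^sup>2) * (\<integral>\<^sup>+x. ennreal (\<Sum>i\<in>UNIV. (partial_deriv i \<psi> x)\<^sup>2) * indicator (frame R) x \<partial>lborel)"
    using poincare_frame[OF \<psi>(1) R] by blast
  have fs: "frame R \<in> sets lebesgue" using sets_frame by simp
  \<comment> \<open>Subtracting the Poincare constant leaves the field unchanged and lets its norm
    on the frame control the stream function there.\<close>
  define h where "h x = \<psi> x - c" for x
  have hC: "Ck k h" for k unfolding h_def[abs_def] by (intro Ck_diff \<psi> Ck_const)
  have hd: "partial_deriv i h x = partial_deriv i \<psi> x" for i x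
    unfolding h_def[abs_def] by (subst partial_deriv_diff[OF \<psi>(1) Ck_const]) simp
  have hm: "h \<in> borel_measurable lebesgue" by (rule borel_measurable_lebesgue_continuous[OF Ck_imp_continuous[OF hC]])
  have sM: "sqint (cutf (frame R) \<phi>)" by (intro sqint_cutf fs test_funs_sqint[OF t])
  have sh: "sqint (cutf (frame R) h)" and nh: "nrm (cutf (frame R) h) \<le> 1172 * R * M"
  proof -
    have "(\<integral>\<^sup>+x. ennreal (\<Sum>i\<in>UNIV. (partial_deriv i \<psi> x)\<^sup>2) * indicator (frame R) x \<partial>lborel) = (\<integral>\<^sup>+x. ennreal ((norm (cutf (frame R) \<phi> x))\<^sup>2) \<partial>lborel)"
      by (intro nn_integral_cong) (auto simp: cutf_def indicator_def sum_2 \<psi> norm_vec_sq add.commute)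
    also have "\<dots> = (\<integral>\<^sup>+x. ennreal ((norm (cutf (frame R) \<phi> x))\<^sup>2) \<partial>lebesgue)"
      by (rule nn_integral_completion[symmetric])
    also have "\<dots> = ennreal (M\<^sup>2)"
      using sM by (simp add: M_def nrm_sq nn_integral_eq_integral sqint_def)
    finally have IM: "(\<integral>\<^sup>+x. ennreal (\<Sum>i\<in>UNIV. (partial_deriv i \<psi> x)\<^sup>2) * indicator (frame R) x \<partial>lborel) = ennreal (M\<^sup>2)" .
    have "(\<integral>\<^sup>+x. ennreal ((norm (cutf (frame R) h x))\<^sup>2) \<partial>lborel) = (\<integral>\<^sup>+x. ennreal ((\<psi> x - c)\<^sup>2) * indicator (frame R) x \<partial>lborel)"
      by (intro nn_integral_cong) (auto simp: cutf_def indicator_def h_def)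
    also have "\<dots> \<le> ennreal (1372000 * R\<^sup>2) * ennreal (M\<^sup>2)"
      using c unfolding IM .
    \<comment> \<open>1172 is the least integer whose square exceeds 1372000.\<close>
    also have "\<dots> \<le> ennreal ((1172 * R * M)\<^sup>2)"
      using mult_right_mono[of 1372000 "1172\<^sup>2" "R\<^sup>2 * M\<^sup>2"]
      by (subst ennreal_mult[symmetric]) (auto intro!: ennreal_leI simp: power_mult_distrib mult.assoc)
    finally have le: "(\<integral>\<^sup>+x. ennreal ((norm (cutf (frame R) h x))\<^sup>2) \<partial>lebesgue) \<le> ennreal ((1172 * R * M)\<^sup>2)"
      by (simp add: nn_integral_completion)
    have m: "cutf (frame R) h \<in> borel_measurable lebesgue" by (intro measurable_cutf fs hm)
    have i: "integrable lebesgue (\<lambda>x. (norm (cutf (frame R) h x))\<^sup>2)"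
      by (rule integrableI_bounded) (use le m in \<open>auto intro: le_less_trans\<close>)
    then show "sqint (cutf (frame R) h)" using m by (simp add: sqint_def)
    have "ennreal (\<integral>x. (norm (cutf (frame R) h x))\<^sup>2 \<partial>lebesgue) \<le> ennreal ((1172 * R * M)\<^sup>2)"
      using le i by (simp add: nn_integral_eq_integral)
    then show "nrm (cutf (frame R) h) \<le> 1172 * R * M"
      using R by (intro nrm_leI) (auto simp: M_def)
  qed
  define X where "X i = partial_deriv i (chi R)" for i
  have XC: "Ck k (X i)" for k i unfolding X_def by (rule Ck_partial_deriv[OF Ck_chi])
  \<comment> \<open>The perpendicular gradient of \<open>chi R\<close> times \<open>h\<close>: what
    the product rule adds to \<open>chi R x *\<^sub>R \<phi> x\<close>.\<close>
  define g where "g x = X 2 x *\<^sub>R h x *\<^sub>R axis 1 1 - X 1 x *\<^sub>R h x *\<^sub>R (axis 2 1 :: real^2)" for x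
  have g1: "g x $ 1 = X 2 x * h x" and g2: "g x $ 2 = - (X 1 x * h x)" for x
    by (auto simp: g_def axis_def)
  have gC: "Ck k g" for k
    unfolding g_def[abs_def] by (intro Ck_diff Ck_scaleR XC hC Ck_const)
  have g0: "g x = 0" if "x \<notin> frame R" for x
    using chi_deriv_frame(1)[OF R that] by (simp add: g_def X_def)
  have cf: "compact (frame R)"
    unfolding frame_eq by (intro compact_Un compact_cbox)
  have gt: "g \<in> test_funs \<Omega>" by (rule test_funsI[OF gC cf fr g0])
  have gg: "grad g x $ 1 $ i = X 2 x * partial_deriv i \<psi> x + partial_deriv i (X 2) x * h x"
    "grad g x $ 2 $ i = - (X 1 x * partial_deriv i \<psi> x + partial_deriv i (X 1) x * h x)" for x i
  proof -
    show "grad g x $ 1 $ i = X 2 x * partial_deriv i \<psi> x + partial_deriv i (X 2) x * h x"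
      unfolding grad_nth g1 by (subst partial_deriv_mult[OF XC hC]) (simp add: hd)
    have "partial_deriv i (\<lambda>x. (-1) *\<^sub>R (X 1 x * h x)) x = (-1) *\<^sub>R partial_deriv i (\<lambda>x. X 1 x * h x) x"
      by (intro partial_deriv_cmult Ck_mult XC hC)
    then show "grad g x $ 2 $ i = - (X 1 x * partial_deriv i \<psi> x + partial_deriv i (X 1) x * h x)"
      unfolding grad_nth g2 using partial_deriv_mult[OF XC hC, of i 1 x] by (simp add: hd)
  qed
  have XK: "\<bar>X i x\<bar> \<le> chiK / R" "\<bar>partial_deriv j (X i) x\<bar> \<le> chiK / R\<^sup>2" for i j x
    using chiK R by (auto simp: X_def)
  have bg: "norm (g x) \<le> (2 * (chiK / R)) * norm (cutf (frame R) h x)" for x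
  proof (cases "x \<in> frame R")
    case True
    have "norm (g x) \<le> \<bar>X 2 x\<bar> * \<bar>h x\<bar> + \<bar>X 1 x\<bar> * \<bar>h x\<bar>"
      using norm_le_sum_nth[of "g x"] by (simp add: sum_2 g1 g2 abs_mult)
    also have "\<dots> \<le> (chiK / R) * \<bar>h x\<bar> + (chiK / R) * \<bar>h x\<bar>"
      by (intro add_mono mult_right_mono XK) auto
    finally show ?thesis using True by (simp add: cutf_def)
  qed (simp add: g0 cutf_def)
  have bgrad: "norm (grad g x) \<le> norm ((4 * (chiK / R\<^sup>2)) *\<^sub>R norm (cutf (frame R) h x) + (4 * (chiK / R)) *\<^sub>R norm (cutf (frame R) \<phi> x))" for x
  proof (cases "x \<in> frame R")
    case True
    have e: "\<bar>grad g x $ j $ i\<bar> \<le> (chiK / R) * norm (\<phi> x) + (chiK / R\<^sup>2) * \<bar>h x\<bar>" for j i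
    proof -
      have p: "\<bar>partial_deriv i \<psi> x\<bar> \<le> norm (\<phi> x)"
        using component_le_norm_cart[of "\<phi> x"] exhaust_2[of i] \<psi> by auto
      have "\<bar>X l x * partial_deriv i \<psi> x + partial_deriv i (X l) x * h x\<bar> \<le> (chiK / R) * norm (\<phi> x) + (chiK / R\<^sup>2) * \<bar>h x\<bar>" for l
      proof -
        have "\<bar>X l x * partial_deriv i \<psi> x + partial_deriv i (X l) x * h x\<bar> \<le> \<bar>X l x\<bar> * \<bar>partial_deriv i \<psi> x\<bar> + \<bar>partial_deriv i (X l) x\<bar> * \<bar>h x\<bar>"
          by (simp add: abs_mult[symmetric] abs_triangle_ineq)
        also have "\<dots> \<le> (chiK / R) * norm (\<phi> x) + (chiK / R\<^sup>2) * \<bar>h x\<bar>"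
          using p XK R chiK(1) by (intro add_mono mult_mono) auto
        finally show ?thesis .
      qed
      then show ?thesis using exhaust_2[of j] gg by (metis abs_minus_cancel)
    qed
    have "norm (grad g x) \<le> (\<Sum>j\<in>UNIV. norm (grad g x $ j))" by (rule norm_le_sum_nth)
    also have "\<dots> \<le> (\<Sum>j\<in>UNIV. \<Sum>i\<in>UNIV. \<bar>grad g x $ j $ i\<bar>)"
      using norm_le_sum_nth[of "grad g x $ _"] by (intro sum_mono) simp
    also have "\<dots> \<le> (\<Sum>j\<in>(UNIV::2 set). \<Sum>i\<in>(UNIV::2 set). (chiK / R) * norm (\<phi> x) + (chiK / R\<^sup>2) * \<bar>h x\<bar>)"
      by (intro sum_mono e)
    also have "\<dots> = (4 * (chiK / R\<^sup>2)) * norm (cutf (frame R) h x) + (4 * (chiK / R)) * norm (cutf (frame R) \<phi> x)"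
      using True by (simp add: cutf_def algebra_simps)
    finally show ?thesis by simp
  next
    case False
    have "grad g x = 0" by (rule grad_zero_off[OF compact_imp_closed[OF cf] g0 False])
    then show ?thesis by simp
  qed
  show ?thesis
  proof (rule that[of g])
    show "g \<in> test_funs \<Omega>" by (rule gt)
    show "g x = 0" if "x \<notin> frame R" for x by (rule g0[OF that])
    have ct: "(\<lambda>x. chi R x *\<^sub>R \<phi> x) \<in> test_funs \<Omega>"
    proof -
      obtain K where K: "compact K" "K \<subseteq> \<Omega>" "\<And>x. x \<notin> K \<Longrightarrow> \<phi> x = 0" using test_funsE[OF t] by metis
      show ?thesis
        by (rule test_funsI[OF _ K(1,2)]) (auto intro: Ck_scaleR Ck_chi test_funs_Ck[OF t] simp: K(3))
    qed
    have gc: "grad (\<lambda>x. chi R x *\<^sub>R \<phi> x) x $ j $ i = chi R x * grad \<phi> x $ j $ i + X i x * \<phi> x $ j" for x j i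
      unfolding grad_nth X_def by (simp add: partial_deriv_mult[OF Ck_chi Ck_nth[OF test_funs_Ck[OF t]]])
    \<comment> \<open>In the divergence of \<open>g\<close> the terms with second derivatives of
      \<open>chi R\<close> cancel by this symmetry; those with first derivatives cancel against the
      divergence of \<open>chi R x *\<^sub>R \<phi> x\<close>.\<close>
    have mix: "partial_deriv 1 (X 2) x = partial_deriv 2 (X 1) x" for x
      unfolding X_def by (rule chi_mixed)
    have "(\<Sum>i\<in>UNIV. grad (\<lambda>x. chi R x *\<^sub>R \<phi> x + g x) x $ i $ i) = 0" for x
    proof -
      have "grad \<phi> x $ 1 $ 1 = - grad \<phi> x $ 2 $ 2" using sol_div[OF \<phi>, of x] by (simp add: sum_2)
      moreover have "grad (\<lambda>x. chi R x *\<^sub>R \<phi> x + g x) x = grad (\<lambda>x. chi R x *\<^sub>R \<phi> x) x + grad g x"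
        by (rule grad_add[OF test_funs_Ck[OF ct] gC])
      ultimately show ?thesis
        by (simp add: sum_2 gc gg \<psi> mix)
    qed
    then show "(\<lambda>x. chi R x *\<^sub>R \<phi> x + g x) \<in> test_funs_sol \<Omega>"
      using test_funs_add[OF ct gt] by (simp add: test_funs_sol_def)
    have K0: "0 \<le> chiK / R" "0 \<le> chiK / R\<^sup>2" using chiK(1) R by auto
    have M0: "0 \<le> M" by (simp add: M_def)
    have "nrm g \<le> (2 * (chiK / R)) * nrm (cutf (frame R) h)"
      using K0 by (intro nrm_dominated[OF sh sqint_measurable[OF test_funs_sqint[OF gt]] AE_I2[OF bg]]) auto
    also have "\<dots> \<le> (2 * (chiK / R)) * (1172 * R * M)"
      using K0 nh by (intro mult_left_mono) auto
    also have "\<dots> = 2344 * chiK * M" using R by simp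
    \<comment> \<open>Rounded up from 2 * 1172 to the constant of the gradient bound, 4 * 1172 + 4,
      so that one number serves both.\<close>
    also have "\<dots> \<le> 4692 * chiK * M" using chiK(1) M0 by (intro mult_right_mono) auto
    finally show "nrm g \<le> 4692 * chiK * nrm (cutf (frame R) \<phi>)" by (simp add: M_def)
    have sn: "sqint (\<lambda>x. norm (w x))" "nrm (\<lambda>x. norm (w x)) = nrm w" if "sqint w" for w :: "real^2 \<Rightarrow> 'z::euclidean_space"
      using that by (auto simp: sqint_def nrm_def)
    have s1: "sqint (\<lambda>x. (4 * (chiK / R\<^sup>2)) *\<^sub>R norm (cutf (frame R) h x))" by (intro sqint_scaleR sn sh)
    have s2: "sqint (\<lambda>x. (4 * (chiK / R)) *\<^sub>R norm (cutf (frame R) \<phi> x))" by (intro sqint_scaleR sn sM)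
    have "nrm (grad g) \<le> 1 * nrm (\<lambda>x. (4 * (chiK / R\<^sup>2)) *\<^sub>R norm (cutf (frame R) h x) + (4 * (chiK / R)) *\<^sub>R norm (cutf (frame R) \<phi> x))"
      using bgrad by (intro nrm_dominated[OF sqint_add[OF s1 s2] sqint_measurable[OF grad_sqint[OF gt]]] AE_I2) auto
    also have "\<dots> \<le> nrm (\<lambda>x. (4 * (chiK / R\<^sup>2)) *\<^sub>R norm (cutf (frame R) h x)) + nrm (\<lambda>x. (4 * (chiK / R)) *\<^sub>R norm (cutf (frame R) \<phi> x))"
      using nrm_triangle[OF s1 s2] by simp
    also have "\<dots> = (4 * (chiK / R\<^sup>2)) * nrm (cutf (frame R) h) + (4 * (chiK / R)) * M"
      using K0 by (simp only: nrm_scaleR sn(2)[OF sh] sn(2)[OF sM] M_def)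
    also have "\<dots> \<le> (4 * (chiK / R\<^sup>2)) * (1172 * R * M) + (4 * (chiK / R)) * M"
      using K0 nh by (intro add_mono mult_left_mono) auto
    also have "\<dots> = 4692 * chiK / R * M" using R by (simp add: field_simps power2_eq_square)
    finally show "nrm (grad g) \<le> 4692 * chiK / R * nrm (cutf (frame R) \<phi>)" by (simp add: M_def)
  qed
qed

section \<open>The trilinear form\<close>

text \<open>For \<open>A = grad a\<close> this is the form (u \<cdot> \<nabla>a, v). The gradient is
  an independent argument, so weak gradients and their restrictions can be inserted.\<close>

definition tri :: "(real^2 \<Rightarrow> real^2^2) \<Rightarrow> (real^2 \<Rightarrow> real^2) \<Rightarrow> (real^2 \<Rightarrow> real^2) \<Rightarrow> real" where
  "tri A u v = (\<integral>x. (A x *v u x) \<bullet> v x \<partial>lebesgue)"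

lemma norm_matrix_vector_le: "norm (A *v u) \<le> norm (A :: real^2^2) * norm (u :: real^2)"
proof (rule power2_le_imp_le)
  have "(norm (A *v u))\<^sup>2 = (\<Sum>j\<in>UNIV. ((A $ j) \<bullet> u)\<^sup>2)"
    by (simp add: norm_vec_sq matrix_vector_mul_component)
  also have "\<dots> \<le> (\<Sum>j\<in>UNIV. (norm (A $ j))\<^sup>2 * (norm u)\<^sup>2)"
    by (intro sum_mono) (metis Cauchy_Schwarz_ineq power2_norm_eq_inner)
  also have "\<dots> = (norm A * norm u)\<^sup>2"
    by (simp add: norm_vec_sq[of A] power_mult_distrib sum_distrib_right)
  finally show "(norm (A *v u))\<^sup>2 \<le> (norm A * norm u)\<^sup>2" .
qed simp

lemma bounded_bilinear_matrix_vector: "bounded_bilinear ((*v) :: real^2^2 \<Rightarrow> real^2 \<Rightarrow> real^2)"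
proof
  show "\<exists>K. \<forall>(a::real^2^2) b. norm (a *v b) \<le> norm a * norm b * K"
    by (rule exI[of _ 1]) (simp add: norm_matrix_vector_le)
qed (simp_all add: matrix_vector_mult_add_rdistrib matrix_vector_right_distrib scaleR_matrix_vector_assoc matrix_vector_mult_scaleR)

text \<open>With two factors merged into one matrix the trilinear form becomes an inner product, and
  limits follow from the bilinear lemma \<open>integral_bilinear_tendsto\<close>.\<close>

definition outer :: "real^2 \<Rightarrow> real^2 \<Rightarrow> real^2^2" where
  "outer w e = (\<chi> j i. w $ j * e $ i)"

lemma inner_outer: "A \<bullet> outer w e = (A *v e) \<bullet> w"
  by (simp add: inner_vec_def outer_def matrix_vector_mult_def sum_2 algebra_simps)

lemma norm_outer: "norm (outer w e) = norm w * norm e"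
proof -
  have "(norm (outer w e))\<^sup>2 = (norm w * norm e)\<^sup>2"
    by (simp add: norm_vec_sq outer_def sum_2 power_mult_distrib algebra_simps)
  then show ?thesis by (rule power2_eq_imp_eq) auto
qed

lemma bounded_bilinear_outer: "bounded_bilinear outer"
proof
  show "\<exists>K. \<forall>a b. norm (outer a b) \<le> norm a * norm b * K"
    by (rule exI[of _ 1]) (simp add: norm_outer)
qed (simp_all add: outer_def vec_eq_iff algebra_simps)

lemma measurable_bilinear:
  fixes B :: "'a::euclidean_space \<Rightarrow> 'b::euclidean_space \<Rightarrow> 'c::euclidean_space"
  assumes B: "bounded_bilinear B" and m: "f \<in> borel_measurable M" "g \<in> borel_measurable M"
  shows "(\<lambda>x. B (f x) (g x)) \<in> borel_measurable M"
proof -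
  have "(\<lambda>z. B (fst z) (snd z)) \<in> borel_measurable borel"
    by (intro borel_measurable_continuous_onI bounded_bilinear.continuous_on[OF B] continuous_intros)
  moreover have "(\<lambda>x. (f x, g x)) \<in> borel_measurable M" using m by measurable
  ultimately have "(\<lambda>x. (\<lambda>z. B (fst z) (snd z)) (f x, g x)) \<in> borel_measurable M"
    by (rule measurable_compose[rotated])
  then show ?thesis by simp
qed

lemma measurable_tri:
  fixes A :: "real^2 \<Rightarrow> real^2^2" and u v :: "real^2 \<Rightarrow> real^2"
  shows
  "A \<in> borel_measurable lebesgue \<Longrightarrow> u \<in> borel_measurable lebesgue \<Longrightarrow> v \<in> borel_measurable lebesgue \<Longrightarrow>
    (\<lambda>x. (A x *v u x) \<bullet> v x) \<in> borel_measurable lebesgue"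
  by (rule measurable_bilinear[OF bounded_bilinear_inner measurable_bilinear[OF bounded_bilinear_matrix_vector]])

lemma norm_tri_le: "norm ((A *v u) \<bullet> v) \<le> norm (A :: real^2^2) * (norm (u :: real^2) * norm v)"
proof -
  have "norm ((A *v u) \<bullet> v) \<le> norm (A *v u) * norm v" using Cauchy_Schwarz_ineq2 by simp
  also have "\<dots> \<le> (norm A * norm u) * norm v" by (intro mult_right_mono norm_matrix_vector_le) auto
  finally show ?thesis by simp
qed

text \<open>In the plane a field with finite Dirichlet integral need not be bounded, so the estimate
  asks for an L2 bound on the product of the two undifferentiated fields instead of a separate bound
  for each.\<close>

lemma tri_outer:
  assumes A: "sqint A" and u: "u \<in> borel_measurable lebesgue" and v: "v \<in> borel_measurable lebesgue"
    and g: "sqint (g :: real^2 \<Rightarrow> 'b::euclidean_space)" and le: "AE x in lebesgue. norm (u x) * norm (v x) \<le> C * norm (g x)" and C: "0 \<le> C"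
  shows "integrable lebesgue (\<lambda>x. (A x *v u x) \<bullet> v x)" "\<bar>tri A u v\<bar> \<le> C * nrm A * nrm g"
proof -
  have "AE x in lebesgue. norm ((A x *v u x) \<bullet> v x) \<le> C * (norm (A x) * norm (g x))"
    using le
  proof eventually_elim
    case (elim x)
    have "norm ((A x *v u x) \<bullet> v x) \<le> norm (A x) * (norm (u x) * norm (v x))" by (rule norm_tri_le)
    also have "\<dots> \<le> norm (A x) * (C * norm (g x))" by (intro mult_left_mono elim) auto
    finally show ?case by (simp add: mult_ac)
  qed
  note * = sqint_product[OF A g measurable_tri[OF sqint_measurable[OF A] u v] this C]
  show "integrable lebesgue (\<lambda>x. (A x *v u x) \<bullet> v x)" by (rule *(1))
  show "\<bar>tri A u v\<bar> \<le> C * nrm A * nrm g" using *(2) by (simp add: tri_def)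
qed

text \<open>The sum of the integrands is a \<cdot> \<nabla>(b \<cdot> c); integration by parts moves
  the derivative onto \<open>a\<close>, which has zero divergence.\<close>

lemma tri_smooth_antisym:
  assumes a: "a \<in> test_funs_sol \<Omega>" and b: "b \<in> test_funs \<Omega>" and c: "c \<in> test_funs \<Omega>"
  shows "tri (grad b) a c + tri (grad c) a b = 0"
proof -
  note ca = sol_test[OF a]
  note cont = test_funs_continuous[OF ca, of UNIV] test_funs_continuous[OF b, of UNIV] test_funs_continuous[OF c, of UNIV]
    grad_continuous[OF b, of UNIV] grad_continuous[OF c, of UNIV]
  note k = Ck_nth[OF test_funs_Ck[OF ca]] Ck_nth[OF test_funs_Ck[OF b]] Ck_nth[OF test_funs_Ck[OF c]]
  define s where "s x = b x $ 1 * c x $ 1 + b x $ 2 * c x $ 2" for x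
  have sC: "Ck l s" for l unfolding s_def[abs_def] by (intro Ck_add Ck_mult k)
  have ds: "partial_deriv i s x = (b x $ 1 * grad c x $ 1 $ i + grad b x $ 1 $ i * c x $ 1) + (b x $ 2 * grad c x $ 2 $ i + grad b x $ 2 $ i * c x $ 2)" for i x
    unfolding s_def[abs_def] grad_nth
    by (subst partial_deriv_add[OF Ck_mult[OF k(2,3)] Ck_mult[OF k(2,3)]]) (simp add: partial_deriv_mult[OF k(2,3)])
  obtain r where r: "\<And>x. r < norm x \<Longrightarrow> a x = 0" using test_funs_far[OF ca] by metis
  have mc: "continuous_on UNIV (\<lambda>x. (M x *v f x) \<bullet> h x)" if "continuous_on UNIV M" "continuous_on UNIV f" "continuous_on UNIV h"
    for M :: "real^2 \<Rightarrow> real^2^2" and f h :: "real^2 \<Rightarrow> real^2"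
    by (intro continuous_on_inner bounded_bilinear.continuous_on[OF bounded_bilinear_matrix_vector] that)
  have i1: "integrable lebesgue (\<lambda>x. (grad b x *v a x) \<bullet> c x)"
    by (rule integrable_lebesgue_cs[where R=r]) (auto intro: mc cont simp: r)
  have i2: "integrable lebesgue (\<lambda>x. (grad c x *v a x) \<bullet> b x)"
    by (rule integrable_lebesgue_cs[where R=r]) (auto intro: mc cont simp: r)
  have pt: "(grad b x *v a x) \<bullet> c x + (grad c x *v a x) \<bullet> b x = a x $ 1 * partial_deriv 1 s x + a x $ 2 * partial_deriv 2 s x" for x
    by (simp add: ds inner_vec_def matrix_vector_mult_def sum_2 algebra_simps)
  have ib: "(\<integral>x. a x $ i * partial_deriv i s x \<partial>lebesgue) = - (\<integral>x. grad a x $ i $ i * s x \<partial>lebesgue)" for i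
    using integral_by_parts[OF test_funs_nth[OF ca] sC, of i i] by (simp add: grad_nth)
  have cs: "continuous_on UNIV s" "continuous_on UNIV (partial_deriv i s)" for i
    by (rule Ck_imp_continuous[OF sC], rule continuous_partial_deriv[OF sC])
  have i3: "integrable lebesgue (\<lambda>x. a x $ i * partial_deriv i s x)" for i
    by (rule integrable_lebesgue_cs[where R=r]) (auto intro!: continuous_intros cont cs simp: r)
  have i4: "integrable lebesgue (\<lambda>x. grad a x $ i $ i * s x)" for i
    by (rule integrable_lebesgue_cs[where R=r]) (auto intro!: continuous_intros cs grad_continuous[OF ca] simp: grad_far[OF r])
  have "tri (grad b) a c + tri (grad c) a b = (\<integral>x. (grad b x *v a x) \<bullet> c x + (grad c x *v a x) \<bullet> b x \<partial>lebesgue)"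
    using i1 i2 by (simp add: tri_def)
  also have "\<dots> = (\<integral>x. a x $ 1 * partial_deriv 1 s x \<partial>lebesgue) + (\<integral>x. a x $ 2 * partial_deriv 2 s x \<partial>lebesgue)"
    unfolding pt using i3 by simp
  also have "\<dots> = - (\<integral>x. grad a x $ 1 $ 1 * s x + grad a x $ 2 $ 2 * s x \<partial>lebesgue)"
    using i4 by (simp add: ib)
  also have "(\<lambda>x. grad a x $ 1 $ 1 * s x + grad a x $ 2 $ 2 * s x) = (\<lambda>x. 0)"
  proof
    fix x
    have "grad a x $ 1 $ 1 = - grad a x $ 2 $ 2" using sol_div[OF a, of x] by (simp add: sum_2)
    then show "grad a x $ 1 $ 1 * s x + grad a x $ 2 $ 2 * s x = 0" by simp
  qed
  finally show ?thesis by simp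
qed

text \<open>A bounded factor with compact support confines the fields to one ball, where they
  converge in L2.\<close>

lemma conv_bilinear_tendsto:
  fixes B :: "'a::euclidean_space \<Rightarrow> real^2 \<Rightarrow> 'c::euclidean_space"
  assumes c: "conv \<Omega> \<phi> u G" and B: "bounded_bilinear B" "\<And>a b. norm (B a b) \<le> norm a * norm b"
    and h: "continuous_on UNIV h" "\<And>x. norm (h x) \<le> K" "\<And>x. r < norm x \<Longrightarrow> h x = 0"
  shows "sqint (\<lambda>x. B (h x) (u x))" "sqint (\<lambda>x. B (h x) (\<phi> n x))"
    "(\<lambda>n. nrm (\<lambda>x. B (h x) (\<phi> n x) - B (h x) (u x))) \<longlonglongrightarrow> 0"
proof -
  note d = convD[OF c]
  obtain m :: nat where m: "\<forall>x. x \<notin> ball 0 (real m) \<longrightarrow> h x = 0" using cs_in_ball[of r h, OF h(3)] by blast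
  have K: "0 \<le> K" using h(2)[of 0] norm_ge_zero order_trans by blast
  have bd: "norm (B (h x) (w x)) \<le> K * norm (cutf (ball 0 (real m)) w x)" for w x
  proof (cases "x \<in> ball 0 (real m)")
    case True
    have "norm (B (h x) (w x)) \<le> norm (h x) * norm (w x)" by (rule B(2))
    also have "\<dots> \<le> K * norm (w x)" by (intro mult_right_mono h(2)) auto
    finally show ?thesis using True by (simp add: cutf_def)
  next
    case False
    then show ?thesis using m by (simp add: bounded_bilinear.zero_left[OF B(1)] K)
  qed
  have mm: "(\<lambda>x. B (h x) (w x)) \<in> borel_measurable lebesgue" if "w \<in> borel_measurable lebesgue" for w
    by (rule measurable_bilinear[OF B(1) borel_measurable_lebesgue_continuous[OF h(1)] that])
  show "sqint (\<lambda>x. B (h x) (u x))" by (rule sqint_dominated[OF d(5)[of m] mm[OF d(4)] AE_I2[OF bd]])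
  show "sqint (\<lambda>x. B (h x) (\<phi> n x))"
    by (rule sqint_dominated[OF d(10)[of m n] mm[OF sqint_measurable[OF test_funs_sqint[OF d(2)]]] AE_I2[OF bd]])
  show "(\<lambda>n. nrm (\<lambda>x. B (h x) (\<phi> n x) - B (h x) (u x))) \<longlonglongrightarrow> 0"
  proof (rule Lim_null_comparison[OF always_eventually])
    show "(\<lambda>n. K * nrm (cutf (ball 0 (real m)) (\<lambda>x. \<phi> n x - u x))) \<longlonglongrightarrow> 0"
      using tendsto_mult_left[OF d(7)[of m], of K] by simp
    have "nrm (\<lambda>x. B (h x) (\<phi> n x - u x)) \<le> K * nrm (cutf (ball 0 (real m)) (\<lambda>x. \<phi> n x - u x))" for n
      by (rule nrm_dominated[OF d(11) mm[OF borel_measurable_diff[OF sqint_measurable[OF test_funs_sqint[OF d(2)]] d(4)]] AE_I2[OF bd] K])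
    then show "\<forall>n. norm (nrm (\<lambda>x. B (h x) (\<phi> n x) - B (h x) (u x))) \<le> K * nrm (cutf (ball 0 (real m)) (\<lambda>x. \<phi> n x - u x))"
      by (simp add: bounded_bilinear.diff_right[OF B(1)])
  qed
qed

section \<open>Uniqueness\<close>

text \<open>The situation of the theorem after extension by zero. Besides its values at test fields,
  the functional enters only through the numbers \<open>fu\<close> and \<open>fv\<close> at the two
  solutions and its continuity there; \<open>far\<close> places large frames inside the
  domain.\<close>

locale solution_pair =
  fixes \<Omega> :: "(real^2) set" and \<phi> \<psi> :: "nat \<Rightarrow> real^2 \<Rightarrow> real^2" and U V :: "real^2 \<Rightarrow> real^2"
    and GU GV :: "real^2 \<Rightarrow> real^2^2" and d :: "2 \<Rightarrow> 2" and \<delta> :: real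
    and f :: "(real^2 \<Rightarrow> real^2) \<Rightarrow> real" and fu fv C r0 :: real
  assumes cU: "conv \<Omega> \<phi> U GU" and oU: "\<And>n. odd_vf d (\<phi> n)"
    and cV: "conv \<Omega> \<psi> V GV" and oV: "\<And>n. odd_vf d (\<psi> n)"
    and V_bound: "AE x in lebesgue. (1 + norm x) * norm (V x) \<le> \<delta>" and \<delta>: "0 \<le> \<delta>"
    and eqU: "\<And>\<eta>. \<eta> \<in> test_funs_sol \<Omega> \<Longrightarrow> (\<integral>x. GU x \<bullet> grad \<eta> x \<partial>lebesgue) + tri GU U \<eta> = f \<eta>"
    and eqV: "\<And>\<eta>. \<eta> \<in> test_funs_sol \<Omega> \<Longrightarrow> (\<integral>x. GV x \<bullet> grad \<eta> x \<partial>lebesgue) + tri GV V \<eta> = f \<eta>"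
    and fu: "\<And>\<eta>. \<eta> \<in> test_funs_sol \<Omega> \<Longrightarrow> \<bar>f \<eta> - fu\<bar> \<le> C * nrm (\<lambda>x. grad \<eta> x - GU x)"
    and fv: "\<And>\<eta>. \<eta> \<in> test_funs_sol \<Omega> \<Longrightarrow> \<bar>f \<eta> - fv\<bar> \<le> C * nrm (\<lambda>x. grad \<eta> x - GV x)" and C: "0 \<le> C"
    and energy: "(nrm GU)\<^sup>2 \<le> fu" and far: "\<And>x. r0 \<le> norm x \<Longrightarrow> x \<in> \<Omega>"
begin

section \<open>Estimates that use the decay of \<open>V\<close>\<close>

lemmas dU = convD[OF cU] and dV = convD[OF cV]
lemmas wU = hardy_conv[OF cU oU] and wV = hardy_conv[OF cV oV]
lemmas mU = dU(4) and mV = dV(4)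

lemma mphi: "\<phi> n \<in> borel_measurable lebesgue" "\<psi> n \<in> borel_measurable lebesgue"
  using test_funs_sqint[OF dU(2)] test_funs_sqint[OF dV(2)] sqint_measurable by blast+

text \<open>The decay of \<open>V\<close> supplies exactly the weight under which Hardy's inequality
  controls the other field.\<close>

lemma bound_right:
  fixes w :: "real^2 \<Rightarrow> real^2"
  shows "AE x in lebesgue. norm (w x) * norm (V x) \<le> \<delta> * norm (wt w x)"
  using V_bound
proof eventually_elim
  case (elim x)
  have "norm (w x) * norm (V x) = norm (wt w x) * ((1 + norm x) * norm (V x))"
    using norm_wt_eq[of w x] by simp
  also have "\<dots> \<le> norm (wt w x) * \<delta>" using elim by (intro mult_left_mono) auto
  finally show ?case by (simp add: mult.commute)
qed

lemma bound_left:
  fixes w :: "real^2 \<Rightarrow> real^2"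
  shows "AE x in lebesgue. norm (V x) * norm (w x) \<le> \<delta> * norm (wt w x)"
  using bound_right[of w] by eventually_elim (simp add: mult.commute)

lemma tri_right:
  assumes "sqint A" "w \<in> borel_measurable lebesgue" "sqint (wt w)"
  shows "integrable lebesgue (\<lambda>x. (A x *v w x) \<bullet> V x)" "\<bar>tri A w V\<bar> \<le> \<delta> * nrm A * nrm (wt w)"
  using tri_outer[OF assms(1,2) mV assms(3) bound_right \<delta>] by auto

lemma tri_left:
  assumes "sqint A" "w \<in> borel_measurable lebesgue" "sqint (wt w)"
  shows "integrable lebesgue (\<lambda>x. (A x *v V x) \<bullet> w x)" "\<bar>tri A V w\<bar> \<le> \<delta> * nrm A * nrm (wt w)"
  using tri_outer[OF assms(1) mV assms(2,3) bound_left \<delta>] by auto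

text \<open>The equation for \<open>V\<close> may be tested with every antisymmetric field.\<close>

lemma test_V:
  assumes c: "conv \<Omega> \<eta> Z GZ" and o: "\<And>n. odd_vf d (\<eta> n)"
    and fz: "\<And>\<zeta>. \<zeta> \<in> test_funs_sol \<Omega> \<Longrightarrow> \<bar>f \<zeta> - fz\<bar> \<le> C * nrm (\<lambda>x. grad \<zeta> x - GZ x)"
  shows "fz = (\<integral>x. GV x \<bullet> GZ x \<partial>lebesgue) + tri GV V Z"
proof -
  note e = convD[OF c]
  note w = hardy_conv[OF c o] and w' = hardy_conv_diff[OF c o]
  have me: "\<eta> n \<in> borel_measurable lebesgue" for n by (rule sqint_measurable[OF test_funs_sqint[OF e(2)]])
  have l1: "(\<lambda>n. \<integral>x. GV x \<bullet> grad (\<eta> n) x \<partial>lebesgue) \<longlonglongrightarrow> (\<integral>x. GV x \<bullet> GZ x \<partial>lebesgue)"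
    by (rule integral_bilinear_tendsto[OF bounded_bilinear_inner dV(3) dV(3) _ e(8) e(3) e(6)]) simp
  \<comment> \<open>The test fields need not converge in L2 near infinity; the decay of
    \<open>V\<close> reduces the error to the weighted norm, and Hardy's inequality reduces that to
    the gradients.\<close>
  have l2: "(\<lambda>n. tri GV V (\<eta> n)) \<longlonglongrightarrow> tri GV V Z"
  proof -
    have "(\<lambda>n. tri GV V (\<eta> n) - tri GV V Z) \<longlonglongrightarrow> 0"
    proof (rule Lim_null_comparison[OF always_eventually])
      show "(\<lambda>n. \<delta> * nrm GV * (2 * nrm (\<lambda>x. grad (\<eta> n) x - GZ x))) \<longlonglongrightarrow> 0"
        using tendsto_mult_left[OF tendsto_mult_left[OF e(6), of 2], of "\<delta> * nrm GV"] by simp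
      show "\<forall>n. norm (tri GV V (\<eta> n) - tri GV V Z) \<le> \<delta> * nrm GV * (2 * nrm (\<lambda>x. grad (\<eta> n) x - GZ x))"
      proof
        fix n
        have "tri GV V (\<eta> n) - tri GV V Z = tri GV V (\<lambda>x. \<eta> n x - Z x)"
          using tri_left(1)[OF dV(3) me sqint_wt[OF test_funs_sqint[OF e(2)]], of n] tri_left(1)[OF dV(3) e(4) w(1)]
          by (simp add: tri_def inner_diff_right)
        also have "\<bar>\<dots>\<bar> \<le> \<delta> * nrm GV * nrm (wt (\<lambda>x. \<eta> n x - Z x))"
          by (intro tri_left dV borel_measurable_diff me e w')
        also have "\<dots> \<le> \<delta> * nrm GV * (2 * nrm (\<lambda>x. grad (\<eta> n) x - GZ x))"
          using \<delta> by (intro mult_left_mono w') auto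
        finally show "norm (tri GV V (\<eta> n) - tri GV V Z) \<le> \<delta> * nrm GV * (2 * nrm (\<lambda>x. grad (\<eta> n) x - GZ x))" by simp
      qed
    qed
    then show ?thesis by (simp add: LIM_zero_iff)
  qed
  have l3: "(\<lambda>n. f (\<eta> n)) \<longlonglongrightarrow> fz"
  proof -
    have "(\<lambda>n. f (\<eta> n) - fz) \<longlonglongrightarrow> 0"
    proof (rule Lim_null_comparison[OF always_eventually])
      show "(\<lambda>n. C * nrm (\<lambda>x. grad (\<eta> n) x - GZ x)) \<longlonglongrightarrow> 0" using tendsto_mult_left[OF e(6), of C] by simp
    qed (use fz[OF e(1)] in auto)
    then show ?thesis by (simp add: LIM_zero_iff)
  qed
  have "(\<lambda>n. f (\<eta> n)) \<longlonglongrightarrow> (\<integral>x. GV x \<bullet> GZ x \<partial>lebesgue) + tri GV V Z"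
    using tendsto_add[OF l1 l2] eqV[OF e(1)] by simp
  with l3 show ?thesis by (rule LIMSEQ_unique)
qed

text \<open>For equal fields antisymmetry says that twice the form is 0; the compact support of
  \<open>\<eta>\<close> allows the passage from \<open>\<psi> n\<close> to \<open>V\<close>.\<close>

lemma tri_test_zero:
  assumes \<eta>: "\<eta> \<in> test_funs_sol \<Omega>"
  shows "tri GV \<eta> V = 0"
proof -
  note t = sol_test[OF \<eta>]
  obtain K where K: "0 \<le> K" "\<And>x. norm (\<eta> x) \<le> K" using test_funs_bounded[OF t] by metis
  obtain r where r: "\<And>x. r < norm x \<Longrightarrow> \<eta> x = 0" using test_funs_far[OF t] by metis
  have B: "bounded_bilinear (\<lambda>e w. outer w e)" by (rule bounded_bilinear.flip[OF bounded_bilinear_outer])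
  note cb = conv_bilinear_tendsto[OF cV B _ test_funs_continuous[OF t] K(2) r]
  have "(\<lambda>n. \<integral>x. grad (\<psi> n) x \<bullet> outer (\<psi> n x) (\<eta> x) \<partial>lebesgue) \<longlonglongrightarrow> (\<integral>x. GV x \<bullet> outer (V x) (\<eta> x) \<partial>lebesgue)"
    by (rule integral_bilinear_tendsto[OF bounded_bilinear_inner dV(8) dV(3) dV(6) cb(2) cb(1) cb(3)]) (simp_all add: norm_outer mult.commute)
  then have "(\<lambda>n. tri (grad (\<psi> n)) \<eta> (\<psi> n)) \<longlonglongrightarrow> tri GV \<eta> V" by (simp add: inner_outer tri_def)
  moreover have "tri (grad (\<psi> n)) \<eta> (\<psi> n) = 0" for n
    using tri_smooth_antisym[OF \<eta> dV(2) dV(2), of n n] by simp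
  ultimately show ?thesis by (simp add: LIMSEQ_const_iff)
qed

text \<open>All test fields give 0, so the value at \<open>Z\<close> equals its own approximation
  error, which the decay of \<open>V\<close> and Hardy's inequality send to 0.\<close>

lemma tri_zero:
  assumes c: "conv \<Omega> \<eta> Z GZ" and o: "\<And>n. odd_vf d (\<eta> n)"
  shows "tri GV Z V = 0"
proof -
  note e = convD[OF c]
  note w = hardy_conv[OF c o] and w' = hardy_conv_diff[OF c o]
  have me: "\<eta> n \<in> borel_measurable lebesgue" for n by (rule sqint_measurable[OF test_funs_sqint[OF e(2)]])
  have "(\<lambda>n. - tri GV Z V) \<longlonglongrightarrow> 0"
  proof (rule Lim_null_comparison[OF always_eventually])
    show "(\<lambda>n. \<delta> * nrm GV * (2 * nrm (\<lambda>x. grad (\<eta> n) x - GZ x))) \<longlonglongrightarrow> 0"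
      using tendsto_mult_left[OF tendsto_mult_left[OF e(6), of 2], of "\<delta> * nrm GV"] by simp
    show "\<forall>n. norm (- tri GV Z V) \<le> \<delta> * nrm GV * (2 * nrm (\<lambda>x. grad (\<eta> n) x - GZ x))"
    proof
      fix n
      have "- tri GV Z V = tri GV (\<eta> n) V - tri GV Z V" by (simp add: tri_test_zero[OF e(1)])
      also have "\<dots> = tri GV (\<lambda>x. \<eta> n x - Z x) V"
        using tri_right(1)[OF dV(3) me sqint_wt[OF test_funs_sqint[OF e(2)]], of n] tri_right(1)[OF dV(3) e(4) w(1)]
        by (simp add: tri_def matrix_vector_mult_diff_distrib inner_diff_left)
      also have "\<bar>\<dots>\<bar> \<le> \<delta> * nrm GV * nrm (wt (\<lambda>x. \<eta> n x - Z x))"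
        by (intro tri_right dV borel_measurable_diff me e w')
      also have "\<dots> \<le> \<delta> * nrm GV * (2 * nrm (\<lambda>x. grad (\<eta> n) x - GZ x))"
        using \<delta> by (intro mult_left_mono w') auto
      finally show "norm (- tri GV Z V) \<le> \<delta> * nrm GV * (2 * nrm (\<lambda>x. grad (\<eta> n) x - GZ x))" by simp
    qed
  qed
  then show ?thesis by (simp add: LIMSEQ_const_iff)
qed

text \<open>In each term two slots follow the sequence \<open>\<psi> n\<close>. The fixed slot,
  \<open>\<eta>\<close> or its gradient, has compact support, so L2 convergence of the fields on a
  ball suffices.\<close>

lemma tri_antisym_test:
  assumes \<eta>: "\<eta> \<in> test_funs_sol \<Omega>"
  shows "tri GV V \<eta> + tri (grad \<eta>) V V = 0"
proof -
  note t = sol_test[OF \<eta>]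
  obtain K where K: "0 \<le> K" "\<And>x. norm (\<eta> x) \<le> K" using test_funs_bounded[OF t] by metis
  obtain r where r: "\<And>x. r < norm x \<Longrightarrow> \<eta> x = 0" using test_funs_far[OF t] by metis
  note cb = conv_bilinear_tendsto[OF cV bounded_bilinear_outer _ test_funs_continuous[OF t] K(2) r]
  have "(\<lambda>n. \<integral>x. grad (\<psi> n) x \<bullet> outer (\<eta> x) (\<psi> n x) \<partial>lebesgue) \<longlonglongrightarrow> (\<integral>x. GV x \<bullet> outer (\<eta> x) (V x) \<partial>lebesgue)"
    by (rule integral_bilinear_tendsto[OF bounded_bilinear_inner dV(8) dV(3) dV(6) cb(2) cb(1) cb(3)]) (simp_all add: norm_outer)
  then have l1: "(\<lambda>n. tri (grad (\<psi> n)) (\<psi> n) \<eta>) \<longlonglongrightarrow> tri GV V \<eta>" by (simp add: inner_outer tri_def)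
  obtain L where L: "0 \<le> L" "\<And>x. norm (grad \<eta> x) \<le> L"
  proof -
    have "bounded (grad \<eta> ` cball 0 r)"
      by (intro compact_imp_bounded compact_continuous_image grad_continuous[OF t]) auto
    then obtain L where L: "\<forall>x\<in>cball 0 r. norm (grad \<eta> x) \<le> L" by (auto simp: bounded_iff)
    have "norm (grad \<eta> x) \<le> max 0 L" for x
      using L grad_far[of r \<eta> x, OF r] by (cases "r < norm x") (auto simp: le_max_iff_disj)
    then show ?thesis by (intro that[of "max 0 L"]) auto
  qed
  note cg = conv_bilinear_tendsto[OF cV bounded_bilinear_matrix_vector norm_matrix_vector_le grad_continuous[OF t] L(2) grad_far[of r, OF r]]
  obtain m :: nat where m: "\<forall>x. x \<notin> ball 0 (real m) \<longrightarrow> grad \<eta> x = 0" using cs_in_ball[of r "grad \<eta>", OF grad_far[of r, OF r]] by blast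
  have l: "(\<lambda>n. nrm (\<lambda>x. cutf (ball 0 (real m)) (\<psi> n) x - cutf (ball 0 (real m)) V x)) \<longlonglongrightarrow> 0"
    using dV(7)[of m] by (simp add: cutf_def[abs_def] scaleR_diff_right)
  \<comment> \<open>Cutting the second copy of \<open>\<psi> n\<close> off at a ball containing the
    support of \<open>grad \<eta>\<close> turns local convergence into convergence on the plane
    without changing the integral.\<close>
  have "(\<lambda>n. \<integral>x. (grad \<eta> x *v \<psi> n x) \<bullet> cutf (ball 0 (real m)) (\<psi> n) x \<partial>lebesgue) \<longlonglongrightarrow> (\<integral>x. (grad \<eta> x *v V x) \<bullet> cutf (ball 0 (real m)) V x \<partial>lebesgue)"
    by (rule integral_bilinear_tendsto[OF bounded_bilinear_inner cg(2) cg(1) cg(3) dV(10) dV(5) l]) simp_all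
  moreover have "(grad \<eta> x *v w x) \<bullet> cutf (ball 0 (real m)) w x = (grad \<eta> x *v w x) \<bullet> w x" for w x
    using m by (cases "x \<in> ball 0 (real m)") (auto simp: cutf_def)
  ultimately have l2: "(\<lambda>n. tri (grad \<eta>) (\<psi> n) (\<psi> n)) \<longlonglongrightarrow> tri (grad \<eta>) V V" by (simp add: tri_def)
  have "tri (grad (\<psi> n)) (\<psi> n) \<eta> + tri (grad \<eta>) (\<psi> n) (\<psi> n) = 0" for n
    by (rule tri_smooth_antisym[OF dV(1) dV(2) t])
  with tendsto_add[OF l1 l2] show ?thesis by (simp add: LIMSEQ_const_iff)
qed

text \<open>\<open>U\<close> has no decay, but each term contains \<open>V\<close> undifferentiated,
  and the decay of \<open>V\<close> makes both terms continuous in \<open>U\<close> with respect to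
  the gradient norm.\<close>

lemma tri_antisym: "tri GV V U + tri GU V V = 0"
proof -
  note w' = hardy_conv_diff[OF cU oU]
  have "(\<lambda>n. - (tri GV V U + tri GU V V)) \<longlonglongrightarrow> 0"
  proof (rule Lim_null_comparison[OF always_eventually])
    show "(\<lambda>n. (\<delta> * nrm GV * 2 + \<delta> * nrm (wt V)) * nrm (\<lambda>x. grad (\<phi> n) x - GU x)) \<longlonglongrightarrow> 0"
      using tendsto_mult_left[OF dU(6)] by force
    show "\<forall>n. norm (- (tri GV V U + tri GU V V)) \<le> (\<delta> * nrm GV * 2 + \<delta> * nrm (wt V)) * nrm (\<lambda>x. grad (\<phi> n) x - GU x)"
    proof
      fix n
      have 1: "tri GV V (\<phi> n) - tri GV V U = tri GV V (\<lambda>x. \<phi> n x - U x)"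
        using tri_left(1)[OF dV(3) mphi(1) sqint_wt[OF test_funs_sqint[OF dU(2)]], of n] tri_left(1)[OF dV(3) mU wU(1)]
        by (simp add: tri_def inner_diff_right)
      have 2: "tri (grad (\<phi> n)) V V - tri GU V V = tri (\<lambda>x. grad (\<phi> n) x - GU x) V V"
        using tri_left(1)[OF dU(8) mV wV(1), of n] tri_left(1)[OF dU(3) mV wV(1)]
        by (simp add: tri_def matrix_vector_mult_diff_rdistrib inner_diff_left)
      have "\<bar>tri GV V (\<lambda>x. \<phi> n x - U x)\<bar> \<le> \<delta> * nrm GV * nrm (wt (\<lambda>x. \<phi> n x - U x))"
        by (intro tri_left dV borel_measurable_diff mphi mU w')
      also have "\<dots> \<le> \<delta> * nrm GV * (2 * nrm (\<lambda>x. grad (\<phi> n) x - GU x))"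
        using \<delta> by (intro mult_left_mono w') auto
      finally have 3: "\<bar>tri GV V (\<lambda>x. \<phi> n x - U x)\<bar> \<le> \<delta> * nrm GV * (2 * nrm (\<lambda>x. grad (\<phi> n) x - GU x))" .
      have 4: "\<bar>tri (\<lambda>x. grad (\<phi> n) x - GU x) V V\<bar> \<le> \<delta> * nrm (\<lambda>x. grad (\<phi> n) x - GU x) * nrm (wt V)"
        by (intro tri_left dU(9) mV wV(1))
      have "- (tri GV V U + tri GU V V) = tri GV V (\<lambda>x. \<phi> n x - U x) + tri (\<lambda>x. grad (\<phi> n) x - GU x) V V"
        using tri_antisym_test[OF dU(1), of n] unfolding 1[symmetric] 2[symmetric] by simp
      then show "norm (- (tri GV V U + tri GU V V)) \<le> (\<delta> * nrm GV * 2 + \<delta> * nrm (wt V)) * nrm (\<lambda>x. grad (\<phi> n) x - GU x)"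
        using 3 4 by (simp add: algebra_simps)
    qed
  qed
  then show ?thesis by (simp add: LIMSEQ_const_iff)
qed

end

text \<open>An estimate without pointwise decay: each component of \<open>v\<close> times
  \<open>w\<close> is bounded in L2 by \<open>product_bound\<close>. The factor R is harmless when R
  is kept fixed, as for the truncated test fields, or when \<open>Q\<close> is of order 1 / R, as
  for the corrector.\<close>

lemma tri_product:
  assumes A: "sqint A" and c: "conv \<Omega> \<eta> w Gw" and o: "\<And>n. odd_vf d (\<eta> n)" and R: "R \<ge> 1"
    and v: "v \<in> test_funs UNIV" "\<And>x j. 2 * R < \<bar>x $ j\<bar> \<Longrightarrow> v x = 0"
    and Q: "\<And>j. nrm (\<lambda>x. v x $ j) * nrm (partial_deriv 1 (\<lambda>x. v x $ j)) \<le> Q"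
  shows "integrable lebesgue (\<lambda>x. (A x *v w x) \<bullet> v x)"
    and "\<bar>tri A w v\<bar> \<le> nrm A * (2 * (sqrt (160 * (1 + 10 * chiK) * R * Q) * nrm Gw))"
proof -
  note e = convD[OF c]
  define g where "g j x = (v x $ j) *\<^sub>R w x" for j x
  have vt: "(\<lambda>x. v x $ j) \<in> test_funs UNIV" for j by (rule test_funs_nth[OF v(1)])
  have sg: "sqint (g j)" for j
    unfolding g_def[abs_def] by (rule conv_mult_tendsto(1)[OF c vt])
  have Q0: "0 \<le> Q" using Q[of 1] by (rule order_trans[rotated]) simp
  have ng: "nrm (g j) \<le> sqrt (160 * (1 + 10 * chiK) * R * Q) * nrm Gw" for j
  proof (rule power2_le_imp_le)
    have "(nrm (g j))\<^sup>2 \<le> 160 * (1 + 10 * chiK) * R * (nrm Gw)\<^sup>2 * (nrm (\<lambda>x. v x $ j) * nrm (partial_deriv 1 (\<lambda>x. v x $ j)))"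
      unfolding g_def[abs_def] by (rule product_bound[OF c o R vt]) (simp add: v)
    also have "\<dots> \<le> 160 * (1 + 10 * chiK) * R * (nrm Gw)\<^sup>2 * Q"
      using R chiK(1) by (intro mult_left_mono Q) auto
    also have "\<dots> = (sqrt (160 * (1 + 10 * chiK) * R * Q) * nrm Gw)\<^sup>2"
      using R chiK(1) Q0 by (simp add: power_mult_distrib)
    finally show "(nrm (g j))\<^sup>2 \<le> (sqrt (160 * (1 + 10 * chiK) * R * Q) * nrm Gw)\<^sup>2" .
  qed (use R chiK(1) Q0 in auto)
  define h where "h x = norm (g 1 x) + norm (g 2 x)" for x
  have sn: "sqint (\<lambda>x. norm (g j x))" "nrm (\<lambda>x. norm (g j x)) = nrm (g j)" for j
    using sg[of j] by (auto simp: sqint_def nrm_def)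
  have sh: "sqint h" unfolding h_def[abs_def] by (intro sqint_add sn)
  have nh: "nrm h \<le> 2 * (sqrt (160 * (1 + 10 * chiK) * R * Q) * nrm Gw)"
    using nrm_triangle[OF sn(1) sn(1), of 1 2] ng[of 1] ng[of 2] by (simp add: h_def[abs_def] sn)
  have le: "norm (w x) * norm (v x) \<le> 1 * norm (h x)" for x
  proof -
    have "norm (w x) * norm (v x) \<le> norm (w x) * (\<bar>v x $ 1\<bar> + \<bar>v x $ 2\<bar>)"
      using norm_le_sum_nth[of "v x"] by (intro mult_left_mono) (auto simp: sum_2)
    then show ?thesis by (simp add: h_def g_def algebra_simps)
  qed
  note t = tri_outer[OF A e(4) sqint_measurable[OF test_funs_sqint[OF v(1)]] sh AE_I2[OF le]]
  show "integrable lebesgue (\<lambda>x. (A x *v w x) \<bullet> v x)" by (rule t) simp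
  have "\<bar>tri A w v\<bar> \<le> 1 * nrm A * nrm h" by (rule t) simp
  also have "\<dots> \<le> nrm A * (2 * (sqrt (160 * (1 + 10 * chiK) * R * Q) * nrm Gw))"
    using nh by (simp add: mult_left_mono)
  finally show "\<bar>tri A w v\<bar> \<le> nrm A * (2 * (sqrt (160 * (1 + 10 * chiK) * R * Q) * nrm Gw))" .
qed

lemma frame_sub_cbox: "frame R \<subseteq> cbox (vector [-2*R, -2*R]) (vector [2*R, 2*R])"
proof
  fix x assume "x \<in> frame R"
  then have "\<bar>x $ 1\<bar> \<le> 2 * R" "\<bar>x $ 2\<bar> \<le> 2 * R" by (auto simp: frame_def)
  then show "x \<in> cbox (vector [-2*R, -2*R]) (vector [2*R, 2*R])" by (auto simp: mem_cbox_vector2)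
qed

lemma nrm_indicator_frame:
  assumes R: "R > 0"
  shows "sqint (indicator (frame R) :: real^2 \<Rightarrow> real)" "nrm (indicator (frame R) :: real^2 \<Rightarrow> real) \<le> 4 * R"
proof -
  let ?c = "cbox (vector [-2*R, -2*R]) (vector [2*R, 2*R]) :: (real^2) set"
  have sq: "(norm (indicator A x :: real))\<^sup>2 = indicator A x" for A and x :: "real^2" by (simp add: indicator_def)
  have i: "integrable lebesgue (indicator ?c :: real^2 \<Rightarrow> real)"
    using lmeasurable_cbox lmeasurable_iff_integrable by blast
  have sc: "sqint (indicator ?c :: real^2 \<Rightarrow> real)"
    using i unfolding sqint_def sq by (auto intro!: borel_measurable_indicator)
  have m: "(indicator (frame R) :: real^2 \<Rightarrow> real) \<in> borel_measurable lebesgue"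
    using sets_frame by (intro borel_measurable_indicator) simp
  have le: "norm (indicator (frame R) x :: real) \<le> 1 * norm (indicator ?c x :: real)" for x
    using frame_sub_cbox[of R] by (auto simp: indicator_def)
  show "sqint (indicator (frame R) :: real^2 \<Rightarrow> real)" by (rule sqint_dominated[OF sc m AE_I2[OF le]])
  have "nrm (indicator (frame R) :: real^2 \<Rightarrow> real) \<le> 1 * nrm (indicator ?c :: real^2 \<Rightarrow> real)"
    by (rule nrm_dominated[OF sc m AE_I2[OF le]]) simp
  also have "nrm (indicator ?c :: real^2 \<Rightarrow> real) \<le> 4 * R"
  proof (rule nrm_leI)
    have "(\<integral>x. (norm (indicator ?c x :: real))\<^sup>2 \<partial>lebesgue) = measure lebesgue ?c"
      unfolding sq by simp
    also have "\<dots> = measure lborel ?c" by simp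
    also have "\<dots> = (4 * R)\<^sup>2"
      using emeasure_box_vec[of "-2*R" "2*R" "-2*R" "2*R"] R by (simp add: measure_def power2_eq_square)
    finally show "(\<integral>x. (norm (indicator ?c x :: real))\<^sup>2 \<partial>lebesgue) \<le> (4 * R)\<^sup>2" by simp
  qed (use R in simp)
  finally show "nrm (indicator (frame R) :: real^2 \<Rightarrow> real) \<le> 4 * R" by simp
qed

section \<open>Testing the equation for \<open>U\<close> with \<open>V\<close>\<close>

context solution_pair
begin

lemma tri_dominated:
  fixes w v :: "real^2 \<Rightarrow> real^2"
  assumes A: "sqint A" and w: "w \<in> borel_measurable lebesgue" "sqint (wt w)"
    and v: "v \<in> borel_measurable lebesgue" "\<And>x. norm (v x) \<le> norm (V x)"
  shows "integrable lebesgue (\<lambda>x. (A x *v w x) \<bullet> v x)" "\<bar>tri A w v\<bar> \<le> \<delta> * nrm A * nrm (wt w)"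
proof -
  have "AE x in lebesgue. norm (w x) * norm (v x) \<le> \<delta> * norm (wt w x)"
    using bound_right[of w]
  proof eventually_elim
    case (elim x)
    then show ?case using mult_left_mono[OF v(2)[of x], of "norm (w x)"] by simp
  qed
  from tri_outer[OF A w(1) v(1) w(2) this \<delta>]
  show "integrable lebesgue (\<lambda>x. (A x *v w x) \<bullet> v x)" "\<bar>tri A w v\<bar> \<le> \<delta> * nrm A * nrm (wt w)" by auto
qed

lemma mchi: "chi R \<in> borel_measurable lebesgue"
  by (rule borel_measurable_lebesgue_continuous[OF continuous_chi])

text \<open>Provides the hypotheses of \<open>tri_product\<close> for the truncated
  \<open>\<psi> n\<close>, with a bound that depends on \<open>R\<close> but not on
  \<open>n\<close>.\<close>

lemma chi_psi:
  assumes R: "R \<ge> 1" and \<Gamma>: "nrm (grad (\<psi> n)) \<le> \<Gamma>"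
  shows "(\<lambda>x. chi R x *\<^sub>R \<psi> n x) \<in> test_funs UNIV" "2 * R < \<bar>x $ j\<bar> \<Longrightarrow> chi R x *\<^sub>R \<psi> n x = 0"
    "nrm (\<lambda>x. (chi R x *\<^sub>R \<psi> n x) $ j) * nrm (partial_deriv 1 (\<lambda>x. (chi R x *\<^sub>R \<psi> n x) $ j)) \<le> (10 * R * \<Gamma>) * ((1 + 10 * chiK) * \<Gamma>)"
proof -
  show "(\<lambda>x. chi R x *\<^sub>R \<psi> n x) \<in> test_funs UNIV"
  proof -
    obtain K where K: "compact K" "K \<subseteq> \<Omega>" "\<And>x. x \<notin> K \<Longrightarrow> \<psi> n x = 0" using test_funsE[OF dV(2)] by metis
    show ?thesis
      by (rule test_funsI[OF _ K(1) subset_UNIV]) (auto intro: Ck_scaleR Ck_chi test_funs_Ck[OF dV(2)] simp: K(3))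
  qed
  show "chi R x *\<^sub>R \<psi> n x = 0" if "2 * R < \<bar>x $ j\<bar>" using chi_eq_0[of R x j] that R by simp
  have e: "(\<lambda>x. (chi R x *\<^sub>R \<psi> n x) $ j) = (\<lambda>x. \<psi> n x $ j * chi R x)" by (simp add: mult.commute)
  note b = chi_component_bounds[OF dV(2) oV R, where j=j]
  have \<Gamma>0: "0 \<le> \<Gamma>" using \<Gamma> nrm_nonneg order_trans by blast
  show "nrm (\<lambda>x. (chi R x *\<^sub>R \<psi> n x) $ j) * nrm (partial_deriv 1 (\<lambda>x. (chi R x *\<^sub>R \<psi> n x) $ j)) \<le> (10 * R * \<Gamma>) * ((1 + 10 * chiK) * \<Gamma>)"
    unfolding e
  proof (rule mult_mono)
    show "nrm (\<lambda>x. \<psi> n x $ j * chi R x) \<le> 10 * R * \<Gamma>"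
      using b(2) by (rule order_trans) (use \<Gamma> R in \<open>intro mult_left_mono, auto\<close>)
    show "nrm (partial_deriv 1 (\<lambda>x. \<psi> n x $ j * chi R x)) \<le> (1 + 10 * chiK) * \<Gamma>"
      using b(3) by (rule order_trans) (use \<Gamma> chiK(1) in \<open>intro mult_left_mono, auto\<close>)
  qed (use \<Gamma>0 R in auto)
qed

lemma grad_psi_bounded: "\<exists>\<Gamma>. \<forall>n. nrm (grad (\<psi> n)) \<le> \<Gamma>"
proof -
  have "convergent (\<lambda>n. nrm (grad (\<psi> n)))"
    using nrm_tendsto[OF dV(8) dV(3) dV(6)] by (rule convergentI)
  then have "Bseq (\<lambda>n. nrm (grad (\<psi> n)))" by (rule convergent_imp_Bseq)
  then obtain \<Gamma> where "\<And>n. norm (nrm (grad (\<psi> n))) \<le> \<Gamma>" unfolding Bseq_def by blast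
  then show ?thesis by auto
qed

text \<open>\<open>U\<close> is replaced by a fixed bounded \<open>\<phi> k\<close>; the error is uniformly small in \<open>n\<close>
  by the product estimate for \<open>\<psi> n\<close> and by the pointwise bound for \<open>V\<close>.\<close>

lemma tri_chi_tendsto:
  assumes R: "R \<ge> 1"
  shows "(\<lambda>n. tri GU U (\<lambda>x. chi R x *\<^sub>R (\<psi> n x - V x))) \<longlonglongrightarrow> 0"
proof -
  obtain \<Gamma> where \<Gamma>: "\<And>n. nrm (grad (\<psi> n)) \<le> \<Gamma>" using grad_psi_bounded by blast
  define Q where "Q = (10 * R * \<Gamma>) * ((1 + 10 * chiK) * \<Gamma>)"
  \<comment> \<open>Collects the factors of the gradient error in the two terms that contain the
    difference of \<open>U\<close> and \<open>\<phi> k\<close>; it depends on \<open>R\<close>, but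
    neither on \<open>n\<close> nor on \<open>k\<close>.\<close>
  define K where "K = nrm GU * (2 * sqrt (160 * (1 + 10 * chiK) * R * Q)) + \<delta> * nrm GU * 2"
  define \<epsilon> where "\<epsilon> k = nrm (\<lambda>x. grad (\<phi> k) x - GU x)" for k
  have Q0: "0 \<le> Q"
    using chi_psi(3)[OF R \<Gamma>, of 0 1] unfolding Q_def[symmetric] by (rule order_trans[rotated]) simp
  have K0: "0 \<le> K" unfolding K_def using \<delta> R chiK(1) Q0 by (intro add_nonneg_nonneg mult_nonneg_nonneg) auto
  obtain m :: nat where m: "4 * R < real m" using reals_Archimedean2 by blast
  have bound: "\<exists>B\<ge>0. \<forall>n. \<bar>tri GU U (\<lambda>x. chi R x *\<^sub>R (\<psi> n x - V x))\<bar> \<le> B * nrm (cutf (ball 0 (real m)) (\<lambda>x. \<psi> n x - V x)) + K * \<epsilon> k" for k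
  proof -
    obtain B where B: "0 \<le> B" "\<And>x. norm (\<phi> k x) \<le> B" using test_funs_bounded[OF dU(2)[of k]] by metis
    note c' = conv_diff[OF cU conv_const[OF dU(1)[of k]]]
    have o': "odd_vf d (\<lambda>x. \<phi> n x - \<phi> k x)" for n using oU by (simp add: odd_vf_def)
    note w' = hardy_conv[OF c' o']
    note e' = convD[OF c']
    have \<epsilon>: "nrm (\<lambda>x. GU x - grad (\<phi> k) x) = \<epsilon> k" by (simp add: \<epsilon>_def nrm_minus_commute)
    have "\<bar>tri GU U (\<lambda>x. chi R x *\<^sub>R (\<psi> n x - V x))\<bar> \<le> (B * nrm GU) * nrm (cutf (ball 0 (real m)) (\<lambda>x. \<psi> n x - V x)) + K * \<epsilon> k" for n
    proof -
      let ?p = "\<lambda>x. chi R x *\<^sub>R (\<psi> n x - V x)"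
      let ?q = "\<lambda>x. chi R x *\<^sub>R \<psi> n x"
      let ?v = "\<lambda>x. chi R x *\<^sub>R V x"
      let ?w = "\<lambda>x. U x - \<phi> k x"
      have mp: "?p \<in> borel_measurable lebesgue"
        by (intro borel_measurable_scaleR mchi borel_measurable_diff mphi mV)
      have mv: "?v \<in> borel_measurable lebesgue" by (intro borel_measurable_scaleR mchi mV)
      have "norm (\<phi> k x) * norm (?p x) \<le> B * norm (cutf (ball 0 (real m)) (\<lambda>x. \<psi> n x - V x) x)" for x
      proof (cases "chi R x = 0")
        case False
        then have "norm x < real m" using chi_supp[of R x] R m by linarith
        moreover have "norm (\<phi> k x) * (chi R x * norm (\<psi> n x - V x)) \<le> B * (1 * norm (\<psi> n x - V x))"
          using B chi_bounds[of R x] by (intro mult_mono) auto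
        ultimately show ?thesis using chi_bounds[of R x] by (simp add: cutf_def)
      qed (use B in simp)
      note t1 = tri_outer[OF dU(3) mphi(1)[of k] mp dV(11)[of m n] AE_I2[OF this] B(1)]
      note t2 = tri_product[OF dU(3) c' o' R chi_psi(1)[OF R \<Gamma>] chi_psi(2)[OF R \<Gamma>] chi_psi(3)[OF R \<Gamma>, of n, folded Q_def]]
      have vle: "norm (?v x) \<le> norm (V x)" for x
        using chi_bounds[of R x] by (simp add: mult_left_le_one_le)
      note t3 = tri_dominated[OF dU(3) e'(4) w'(1) mv vle]
      \<comment> \<open>Against the bounded field \<open>\<phi> k\<close> the difference of
        \<open>\<psi> n\<close> and \<open>V\<close> is small on a ball. Against the remainder the
        two are separated, since one is estimated by products and the other by decay.\<close>
      have "(GU x *v U x) \<bullet> ?p x = (GU x *v \<phi> k x) \<bullet> ?p x + (GU x *v ?w x) \<bullet> ?q x - (GU x *v ?w x) \<bullet> ?v x" for x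
        by (simp add: matrix_vector_mult_diff_distrib inner_diff_left inner_diff_right algebra_simps)
      then have "tri GU U ?p = tri GU (\<phi> k) ?p + tri GU ?w ?q - tri GU ?w ?v"
        using t1(1) t2(1) t3(1) by (simp add: tri_def)
      then have "\<bar>tri GU U ?p\<bar> \<le> \<bar>tri GU (\<phi> k) ?p\<bar> + \<bar>tri GU ?w ?q\<bar> + \<bar>tri GU ?w ?v\<bar>" by linarith
      also have "\<dots> \<le> B * nrm GU * nrm (cutf (ball 0 (real m)) (\<lambda>x. \<psi> n x - V x))
          + nrm GU * (2 * (sqrt (160 * (1 + 10 * chiK) * R * Q) * nrm (\<lambda>x. GU x - grad (\<phi> k) x)))
          + \<delta> * nrm GU * nrm (wt ?w)"
        by (intro add_mono t1 t2 t3)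
      also have "\<dots> \<le> B * nrm GU * nrm (cutf (ball 0 (real m)) (\<lambda>x. \<psi> n x - V x))
          + nrm GU * (2 * (sqrt (160 * (1 + 10 * chiK) * R * Q) * nrm (\<lambda>x. GU x - grad (\<phi> k) x)))
          + \<delta> * nrm GU * (2 * nrm (\<lambda>x. GU x - grad (\<phi> k) x))"
        by (rule add_mono[OF order_refl mult_left_mono[OF w'(2)]]) (simp add: \<delta>)
      also have "\<dots> = (B * nrm GU) * nrm (cutf (ball 0 (real m)) (\<lambda>x. \<psi> n x - V x)) + K * \<epsilon> k"
        unfolding \<epsilon> K_def by (simp add: algebra_simps)
      finally show ?thesis .
    qed
    then show ?thesis using B(1) by (intro exI[of _ "B * nrm GU"]) auto
  qed
  show ?thesis
  \<comment> \<open>\<open>k\<close> is chosen before \<open>N\<close>: the constant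
    \<open>B\<close> of the first term depends on \<open>k\<close>.\<close>
  proof (rule LIMSEQ_I)
    fix r :: real assume r: "r > 0"
    have "(\<lambda>k. K * \<epsilon> k) \<longlonglongrightarrow> 0" unfolding \<epsilon>_def using tendsto_mult_left[OF dU(6), of K] by simp
    from order_tendstoD(2)[OF this, of "r/2"] r have "\<exists>k. \<forall>n\<ge>k. K * \<epsilon> n < r / 2"
      by (simp add: eventually_sequentially)
    then obtain k where k: "K * \<epsilon> k < r / 2" by blast
    obtain B where B: "B \<ge> 0" "\<And>n. \<bar>tri GU U (\<lambda>x. chi R x *\<^sub>R (\<psi> n x - V x))\<bar> \<le> B * nrm (cutf (ball 0 (real m)) (\<lambda>x. \<psi> n x - V x)) + K * \<epsilon> k"
      using bound[of k] by blast
    have "(\<lambda>n. B * nrm (cutf (ball 0 (real m)) (\<lambda>x. \<psi> n x - V x))) \<longlonglongrightarrow> 0"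
      using tendsto_mult_left[OF dV(7)[of m], of B] by simp
    from order_tendstoD(2)[OF this, of "r/2"] r
    have "\<exists>N. \<forall>n\<ge>N. B * nrm (cutf (ball 0 (real m)) (\<lambda>x. \<psi> n x - V x)) < r / 2"
      by (simp add: eventually_sequentially)
    then obtain N where N: "\<And>n. n \<ge> N \<Longrightarrow> B * nrm (cutf (ball 0 (real m)) (\<lambda>x. \<psi> n x - V x)) < r / 2" by blast
    have "norm (tri GU U (\<lambda>x. chi R x *\<^sub>R (\<psi> n x - V x)) - 0) < r" if "n \<ge> N" for n
      using B(2)[of n] N[OF that] k by simp
    then show "\<exists>N. \<forall>n\<ge>N. norm (tri GU U (\<lambda>x. chi R x *\<^sub>R (\<psi> n x - V x)) - 0) < r" by blast
  qed
qed

text \<open>On the frame \<open>V\<close> is bounded by \<delta> / R almost everywhere, and the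
  frame lies in a square of side 4 R; the powers of R cancel, so the L2 norm of \<open>V\<close> on
  the frame is bounded uniformly in \<open>R\<close>.\<close>

lemma frame_psi:
  assumes R: "R > 0"
  shows "sqint (cutf (frame R) (\<psi> n))" "(\<lambda>n. nrm (cutf (frame R) (\<psi> n))) \<longlonglongrightarrow> nrm (cutf (frame R) V)"
    "nrm (cutf (frame R) V) \<le> 4 * \<delta>"
proof -
  have fs: "frame R \<in> sets lebesgue" using sets_frame by simp
  obtain m :: nat where m: "4 * R < real m" using reals_Archimedean2 by blast
  have sub: "frame R \<subseteq> ball 0 (real m)" using frame_norm(1)[of _ R] m by force
  show s: "sqint (cutf (frame R) (\<psi> n))" for n by (intro sqint_cutf fs test_funs_sqint[OF dV(2)])
  have sV: "sqint (cutf (frame R) V)" by (rule sqint_cutf_mono[OF sub fs dV(5) mV])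
  show "(\<lambda>n. nrm (cutf (frame R) (\<psi> n))) \<longlonglongrightarrow> nrm (cutf (frame R) V)"
  proof (rule nrm_tendsto[OF s sV])
    show "(\<lambda>n. nrm (\<lambda>x. cutf (frame R) (\<psi> n) x - cutf (frame R) V x)) \<longlonglongrightarrow> 0"
    proof (rule Lim_null_comparison[OF always_eventually dV(7)[of m]], rule allI)
      fix n
      have "nrm (cutf (frame R) (\<lambda>x. \<psi> n x - V x)) \<le> nrm (cutf (ball 0 (real m)) (\<lambda>x. \<psi> n x - V x))"
        by (rule nrm_cutf_mono[OF sub fs dV(11) borel_measurable_diff[OF mphi(2) mV]])
      then show "norm (nrm (\<lambda>x. cutf (frame R) (\<psi> n) x - cutf (frame R) V x)) \<le> nrm (cutf (ball 0 (real m)) (\<lambda>x. \<psi> n x - V x))"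
        by (simp add: cutf_def[abs_def] scaleR_diff_right)
    qed
  qed
  have "AE x in lebesgue. norm (cutf (frame R) V x) \<le> (\<delta> / R) * norm (indicator (frame R) x :: real)"
    using V_bound
  proof eventually_elim
    case (elim x)
    show ?case
    proof (cases "x \<in> frame R")
      case True
      have "R * norm (V x) \<le> (1 + norm x) * norm (V x)"
        using frame_norm(2)[OF True] by (intro mult_right_mono) auto
      then have "norm (V x) \<le> \<delta> / R" using elim R by (simp add: le_divide_eq mult.commute)
      then show ?thesis using True by (simp add: cutf_def)
    qed (simp add: cutf_def)
  qed
  then have "nrm (cutf (frame R) V) \<le> (\<delta> / R) * nrm (indicator (frame R) :: real^2 \<Rightarrow> real)"
    using \<delta> R by (intro nrm_dominated[OF nrm_indicator_frame(1)[OF R] sqint_measurable[OF sV]]) auto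
  also have "\<dots> \<le> (\<delta> / R) * (4 * R)"
    using \<delta> R by (intro mult_left_mono nrm_indicator_frame(2)) auto
  finally show "nrm (cutf (frame R) V) \<le> 4 * \<delta>" using R by simp
qed

text \<open>The equation for \<open>U\<close> is tested with the solenoidal truncation of
  \<open>\<psi> n\<close>, then \<open>n\<close> goes to infinity for fixed \<open>R\<close>. The
  surviving terms stem from the gradient error of the truncation, the part of \<open>V\<close>
  beyond the cut-off, and the corrector.\<close>

lemma tail_estimate:
  assumes R: "R \<ge> 1" "R \<ge> r0"
  defines "\<tau> \<equiv> \<lambda>A :: real^2 \<Rightarrow> real^2^2. nrm (cutf (- ball 0 R) A)"
  shows "\<bar>(\<integral>x. GU x \<bullet> GV x \<partial>lebesgue) + tri GU U V - fv\<bar> \<le>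
    (nrm GU + C) * (\<tau> GV + (4694 * chiK / R) * (4 * \<delta>)) + \<delta> * \<tau> GU * nrm (wt U)
    + \<tau> GU * (2 * (sqrt (160 * (1 + 10 * chiK)) * (4692 * chiK) * (4 * \<delta>) * nrm GU))"
proof -
  have R0: "R > 0" using R by simp
  have fr: "frame R \<subseteq> \<Omega>" using frame_norm(2)[of _ R] far R(2) by force
  define M where "M n = nrm (cutf (frame R) (\<psi> n))" for n
  define \<epsilon> where "\<epsilon> n = nrm (\<lambda>x. grad (\<psi> n) x - GV x)" for n
  define T where "T n = tri GU U (\<lambda>x. chi R x *\<^sub>R (\<psi> n x - V x))" for n
  define D where "D = (\<integral>x. GU x \<bullet> GV x \<partial>lebesgue) + tri GU U V - fv"
  have bs: "- ball 0 R \<in> sets lebesgue" by (simp add: borel_open borel_comp)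
  define cGU where "cGU = cutf (- ball 0 R) GU"
  have scGU: "sqint cGU" unfolding cGU_def by (rule sqint_cutf[OF bs dU(3)])
  obtain \<Gamma> where \<Gamma>: "\<And>n. nrm (grad (\<psi> n)) \<le> \<Gamma>" using grad_psi_bounded by blast
  have step: "\<bar>D\<bar> \<le> (nrm GU + C) * (2 * \<epsilon> n + \<tau> GV + (4694 * chiK / R) * M n) + \<delta> * \<tau> GU * nrm (wt U)
    + \<bar>T n\<bar> + \<tau> GU * (2 * (sqrt (160 * (1 + 10 * chiK)) * (4692 * chiK) * M n * nrm GU))" for n
  proof -
    obtain g where g: "(\<lambda>x. chi R x *\<^sub>R \<psi> n x + g x) \<in> test_funs_sol \<Omega>" "g \<in> test_funs \<Omega>" "\<And>x. x \<notin> frame R \<Longrightarrow> g x = 0"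
        "nrm g \<le> 4692 * chiK * M n" "nrm (grad g) \<le> 4692 * chiK / R * M n"
      unfolding M_def using solenoidal_truncation[OF dV(1) R0 fr] by blast
    define \<Phi> where "\<Phi> x = chi R x *\<^sub>R \<psi> n x + g x" for x
    have \<Phi>: "\<Phi> \<in> test_funs_sol \<Omega>" unfolding \<Phi>_def[abs_def] by (rule g(1))
    have M0: "0 \<le> M n" by (simp add: M_def)
    define dchi :: "real^2 \<Rightarrow> real^2" where "dchi x = (\<chi> i. partial_deriv i (chi R) x)" for x
    have c1: "Ck (Suc 0) (\<lambda>x. chi R x *\<^sub>R \<psi> n x)" by (intro Ck_scaleR Ck_chi test_funs_Ck[OF dV(2)])
    have gr: "grad \<Phi> x = (chi R x *\<^sub>R grad (\<psi> n) x + outer (\<psi> n x) (dchi x)) + grad g x" for x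
    proof -
      have "grad (\<lambda>x. chi R x *\<^sub>R \<psi> n x) x = chi R x *\<^sub>R grad (\<psi> n) x + outer (\<psi> n x) (dchi x)"
        by (simp add: vec_eq_iff grad_nth outer_def dchi_def partial_deriv_mult[OF Ck_chi Ck_nth[OF test_funs_Ck[OF dV(2)]]])
      then show ?thesis
        unfolding \<Phi>_def[abs_def] by (simp add: grad_add[OF c1 test_funs_Ck[OF g(2)]])
    qed
    have s\<Phi>: "sqint (grad \<Phi>)" by (rule grad_sqint[OF sol_test[OF \<Phi>]])
    \<comment> \<open>The gradient error of \<Phi> is \<open>?a\<close> minus \<open>?b\<close> plus
      \<open>?c\<close> plus the gradient of the corrector: approximation error, loss of gradient
      outside the cut-off, and the derivative falling on \<open>chi R\<close>.\<close>
    let ?a = "\<lambda>x. grad (\<psi> n) x - GV x"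
    let ?b = "\<lambda>x. (1 - chi R x) *\<^sub>R grad (\<psi> n) x"
    let ?c = "\<lambda>x. outer (\<psi> n x) (dchi x)"
    have mdchi: "dchi \<in> borel_measurable lebesgue"
      by (intro borel_measurable_lebesgue_continuous continuous_on_vec2I) (simp add: dchi_def continuous_partial_deriv[OF Ck_chi])
    have mb: "?b \<in> borel_measurable lebesgue"
      by (intro borel_measurable_scaleR borel_measurable_diff borel_measurable_const mchi sqint_measurable[OF dV(8)])
    have mc: "?c \<in> borel_measurable lebesgue" by (rule measurable_bilinear[OF bounded_bilinear_outer mphi(2) mdchi])
    have scg: "sqint (cutf (- ball 0 R) (grad (\<psi> n)))" by (rule sqint_cutf[OF bs dV(8)])
    have bb: "norm (?b x) \<le> 1 * norm (cutf (- ball 0 R) (grad (\<psi> n)) x)" for x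
    proof (cases "x \<in> ball 0 R")
      case True
      then have "chi R x = 1" using component_le_norm_cart[of x] R0 by (intro chi_eq_1) (auto intro: order_trans less_imp_le)
      then show ?thesis by simp
    next
      case False
      then show ?thesis using chi_bounds[of R x] by (simp add: cutf_def mult_left_le_one_le)
    qed
    have bc: "norm (?c x) \<le> (2 * (chiK / R)) * norm (cutf (frame R) (\<psi> n) x)" for x
    proof (cases "x \<in> frame R")
      case True
      have "norm (dchi x) \<le> chiK / R + chiK / R"
        using norm_le_sum_nth[of "dchi x"] chiK(2)[OF R0, of 1 x] chiK(2)[OF R0, of 2 x] by (simp add: sum_2 dchi_def)
      then have "norm (\<psi> n x) * norm (dchi x) \<le> norm (\<psi> n x) * (2 * (chiK / R))" by (intro mult_left_mono) auto
      then show ?thesis using True by (simp add: norm_outer cutf_def mult.commute)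
    next
      case False
      then have "dchi x = 0" using chi_deriv_frame(1)[OF R0 False] by (simp add: dchi_def vec_eq_iff)
      then show ?thesis by (simp add: norm_outer cutf_def False)
    qed
    have sb: "sqint ?b" by (rule sqint_dominated[OF scg mb AE_I2[OF bb]])
    have sc: "sqint ?c" by (rule sqint_dominated[OF frame_psi(1)[OF R0] mc AE_I2[OF bc]])
    have nb: "nrm ?b \<le> \<epsilon> n + \<tau> GV"
    proof -
      have "nrm ?b \<le> 1 * nrm (cutf (- ball 0 R) (grad (\<psi> n)))" by (rule nrm_dominated[OF scg mb AE_I2[OF bb]]) simp
      also have "cutf (- ball 0 R) (grad (\<psi> n)) = (\<lambda>x. cutf (- ball 0 R) ?a x + cutf (- ball 0 R) GV x)"
        by (simp add: fun_eq_iff cutf_def scaleR_diff_right)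
      also have "1 * nrm (\<lambda>x. cutf (- ball 0 R) ?a x + cutf (- ball 0 R) GV x) \<le> nrm (cutf (- ball 0 R) ?a) + nrm (cutf (- ball 0 R) GV)"
        using nrm_triangle[OF sqint_cutf[OF bs dV(9)] sqint_cutf[OF bs dV(3)]] by simp
      also have "\<dots> \<le> \<epsilon> n + \<tau> GV" unfolding \<epsilon>_def \<tau>_def by (intro add_mono nrm_cutf_le bs dV) simp
      finally show ?thesis .
    qed
    have nc: "nrm ?c \<le> (2 * (chiK / R)) * M n"
      unfolding M_def using chiK(1) R0 by (intro nrm_dominated[OF frame_psi(1)[OF R0] mc AE_I2[OF bc]]) auto
    have E: "nrm (\<lambda>x. grad \<Phi> x - GV x) \<le> 2 * \<epsilon> n + \<tau> GV + (4694 * chiK / R) * M n"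
    proof -
      have "(\<lambda>x. grad \<Phi> x - GV x) = (\<lambda>x. (?a x - ?b x) + (?c x + grad g x))"
        by (simp add: fun_eq_iff gr algebra_simps)
      then have "nrm (\<lambda>x. grad \<Phi> x - GV x) \<le> nrm (\<lambda>x. ?a x - ?b x) + nrm (\<lambda>x. ?c x + grad g x)"
        using nrm_triangle[OF sqint_diff[OF dV(9) sb] sqint_add[OF sc grad_sqint[OF g(2)]]] by simp
      also have "\<dots> \<le> (\<epsilon> n + nrm ?b) + (nrm ?c + nrm (grad g))"
        unfolding \<epsilon>_def by (intro add_mono nrm_triangle_diff nrm_triangle dV sb sc grad_sqint[OF g(2)])
      also have "\<dots> \<le> (\<epsilon> n + (\<epsilon> n + \<tau> GV)) + ((2 * (chiK / R)) * M n + 4692 * chiK / R * M n)"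
        by (intro add_mono nb nc g order_refl)
      \<comment> \<open>4694 is 4692 from the corrector plus 2 from \<open>?c\<close>.\<close>
      also have "\<dots> = 2 * \<epsilon> n + \<tau> GV + (4694 * chiK / R) * M n" by (simp add: field_simps)
      finally show ?thesis .
    qed
    have I: "\<bar>(\<integral>x. GU x \<bullet> GV x \<partial>lebesgue) - (\<integral>x. GU x \<bullet> grad \<Phi> x \<partial>lebesgue)\<bar> \<le> nrm GU * nrm (\<lambda>x. grad \<Phi> x - GV x)"
    proof -
      have i: "integrable lebesgue (\<lambda>x. GU x \<bullet> h x)" "\<bar>\<integral>x. GU x \<bullet> h x \<partial>lebesgue\<bar> \<le> nrm GU * nrm h" if "sqint h" for h
        using sqint_product[OF dU(3) that measurable_bilinear[OF bounded_bilinear_inner sqint_measurable[OF dU(3)] sqint_measurable[OF that]], of 1]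
          Cauchy_Schwarz_ineq2 by auto
      have "(\<integral>x. GU x \<bullet> GV x \<partial>lebesgue) - (\<integral>x. GU x \<bullet> grad \<Phi> x \<partial>lebesgue) = (\<integral>x. GU x \<bullet> (GV x - grad \<Phi> x) \<partial>lebesgue)"
        using i(1)[OF dV(3)] i(1)[OF s\<Phi>] by (simp add: inner_diff_right)
      then show ?thesis using i(2)[OF sqint_diff[OF dV(3) s\<Phi>]] by (simp add: nrm_minus_commute[of GV])
    qed
    have F: "\<bar>f \<Phi> - fv\<bar> \<le> C * nrm (\<lambda>x. grad \<Phi> x - GV x)" by (rule fv[OF \<Phi>])
    have v1: "norm ((1 - chi R x) *\<^sub>R V x) \<le> norm (V x)" "norm (chi R x *\<^sub>R V x) \<le> norm (V x)" for x
      using chi_bounds[of R x] by (auto simp: mult_left_le_one_le)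
    have mv1: "(\<lambda>x. (1 - chi R x) *\<^sub>R V x) \<in> borel_measurable lebesgue" "(\<lambda>x. chi R x *\<^sub>R V x) \<in> borel_measurable lebesgue"
      by (intro borel_measurable_scaleR borel_measurable_diff borel_measurable_const mchi mV)+
    have gU: "g \<in> test_funs UNIV" by (rule test_funs_mono[OF g(2)]) simp
    have g0: "g x = 0" if "2 * R < \<bar>x $ j\<bar>" for x j
    proof (rule g(3))
      show "x \<notin> frame R" using that unfolding frame_def mem_Collect_eq by (meson not_le)
    qed
    have gQ: "nrm (\<lambda>x. g x $ j) * nrm (partial_deriv 1 (\<lambda>x. g x $ j)) \<le> (4692 * chiK * M n) * (4692 * chiK / R * M n)" for j
    proof (rule mult_mono)
      show "nrm (\<lambda>x. g x $ j) \<le> 4692 * chiK * M n"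
        using nrm_nth_le[OF test_funs_sqint[OF g(2)], of j] g(4) by simp
      have "nrm (partial_deriv 1 (\<lambda>x. g x $ j)) = nrm (\<lambda>x. grad g x $ j $ 1)" by (simp add: grad_nth[abs_def])
      also have "\<dots> \<le> nrm (\<lambda>x. grad g x $ j)" by (rule nrm_nth_le[OF sqint_nth[OF grad_sqint[OF g(2)]]])
      also have "\<dots> \<le> nrm (grad g)" by (rule nrm_nth_le[OF grad_sqint[OF g(2)]])
      finally show "nrm (partial_deriv 1 (\<lambda>x. g x $ j)) \<le> 4692 * chiK / R * M n" using g(5) by simp
    qed (use chiK(1) M0 in auto)
    note tg = tri_product[OF scGU cU oU R(1) gU g0 gQ]
    \<comment> \<open>The corrector lives on the frame, hence outside the ball; restricting the
      gradient to the complement of the ball brings in the tail of \<open>GU\<close>.\<close>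
    have cg: "(GU x *v U x) \<bullet> g x = (cGU x *v U x) \<bullet> g x" for x
    proof (cases "x \<in> ball 0 R")
      case True
      then have "x \<notin> frame R" using frame_norm(2)[of x R] by auto
      then show ?thesis using g(3) by simp
    qed (simp add: cGU_def cutf_def)
    have ig: "integrable lebesgue (\<lambda>x. (GU x *v U x) \<bullet> g x)" unfolding cg by (rule tg(1))
    have ng: "\<bar>tri GU U g\<bar> \<le> \<tau> GU * (2 * (sqrt (160 * (1 + 10 * chiK)) * (4692 * chiK) * M n * nrm GU))"
    proof -
      have "tri GU U g = tri cGU U g" by (simp add: tri_def cg)
      \<comment> \<open>The factor R of the product estimate cancels against the 1 / R in the
        gradient bound of the corrector.\<close>
      moreover have "sqrt (160 * (1 + 10 * chiK) * R * ((4692 * chiK * M n) * (4692 * chiK / R * M n))) = sqrt (160 * (1 + 10 * chiK)) * (4692 * chiK) * M n"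
      proof -
        have "160 * (1 + 10 * chiK) * R * ((4692 * chiK * M n) * (4692 * chiK / R * M n)) = (160 * (1 + 10 * chiK)) * (4692 * chiK * M n)\<^sup>2"
          using R0 by (simp add: power2_eq_square field_simps)
        then show ?thesis using chiK(1) M0 by (simp add: real_sqrt_mult)
      qed
      ultimately show ?thesis using tg(2) by (simp add: \<tau>_def cGU_def mult.assoc)
    qed
    note t1 = tri_dominated[OF scGU mU wU(1) mv1(1) v1(1)]
    have c1': "(GU x *v U x) \<bullet> ((1 - chi R x) *\<^sub>R V x) = (cGU x *v U x) \<bullet> ((1 - chi R x) *\<^sub>R V x)" for x
    proof (cases "x \<in> ball 0 R")
      case True
      then have "chi R x = 1" using component_le_norm_cart[of x] R0 by (intro chi_eq_1) (auto intro: order_trans less_imp_le)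
      then show ?thesis by simp
    qed (simp add: cGU_def cutf_def)
    have i1: "integrable lebesgue (\<lambda>x. (GU x *v U x) \<bullet> ((1 - chi R x) *\<^sub>R V x))" unfolding c1' by (rule t1(1))
    have n1: "\<bar>tri GU U (\<lambda>x. (1 - chi R x) *\<^sub>R V x)\<bar> \<le> \<delta> * \<tau> GU * nrm (wt U)"
    proof -
      have "tri GU U (\<lambda>x. (1 - chi R x) *\<^sub>R V x) = tri cGU U (\<lambda>x. (1 - chi R x) *\<^sub>R V x)" unfolding tri_def c1' ..
      then show ?thesis using t1(2) by (simp add: \<tau>_def cGU_def)
    qed
    have iq: "integrable lebesgue (\<lambda>x. (GU x *v U x) \<bullet> (chi R x *\<^sub>R \<psi> n x))"
      by (rule tri_product(1)[OF dU(3) cU oU R(1) chi_psi(1)[OF R(1) \<Gamma>] chi_psi(2)[OF R(1) \<Gamma>] chi_psi(3)[OF R(1) \<Gamma>]])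
    have iv: "integrable lebesgue (\<lambda>x. (GU x *v U x) \<bullet> (chi R x *\<^sub>R V x))"
      by (rule tri_dominated(1)[OF dU(3) mU wU(1) mv1(2) v1(2)])
    have iT: "integrable lebesgue (\<lambda>x. (GU x *v U x) \<bullet> (chi R x *\<^sub>R (\<psi> n x - V x)))"
      using Bochner_Integration.integrable_diff[OF iq iv] by (simp add: scaleR_diff_right inner_diff_right)
    \<comment> \<open>Splits the difference of \<open>V\<close> and \<Phi> into the part of
      \<open>V\<close> beyond the cut-off, the approximation error inside, and the
      corrector.\<close>
    have tU: "tri GU U V - tri GU U \<Phi> = tri GU U (\<lambda>x. (1 - chi R x) *\<^sub>R V x) - T n - tri GU U g"
    proof -
      have iV: "integrable lebesgue (\<lambda>x. (GU x *v U x) \<bullet> V x)" by (rule tri_right(1)[OF dU(3) mU wU(1)])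
      have i\<Phi>: "integrable lebesgue (\<lambda>x. (GU x *v U x) \<bullet> \<Phi> x)"
        using Bochner_Integration.integrable_add[OF iq ig] by (simp add: \<Phi>_def inner_add_right)
      have "tri GU U V - tri GU U \<Phi> = (\<integral>x. (GU x *v U x) \<bullet> V x - (GU x *v U x) \<bullet> \<Phi> x \<partial>lebesgue)"
        using iV i\<Phi> by (simp add: tri_def)
      also have "\<dots> = (\<integral>x. (GU x *v U x) \<bullet> ((1 - chi R x) *\<^sub>R V x) - (GU x *v U x) \<bullet> (chi R x *\<^sub>R (\<psi> n x - V x)) - (GU x *v U x) \<bullet> g x \<partial>lebesgue)"
        by (intro Bochner_Integration.integral_cong refl) (simp add: \<Phi>_def inner_add_right inner_diff_right algebra_simps)
      also have "\<dots> = tri GU U (\<lambda>x. (1 - chi R x) *\<^sub>R V x) - T n - tri GU U g"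
        unfolding T_def tri_def using i1 iT ig
        by (subst Bochner_Integration.integral_diff, simp, simp, subst Bochner_Integration.integral_diff, simp_all)
      finally show ?thesis .
    qed
    have "D = ((\<integral>x. GU x \<bullet> GV x \<partial>lebesgue) - (\<integral>x. GU x \<bullet> grad \<Phi> x \<partial>lebesgue)) + (tri GU U V - tri GU U \<Phi>) + (f \<Phi> - fv)"
      using eqU[OF \<Phi>] by (simp add: D_def)
    then have "\<bar>D\<bar> \<le> nrm GU * nrm (\<lambda>x. grad \<Phi> x - GV x) + (\<delta> * \<tau> GU * nrm (wt U) + \<bar>T n\<bar>
        + \<tau> GU * (2 * (sqrt (160 * (1 + 10 * chiK)) * (4692 * chiK) * M n * nrm GU))) + C * nrm (\<lambda>x. grad \<Phi> x - GV x)"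
      using I F n1 ng unfolding tU by linarith
    also have "nrm GU * nrm (\<lambda>x. grad \<Phi> x - GV x) \<le> nrm GU * (2 * \<epsilon> n + \<tau> GV + (4694 * chiK / R) * M n)"
      by (intro mult_left_mono E) simp
    also have "C * nrm (\<lambda>x. grad \<Phi> x - GV x) \<le> C * (2 * \<epsilon> n + \<tau> GV + (4694 * chiK / R) * M n)"
      by (intro mult_left_mono E C)
    finally show ?thesis by (simp add: distrib_right)
  qed
  \<comment> \<open>\<open>\<epsilon> n\<close> and \<open>T n\<close> vanish in the limit, and
    \<open>M n\<close> becomes the norm of \<open>V\<close> on the frame, to which the decay bound
    applies.\<close>
  have "\<bar>D\<bar> \<le> (nrm GU + C) * (2 * 0 + \<tau> GV + (4694 * chiK / R) * nrm (cutf (frame R) V)) + \<delta> * \<tau> GU * nrm (wt U)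
    + \<bar>0\<bar> + \<tau> GU * (2 * (sqrt (160 * (1 + 10 * chiK)) * (4692 * chiK) * nrm (cutf (frame R) V) * nrm GU))"
  proof (rule LIMSEQ_le[OF tendsto_const])
    show "(\<lambda>n. (nrm GU + C) * (2 * \<epsilon> n + \<tau> GV + (4694 * chiK / R) * M n) + \<delta> * \<tau> GU * nrm (wt U)
      + \<bar>T n\<bar> + \<tau> GU * (2 * (sqrt (160 * (1 + 10 * chiK)) * (4692 * chiK) * M n * nrm GU))) \<longlonglongrightarrow>
      (nrm GU + C) * (2 * 0 + \<tau> GV + (4694 * chiK / R) * nrm (cutf (frame R) V)) + \<delta> * \<tau> GU * nrm (wt U)
      + \<bar>0\<bar> + \<tau> GU * (2 * (sqrt (160 * (1 + 10 * chiK)) * (4692 * chiK) * nrm (cutf (frame R) V) * nrm GU))"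
      unfolding \<epsilon>_def M_def T_def
      by (intro tendsto_intros dV(6) frame_psi(2) R0 tri_chi_tendsto R)
  qed (use step in blast)
  also have "\<dots> \<le> (nrm GU + C) * (2 * 0 + \<tau> GV + (4694 * chiK / R) * (4 * \<delta>)) + \<delta> * \<tau> GU * nrm (wt U)
    + \<bar>0\<bar> + \<tau> GU * (2 * (sqrt (160 * (1 + 10 * chiK)) * (4692 * chiK) * (4 * \<delta>) * nrm GU))"
    using C chiK(1) R0 frame_psi(3)[OF R0] unfolding \<tau>_def
    by (intro add_mono mult_left_mono mult_right_mono order_refl) auto
  finally show ?thesis by (simp add: D_def)
qed

text \<open>Every term of \<open>tail_estimate\<close> carries a factor 1 / R or a tail of one of
  the gradients, so the left-hand side, which does not depend on \<open>R\<close>, is 0.\<close>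

lemma test_U: "fv = (\<integral>x. GU x \<bullet> GV x \<partial>lebesgue) + tri GU U V"
proof -
  define D where "D = (\<integral>x. GU x \<bullet> GV x \<partial>lebesgue) + tri GU U V - fv"
  let ?\<tau> = "\<lambda>n A. nrm (cutf (- ball 0 (real n)) (A :: real^2 \<Rightarrow> real^2^2))"
  have "\<bar>D\<bar> \<le> (nrm GU + C) * (0 + (4694 * chiK * 0) * (4 * \<delta>)) + \<delta> * 0 * nrm (wt U)
    + 0 * (2 * (sqrt (160 * (1 + 10 * chiK)) * (4692 * chiK) * (4 * \<delta>) * nrm GU))"
  proof (rule LIMSEQ_le[OF tendsto_const])
    have inv: "(\<lambda>n. 4694 * chiK / real n) \<longlonglongrightarrow> 4694 * chiK * 0"
      using tendsto_mult_left[OF lim_inverse_n', of "4694 * chiK"] by simp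
    show "(\<lambda>n. (nrm GU + C) * (?\<tau> n GV + (4694 * chiK / real n) * (4 * \<delta>)) + \<delta> * ?\<tau> n GU * nrm (wt U)
      + ?\<tau> n GU * (2 * (sqrt (160 * (1 + 10 * chiK)) * (4692 * chiK) * (4 * \<delta>) * nrm GU))) \<longlonglongrightarrow>
      (nrm GU + C) * (0 + (4694 * chiK * 0) * (4 * \<delta>)) + \<delta> * 0 * nrm (wt U)
      + 0 * (2 * (sqrt (160 * (1 + 10 * chiK)) * (4692 * chiK) * (4 * \<delta>) * nrm GU))"
      by (intro tendsto_add tendsto_mult tendsto_const inv nrm_cutf_tail dU(3) dV(3))
    obtain N :: nat where N: "max 1 r0 < real N" using reals_Archimedean2 by blast
    show "\<exists>N. \<forall>n\<ge>N. \<bar>D\<bar> \<le> (nrm GU + C) * (?\<tau> n GV + (4694 * chiK / real n) * (4 * \<delta>)) + \<delta> * ?\<tau> n GU * nrm (wt U)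
      + ?\<tau> n GU * (2 * (sqrt (160 * (1 + 10 * chiK)) * (4692 * chiK) * (4 * \<delta>) * nrm GU))"
    proof (intro exI allI impI)
      fix n assume "n \<ge> N"
      then have "real n \<ge> real N" by simp
      then have "real n \<ge> 1" "real n \<ge> r0" using N by linarith+
      then show "\<bar>D\<bar> \<le> (nrm GU + C) * (?\<tau> n GV + (4694 * chiK / real n) * (4 * \<delta>)) + \<delta> * ?\<tau> n GU * nrm (wt U)
        + ?\<tau> n GU * (2 * (sqrt (160 * (1 + 10 * chiK)) * (4692 * chiK) * (4 * \<delta>) * nrm GU))"
        unfolding D_def by (rule tail_estimate)
    qed
  qed
  then show ?thesis by (simp add: D_def)
qed

section \<open>Comparison of the two energies\<close>

lemma grad_diff_bound: "(nrm (\<lambda>x. GU x - GV x))\<^sup>2 \<le> 2 * \<delta> * (nrm (\<lambda>x. GU x - GV x))\<^sup>2"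
proof -
  note c = conv_diff[OF cU cV]
  have o: "odd_vf d (\<lambda>x. \<phi> n x - \<psi> n x)" for n using oU oV by (simp add: odd_vf_def)
  note w = hardy_conv[OF c o] and e = convD[OF c]
  let ?H = "\<lambda>x. GU x - GV x" and ?W = "\<lambda>x. U x - V x"
  define I where "I = (\<integral>x. GU x \<bullet> GV x \<partial>lebesgue)"
  have 1: "fu = I + tri GV V U"
    using test_V[OF cU oU fu] by (simp add: I_def inner_commute)
  \<comment> \<open>\<open>V\<close> has decay, so it may be tested with itself and satisfies the
    energy equality.\<close>
  have 2: "fv = (nrm GV)\<^sup>2"
    using test_V[OF cV oV fv] tri_zero[OF cV oV] by (simp add: nrm_sq power2_norm_eq_inner)
  have 3: "fv = I + tri GU U V" using test_U by (simp add: I_def)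
  have sq: "(nrm ?H)\<^sup>2 = (nrm GU)\<^sup>2 + (nrm GV)\<^sup>2 - 2 * I"
  proof -
    have i: "integrable lebesgue (\<lambda>x. GU x \<bullet> GV x)"
      using sqint_product(1)[OF dU(3) dV(3) measurable_bilinear[OF bounded_bilinear_inner sqint_measurable[OF dU(3)] sqint_measurable[OF dV(3)]], of 1]
        Cauchy_Schwarz_ineq2 by auto
    have j: "integrable lebesgue (\<lambda>x. (norm (GU x))\<^sup>2)" "integrable lebesgue (\<lambda>x. (norm (GV x))\<^sup>2)"
      using dU(3) dV(3) by (auto simp: sqint_def)
    have "(norm (?H x))\<^sup>2 = (norm (GU x))\<^sup>2 + (norm (GV x))\<^sup>2 - 2 * (GU x \<bullet> GV x)" for x
      by (simp add: power2_norm_eq_inner inner_diff_left inner_diff_right inner_commute)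
    then show ?thesis using i j by (simp add: nrm_sq I_def)
  qed
  have t: "tri ?H ?W V = tri GU U V - tri GU V V - tri GV U V + tri GV V V"
  proof -
    note i = tri_right(1)[OF dU(3) mU wU(1)] tri_right(1)[OF dU(3) mV wV(1)] tri_right(1)[OF dV(3) mU wU(1)] tri_right(1)[OF dV(3) mV wV(1)]
    have "(?H x *v ?W x) \<bullet> V x = (GU x *v U x) \<bullet> V x - (GU x *v V x) \<bullet> V x - ((GV x *v U x) \<bullet> V x - (GV x *v V x) \<bullet> V x)" for x
      by (simp add: matrix_vector_mult_diff_distrib matrix_vector_mult_diff_rdistrib inner_diff_left)
    then show ?thesis using i by (simp add: tri_def)
  qed
  have "(nrm ?H)\<^sup>2 \<le> fu + fv - 2 * I" using energy 2 sq by simp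
  also have "\<dots> = tri GV V U + tri GU U V" using 1 3 by simp
  \<comment> \<open>Of the four terms in the expansion, the two with \<open>GV\<close> vanish by
    \<open>tri_zero\<close>, and \<open>tri_antisym\<close> identifies the negative of
    \<open>tri GU V V\<close> with \<open>tri GV V U\<close>.\<close>
  also have "\<dots> = tri ?H ?W V"
    unfolding t using tri_antisym tri_zero[OF cU oU] tri_zero[OF cV oV] by simp
  also have "\<dots> \<le> \<delta> * nrm ?H * nrm (wt ?W)"
    using tri_right(2)[OF e(3) e(4) w(1)] by simp
  also have "\<dots> \<le> \<delta> * nrm ?H * (2 * nrm ?H)"
    using \<delta> by (intro mult_left_mono w(2)) auto
  finally show ?thesis by (simp add: power2_eq_square mult_ac)
qed

lemma unique:
  assumes "\<delta> \<le> 1/4"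
  shows "AE x in lebesgue. U x = V x"
proof -
  note c = conv_diff[OF cU cV]
  have o: "odd_vf d (\<lambda>x. \<phi> n x - \<psi> n x)" for n using oU oV by (simp add: odd_vf_def)
  note w = hardy_conv[OF c o]
  have "2 * \<delta> * (nrm (\<lambda>x. GU x - GV x))\<^sup>2 \<le> (1/2) * (nrm (\<lambda>x. GU x - GV x))\<^sup>2"
    using assms by (intro mult_right_mono) auto
  with grad_diff_bound have "(nrm (\<lambda>x. GU x - GV x))\<^sup>2 \<le> 0" by linarith
  then have "nrm (\<lambda>x. GU x - GV x) = 0" by simp
  \<comment> \<open>Hardy's inequality turns the vanishing gradient into a vanishing field, with no
    free constant left.\<close>
  with w(2) have "nrm (wt (\<lambda>x. U x - V x)) = 0" using nrm_nonneg[of "wt (\<lambda>x. U x - V x)"] by linarith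
  from nrm_eq_0[OF w(1) this] show ?thesis
    by eventually_elim (simp add: wt_def one_plus_norm_neq_0)
qed

end

theorem theorem1:
  fixes \<Omega> :: "(real^2) set"
  assumes "symmetric_exterior_domain \<Omega>"
    and "lipschitz_boundary \<Omega>"
  shows "\<exists>\<delta>>0. \<forall>f\<in>hdot_dual \<Omega>. \<forall>u v.
           symmetric_weak_solution \<Omega> f u \<longrightarrow>
           symmetric_weak_solution \<Omega> f v \<longrightarrow>
           same_symmetry \<Omega> u v \<longrightarrow>
           (L2_norm \<Omega> (weak_grad \<Omega> u))\<^sup>2 \<le> f u \<longrightarrow>
           esssup (lebesgue_on \<Omega>) (\<lambda>x. ereal ((norm x + 1) * norm (v x))) \<le> ereal \<delta> \<longrightarrow>
           (AE x in lebesgue_on \<Omega>. u x = v x)"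
proof -
  have \<Omega>: "open \<Omega>" and comp: "compact (- \<Omega>)"
    using assms(1) by (auto simp: symmetric_exterior_domain_def exterior_domain_def)
  have inv: "flip i x \<in> \<Omega>" if "x \<in> \<Omega>" for i x
    using assms(1) that exhaust_2[of i] by (auto simp: symmetric_exterior_domain_def flip1_eq flip2_eq)
  have sets: "\<Omega> \<in> sets lebesgue" using \<Omega> by auto
  obtain r where r: "\<forall>x\<in>- \<Omega>. norm x \<le> r" using compact_imp_bounded[OF comp] unfolding bounded_iff by blast
  show ?thesis
  \<comment> \<open>With 1/4 the factor 2 \<delta> in \<open>grad_diff_bound\<close> is 1/2, so the
    right-hand side is absorbed.\<close>
  proof (intro exI[of _ "1/4"] conjI ballI allI impI)
    fix f u v
    assume f: "f \<in> hdot_dual \<Omega>" and su: "symmetric_weak_solution \<Omega> f u" and sv: "symmetric_weak_solution \<Omega> f v"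
      and sym: "same_symmetry \<Omega> u v" and en: "(L2_norm \<Omega> (weak_grad \<Omega> u))\<^sup>2 \<le> f u"
      and ess: "esssup (lebesgue_on \<Omega>) (\<lambda>x. ereal ((norm x + 1) * norm (v x))) \<le> ereal (1/4)"
    let ?U = "cutf \<Omega> u" and ?V = "cutf \<Omega> v"
    let ?GU = "cutf \<Omega> (weak_grad \<Omega> u)" and ?GV = "cutf \<Omega> (weak_grad \<Omega> v)"
    have hu: "u \<in> hdot \<Omega>" and hv: "v \<in> hdot \<Omega>"
      using su sv by (auto simp: symmetric_weak_solution_def hdot_sym_def)
    obtain d where d: "AE_odd d ?U" "AE_odd d ?V"
      using same_symmetry_AE_odd[OF \<Omega> inv sym] by blast
    \<comment> \<open>Both solutions share \<open>d\<close>, so their approximating fields get the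
      same type \<open>d'\<close>, and differences of these fields are odd as well.\<close>
    define d' where "d' = (if d = (\<lambda>j. j) then (\<lambda>j. j) else oth)"
    obtain \<phi> where \<phi>: "conv \<Omega> \<phi> ?U ?GU" "\<And>n. odd_vf d' (\<phi> n)"
      using hdot_conv[OF \<Omega> hu] conv_odd_approx[OF inv _ d(1)] unfolding d'_def by blast
    obtain \<psi> where \<psi>: "conv \<Omega> \<psi> ?V ?GV" "\<And>n. odd_vf d' (\<psi> n)"
      using hdot_conv[OF \<Omega> hv] conv_odd_approx[OF inv _ d(2)] unfolding d'_def by blast
    obtain C1 where C1: "C1 \<ge> 0" "\<And>\<eta>. \<eta> \<in> test_funs_sol \<Omega> \<Longrightarrow> \<bar>f \<eta> - f u\<bar> \<le> C1 * nrm (\<lambda>x. grad \<eta> x - ?GU x)"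
      using dual_continuous[OF \<Omega> f hu] by blast
    obtain C2 where C2: "C2 \<ge> 0" "\<And>\<eta>. \<eta> \<in> test_funs_sol \<Omega> \<Longrightarrow> \<bar>f \<eta> - f v\<bar> \<le> C2 * nrm (\<lambda>x. grad \<eta> x - ?GV x)"
      using dual_continuous[OF \<Omega> f hv] by blast
    have vb: "AE x in lebesgue. (1 + norm x) * norm (?V x) \<le> 1/4"
    proof -
      have "AE x in lebesgue_on \<Omega>. (norm x + 1) * norm (v x) \<le> 1/4"
        using esssup_AE[of "\<lambda>x. ereal ((norm x + 1) * norm (v x))" "lebesgue_on \<Omega>"]
      proof eventually_elim
        case (elim x)
        with ess have "ereal ((norm x + 1) * norm (v x)) \<le> ereal (1/4)" by (rule order_trans[rotated])
        then show ?case by simp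
      qed
      then have "AE x in lebesgue. x \<in> \<Omega> \<longrightarrow> (norm x + 1) * norm (v x) \<le> 1/4"
        by (simp only: AE_lebesgue_on[OF \<Omega>])
      then show ?thesis by eventually_elim (auto simp: cutf_def indicator_def add.commute)
    qed
    \<comment> \<open>\<open>max C1 C2\<close> is a common continuity constant, and
      \<open>r + 1\<close> lies strictly beyond the complement of the domain.\<close>
    interpret solution_pair \<Omega> \<phi> \<psi> ?U ?V ?GU ?GV d' "1/4" f "f u" "f v" "max C1 C2" "r + 1"
    proof
      show "(\<integral>x. ?GU x \<bullet> grad \<eta> x \<partial>lebesgue) + tri ?GU ?U \<eta> = f \<eta>" if "\<eta> \<in> test_funs_sol \<Omega>" for \<eta>
        unfolding tri_def by (rule weak_solution_eq[OF \<Omega> su that])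
      show "(\<integral>x. ?GV x \<bullet> grad \<eta> x \<partial>lebesgue) + tri ?GV ?V \<eta> = f \<eta>" if "\<eta> \<in> test_funs_sol \<Omega>" for \<eta>
        unfolding tri_def by (rule weak_solution_eq[OF \<Omega> sv that])
      show "\<bar>f \<eta> - f u\<bar> \<le> max C1 C2 * nrm (\<lambda>x. grad \<eta> x - ?GU x)" if "\<eta> \<in> test_funs_sol \<Omega>" for \<eta>
        using C1(2)[OF that] mult_right_mono[of C1 "max C1 C2" "nrm (\<lambda>x. grad \<eta> x - ?GU x)"] by simp
      show "\<bar>f \<eta> - f v\<bar> \<le> max C1 C2 * nrm (\<lambda>x. grad \<eta> x - ?GV x)" if "\<eta> \<in> test_funs_sol \<Omega>" for \<eta>
        using C2(2)[OF that] mult_right_mono[of C2 "max C1 C2" "nrm (\<lambda>x. grad \<eta> x - ?GV x)"] by simp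
      show "(nrm ?GU)\<^sup>2 \<le> f u" using en by (simp add: L2_norm_eq[OF sets])
      show "x \<in> \<Omega>" if "r + 1 \<le> norm x" for x using r that by force
    qed (use \<phi> \<psi> vb C1 in auto)
    have "AE x in lebesgue. ?U x = ?V x" by (rule unique) simp
    then have "AE x in lebesgue. x \<in> \<Omega> \<longrightarrow> u x = v x" by eventually_elim (auto simp: cutf_def)
    then show "AE x in lebesgue_on \<Omega>. u x = v x" by (simp only: AE_lebesgue_on[OF \<Omega>])
  qed simp
qed

end
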